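(* Let $k$ be an algebraically closed field of characteristic zero, let $m,p,d,n$ be positive integers with $m=pd$, let $\xi\in k$ be a primitive $m$th root of unity, and let $\delta=(\delta_0,\delta_p,\dots,\delta_{(d-1)p})\in k^d$, with $\delta\ne0$ if $n$ is even. Let $\lambda\in\Lambda(m,1,n)$ with $\operatorname{Stab}_{\mathbb{Z}/p\mathbb{Z}}(\lambda)=\langle\sigma^t\rangle$. Then the simple module $\overline{L(\lambda)}$ and the indecomposable projective module $\overline{P(\lambda)}$ of $B_{m,1,n}$ restrict to $B_{m,p,n}$ as $$\overline{L(\lambda)}\big\downarrow^{B_{m,1,n}}_{B_{m,p,n}}\cong\bigoplus_{0\le r<p/t}L(\lambda^r),\qquad \overline{P(\lambda)}\big\downarrow^{B_{m,1,n}}_{B_{m,p,n}}\cong\bigoplus_{0\le r<p/t}P(\lambda^r).$$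
   Context: Diagrams and algebras. A reduced diagram has $n$ northern and $n$ southern nodes, each node joined to precisely one other by a strand, each strand labelled by an element of $\mathbb{Z}/m\mathbb{Z}$. Strands joining north to south are through-strands; the others are arcs. $B_{m,p,n}(\delta)$ has $k$-basis the reduced diagrams whose labels sum to a multiple of $p$; the product $x\cdot y$ is obtained by placing $x$ above $y$, adding labels along composed strands, and removing each closed loop with label $ip$ at the cost of the factor $\delta_{ip}$ (the product is $0$ if some loop has label not divisible by $p$). $B_{m,1,n}$ is the same with no restriction on the label sum, with parameter $\delta$ extended by $\delta_i=0$ for $p\nmid i$; so $B_{m,p,n}\subseteq B_{m,1,n}$ is a subalgebra. The diagrams with no arcs span the group algebras $kG(m,p,n)\subseteq kG(m,1,n)$. Let $t_1$ be the identity diagram with label $1$ on its first strand, and $s_{i,i+1}$ the unlabelled diagram transposing $i,i+1$. Combinatorics. An $m$-partition of $N$ is an $m$-tuple $\lambda=(\lambda^0,\dots,\lambda^{m-1})$ of partitions of total size $N$. $\Lambda(m,1,n)$ is the set of $m$-partitions of $n-2l$, $0\le l\le n/2$. A standard $\lambda$-tableau is a tuple $\mathfrak t=(\mathfrak t^0,\dots,\mathfrak t^{m-1})$ filling the boxes of $\lambda$ bijectively with $1,\dots,N$, increasing along rows and columns of each component; $\mathfrak t(i)=s$ if $i$ lies in $\mathfrak t^s$. Let $\sigma$ be the generator of $\mathbb{Z}/p\mathbb{Z}$ acting on $m$-partitions and tableaux by $\sigma(\mathfrak t^0,\dots,\mathfrak t^{m-1})=(\mathfrak t^{d},\mathfrak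 t^{1+d},\dots,\mathfrak t^{m-1+d})$ (indices mod $m$). Write $\operatorname{Stab}_{\mathbb{Z}/p\mathbb{Z}}(\lambda)=\langle\sigma^t\rangle$ with $t\mid p$. Group modules. For $\lambda$ an $m$-partition of $N$, the simple $kG(m,1,N)$-module $\overline{\mathbf S(\lambda)}$ has basis the standard $\lambda$-tableaux, with $t_1\mathfrak t=\xi^{\mathfrak t(1)}\mathfrak t$ and $s_{i,i+1}\mathfrak t=\frac1{a}\mathfrak t+(1+\frac1{a})\mathfrak t_{i\leftrightarrow i+1}$. Here $\mathfrak t_{i\leftrightarrow i+1}$ is $\mathfrak t$ with $i,i+1$ exchanged if this is standard, and $0$ otherwise; $1/a=0$ if $\mathfrak t(i)\ne\mathfrak t(i+1)$, and otherwise $a=(i_0-i_1)-(j_0-j_1)$ with $i$ in row $i_0$, column $i_1$ and $i+1$ in row $j_0$, column $j_1$. ($\overline{\mathbf S(\emptyset)}=k$ with trivial $\sigma$.) Standard modules. $V_l$ is the $k$-span of $(m,n,l)$-dangles: $n$ nodes on a line, $l$ arcs each joining two nodes and labelled by an element of $\mathbb{Z}/m\mathbb{Z}$, and $n-2l$ unlabelled, non-crossing free lines from the remaining nodes to $n-2l$ bottom nodes. For $\lambda$ an $m$-partition of $n-2l$, the standard $B_{m,1,n}$-module is $\overline{\Delta_n(\lambda)}=V_l\otimes_k\overline{\mathbf S(\lambda)}$, with action: place a diagram $X$ above a dangle $v$. If more than $l$ arcs result, or a closed loop with label not divisible by $p$, then $X(v\otimes x)=0$. Otherwise the concatenation equals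 a scalar (the product of the $\delta_{ip}$ of the removed loops) times a dangle $v'$ with an element $w\in G(m,1,n-2l)$ placed below it on the free lines, and $X(v\otimes x)$ is that scalar times $v'\otimes wx$. Put $\sigma(v\otimes\mathfrak t)=\xi^{dq}\,v\otimes\sigma(\mathfrak t)$, where $q$ is the sum of the labels of $v$. Then $\sigma^t$ is an endomorphism of $\overline{\Delta_n(\lambda)}$ commuting with $B_{m,p,n}$, and the standard $B_{m,p,n}$-module is (up to isomorphism) $\Delta_n(\lambda^r)=\ker(\sigma^t-\xi^{dtr})\subseteq\overline{\Delta_n(\lambda)}$, $0\le r<p/t$. Simple and projective modules. $\overline{L(\lambda)}$ is the simple head of $\overline{\Delta_n(\lambda)}$ and $\overline{P(\lambda)}$ its projective cover (as $B_{m,1,n}$-modules); $L(\lambda^r)$ is the simple head of $\Delta_n(\lambda^r)$ and $P(\lambda^r)$ its projective cover (as $B_{m,p,n}$-modules). *)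

theory Defs
  imports
    "HOL-Computational_Algebra.Polynomial"
    "HOL-Algebra.Elementary_Groups"
    "HOL-Algebra.Generated_Groups"
    "HOL-Algebra.AbelCoset"
    "HOL-Algebra.Module"
begin

section \<open>Modules over a not necessarily commutative ring\<close>

text \<open>The library locale \<^locale>\<open>Module.module\<close> requires a commutative ring, so its axioms are repeated
  over a \<^locale>\<open>ring\<close>; the record type, \<^locale>\<open>submodule\<close> and the cosets are the
  library's. The ring operations \<open>mult\<close> and \<open>one\<close> of the record are never used for modules.
  Over a unital \<open>k\<close>-algebra the \<open>k\<close>-structure of a module is the action of the
  multiples of the unit, so that submodules and homomorphisms are automatically \<open>k\<close>-linear.\<close>

locale left_module = R?: ring R + M?: abelian_group M for R (structure) and M (structure) +
  assumes smult_closed: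
      "\<lbrakk>a \<in> carrier R; x \<in> carrier M\<rbrakk> \<Longrightarrow> a \<odot>\<^bsub>M\<^esub> x \<in> carrier M"
    and smult_l_distr:
      "\<lbrakk>a \<in> carrier R; b \<in> carrier R; x \<in> carrier M\<rbrakk>
        \<Longrightarrow> (a \<oplus>\<^bsub>R\<^esub> b) \<odot>\<^bsub>M\<^esub> x = a \<odot>\<^bsub>M\<^esub> x \<oplus>\<^bsub>M\<^esub> b \<odot>\<^bsub>M\<^esub> x"
    and smult_r_distr:
      "\<lbrakk>a \<in> carrier R; x \<in> carrier M; y \<in> carrier M\<rbrakk>
        \<Longrightarrow> a \<odot>\<^bsub>M\<^esub> (x \<oplus>\<^bsub>M\<^esub> y) = a \<odot>\<^bsub>M\<^esub> x \<oplus>\<^bsub>M\<^esub> a \<odot>\<^bsub>M\<^esub> y"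
    and smult_assoc:
      "\<lbrakk>a \<in> carrier R; b \<in> carrier R; x \<in> carrier M\<rbrakk>
        \<Longrightarrow> (a \<otimes>\<^bsub>R\<^esub> b) \<odot>\<^bsub>M\<^esub> x = a \<odot>\<^bsub>M\<^esub> (b \<odot>\<^bsub>M\<^esub> x)"
    and smult_one:
      "x \<in> carrier M \<Longrightarrow> \<one>\<^bsub>R\<^esub> \<odot>\<^bsub>M\<^esub> x = x"

definition mod_hom :: "('a, 'r) ring_scheme \<Rightarrow> ('a, 'b) module \<Rightarrow> ('a, 'c) module \<Rightarrow> ('b \<Rightarrow> 'c) set" where
  "mod_hom R M N = {f \<in> carrier M \<rightarrow> carrier N.
     (\<forall>x\<in>carrier M. \<forall>y\<in>carrier M. f (x \<oplus>\<^bsub>M\<^esub> y) = f x \<oplus>\<^bsub>N\<^esub> f y) \<and>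
     (\<forall>a\<in>carrier R. \<forall>x\<in>carrier M. f (a \<odot>\<^bsub>M\<^esub> x) = a \<odot>\<^bsub>N\<^esub> f x)}"

definition mod_isomorphic :: "('a, 'r) ring_scheme \<Rightarrow> ('a, 'b) module \<Rightarrow> ('a, 'c) module \<Rightarrow> bool" where
  "mod_isomorphic R M N \<longleftrightarrow> (\<exists>f\<in>mod_hom R M N. bij_betw f (carrier M) (carrier N))"

definition restrict_scalars :: "('a, 'r) ring_scheme \<Rightarrow> ('a, 'b) module \<Rightarrow> ('a, 'b) module" where
  "restrict_scalars R M = M\<lparr>module.smult := (\<lambda>a\<in>carrier R. \<lambda>x. a \<odot>\<^bsub>M\<^esub> x)\<rparr>"

text \<open>For infinite \<open>I\<close> this is the direct product; only finite \<open>I\<close> are used.\<close>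

definition dsum :: "'i set \<Rightarrow> ('i \<Rightarrow> ('a, 'b) module) \<Rightarrow> ('a, 'i \<Rightarrow> 'b) module" where
  "dsum I M =
    \<lparr>carrier = (\<Pi>\<^sub>E i\<in>I. carrier (M i)), mult = undefined, one = undefined,
     zero = (\<lambda>i\<in>I. \<zero>\<^bsub>M i\<^esub>), add = (\<lambda>f g. \<lambda>i\<in>I. f i \<oplus>\<^bsub>M i\<^esub> g i),
     smult = (\<lambda>a f. \<lambda>i\<in>I. a \<odot>\<^bsub>M i\<^esub> f i)\<rparr>"

definition quotient_module :: "('a, 'b) module \<Rightarrow> 'b set \<Rightarrow> ('a, 'b set) module" where
  "quotient_module M N =
    \<lparr>carrier = a_rcosets\<^bsub>M\<^esub> N, mult = undefined, one = undefined,
     zero = N, add = set_add M, smult = (\<lambda>a X. \<Union>x\<in>X. N +>\<^bsub>M\<^esub> (a \<odot>\<^bsub>M\<^esub> x))\<rparr>"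

text \<open>The head is the quotient by the radical, the intersection of all maximal submodules. A module
  with a simple head has a unique maximal submodule, and its head is the quotient by it.\<close>

definition maximal_submodule :: "('a, 'r) ring_scheme \<Rightarrow> ('a, 'b) module \<Rightarrow> 'b set \<Rightarrow> bool" where
  "maximal_submodule R M N \<longleftrightarrow> submodule N R M \<and> N \<noteq> carrier M \<and>
     (\<forall>N'. submodule N' R M \<and> N \<subseteq> N' \<longrightarrow> N' = N \<or> N' = carrier M)"

definition module_radical :: "('a, 'r) ring_scheme \<Rightarrow> ('a, 'b) module \<Rightarrow> 'b set" where
  "module_radical R M = carrier M \<inter> \<Inter> {N. maximal_submodule R M N}"

definition module_head :: "('a, 'r) ring_scheme \<Rightarrow> ('a, 'b) module \<Rightarrow> ('a, 'b set) module" where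
  "module_head R M = quotient_module M (module_radical R M)"

definition regular_module :: "('a, 'r) ring_scheme \<Rightarrow> ('a, 'a) module" where
  "regular_module R =
    \<lparr>carrier = carrier R, mult = undefined, one = undefined,
     zero = \<zero>\<^bsub>R\<^esub>, add = add R, smult = mult R\<rparr>"

text \<open>Finitely generated projective modules: direct summands of \<open>R\<^sup>N\<close>. A projective cover of a
  finitely generated module is finitely generated, so nothing is lost in \<open>projective_cover\<close>.\<close>

definition projective_module :: "('a, 'r) ring_scheme \<Rightarrow> ('a, 'b) module \<Rightarrow> bool" where
  "projective_module R P \<longleftrightarrow> left_module R P \<and>
     (\<exists>(N::nat). \<exists>i\<in>mod_hom R P (dsum {..<N} (\<lambda>_. regular_module R)).
        \<exists>q\<in>mod_hom R (dsum {..<N} (\<lambda>_. regular_module R)) P. \<forall>x\<in>carrier P. q (i x) = x)"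

definition superfluous :: "('a, 'r) ring_scheme \<Rightarrow> ('a, 'b) module \<Rightarrow> 'b set \<Rightarrow> bool" where
  "superfluous R M K \<longleftrightarrow> submodule K R M \<and>
     (\<forall>N. submodule N R M \<and> N <+>\<^bsub>M\<^esub> K = carrier M \<longrightarrow> N = carrier M)"

definition projective_cover :: "('a, 'r) ring_scheme \<Rightarrow> ('a, 'b) module \<Rightarrow> ('a, 'c) module \<Rightarrow> bool" where
  "projective_cover R P L \<longleftrightarrow> projective_module R P \<and>
     (\<exists>\<pi>\<in>mod_hom R P L. \<pi> ` carrier P = carrier L \<and>
        superfluous R P {x \<in> carrier P. \<pi> x = \<zero>\<^bsub>L\<^esub>})"


section \<open>Labelled diagrams\<close>

text \<open>An \<open>(a, b)\<close>-diagram has \<open>a\<close> northern and \<open>b\<close> southern nodes, numbered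
  from 1. A labelled strand is the pair of its set of end nodes and its label, elements of \<open>\<int>/m\<int>\<close> being
  represented by \<open>0, \<dots>, m-1\<close>. Reduced diagrams are the case \<open>a = b\<close>; the case
  \<open>a \<noteq> b\<close> is needed for dangles.\<close>

datatype node = North nat | South nat

type_synonym diagram = "(node set \<times> nat) set"

definition nodes :: "nat \<Rightarrow> nat \<Rightarrow> node set" where
  "nodes a b = North ` {1..a} \<union> South ` {1..b}"

definition diagrams :: "nat \<Rightarrow> nat \<Rightarrow> nat \<Rightarrow> diagram set" where
  "diagrams m a b = {D.
     (\<forall>(e, l)\<in>D. e \<subseteq> nodes a b \<and> card e = 2 \<and> l < m) \<and>
     (\<forall>v\<in>nodes a b. \<exists>!s. s \<in> D \<and> v \<in> fst s)}"

definition arcs :: "diagram \<Rightarrow> diagram" where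
  "arcs D = {s \<in> D. \<nexists>i j. fst s = {North i, South j}}"

definition label_sum :: "diagram \<Rightarrow> nat" where
  "label_sum D = (\<Sum>s\<in>D. snd s)"

text \<open>Placing \<open>x\<close> above \<open>y\<close>: the strands of both are the summands of
  \<open>x <+> y\<close>, a strand of \<open>x\<close> being glued to a strand of \<open>y\<close> when they meet in a
  middle node. A connected component is a closed loop if it contains no outer node.\<close>

definition glued :: "diagram \<Rightarrow> diagram \<Rightarrow> ((node set \<times> nat) + (node set \<times> nat)) rel" where
  "glued x y = {(Inl s, Inr s') | s s'. s \<in> x \<and> s' \<in> y \<and> (\<exists>i. South i \<in> fst s \<and> North i \<in> fst s')}"

definition components :: "diagram \<Rightarrow> diagram \<Rightarrow> ((node set \<times> nat) + (node set \<times> nat)) set set" where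
  "components x y = (x <+> y) // (glued x y \<union> (glued x y)\<inverse>)\<^sup>*"

definition ends :: "((node set \<times> nat) + (node set \<times> nat)) set \<Rightarrow> node set" where
  "ends C = {North i | i. \<exists>s. Inl s \<in> C \<and> North i \<in> fst s} \<union>
            {South i | i. \<exists>s. Inr s \<in> C \<and> South i \<in> fst s}"

definition component_label :: "nat \<Rightarrow> ((node set \<times> nat) + (node set \<times> nat)) set \<Rightarrow> nat" where
  "component_label m C = (\<Sum>z\<in>C. case z of Inl s \<Rightarrow> snd s | Inr s \<Rightarrow> snd s) mod m"

definition concatenation :: "nat \<Rightarrow> diagram \<Rightarrow> diagram \<Rightarrow> diagram" where
  "concatenation m x y = {(ends C, component_label m C) | C. C \<in> components x y \<and> ends C \<noteq> {}}"

definition loops :: "diagram \<Rightarrow> diagram \<Rightarrow> ((node set \<times> nat) + (node set \<times> nat)) set set" where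
  "loops x y = {C \<in> components x y. ends C = {}}"

text \<open>The parameters are given by \<open>\<delta> i\<close> for \<open>i < d\<close>, standing for \<open>\<delta>\<^bsub>ip\<^esub>\<close>; values
  of \<open>\<delta>\<close> at other arguments are never used.\<close>

definition loop_value :: "nat \<Rightarrow> (nat \<Rightarrow> 'k::field) \<Rightarrow> nat \<Rightarrow> 'k" where
  "loop_value p \<delta> j = (if p dvd j then \<delta> (j div p) else 0)"

definition loop_factor :: "nat \<Rightarrow> nat \<Rightarrow> (nat \<Rightarrow> 'k::field) \<Rightarrow> diagram \<Rightarrow> diagram \<Rightarrow> 'k" where
  "loop_factor m p \<delta> x y = (\<Prod>C\<in>loops x y. loop_value p \<delta> (component_label m C))"

definition id_diagram :: "nat \<Rightarrow> diagram" where
  "id_diagram n = {({North i, South i}, 0) | i. i \<in> {1..n}}"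

text \<open>\<open>brauer_span m p n \<delta> c\<close> is the \<open>k\<close>-span of the reduced diagrams whose label sum is divisible
  by \<open>c\<close>, with the loop parameters \<open>\<delta>\<^sub>0, \<delta>\<^sub>p, \<dots>, \<delta>\<^bsub>(d-1)p\<^esub>\<close> extended by zero. For \<open>c = p\<close> it is
  \<open>B\<^bsub>m,p,n\<^esub>(\<delta>)\<close>, for \<open>c = 1\<close> it is \<open>B\<^bsub>m,1,n\<^esub>\<close>.\<close>

definition brauer_span :: "nat \<Rightarrow> nat \<Rightarrow> nat \<Rightarrow> (nat \<Rightarrow> 'k::field) \<Rightarrow> nat \<Rightarrow> (diagram \<Rightarrow> 'k) ring" where
  "brauer_span m p n \<delta> c =
    \<lparr>carrier = {f. \<forall>D. f D \<noteq> 0 \<longrightarrow> D \<in> diagrams m n n \<and> c dvd label_sum D},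
     mult = (\<lambda>f g D. \<Sum>x\<in>diagrams m n n. \<Sum>y\<in>diagrams m n n.
       if concatenation m x y = D then f x * g y * loop_factor m p \<delta> x y else 0),
     one = (\<lambda>D. if D = id_diagram n then 1 else 0),
     zero = (\<lambda>D. 0),
     add = (\<lambda>f g D. f D + g D)\<rparr>"

definition brauer_mpn :: "nat \<Rightarrow> nat \<Rightarrow> nat \<Rightarrow> (nat \<Rightarrow> 'k::field) \<Rightarrow> (diagram \<Rightarrow> 'k) ring" where
  "brauer_mpn m p n \<delta> = brauer_span m p n \<delta> p"

definition brauer_m1n :: "nat \<Rightarrow> nat \<Rightarrow> nat \<Rightarrow> (nat \<Rightarrow> 'k::field) \<Rightarrow> (diagram \<Rightarrow> 'k) ring" where
  "brauer_m1n m p n \<delta> = brauer_span m p n \<delta> 1"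

definition group_diagrams :: "nat \<Rightarrow> nat \<Rightarrow> diagram set" where
  "group_diagrams m N = {D \<in> diagrams m N N. arcs D = {}}"

definition t1_diagram :: "nat \<Rightarrow> nat \<Rightarrow> diagram" where
  "t1_diagram m N = insert ({North 1, South 1}, 1 mod m)
     {({North i, South i}, 0) | i. i \<in> {2..N}}"

definition s_diagram :: "nat \<Rightarrow> nat \<Rightarrow> diagram" where
  "s_diagram N i = {({North j, South ((id(i := Suc i, Suc i := i)) j)}, 0) | j. j \<in> {1..N}}"


section \<open>Multipartitions and tableaux\<close>

type_synonym multipartition = "nat list list"
type_synonym tableau = "nat list list list"

definition is_partition :: "nat list \<Rightarrow> bool" where
  "is_partition \<mu> \<longleftrightarrow> sorted_wrt (\<ge>) \<mu> \<and> 0 \<notin> set \<mu>"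

definition mp_size :: "multipartition \<Rightarrow> nat" where
  "mp_size lam = sum_list (map sum_list lam)"

definition multipartitions :: "nat \<Rightarrow> nat \<Rightarrow> multipartition set" where
  "multipartitions m N = {lam. length lam = m \<and> (\<forall>\<mu>\<in>set lam. is_partition \<mu>) \<and> mp_size lam = N}"

definition Lambda_m1n :: "nat \<Rightarrow> nat \<Rightarrow> multipartition set" where
  "Lambda_m1n m n = (\<Union>l\<in>{l. 2 * l \<le> n}. multipartitions m (n - 2 * l))"

text \<open>A tableau is the list of its components, each given by the list of its rows.\<close>

definition std_tableaux :: "multipartition \<Rightarrow> tableau set" where
  "std_tableaux lam = {T. map (map length) T = lam \<and>
     distinct (concat (concat T)) \<and> set (concat (concat T)) = {1..mp_size lam} \<and>
     (\<forall>c<length T. \<forall>i<length (T ! c). sorted_wrt (<) (T ! c ! i)) \<and>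
     (\<forall>c<length T. \<forall>i j. Suc i < length (T ! c) \<and> j < length (T ! c ! Suc i)
        \<longrightarrow> T ! c ! i ! j < T ! c ! Suc i ! j)}"

definition position :: "tableau \<Rightarrow> nat \<Rightarrow> nat \<times> nat \<times> nat" where
  "position T x = (THE (c, i, j). c < length T \<and> i < length (T ! c) \<and> j < length (T ! c ! i) \<and>
     T ! c ! i ! j = x)"

definition comp_of :: "tableau \<Rightarrow> nat \<Rightarrow> nat" where
  "comp_of T x = fst (position T x)"

definition row_of :: "tableau \<Rightarrow> nat \<Rightarrow> nat" where
  "row_of T x = fst (snd (position T x))"

definition col_of :: "tableau \<Rightarrow> nat \<Rightarrow> nat" where
  "col_of T x = snd (snd (position T x))"

text \<open>The scalar \<open>1/a\<close>.\<close>

definition inv_axial :: "tableau \<Rightarrow> nat \<Rightarrow> 'k::field_char_0" where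
  "inv_axial T i = (if comp_of T i \<noteq> comp_of T (Suc i) then 0
     else 1 / of_int ((int (row_of T i) - int (col_of T i))
                    - (int (row_of T (Suc i)) - int (col_of T (Suc i)))))"

definition swap_entries :: "nat \<Rightarrow> tableau \<Rightarrow> tableau" where
  "swap_entries i T = map (map (map (id(i := Suc i, Suc i := i)))) T"

text \<open>\<open>\<rho> w T U\<close> is the coefficient of \<open>U\<close> in \<open>wT\<close>, for the \<open>kG(m,1,N)\<close>-module with basis the standard
  \<open>\<lambda>\<close>-tableaux that is determined by the prescribed action of the generators. Fixing \<open>\<rho>\<close> to be
  zero outside its domain makes it unique.\<close>

definition is_seminormal ::
  "nat \<Rightarrow> 'k::field_char_0 \<Rightarrow> multipartition \<Rightarrow> (diagram \<Rightarrow> tableau \<Rightarrow> tableau \<Rightarrow> 'k) \<Rightarrow> bool" where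
  "is_seminormal m \<xi> lam \<rho> \<longleftrightarrow>
     (let N = mp_size lam; G = group_diagrams m N; S = std_tableaux lam in
       (\<forall>w T U. \<rho> w T U \<noteq> 0 \<longrightarrow> w \<in> G \<and> T \<in> S \<and> U \<in> S) \<and>
       (\<forall>T\<in>S. \<forall>U\<in>S. \<rho> (id_diagram N) T U = (if U = T then 1 else 0)) \<and>
       (\<forall>w\<in>G. \<forall>w'\<in>G. \<forall>T\<in>S. \<forall>U\<in>S.
          \<rho> (concatenation m w w') T U = (\<Sum>V\<in>S. \<rho> w' T V * \<rho> w V U)) \<and>
       (1 \<le> N \<longrightarrow> (\<forall>T\<in>S. \<forall>U\<in>S.
          \<rho> (t1_diagram m N) T U = (if U = T then \<xi> ^ comp_of T 1 else 0))) \<and>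
       (\<forall>i\<in>{1..<N}. \<forall>T\<in>S. \<forall>U\<in>S.
          \<rho> (s_diagram N i) T U =
            (if U = T then inv_axial T i else 0) +
            (if U = swap_entries i T then 1 + inv_axial T i else 0)))"

definition seminormal :: "nat \<Rightarrow> 'k::field_char_0 \<Rightarrow> multipartition \<Rightarrow> diagram \<Rightarrow> tableau \<Rightarrow> tableau \<Rightarrow> 'k" where
  "seminormal m \<xi> lam = (THE \<rho>. is_seminormal m \<xi> lam \<rho>)"

text \<open>The generator \<open>\<sigma>\<close> of \<open>\<int>/p\<int>\<close> acts on tuples of length \<open>m = pd\<close> by \<open>rotate d\<close>.\<close>

definition stabilizer_Zp :: "nat \<Rightarrow> nat \<Rightarrow> multipartition \<Rightarrow> int set" where
  "stabilizer_Zp p d lam = {j \<in> carrier (integer_mod_group p). (rotate d ^^ nat j) lam = lam}"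


section \<open>Standard modules\<close>

text \<open>An \<open>(m, n, l)\<close>-dangle is an \<open>(n, n - 2l)\<close>-diagram; having only \<open>l\<close> arcs, it has all its arcs
  in the north. Unlabelled means label 0, and free lines do not cross each other.\<close>

definition dangles :: "nat \<Rightarrow> nat \<Rightarrow> nat \<Rightarrow> diagram set" where
  "dangles m n l = {v \<in> diagrams m n (n - 2 * l). card (arcs v) = l \<and>
     (\<forall>s\<in>v - arcs v. snd s = 0) \<and>
     (\<forall>s\<in>v. \<forall>s'\<in>v. \<forall>i j i' j'.
        fst s = {North i, South j} \<and> fst s' = {North i', South j'} \<and> i < i' \<longrightarrow> j < j')}"

text \<open>The coefficients of \<open>X(v \<otimes> T)\<close> in the basis \<open>v' \<otimes> U\<close>. The case of a closed loop with label not
  divisible by \<open>p\<close> is covered by \<open>loop_factor\<close> being zero.\<close>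

definition std_action_basis ::
  "nat \<Rightarrow> nat \<Rightarrow> 'k::field_char_0 \<Rightarrow> (nat \<Rightarrow> 'k) \<Rightarrow> nat \<Rightarrow> multipartition \<Rightarrow>
   diagram \<Rightarrow> diagram \<times> tableau \<Rightarrow> diagram \<times> tableau \<Rightarrow> 'k" where
  "std_action_basis m p \<xi> \<delta> n lam X =
    (\<lambda>(v, T) (u, U).
      let N = mp_size lam; l = (n - N) div 2; c = concatenation m X v in
      if card (arcs c) > l then 0
      else let (v', w) = (THE (v', w). v' \<in> dangles m n l \<and> w \<in> group_diagrams m N \<and>
                            concatenation m v' w = c)
           in if u = v' then loop_factor m p \<delta> X v * seminormal m \<xi> lam w T U else 0)"

definition std_basis :: "nat \<Rightarrow> nat \<Rightarrow> multipartition \<Rightarrow> (diagram \<times> tableau) set" where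
  "std_basis m n lam = dangles m n ((n - mp_size lam) div 2) \<times> std_tableaux lam"

definition Delta_bar ::
  "nat \<Rightarrow> nat \<Rightarrow> 'k::field_char_0 \<Rightarrow> (nat \<Rightarrow> 'k) \<Rightarrow> nat \<Rightarrow> multipartition \<Rightarrow>
   (diagram \<Rightarrow> 'k, diagram \<times> tableau \<Rightarrow> 'k) module" where
  "Delta_bar m p \<xi> \<delta> n lam =
    \<lparr>carrier = {f. \<forall>b. f b \<noteq> 0 \<longrightarrow> b \<in> std_basis m n lam},
     mult = undefined, one = undefined,
     zero = (\<lambda>b. 0), add = (\<lambda>f g b. f b + g b),
     smult = (\<lambda>a f b'. \<Sum>X\<in>diagrams m n n. \<Sum>b\<in>std_basis m n lam.
        a X * f b * std_action_basis m p \<xi> \<delta> n lam X b b')\<rparr>"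

text \<open>The linear map \<open>v \<otimes> T \<mapsto> \<xi>\<^bsup>dq\<^esup> v \<otimes> \<sigma>(T)\<close>, on coefficient functions; \<open>rotate d\<close> is a bijection.\<close>

definition sigma_map ::
  "nat \<Rightarrow> 'k::field \<Rightarrow> (diagram \<times> tableau \<Rightarrow> 'k) \<Rightarrow> (diagram \<times> tableau \<Rightarrow> 'k)" where
  "sigma_map d \<xi> f = (\<lambda>(v, U). \<xi> ^ (d * label_sum v) * f (v, inv_into UNIV (rotate d) U))"

text \<open>\<open>\<Delta>\<^sub>n(\<lambda>\<^sup>r)\<close>, where \<open>\<sigma>\<^sup>t\<close> generates the stabilizer of \<open>\<lambda>\<close>.\<close>

definition Delta ::
  "nat \<Rightarrow> nat \<Rightarrow> nat \<Rightarrow> 'k::field_char_0 \<Rightarrow> (nat \<Rightarrow> 'k) \<Rightarrow> nat \<Rightarrow> multipartition \<Rightarrow> nat \<Rightarrow> nat \<Rightarrow>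
   (diagram \<Rightarrow> 'k, diagram \<times> tableau \<Rightarrow> 'k) module" where
  "Delta m p d \<xi> \<delta> n lam t r =
    restrict_scalars (brauer_mpn m p n \<delta>)
      ((Delta_bar m p \<xi> \<delta> n lam)\<lparr>carrier :=
         {f \<in> carrier (Delta_bar m p \<xi> \<delta> n lam).
            (sigma_map d \<xi> ^^ t) f = (\<lambda>b. \<xi> ^ (d * t * r) * f b)}\<rparr>)"

definition L_bar ::
  "nat \<Rightarrow> nat \<Rightarrow> 'k::field_char_0 \<Rightarrow> (nat \<Rightarrow> 'k) \<Rightarrow> nat \<Rightarrow> multipartition \<Rightarrow>
   (diagram \<Rightarrow> 'k, (diagram \<times> tableau \<Rightarrow> 'k) set) module" where
  "L_bar m p \<xi> \<delta> n lam = module_head (brauer_m1n m p n \<delta>) (Delta_bar m p \<xi> \<delta> n lam)"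

definition L_simple ::
  "nat \<Rightarrow> nat \<Rightarrow> nat \<Rightarrow> 'k::field_char_0 \<Rightarrow> (nat \<Rightarrow> 'k) \<Rightarrow> nat \<Rightarrow> multipartition \<Rightarrow> nat \<Rightarrow> nat \<Rightarrow>
   (diagram \<Rightarrow> 'k, (diagram \<times> tableau \<Rightarrow> 'k) set) module" where
  "L_simple m p d \<xi> \<delta> n lam t r = module_head (brauer_mpn m p n \<delta>) (Delta m p d \<xi> \<delta> n lam t r)"

definition primitive_root_of_unity :: "nat \<Rightarrow> 'k::field \<Rightarrow> bool" where
  "primitive_root_of_unity m \<xi> \<longleftrightarrow> \<xi> ^ m = 1 \<and> (\<forall>j. 0 < j \<and> j < m \<longrightarrow> \<xi> ^ j \<noteq> 1)"

end

theory Submission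
  imports Defs "HOL-Combinatorics.Permutations"
begin

text \<open>Let \<open>B = B\<^bsub>m,1,n\<^esub>\<close>, \<open>A = B\<^bsub>m,p,n\<^esub>\<close>, and let \<open>E\<close> be the action of the unit \<open>t\<^sub>1\<close> of \<open>B\<close>. Then
  \<open>B = \<Oplus>\<^bsub>i<p\<^esub> t\<^sub>1\<^sup>i A\<close>, \<open>E\<close> normalises \<open>A\<close> and \<open>E\<^sup>p\<close> lies in \<open>A\<close>, so that the \<open>B\<close>-submodules of a \<open>B\<close>-module
  are its \<open>E\<close>-stable \<open>A\<close>-submodules. As \<open>p\<close> is invertible and \<open>k\<close> has a primitive \<open>p\<close>-th root of unity, a Maschke-type
  argument shows that a \<open>B\<close>-submodule is superfluous over \<open>A\<close> if it is so over \<open>B\<close>. Hence the two radicals of the standard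
  module agree. Over \<open>A\<close> it is the direct sum of the eigenspaces of \<open>\<sigma>\<^sup>t\<close>, and its head decomposes accordingly, which is
  the first isomorphism. A projective \<open>B\<close>-module stays projective over \<open>A\<close>, so a projective cover over \<open>B\<close> is one over \<open>A\<close>
  as well, and uniqueness of projective covers gives the second. That \<open>\<sigma>\<^sup>t\<close> commutes with \<open>A\<close> follows from the
  uniqueness of the seminormal form, whose existence is obtained from the Coxeter presentation of the symmetric group.\<close>

section \<open>Modules with operators\<close>

text \<open>The label sum modulo \<open>p\<close> grades \<open>B\<close>, with \<open>A\<close> in
  degree zero: a loop whose label is not divisible by \<open>p\<close> has value zero, so no
  surviving product loses degree to a loop. The same vanishing makes the twist \<xi>^(dq) in
  \<sigma> compatible with \<open>A\<close>, because \<xi>^d has order \<open>p\<close>. The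
  obstacle is that the definitions do not compute. The action on a standard module goes through two
  definite descriptions, the factorisation of a concatenation into a dangle and a group diagram and
  the seminormal matrices, so existence and uniqueness have to be established for both.
  Multiplication glues strands along connected components, and associativity in general would mean
  comparing the components of triple products. For the standard modules, however, only laws with a
  power of t_1 or a scalar on one side enter, and multiplication by t_1^j adds \<open>j\<close> to
  the label at one node; relabelling a fixed gluing, with associativity for group diagrams alone,
  takes the place of the general law. Where projective covers need the ring laws of the algebras,
  these come with the assumption that the covers are modules.\<close>

text \<open>Radicals, superfluous submodules and direct sums only use that the operators act additively. Working
  without the remaining module axioms avoids proving that the Brauer algebra is associative.\<close>

locale op_module = M?: abelian_group M
  for R :: "('a, 'r) ring_scheme" (structure) and M :: "('a, 'b) module" (structure) +
  assumes smult_closed: "\<lbrakk>a \<in> carrier R; x \<in> carrier M\<rbrakk> \<Longrightarrow> a \<odot>\<^bsub>M\<^esub> x \<in> carrier M"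
    and smult_r_distr: "\<lbrakk>a \<in> carrier R; x \<in> carrier M; y \<in> carrier M\<rbrakk>
        \<Longrightarrow> a \<odot>\<^bsub>M\<^esub> (x \<oplus>\<^bsub>M\<^esub> y) = a \<odot>\<^bsub>M\<^esub> x \<oplus>\<^bsub>M\<^esub> a \<odot>\<^bsub>M\<^esub> y"

lemma left_module_imp_op_module: "left_module R M \<Longrightarrow> op_module R M"
  by (simp add: left_module_def left_module_axioms_def op_module_def op_module_axioms_def)

lemma (in abelian_group) add_diff_cancel:
  "x \<in> carrier G \<Longrightarrow> y \<in> carrier G \<Longrightarrow> y \<oplus> (x \<ominus> y) = x"
  by (simp add: a_minus_def a_lcomm[of y x] r_neg)

lemma additive_zero:
  assumes "abelian_group M" "abelian_group N" "f \<in> carrier M \<rightarrow> carrier N"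
    and "\<And>x y. x \<in> carrier M \<Longrightarrow> y \<in> carrier M \<Longrightarrow> f (x \<oplus>\<^bsub>M\<^esub> y) = f x \<oplus>\<^bsub>N\<^esub> f y"
  shows "f \<zero>\<^bsub>M\<^esub> = \<zero>\<^bsub>N\<^esub>"
proof -
  interpret M: abelian_group M by fact
  interpret N: abelian_group N by fact
  have "f \<zero>\<^bsub>M\<^esub> \<in> carrier N" using assms(3) by auto
  moreover have "f \<zero>\<^bsub>M\<^esub> \<oplus>\<^bsub>N\<^esub> f \<zero>\<^bsub>M\<^esub> = f \<zero>\<^bsub>M\<^esub>"
    using assms(4)[of "\<zero>\<^bsub>M\<^esub>" "\<zero>\<^bsub>M\<^esub>"] by simp
  ultimately show ?thesis by (metis N.add.r_cancel_one)
qed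

lemma additive_neg:
  assumes "abelian_group M" "abelian_group N" "f \<in> carrier M \<rightarrow> carrier N"
    and add: "\<And>x y. x \<in> carrier M \<Longrightarrow> y \<in> carrier M \<Longrightarrow> f (x \<oplus>\<^bsub>M\<^esub> y) = f x \<oplus>\<^bsub>N\<^esub> f y"
    and x: "x \<in> carrier M"
  shows "f (\<ominus>\<^bsub>M\<^esub> x) = \<ominus>\<^bsub>N\<^esub> f x"
proof -
  interpret M: abelian_group M by fact
  interpret N: abelian_group N by fact
  have "f (\<ominus>\<^bsub>M\<^esub> x) \<oplus>\<^bsub>N\<^esub> f x = \<zero>\<^bsub>N\<^esub>"
    using additive_zero[OF assms(1-3) add] add[of "\<ominus>\<^bsub>M\<^esub> x" x] x by (simp add: M.l_neg)
  thus ?thesis using assms(3) x by (metis N.minus_equality PiE M.a_inv_closed)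
qed

lemma additive_finsum:
  assumes "abelian_group M" "abelian_group N" "f \<in> carrier M \<rightarrow> carrier N"
    and add: "\<And>x y. x \<in> carrier M \<Longrightarrow> y \<in> carrier M \<Longrightarrow> f (x \<oplus>\<^bsub>M\<^esub> y) = f x \<oplus>\<^bsub>N\<^esub> f y"
    and g: "g \<in> J \<rightarrow> carrier M" and "finite J"
  shows "f (finsum M g J) = finsum N (\<lambda>j. f (g j)) J"
proof -
  interpret M: abelian_group M by fact
  interpret N: abelian_group N by fact
  show ?thesis using assms(6) g
  proof (induction J rule: finite_induct)
    case empty
    then show ?case using additive_zero[OF assms(1-3) add] by simp
  next
    case (insert j J)
    have c: "finsum M g J \<in> carrier M" "g j \<in> carrier M" "g \<in> J \<rightarrow> carrier M" using insert by auto
    have "f (finsum M g (insert j J)) = f (g j \<oplus>\<^bsub>M\<^esub> finsum M g J)"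
      using insert c by (simp add: M.finsum_insert)
    also have "\<dots> = f (g j) \<oplus>\<^bsub>N\<^esub> finsum N (\<lambda>j. f (g j)) J" using add c insert by simp
    also have "\<dots> = finsum N (\<lambda>j. f (g j)) (insert j J)"
      using insert c assms(3) by (subst N.finsum_insert) (auto simp: Pi_iff)
    finally show ?case .
  qed
qed

lemma finsum_swap:
  assumes "abelian_group M" "finite I" "finite J"
    and "\<And>i j. i \<in> I \<Longrightarrow> j \<in> J \<Longrightarrow> h i j \<in> carrier M"
  shows "finsum M (\<lambda>i. finsum M (h i) J) I = finsum M (\<lambda>j. finsum M (\<lambda>i. h i j) I) J"
proof -
  interpret M: abelian_group M by fact
  show ?thesis using assms(2,4)
  proof (induction I rule: finite_induct)
    case empty
    then show ?case by (simp add: M.add.finprod_one)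
  next
    case (insert i I)
    have "finsum M (\<lambda>i. finsum M (h i) J) (insert i I)
        = finsum M (h i) J \<oplus>\<^bsub>M\<^esub> finsum M (\<lambda>j. finsum M (\<lambda>i. h i j) I) J"
      using insert by (subst M.finsum_insert) auto
    also have "\<dots> = finsum M (\<lambda>j. h i j \<oplus>\<^bsub>M\<^esub> finsum M (\<lambda>i. h i j) I) J"
      using insert by (subst M.finsum_addf) auto
    also have "\<dots> = finsum M (\<lambda>j. finsum M (\<lambda>i. h i j) (insert i I)) J"
    proof (rule M.finsum_cong')
      show "h i j \<oplus>\<^bsub>M\<^esub> finsum M (\<lambda>i. h i j) I = finsum M (\<lambda>i. h i j) (insert i I)" if "j \<in> J" for j
        using insert that by (subst M.finsum_insert) auto
      show "(\<lambda>j. finsum M (\<lambda>i. h i j) (insert i I)) \<in> J \<rightarrow> carrier M"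
        using insert by auto
    qed simp
    finally show ?case .
  qed
qed

lemma mem_set_add_iff: "x \<in> set_add M N K \<longleftrightarrow> (\<exists>n\<in>N. \<exists>k\<in>K. x = n \<oplus>\<^bsub>M\<^esub> k)"
  by (auto simp: set_add_def')

lemma mod_homD:
  assumes "f \<in> mod_hom R M N"
  shows "x \<in> carrier M \<Longrightarrow> f x \<in> carrier N"
    and "x \<in> carrier M \<Longrightarrow> y \<in> carrier M \<Longrightarrow> f (x \<oplus>\<^bsub>M\<^esub> y) = f x \<oplus>\<^bsub>N\<^esub> f y"
    and "a \<in> carrier R \<Longrightarrow> x \<in> carrier M \<Longrightarrow> f (a \<odot>\<^bsub>M\<^esub> x) = a \<odot>\<^bsub>N\<^esub> f x"
    and "f \<in> carrier M \<rightarrow> carrier N"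
  using assms by (auto simp: mod_hom_def)

lemma mod_homI:
  assumes "\<And>x. x \<in> carrier M \<Longrightarrow> f x \<in> carrier N"
    and "\<And>x y. x \<in> carrier M \<Longrightarrow> y \<in> carrier M \<Longrightarrow> f (x \<oplus>\<^bsub>M\<^esub> y) = f x \<oplus>\<^bsub>N\<^esub> f y"
    and "\<And>a x. a \<in> carrier R \<Longrightarrow> x \<in> carrier M \<Longrightarrow> f (a \<odot>\<^bsub>M\<^esub> x) = a \<odot>\<^bsub>N\<^esub> f x"
  shows "f \<in> mod_hom R M N"
  using assms by (auto simp: mod_hom_def)

lemma mod_hom_comp:
  assumes "f \<in> mod_hom R M N" "g \<in> mod_hom R N Q"
  shows "(\<lambda>x. g (f x)) \<in> mod_hom R M Q"
  using assms by (auto simp: mod_hom_def Pi_iff)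

lemma mod_isomorphic_sym:
  assumes "op_module R M" "mod_isomorphic R M N"
  shows "mod_isomorphic R N M"
proof -
  interpret M: op_module R M by fact
  obtain f where f: "f \<in> mod_hom R M N" and b: "bij_betw f (carrier M) (carrier N)"
    using assms by (auto simp: mod_isomorphic_def)
  let ?g = "inv_into (carrier M) f"
  have gc: "?g y \<in> carrier M" "f (?g y) = y" if "y \<in> carrier N" for y
    using b that by (auto simp: bij_betw_def inv_into_into f_inv_into_f)
  have gf: "?g y = x" if "x \<in> carrier M" "f x = y" for x y
    using b that by (auto simp: bij_betw_def)
  have "?g \<in> mod_hom R N M"
  proof (rule mod_homI)
    fix x y assume "x \<in> carrier N" "y \<in> carrier N"
    then show "?g (x \<oplus>\<^bsub>N\<^esub> y) = ?g x \<oplus>\<^bsub>M\<^esub> ?g y"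
      using gc mod_homD(2)[OF f] by (intro gf) auto
  next
    fix a x assume "a \<in> carrier R" "x \<in> carrier N"
    then show "?g (a \<odot>\<^bsub>N\<^esub> x) = a \<odot>\<^bsub>M\<^esub> ?g x"
      using gc mod_homD(3)[OF f] M.smult_closed by (intro gf) auto
  qed (use gc in auto)
  moreover have "bij_betw ?g (carrier N) (carrier M)" by (rule bij_betw_inv_into[OF b])
  ultimately show ?thesis unfolding mod_isomorphic_def by blast
qed

context op_module
begin

lemma smult_zero: "a \<in> carrier R \<Longrightarrow> a \<odot>\<^bsub>M\<^esub> \<zero>\<^bsub>M\<^esub> = \<zero>\<^bsub>M\<^esub>"
  by (rule additive_zero[OF M.abelian_group_axioms M.abelian_group_axioms])
     (auto simp: smult_closed smult_r_distr)

lemma smult_finsum: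
  "a \<in> carrier R \<Longrightarrow> g \<in> J \<rightarrow> carrier M \<Longrightarrow> finite J
    \<Longrightarrow> a \<odot>\<^bsub>M\<^esub> finsum M g J = finsum M (\<lambda>j. a \<odot>\<^bsub>M\<^esub> g j) J"
  by (rule additive_finsum[OF M.abelian_group_axioms M.abelian_group_axioms])
     (auto simp: smult_closed smult_r_distr)

lemma submoduleI:
  assumes "H \<subseteq> carrier M" "\<zero>\<^bsub>M\<^esub> \<in> H" "\<And>x y. x \<in> H \<Longrightarrow> y \<in> H \<Longrightarrow> x \<oplus>\<^bsub>M\<^esub> y \<in> H"
    and "\<And>x. x \<in> H \<Longrightarrow> \<ominus>\<^bsub>M\<^esub> x \<in> H" "\<And>a x. a \<in> carrier R \<Longrightarrow> x \<in> H \<Longrightarrow> a \<odot>\<^bsub>M\<^esub> x \<in> H"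
  shows "submodule H R M"
  using assms by (intro submodule.intro subgroup.intro) (auto simp: submodule_axioms_def a_inv_def)

lemma submoduleD:
  assumes "submodule H R M"
  shows "x \<in> H \<Longrightarrow> x \<in> carrier M" "\<zero>\<^bsub>M\<^esub> \<in> H" "x \<in> H \<Longrightarrow> y \<in> H \<Longrightarrow> x \<oplus>\<^bsub>M\<^esub> y \<in> H"
    and "x \<in> H \<Longrightarrow> \<ominus>\<^bsub>M\<^esub> x \<in> H" "a \<in> carrier R \<Longrightarrow> x \<in> H \<Longrightarrow> a \<odot>\<^bsub>M\<^esub> x \<in> H"
    and "x \<in> H \<Longrightarrow> y \<in> H \<Longrightarrow> x \<ominus>\<^bsub>M\<^esub> y \<in> H"
proof -
  interpret H: subgroup H "add_monoid M" using assms by (simp add: submodule_def)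
  show "x \<in> H \<Longrightarrow> x \<in> carrier M" using H.subset by auto
  show "\<zero>\<^bsub>M\<^esub> \<in> H" using H.one_closed by simp
  show *: "x \<in> H \<Longrightarrow> y \<in> H \<Longrightarrow> x \<oplus>\<^bsub>M\<^esub> y \<in> H" for x y using H.m_closed by simp
  show **: "x \<in> H \<Longrightarrow> \<ominus>\<^bsub>M\<^esub> x \<in> H" for x using H.m_inv_closed by (simp add: a_inv_def)
  show "a \<in> carrier R \<Longrightarrow> x \<in> H \<Longrightarrow> a \<odot>\<^bsub>M\<^esub> x \<in> H" using assms by (rule submodule.smult_closed)
  show "x \<in> H \<Longrightarrow> y \<in> H \<Longrightarrow> x \<ominus>\<^bsub>M\<^esub> y \<in> H" using * ** by (simp add: a_minus_def)
qed

lemma submodule_finsum: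
  assumes "submodule H R M" "finite J" "g \<in> J \<rightarrow> H"
  shows "finsum M g J \<in> H"
  using assms(2,3)
proof (induction J rule: finite_induct)
  case empty
  then show ?case using submoduleD(2)[OF assms(1)] by simp
next
  case (insert j J)
  then have "g \<in> insert j J \<rightarrow> carrier M" using submoduleD(1)[OF assms(1)] by blast
  then show ?case using insert submoduleD[OF assms(1)]
    by (subst M.finsum_insert) auto
qed

lemma submodule_carrier: "submodule (carrier M) R M"
  by (rule submoduleI) (auto simp: smult_closed)

lemma submodule_set_add:
  assumes N: "submodule N R M" and K: "submodule K R M"
  shows "submodule (set_add M N K) R M"
proof (rule submoduleI)
  note D = submoduleD[OF N] submoduleD[OF K]
  show "set_add M N K \<subseteq> carrier M" using D by (auto simp: mem_set_add_iff)
  show "\<zero>\<^bsub>M\<^esub> \<in> set_add M N K" unfolding mem_set_add_iff using D by (metis M.r_zero M.zero_closed)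
  fix x y assume "x \<in> set_add M N K" "y \<in> set_add M N K"
  then obtain n k n' k' where *: "n \<in> N" "k \<in> K" "x = n \<oplus>\<^bsub>M\<^esub> k" "n' \<in> N" "k' \<in> K" "y = n' \<oplus>\<^bsub>M\<^esub> k'"
    by (auto simp: mem_set_add_iff)
  have "x \<oplus>\<^bsub>M\<^esub> y = (n \<oplus>\<^bsub>M\<^esub> n') \<oplus>\<^bsub>M\<^esub> (k \<oplus>\<^bsub>M\<^esub> k')"
    using *(3,6) D(1)[OF *(1)] D(1)[OF *(4)] D(7)[OF *(2)] D(7)[OF *(5)] by (simp add: M.a_ac)
  then show "x \<oplus>\<^bsub>M\<^esub> y \<in> set_add M N K"
    unfolding mem_set_add_iff using D(3)[OF *(1,4)] D(9)[OF *(2,5)] by blast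
next
  note D = submoduleD[OF N] submoduleD[OF K]
  fix x assume "x \<in> set_add M N K"
  then obtain n k where *: "n \<in> N" "k \<in> K" "x = n \<oplus>\<^bsub>M\<^esub> k" by (auto simp: mem_set_add_iff)
  have "\<ominus>\<^bsub>M\<^esub> x = (\<ominus>\<^bsub>M\<^esub> n) \<oplus>\<^bsub>M\<^esub> (\<ominus>\<^bsub>M\<^esub> k)"
    using *(3) D(1)[OF *(1)] D(7)[OF *(2)] by (simp add: M.minus_add)
  then show "\<ominus>\<^bsub>M\<^esub> x \<in> set_add M N K"
    unfolding mem_set_add_iff using D(4)[OF *(1)] D(10)[OF *(2)] by blast
  fix a assume a: "a \<in> carrier R"
  have "a \<odot>\<^bsub>M\<^esub> x = a \<odot>\<^bsub>M\<^esub> n \<oplus>\<^bsub>M\<^esub> a \<odot>\<^bsub>M\<^esub> k" "a \<odot>\<^bsub>M\<^esub> n \<in> N" "a \<odot>\<^bsub>M\<^esub> k \<in> K"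
    using *(3) smult_r_distr[OF a D(1)[OF *(1)] D(7)[OF *(2)]] D(5)[OF a *(1)] D(11)[OF a *(2)] by auto
  then show "a \<odot>\<^bsub>M\<^esub> x \<in> set_add M N K" unfolding mem_set_add_iff by blast
qed

lemma submodule_Inter:
  assumes "\<And>N. N \<in> \<N> \<Longrightarrow> submodule N R M"
  shows "submodule (carrier M \<inter> \<Inter>\<N>) R M"
proof (rule submoduleI)
  show "\<zero>\<^bsub>M\<^esub> \<in> carrier M \<inter> \<Inter>\<N>" using assms submoduleD(2) by auto
  show "x \<oplus>\<^bsub>M\<^esub> y \<in> carrier M \<inter> \<Inter>\<N>" if "x \<in> carrier M \<inter> \<Inter>\<N>" "y \<in> carrier M \<inter> \<Inter>\<N>" for x y
    using that assms submoduleD(3) by auto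
  show "\<ominus>\<^bsub>M\<^esub> x \<in> carrier M \<inter> \<Inter>\<N>" if "x \<in> carrier M \<inter> \<Inter>\<N>" for x
    using that assms submoduleD(4) by auto
  show "a \<odot>\<^bsub>M\<^esub> x \<in> carrier M \<inter> \<Inter>\<N>" if "a \<in> carrier R" "x \<in> carrier M \<inter> \<Inter>\<N>" for a x
    using that assms submoduleD(5) smult_closed by auto
qed auto

text \<open>This includes a module without maximal submodules, whose radical is the whole
  carrier.\<close>

lemma submodule_radical: "submodule (module_radical R M) R M"
  unfolding module_radical_def
  by (rule submodule_Inter) (auto simp: maximal_submodule_def)

lemma subset_set_add:
  assumes "submodule N R M" "submodule K R M"
  shows "N \<subseteq> set_add M N K" "K \<subseteq> set_add M N K"
  using submoduleD[OF assms(1)] submoduleD[OF assms(2)] unfolding subset_iff mem_set_add_iff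
  by (metis M.r_zero, metis M.l_zero)

lemma superfluousD:
  assumes "superfluous R M K" "submodule N R M"
    and "\<And>x. x \<in> carrier M \<Longrightarrow> \<exists>n\<in>N. \<exists>k\<in>K. x = n \<oplus>\<^bsub>M\<^esub> k"
  shows "N = carrier M"
proof -
  have "set_add M N K = carrier M"
    using assms submoduleD(1) by (auto simp: superfluous_def mem_set_add_iff)
  then show ?thesis using assms by (auto simp: superfluous_def)
qed

lemma preimage_submodule:
  assumes f: "f \<in> mod_hom R M M'" and "op_module R M'" and N: "submodule N R M'"
  shows "submodule {x \<in> carrier M. f x \<in> N} R M"
proof -
  interpret M': op_module R M' by fact
  note D = M'.submoduleD[OF N] mod_homD[OF f]
  have z: "f \<zero>\<^bsub>M\<^esub> = \<zero>\<^bsub>M'\<^esub>"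
    using D by (intro additive_zero[OF M.abelian_group_axioms M'.abelian_group_axioms])
  have n: "f (\<ominus>\<^bsub>M\<^esub> x) = \<ominus>\<^bsub>M'\<^esub> f x" if "x \<in> carrier M" for x
    using D that by (intro additive_neg[OF M.abelian_group_axioms M'.abelian_group_axioms])
  show ?thesis by (rule submoduleI) (auto simp: z n D smult_closed)
qed

lemma image_submodule:
  assumes f: "f \<in> mod_hom R M M'" and "op_module R M'" and N: "submodule N R M"
  shows "submodule (f ` N) R M'"
proof -
  interpret M': op_module R M' by fact
  note D = submoduleD[OF N] mod_homD[OF f]
  have z: "f \<zero>\<^bsub>M\<^esub> = \<zero>\<^bsub>M'\<^esub>"
    using D by (intro additive_zero[OF M.abelian_group_axioms M'.abelian_group_axioms])
  have n: "f (\<ominus>\<^bsub>M\<^esub> x) = \<ominus>\<^bsub>M'\<^esub> f x" if "x \<in> carrier M" for x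
    using D that by (intro additive_neg[OF M.abelian_group_axioms M'.abelian_group_axioms])
  show ?thesis
  proof (rule M'.submoduleI)
    show "f ` N \<subseteq> carrier M'" using D(1) mod_homD(1)[OF f] by blast
    show "\<zero>\<^bsub>M'\<^esub> \<in> f ` N" using z D(2) by (metis imageI)
    fix x assume "x \<in> f ` N"
    then obtain u where u: "u \<in> N" "x = f u" by blast
    then have uM: "u \<in> carrier M" using D(1) by blast
    show "\<ominus>\<^bsub>M'\<^esub> x \<in> f ` N" using n[OF uM] u D(4) by (metis imageI)
    show "a \<odot>\<^bsub>M'\<^esub> x \<in> f ` N" if "a \<in> carrier R" for a
      using mod_homD(3)[OF f that uM] u D(5)[OF that] by (metis imageI)
    fix y assume "y \<in> f ` N"
    then obtain v where v: "v \<in> N" "y = f v" by blast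
    then have vM: "v \<in> carrier M" using D(1) by blast
    show "x \<oplus>\<^bsub>M'\<^esub> y \<in> f ` N"
      using mod_homD(2)[OF f uM vM] u v D(3) by (metis imageI)
  qed
qed

text \<open>The preimage of a maximal submodule is either everything or again maximal, so an element
  of the radical of the source cannot be sent outside a maximal submodule of the target.\<close>

lemma hom_radical:
  assumes f: "f \<in> mod_hom R M M'" and M': "op_module R M'" and x: "x \<in> module_radical R M"
  shows "f x \<in> module_radical R M'"
proof -
  interpret M': op_module R M' by fact
  have xM: "x \<in> carrier M" using x by (simp add: module_radical_def)
  have "f x \<in> N" if N: "maximal_submodule R M' N" for N
  proof (rule ccontr)
    assume fx: "f x \<notin> N"
    let ?Q = "{x \<in> carrier M. f x \<in> N}"
    have Ns: "submodule N R M'" using N by (simp add: maximal_submodule_def)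
    note D = M'.submoduleD[OF Ns] mod_homD[OF f]
    have Q: "submodule ?Q R M" by (rule preimage_submodule[OF f M' Ns])
    have "maximal_submodule R M ?Q"
      unfolding maximal_submodule_def
    proof (intro conjI allI impI)
      show "submodule ?Q R M" by (rule Q)
      show "?Q \<noteq> carrier M" using fx xM by blast
      fix Y assume "submodule Y R M \<and> ?Q \<subseteq> Y"
      then have Y: "submodule Y R M" and QY: "?Q \<subseteq> Y" by auto
      have fY: "submodule (f ` Y) R M'" by (rule image_submodule[OF f M' Y])
      \<comment> \<open>Maximality of \<open>N\<close> is applied to \<open>f(Y) + N\<close>, since
        \<open>f(Y)\<close> itself need not contain \<open>N\<close>.\<close>
      have "set_add M' (f ` Y) N = N \<or> set_add M' (f ` Y) N = carrier M'"
        using N M'.submodule_set_add[OF fY Ns] M'.subset_set_add[OF fY Ns]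
        by (simp add: maximal_submodule_def)
      then show "Y = ?Q \<or> Y = carrier M"
      proof
        assume "set_add M' (f ` Y) N = N"
        then have "f ` Y \<subseteq> N" using M'.subset_set_add[OF fY Ns] by simp
        then show ?thesis using QY submoduleD(1)[OF Y] by blast
      next
        assume e: "set_add M' (f ` Y) N = carrier M'"
        have "z \<in> Y" if z: "z \<in> carrier M" for z
        proof -
          have "f z \<in> set_add M' (f ` Y) N" using e D z by simp
          then obtain y n where y: "y \<in> Y" "n \<in> N" "f z = f y \<oplus>\<^bsub>M'\<^esub> n"
            by (auto simp: mem_set_add_iff)
          have yM: "y \<in> carrier M" using y submoduleD(1)[OF Y] by blast
          have zy: "y \<oplus>\<^bsub>M\<^esub> (z \<ominus>\<^bsub>M\<^esub> y) = z" by (rule M.add_diff_cancel[OF z yM])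
          have "f y \<oplus>\<^bsub>M'\<^esub> f (z \<ominus>\<^bsub>M\<^esub> y) = f y \<oplus>\<^bsub>M'\<^esub> n"
            using mod_homD(2)[OF f yM M.minus_closed[OF z yM]] zy y(3) by simp
          then have "f (z \<ominus>\<^bsub>M\<^esub> y) = n"
            using D(1)[OF y(2)] mod_homD(1)[OF f] yM z
            by (simp add: M'.a_comm[of "f y"])
          \<comment> \<open>The difference is mapped into \<open>N\<close>, so it lies in the
            preimage of \<open>N\<close> and hence in \<open>Y\<close>.\<close>
          then have "z \<ominus>\<^bsub>M\<^esub> y \<in> Y" using y QY z yM by auto
          then have "y \<oplus>\<^bsub>M\<^esub> (z \<ominus>\<^bsub>M\<^esub> y) \<in> Y" using y submoduleD[OF Y] by auto
          then show ?thesis using zy by simp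
        qed
        then show ?thesis using submoduleD(1)[OF Y] by blast
      qed
    qed
    then have "x \<in> ?Q" using x by (auto simp: module_radical_def)
    then show False using fx by simp
  qed
  then show ?thesis using mod_homD(1)[OF f xM] by (simp add: module_radical_def)
qed

text \<open>Zorn's lemma; finite generation, in the form that only the whole module contains
  \<open>G\<close>, keeps the union of a chain of proper submodules proper.\<close>

lemma proper_in_maximal:
  assumes G: "finite G" "G \<subseteq> carrier M" "\<And>N. submodule N R M \<Longrightarrow> G \<subseteq> N \<Longrightarrow> N = carrier M"
    and U: "submodule U R M" "U \<noteq> carrier M"
  shows "\<exists>N. maximal_submodule R M N \<and> U \<subseteq> N"
proof -
  define \<A> where "\<A> = {N. submodule N R M \<and> U \<subseteq> N \<and> N \<noteq> carrier M}"
  have "\<exists>N\<in>\<A>. \<forall>X\<in>\<A>. N \<subseteq> X \<longrightarrow> X = N"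
  proof (rule subset_Zorn_nonempty)
    show "\<A> \<noteq> {}" using U by (auto simp: \<A>_def)
    fix \<C> assume ne: "\<C> \<noteq> {}" and ch: "subset.chain \<A> \<C>"
    have C: "\<And>X. X \<in> \<C> \<Longrightarrow> submodule X R M \<and> U \<subseteq> X \<and> X \<noteq> carrier M"
      using ch by (auto simp: subset_chain_def \<A>_def)
    have cmp: "X \<subseteq> Y \<or> Y \<subseteq> X" if "X \<in> \<C>" "Y \<in> \<C>" for X Y
      using ch that by (auto simp: subset_chain_def)
    have "submodule (\<Union>\<C>) R M"
    proof (rule submoduleI)
      show "\<Union>\<C> \<subseteq> carrier M" using C submoduleD(1) by blast
      obtain X where "X \<in> \<C>" using ne by blast
      then show "\<zero>\<^bsub>M\<^esub> \<in> \<Union>\<C>" using C[of X] submoduleD(2)[of X] by blast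
      show "x \<oplus>\<^bsub>M\<^esub> y \<in> \<Union>\<C>" if xy: "x \<in> \<Union>\<C>" "y \<in> \<Union>\<C>" for x y
      proof -
        obtain X Y where "x \<in> X" "X \<in> \<C>" "y \<in> Y" "Y \<in> \<C>" using xy by blast
        then obtain Z where Z: "Z \<in> \<C>" "x \<in> Z" "y \<in> Z" using cmp by blast
        then have s: "submodule Z R M" using C by simp
        show ?thesis using submoduleD(3)[OF s Z(2,3)] Z(1) by blast
      qed
      fix x assume "x \<in> \<Union>\<C>"
      then obtain X where X: "X \<in> \<C>" "x \<in> X" by blast
      then have s: "submodule X R M" using C by simp
      show "\<ominus>\<^bsub>M\<^esub> x \<in> \<Union>\<C>" using submoduleD(4)[OF s X(2)] X(1) by blast
      show "a \<odot>\<^bsub>M\<^esub> x \<in> \<Union>\<C>" if "a \<in> carrier R" for a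
        using submoduleD(5)[OF s that X(2)] X(1) by blast
    qed
    moreover have "\<Union>\<C> \<noteq> carrier M"
    proof
      assume e: "\<Union>\<C> = carrier M"
      then have GU: "G \<subseteq> \<Union>\<C>" using G(2) by simp
      obtain X where "X \<in> \<C>" "G \<subseteq> X"
        by (rule finite_subset_Union_chain[OF G(1) GU ne ch])
      then show False using C[of X] G(3)[of X] by simp
    qed
    moreover have "U \<subseteq> \<Union>\<C>" using C ne by blast
    ultimately show "\<Union>\<C> \<in> \<A>" by (simp add: \<A>_def)
  qed
  then obtain N where N: "N \<in> \<A>" "\<And>X. X \<in> \<A> \<Longrightarrow> N \<subseteq> X \<Longrightarrow> X = N" by blast
  have "maximal_submodule R M N"
    unfolding maximal_submodule_def using N by (auto simp: \<A>_def)
  then show ?thesis using N by (auto simp: \<A>_def)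
qed

text \<open>A form of Nakayama's lemma: a proper submodule lies in a maximal one, which contains the
  radical as well, so the two cannot add up to the module.\<close>

lemma radical_superfluous:
  assumes G: "finite G" "G \<subseteq> carrier M" "\<And>N. submodule N R M \<Longrightarrow> G \<subseteq> N \<Longrightarrow> N = carrier M"
  shows "superfluous R M (module_radical R M)"
  unfolding superfluous_def
proof (intro conjI allI impI)
  show "submodule (module_radical R M) R M" by (rule submodule_radical)
  fix N assume "submodule N R M \<and> set_add M N (module_radical R M) = carrier M"
  then have N: "submodule N R M" and e: "set_add M N (module_radical R M) = carrier M" by auto
  show "N = carrier M"
  proof (rule ccontr)
    assume "N \<noteq> carrier M"
    then obtain X where X: "maximal_submodule R M X" "N \<subseteq> X"
      using proper_in_maximal[OF G N] by metis
    have Xs: "submodule X R M" "X \<noteq> carrier M" using X by (auto simp: maximal_submodule_def)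
    have "module_radical R M \<subseteq> X" using X by (auto simp: module_radical_def)
    have "carrier M \<subseteq> X"
    proof
      fix x assume "x \<in> carrier M"
      then obtain u k where "u \<in> N" "k \<in> module_radical R M" "x = u \<oplus>\<^bsub>M\<^esub> k"
        using e mem_set_add_iff[of x M N "module_radical R M"] by blast
      then show "x \<in> X" using X(2) \<open>module_radical R M \<subseteq> X\<close> submoduleD(3)[OF Xs(1)] by auto
    qed
    then show False using Xs submoduleD(1)[OF Xs(1)] by blast
  qed
qed

lemma superfluous_subset_maximal:
  assumes "superfluous R M K" "maximal_submodule R M N"
  shows "K \<subseteq> N"
proof (rule ccontr)
  assume K: "\<not> K \<subseteq> N"
  have s: "submodule N R M" "submodule K R M" using assms by (auto simp: superfluous_def maximal_submodule_def)
  have "set_add M N K = N \<or> set_add M N K = carrier M"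
    using submodule_set_add[OF s] subset_set_add[OF s] assms by (auto simp: maximal_submodule_def)
  moreover have "set_add M N K \<noteq> N" using subset_set_add[OF s] K by auto
  ultimately show False using assms s by (auto simp: superfluous_def maximal_submodule_def)
qed

end

section \<open>Quotients and direct sums\<close>

context op_module
begin

text \<open>The scalar action on cosets is defined as a union over representatives; that the result
  is a single coset rests on \<open>K\<close> being stable under the operators.\<close>

lemma
  assumes K: "submodule K R M"
  shows coset_eq_iff: "x \<in> carrier M \<Longrightarrow> y \<in> carrier M
      \<Longrightarrow> a_r_coset M K x = a_r_coset M K y \<longleftrightarrow> x \<ominus>\<^bsub>M\<^esub> y \<in> K"
    and coset_self: "x \<in> carrier M \<Longrightarrow> x \<in> a_r_coset M K x"
    and coset_add: "x \<in> carrier M \<Longrightarrow> y \<in> carrier M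
      \<Longrightarrow> set_add M (a_r_coset M K x) (a_r_coset M K y) = a_r_coset M K (x \<oplus>\<^bsub>M\<^esub> y)"
    and coset_zero: "a_r_coset M K \<zero>\<^bsub>M\<^esub> = K"
    and carrier_quotient: "carrier (quotient_module M K) = a_r_coset M K ` carrier M"
    and smult_quotient: "a \<in> carrier R \<Longrightarrow> x \<in> carrier M
      \<Longrightarrow> a \<odot>\<^bsub>quotient_module M K\<^esub> (a_r_coset M K x) = a_r_coset M K (a \<odot>\<^bsub>M\<^esub> x)"
proof -
  note D = submoduleD[OF K]
  have sg: "subgroup K (add_monoid M)" using K by (simp add: submodule_def)
  interpret K: normal K "add_monoid M"
    by (rule comm_group.normal_iff_subgroup[THEN iffD2]) (use sg M.a_comm_group in auto)
  have mem: "z \<in> a_r_coset M K x \<longleftrightarrow> (\<exists>k\<in>K. z = k \<oplus>\<^bsub>M\<^esub> x)" for z x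
    by (auto simp: a_r_coset_def')
  show eq: "a_r_coset M K x = a_r_coset M K y \<longleftrightarrow> x \<ominus>\<^bsub>M\<^esub> y \<in> K"
    if x: "x \<in> carrier M" and y: "y \<in> carrier M" for x y
  proof
    assume e: "a_r_coset M K x = a_r_coset M K y"
    have "x \<in> a_r_coset M K x" unfolding mem using D(2) x by (metis M.l_zero)
    then have "x \<in> a_r_coset M K y" using e by simp
    then obtain k where k: "k \<in> K" "x = k \<oplus>\<^bsub>M\<^esub> y" unfolding mem by blast
    have "x \<ominus>\<^bsub>M\<^esub> y = k" using k(2) D(1)[OF k(1)] y by (simp add: a_minus_def M.a_assoc M.r_neg)
    then show "x \<ominus>\<^bsub>M\<^esub> y \<in> K" using k by simp
  next
    assume e: "x \<ominus>\<^bsub>M\<^esub> y \<in> K"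
    have "x = (x \<ominus>\<^bsub>M\<^esub> y) \<oplus>\<^bsub>M\<^esub> y" using M.add_diff_cancel[OF x y] x y by (simp add: M.a_comm)
    then have "x \<in> a_r_coset M K y" unfolding mem using e by blast
    from M.a_repr_independence[OF this y sg] show "a_r_coset M K x = a_r_coset M K y" by simp
  qed
  show self: "x \<in> a_r_coset M K x" if "x \<in> carrier M" for x
    unfolding mem using D(2) that by (metis M.l_zero)
  show "set_add M (a_r_coset M K x) (a_r_coset M K y) = a_r_coset M K (x \<oplus>\<^bsub>M\<^esub> y)"
    if "x \<in> carrier M" "y \<in> carrier M" for x y
    using K.rcos_sum[of x y] that by (simp add: set_add_def a_r_coset_def)
  show "a_r_coset M K \<zero>\<^bsub>M\<^esub> = K" using D(1) by (intro M.a_coset_add_zero) auto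
  show "carrier (quotient_module M K) = a_r_coset M K ` carrier M"
    by (auto simp: quotient_module_def A_RCOSETS_def')
  show "a \<odot>\<^bsub>quotient_module M K\<^esub> (a_r_coset M K x) = a_r_coset M K (a \<odot>\<^bsub>M\<^esub> x)"
    if a: "a \<in> carrier R" and x: "x \<in> carrier M" for a x
  proof -
    have "a_r_coset M K (a \<odot>\<^bsub>M\<^esub> z) = a_r_coset M K (a \<odot>\<^bsub>M\<^esub> x)" if z: "z \<in> a_r_coset M K x" for z
    proof -
      obtain k where k: "k \<in> K" "z = k \<oplus>\<^bsub>M\<^esub> x" using z mem[of z x] by metis
      have kM: "k \<in> carrier M" by (rule D(1)[OF k(1)])
      have "a \<odot>\<^bsub>M\<^esub> z \<ominus>\<^bsub>M\<^esub> a \<odot>\<^bsub>M\<^esub> x = a \<odot>\<^bsub>M\<^esub> k"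
        using k(2) kM a x smult_closed[OF a kM] smult_closed[OF a x]
        by (simp add: smult_r_distr a_minus_def M.a_assoc M.r_neg)
      then show ?thesis using D(5)[OF a k(1)] k(2) kM x a by (subst eq) (auto intro: smult_closed)
    qed
    note all = this
    \<comment> \<open>A union of equal cosets over a nonempty set collapses to one of them.\<close>
    have "(\<Union>z\<in>a_r_coset M K x. a_r_coset M K (a \<odot>\<^bsub>M\<^esub> z)) = a_r_coset M K (a \<odot>\<^bsub>M\<^esub> x)"
      using all by (intro UN_constant_eq[OF self[OF x]]) blast
    then show ?thesis by (simp add: quotient_module_def)
  qed
qed

lemma
  assumes K: "submodule K R M"
  shows op_module_quotient: "op_module R (quotient_module M K)"
    and quotient_hom: "a_r_coset M K \<in> mod_hom R M (quotient_module M K)"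
proof -
  let ?Q = "quotient_module M K" and ?c = "a_r_coset M K"
  note c = carrier_quotient[OF K] coset_add[OF K] coset_zero[OF K] smult_quotient[OF K]
  have add: "X \<oplus>\<^bsub>?Q\<^esub> Y = set_add M X Y" and zero: "\<zero>\<^bsub>?Q\<^esub> = ?c \<zero>\<^bsub>M\<^esub>" for X Y
    using c(3) by (auto simp: quotient_module_def)
  have "abelian_group ?Q"
  proof (rule abelian_groupI)
    fix X assume "X \<in> carrier ?Q"
    then obtain x where x: "X = ?c x" "x \<in> carrier M" using c by auto
    show "\<exists>Y\<in>carrier ?Q. Y \<oplus>\<^bsub>?Q\<^esub> X = \<zero>\<^bsub>?Q\<^esub>"
      using x c by (intro bexI[of _ "?c (\<ominus>\<^bsub>M\<^esub> x)"]) (auto simp: add zero M.l_neg)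
  qed (auto simp: c(1) c(2) add zero M.a_ac)
  then show Q: "op_module R ?Q"
    by (rule op_module.intro, unfold_locales)
       (auto simp: c add smult_closed smult_r_distr)
  show "?c \<in> mod_hom R M ?Q"
    by (rule mod_homI) (auto simp: c add)
qed

lemma quotient_isomorphic:
  assumes K: "submodule K R M" and f: "f \<in> mod_hom R M N" and N: "abelian_group N"
    and surj: "f ` carrier M = carrier N"
    and ker: "\<And>x. x \<in> carrier M \<Longrightarrow> f x = \<zero>\<^bsub>N\<^esub> \<longleftrightarrow> x \<in> K"
  shows "mod_isomorphic R (quotient_module M K) N"
proof -
  interpret N: abelian_group N by fact
  let ?c = "a_r_coset M K" and ?Q = "quotient_module M K"
  note D = mod_homD[OF f] and q = carrier_quotient[OF K]
  have neg: "f (\<ominus>\<^bsub>M\<^esub> x) = \<ominus>\<^bsub>N\<^esub> f x" if "x \<in> carrier M" for x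
    using D that by (intro additive_neg[OF M.abelian_group_axioms N])
  have eq: "?c x = ?c y \<longleftrightarrow> f x = f y" if "x \<in> carrier M" "y \<in> carrier M" for x y
  proof -
    have "f (x \<ominus>\<^bsub>M\<^esub> y) = f x \<ominus>\<^bsub>N\<^esub> f y" using that D by (simp add: a_minus_def neg)
    moreover have "f x \<ominus>\<^bsub>N\<^esub> f y = \<zero>\<^bsub>N\<^esub> \<longleftrightarrow> f x = f y"
      using D that by (metis N.add_diff_cancel N.r_zero N.r_neg a_minus_def)
    ultimately show ?thesis using coset_eq_iff[OF K that] ker[of "x \<ominus>\<^bsub>M\<^esub> y"] that by simp
  qed
  \<comment> \<open>Any representative gives the same value, because the kernel of \<open>f\<close>
    is exactly \<open>K\<close>.\<close>
  define g where "g X = f (SOME x. x \<in> carrier M \<and> ?c x = X)" for X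
  have gc: "g (?c x) = f x" if "x \<in> carrier M" for x
  proof -
    have "(SOME y. y \<in> carrier M \<and> ?c y = ?c x) \<in> carrier M \<and> ?c (SOME y. y \<in> carrier M \<and> ?c y = ?c x) = ?c x"
      by (rule someI[of _ x]) (use that in simp)
    then show ?thesis unfolding g_def using eq that by blast
  qed
  have "g \<in> mod_hom R ?Q N"
  proof (rule mod_homI)
    show "g X \<in> carrier N" if "X \<in> carrier ?Q" for X using that gc D by (auto simp: q)
    show "g (X \<oplus>\<^bsub>?Q\<^esub> Y) = g X \<oplus>\<^bsub>N\<^esub> g Y" if XY: "X \<in> carrier ?Q" "Y \<in> carrier ?Q" for X Y
    proof -
      obtain x y where x: "X = ?c x" "x \<in> carrier M" "Y = ?c y" "y \<in> carrier M" using XY q by auto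
      have "X \<oplus>\<^bsub>?Q\<^esub> Y = ?c (x \<oplus>\<^bsub>M\<^esub> y)" using x mod_homD(2)[OF quotient_hom[OF K]] by simp
      then show ?thesis using x gc D by simp
    qed
    show "g (a \<odot>\<^bsub>?Q\<^esub> X) = a \<odot>\<^bsub>N\<^esub> g X" if aX: "a \<in> carrier R" "X \<in> carrier ?Q" for a X
    proof -
      obtain x where x: "X = ?c x" "x \<in> carrier M" using aX q by auto
      then show ?thesis using aX gc D smult_quotient[OF K] smult_closed by simp
    qed
  qed
  moreover have "bij_betw g (carrier ?Q) (carrier N)"
    unfolding bij_betw_def
  proof
    show "inj_on g (carrier ?Q)" unfolding q by (rule inj_onI) (elim imageE, simp add: gc eq)
    show "g ` carrier ?Q = carrier N" unfolding q image_image using surj gc by (simp cong: image_cong)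
  qed
  ultimately show ?thesis unfolding mod_isomorphic_def by blast
qed

end

section \<open>Direct sums of modules with operators\<close>

lemma dsum_simps:
  "carrier (dsum I M) = (\<Pi>\<^sub>E i\<in>I. carrier (M i))"
  "\<zero>\<^bsub>dsum I M\<^esub> = (\<lambda>i\<in>I. \<zero>\<^bsub>M i\<^esub>)"
  "f \<oplus>\<^bsub>dsum I M\<^esub> g = (\<lambda>i\<in>I. f i \<oplus>\<^bsub>M i\<^esub> g i)"
  "a \<odot>\<^bsub>dsum I M\<^esub> f = (\<lambda>i\<in>I. a \<odot>\<^bsub>M i\<^esub> f i)"
  by (simp_all add: dsum_def)

text \<open>Group laws outside the locale, so that they can be instantiated at a family
  \<open>M i\<close> whose index is still a bound variable.\<close>

lemma abelian_group_facts:
  assumes "abelian_group M"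
  shows "\<zero>\<^bsub>M\<^esub> \<in> carrier M" "x \<in> carrier M \<Longrightarrow> \<ominus>\<^bsub>M\<^esub> x \<in> carrier M"
    and "x \<in> carrier M \<Longrightarrow> y \<in> carrier M \<Longrightarrow> x \<oplus>\<^bsub>M\<^esub> y \<in> carrier M"
    and "x \<in> carrier M \<Longrightarrow> \<zero>\<^bsub>M\<^esub> \<oplus>\<^bsub>M\<^esub> x = x" "x \<in> carrier M \<Longrightarrow> x \<oplus>\<^bsub>M\<^esub> \<zero>\<^bsub>M\<^esub> = x"
    and "x \<in> carrier M \<Longrightarrow> \<ominus>\<^bsub>M\<^esub> x \<oplus>\<^bsub>M\<^esub> x = \<zero>\<^bsub>M\<^esub>"
    and "x \<in> carrier M \<Longrightarrow> y \<in> carrier M \<Longrightarrow> z \<in> carrier M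
      \<Longrightarrow> x \<oplus>\<^bsub>M\<^esub> y \<oplus>\<^bsub>M\<^esub> z = x \<oplus>\<^bsub>M\<^esub> (y \<oplus>\<^bsub>M\<^esub> z)"
    and "\<ominus>\<^bsub>M\<^esub> \<zero>\<^bsub>M\<^esub> = \<zero>\<^bsub>M\<^esub>"
proof -
  interpret abelian_group M by fact
  show "\<zero>\<^bsub>M\<^esub> \<in> carrier M" "x \<in> carrier M \<Longrightarrow> \<ominus>\<^bsub>M\<^esub> x \<in> carrier M"
    "x \<in> carrier M \<Longrightarrow> y \<in> carrier M \<Longrightarrow> x \<oplus>\<^bsub>M\<^esub> y \<in> carrier M"
    "x \<in> carrier M \<Longrightarrow> \<zero>\<^bsub>M\<^esub> \<oplus>\<^bsub>M\<^esub> x = x" "x \<in> carrier M \<Longrightarrow> x \<oplus>\<^bsub>M\<^esub> \<zero>\<^bsub>M\<^esub> = x"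
    "x \<in> carrier M \<Longrightarrow> \<ominus>\<^bsub>M\<^esub> x \<oplus>\<^bsub>M\<^esub> x = \<zero>\<^bsub>M\<^esub>"
    "x \<in> carrier M \<Longrightarrow> y \<in> carrier M \<Longrightarrow> z \<in> carrier M
      \<Longrightarrow> x \<oplus>\<^bsub>M\<^esub> y \<oplus>\<^bsub>M\<^esub> z = x \<oplus>\<^bsub>M\<^esub> (y \<oplus>\<^bsub>M\<^esub> z)"
    "\<ominus>\<^bsub>M\<^esub> \<zero>\<^bsub>M\<^esub> = \<zero>\<^bsub>M\<^esub>"
    by (simp_all add: l_neg a_assoc)
qed

lemma abelian_group_dsum:
  assumes "\<And>i. i \<in> I \<Longrightarrow> abelian_group (M i)"
  shows "abelian_group (dsum I M)"
proof (rule abelian_groupI)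
  note [simp] = dsum_simps
  note a = abelian_group_facts[OF assms]
  show "\<zero>\<^bsub>dsum I M\<^esub> \<in> carrier (dsum I M)" using a(1) by (auto simp: dsum_simps)
  fix x assume x: "x \<in> carrier (dsum I M)"
  show "\<exists>y\<in>carrier (dsum I M). y \<oplus>\<^bsub>dsum I M\<^esub> x = \<zero>\<^bsub>dsum I M\<^esub>"
    by (rule bexI[of _ "\<lambda>i\<in>I. \<ominus>\<^bsub>M i\<^esub> x i"])
       (use x a in \<open>auto simp: PiE_iff fun_eq_iff\<close>)
  show "\<zero>\<^bsub>dsum I M\<^esub> \<oplus>\<^bsub>dsum I M\<^esub> x = x"
    using x a by (auto simp: PiE_iff fun_eq_iff extensional_def)
  fix y assume y: "y \<in> carrier (dsum I M)"
  show "x \<oplus>\<^bsub>dsum I M\<^esub> y \<in> carrier (dsum I M)" using x y a by (auto simp: PiE_iff)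
  have "x i \<oplus>\<^bsub>M i\<^esub> y i = y i \<oplus>\<^bsub>M i\<^esub> x i" if "i \<in> I" for i
    using abelian_groupE(4)[OF assms[OF that]] x y that by (auto simp: PiE_iff)
  then show "x \<oplus>\<^bsub>dsum I M\<^esub> y = y \<oplus>\<^bsub>dsum I M\<^esub> x" by (auto simp: fun_eq_iff)
  fix z assume z: "z \<in> carrier (dsum I M)"
  show "x \<oplus>\<^bsub>dsum I M\<^esub> y \<oplus>\<^bsub>dsum I M\<^esub> z = x \<oplus>\<^bsub>dsum I M\<^esub> (y \<oplus>\<^bsub>dsum I M\<^esub> z)"
    using x y z a by (auto simp: PiE_iff fun_eq_iff)
qed

lemma op_module_dsum:
  assumes "\<And>i. i \<in> I \<Longrightarrow> op_module R (M i)"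
  shows "op_module R (dsum I M)"
proof -
  have "abelian_group (dsum I M)"
    using assms by (intro abelian_group_dsum) (simp add: op_module_def)
  then show ?thesis
  proof (rule op_module.intro, unfold_locales)
    fix a x assume a: "a \<in> carrier R" and x: "x \<in> carrier (dsum I M)"
    then show "a \<odot>\<^bsub>dsum I M\<^esub> x \<in> carrier (dsum I M)"
      using op_module.smult_closed[OF assms] by (auto simp: PiE_iff dsum_simps)
    fix y assume "y \<in> carrier (dsum I M)"
    then show "a \<odot>\<^bsub>dsum I M\<^esub> (x \<oplus>\<^bsub>dsum I M\<^esub> y) = a \<odot>\<^bsub>dsum I M\<^esub> x \<oplus>\<^bsub>dsum I M\<^esub> a \<odot>\<^bsub>dsum I M\<^esub> y"
      using a x op_module.smult_r_distr[OF assms] by (auto simp: PiE_iff dsum_simps fun_eq_iff)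
  qed
qed

lemma uminus_dsum:
  assumes "\<And>i. i \<in> I \<Longrightarrow> abelian_group (M i)" "x \<in> carrier (dsum I M)"
  shows "\<ominus>\<^bsub>dsum I M\<^esub> x = (\<lambda>i\<in>I. \<ominus>\<^bsub>M i\<^esub> x i)"
proof -
  interpret D: abelian_group "dsum I M" by (rule abelian_group_dsum[OF assms(1)])
  note a = abelian_group_facts[OF assms(1)]
  show ?thesis
    by (rule D.minus_equality) (use assms(2) a in \<open>auto simp: dsum_simps PiE_iff fun_eq_iff\<close>)
qed

text \<open>Evaluation at a coordinate is additive, so it commutes with finite sums.\<close>

lemma finsum_dsum:
  assumes "\<And>i. i \<in> I \<Longrightarrow> abelian_group (M i)" "finite J" "g \<in> J \<rightarrow> carrier (dsum I M)" "i \<in> I"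
  shows "finsum (dsum I M) g J i = finsum (M i) (\<lambda>j. g j i) J"
  by (rule additive_finsum[OF abelian_group_dsum[OF assms(1)] assms(1)[OF assms(4)], where f = "\<lambda>f. f i"])
     (use assms in \<open>auto simp: dsum_simps PiE_iff\<close>)

text \<open>The coordinates are cleared one at a time: if \<open>N\<close> and the tuples of
  elements of \<open>K\<close> span the sum, then so do \<open>N\<close> and those tuples whose
  entries vanish on a growing set \<open>J\<close>; for \<open>J = I\<close> only \<open>N\<close>
  is left.\<close>

lemma dsum_superfluous:
  assumes I: "finite I" and M: "\<And>i. i \<in> I \<Longrightarrow> op_module R (M i)"
    and K: "\<And>i. i \<in> I \<Longrightarrow> superfluous R (M i) (K i)"
  shows "superfluous R (dsum I M) {f \<in> carrier (dsum I M). \<forall>i\<in>I. f i \<in> K i}"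
proof -
  let ?D = "dsum I M"
  interpret D: op_module R ?D by (rule op_module_dsum[OF M])
  have ab: "abelian_group (M i)" if "i \<in> I" for i using M[OF that] by (simp add: op_module_def)
  have Ks: "submodule (K i) R (M i)" if "i \<in> I" for i using K[OF that] by (simp add: superfluous_def)
  note KD = op_module.submoduleD[OF M Ks]
  note a = abelian_group_facts[OF ab] and sm = op_module.smult_closed[OF M] op_module.smult_zero[OF M]
  define KJ where "KJ J = {f \<in> carrier ?D. \<forall>i\<in>I. f i \<in> (if i \<in> J then {\<zero>\<^bsub>M i\<^esub>} else K i)}" for J
  have KJs: "submodule (KJ J) R ?D" for J
  proof (rule D.submoduleI)
    show "KJ J \<subseteq> carrier ?D" by (auto simp: KJ_def)
    show "\<zero>\<^bsub>?D\<^esub> \<in> KJ J" using KD(2) a by (auto simp: KJ_def dsum_simps)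
    show "x \<oplus>\<^bsub>?D\<^esub> y \<in> KJ J" if "x \<in> KJ J" "y \<in> KJ J" for x y
      using that KD(3) a by (fastforce simp: KJ_def dsum_simps PiE_iff)
    show "\<ominus>\<^bsub>?D\<^esub> x \<in> KJ J" if x: "x \<in> KJ J" for x
    proof -
      have xc: "x \<in> carrier ?D" using x by (simp add: KJ_def)
      have ux: "\<ominus>\<^bsub>?D\<^esub> x = (\<lambda>i\<in>I. \<ominus>\<^bsub>M i\<^esub> x i)" by (rule uminus_dsum[OF ab xc])
      have "(\<ominus>\<^bsub>?D\<^esub> x) i \<in> (if i \<in> J then {\<zero>\<^bsub>M i\<^esub>} else K i)" if i: "i \<in> I" for i
      proof -
        have "x i \<in> (if i \<in> J then {\<zero>\<^bsub>M i\<^esub>} else K i)" using x i by (auto simp: KJ_def)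
        then show ?thesis
          using i KD(4)[OF i] a(8)[OF i] by (simp add: ux split: if_splits)
      qed
      then show ?thesis using D.a_inv_closed[OF xc] by (simp add: KJ_def)
    qed
    show "a \<odot>\<^bsub>?D\<^esub> x \<in> KJ J" if "a \<in> carrier R" "x \<in> KJ J" for a x
    proof -
      have xc: "x \<in> carrier ?D" using that by (simp add: KJ_def)
      have "(a \<odot>\<^bsub>?D\<^esub> x) i \<in> (if i \<in> J then {\<zero>\<^bsub>M i\<^esub>} else K i)" if i: "i \<in> I" for i
      proof -
        have "x i \<in> (if i \<in> J then {\<zero>\<^bsub>M i\<^esub>} else K i)" using \<open>x \<in> KJ J\<close> i by (auto simp: KJ_def)
        then show ?thesis
          using i KD(5)[OF i i \<open>a \<in> carrier R\<close>] sm(2)[OF i \<open>a \<in> carrier R\<close>]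
          by (simp add: dsum_simps split: if_splits)
      qed
      then show ?thesis using D.smult_closed[OF \<open>a \<in> carrier R\<close> xc] by (simp add: KJ_def)
    qed
  qed
  have main: "set_add ?D N (KJ J) = carrier ?D" if "J \<subseteq> I" "submodule N R ?D" "set_add ?D N (KJ {}) = carrier ?D" for N J
  proof -
    have "finite J" using that I finite_subset by blast
    then show ?thesis using that(1)
    proof (induction J rule: finite_induct)
      case empty
      then show ?case using that(3) by simp
    next
      case (insert j J)
      then have j: "j \<in> I" and IH: "set_add ?D N (KJ J) = carrier ?D" by auto
      let ?Y = "set_add ?D N (KJ (insert j J))"
      have Ys: "submodule ?Y R ?D" by (rule D.submodule_set_add[OF that(2) KJs])
      note YD = D.submoduleD[OF Ys]
      define s where "s q = (\<lambda>i\<in>I. if i = j then q else \<zero>\<^bsub>M i\<^esub>)" for q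
      have s: "s \<in> mod_hom R (M j) ?D"
        using j a sm by (intro mod_homI) (auto simp: s_def dsum_simps PiE_iff fun_eq_iff)
      have Q: "submodule {q \<in> carrier (M j). s q \<in> ?Y} R (M j)"
        by (rule op_module.preimage_submodule[OF M[OF j] s D.op_module_axioms Ys])
      interpret Mj: op_module R "M j" by (rule M[OF j])
      have KY: "KJ (insert j J) \<subseteq> ?Y" and NY: "N \<subseteq> ?Y"
        using D.subset_set_add[OF that(2) KJs] by auto
      \<comment> \<open>The \<open>j\<close>-th entry is split off; what remains vanishes at
        \<open>j\<close> as well.\<close>
      have split: "\<exists>w \<in> KJ (insert j J). k = s (k j) \<oplus>\<^bsub>?D\<^esub> w" if k: "k \<in> KJ J" for k
      proof
        show "(\<lambda>i\<in>I. if i = j then \<zero>\<^bsub>M j\<^esub> else k i) \<in> KJ (insert j J)"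
          using k j a by (auto simp: KJ_def dsum_simps PiE_iff)
        show "k = s (k j) \<oplus>\<^bsub>?D\<^esub> (\<lambda>i\<in>I. if i = j then \<zero>\<^bsub>M j\<^esub> else k i)"
          using k j a by (auto simp: KJ_def s_def dsum_simps PiE_iff fun_eq_iff extensional_def)
      qed
      have kj: "k j \<in> K j" if "k \<in> KJ J" for k using that j insert(2) by (auto simp: KJ_def)
      \<comment> \<open>Here superfluity of \<open>K j\<close> enters: the preimage of
        \<open>?Y\<close> under the \<open>j\<close>-th inclusion and \<open>K j\<close> add up to
        \<open>M j\<close>.\<close>
      have full: "{q \<in> carrier (M j). s q \<in> ?Y} = carrier (M j)"
      proof (rule Mj.superfluousD[OF K[OF j] Q])
        fix q assume q: "q \<in> carrier (M j)"
        have sq: "s q \<in> carrier ?D" using mod_homD(1)[OF s q] .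
        then obtain n k where n: "n \<in> N" "k \<in> KJ J" "s q = n \<oplus>\<^bsub>?D\<^esub> k"
          using IH by (metis mem_set_add_iff)
        have nc: "n \<in> carrier ?D" "k \<in> carrier ?D" using n D.submoduleD(1) that(2) KJs by blast+
        obtain w where w: "w \<in> KJ (insert j J)" "k = s (k j) \<oplus>\<^bsub>?D\<^esub> w" using split n by blast
        have kc: "k j \<in> carrier (M j)" using KD(1)[OF j j kj] n by blast
        have wc: "w \<in> carrier ?D" using w by (simp add: KJ_def)
        let ?q = "q \<ominus>\<^bsub>M j\<^esub> k j"
        have qd: "k j \<oplus>\<^bsub>M j\<^esub> ?q = q" using Mj.add_diff_cancel[OF q kc] .
        have qc: "?q \<in> carrier (M j)" using q kc Mj.minus_closed by blast
        note sc = mod_homD(1)[OF s kc] mod_homD(1)[OF s qc]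
        have "s (k j) \<oplus>\<^bsub>?D\<^esub> s ?q = s q" using mod_homD(2)[OF s kc qc] qd by simp
        also have "\<dots> = s (k j) \<oplus>\<^bsub>?D\<^esub> (n \<oplus>\<^bsub>?D\<^esub> w)"
          using n(3) w(2) nc wc sc by (metis D.a_lcomm)
        finally have "s ?q = n \<oplus>\<^bsub>?D\<^esub> w" using sc nc wc by (simp add: D.a_comm[of "s (k j)"])
        then have "s ?q \<in> ?Y" using n w by (auto simp: mem_set_add_iff)
        then show "\<exists>n\<in>{q \<in> carrier (M j). s q \<in> ?Y}. \<exists>k\<in>K j. q = n \<oplus>\<^bsub>M j\<^esub> k"
          using qc qd kj[OF n(2)] kc by (intro bexI[of _ ?q] bexI[of _ "k j"]) (auto simp: Mj.a_comm)
      qed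
      show ?case
      proof
        show "?Y \<subseteq> carrier ?D" using YD(1) by blast
        show "carrier ?D \<subseteq> ?Y"
        proof
          fix x assume "x \<in> carrier ?D"
          then obtain n k where n: "n \<in> N" "k \<in> KJ J" "x = n \<oplus>\<^bsub>?D\<^esub> k" using IH by (metis mem_set_add_iff)
          obtain w where w: "w \<in> KJ (insert j J)" "k = s (k j) \<oplus>\<^bsub>?D\<^esub> w" using split n by blast
          have "k j \<in> carrier (M j)" using KD(1)[OF j j kj] n by blast
          then have "s (k j) \<in> ?Y" using full by blast
          then have "k \<in> ?Y" using w(2) YD(3) KY w(1) by (metis subsetD)
          then show "x \<in> ?Y" using n NY YD(3) by blast
        qed
      qed
    qed
  qed
  have e: "KJ {} = {f \<in> carrier ?D. \<forall>i\<in>I. f i \<in> K i}" by (auto simp: KJ_def)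
  have z: "KJ I = {\<zero>\<^bsub>?D\<^esub>}"
    using a by (auto simp: KJ_def dsum_simps fun_eq_iff PiE_iff extensional_def)
  show ?thesis unfolding e[symmetric] superfluous_def
  proof (intro conjI allI impI)
    show "submodule (KJ {}) R ?D" by (rule KJs)
    fix N assume N: "submodule N R ?D \<and> set_add ?D N (KJ {}) = carrier ?D"
    then have Ns: "submodule N R ?D" by simp
    have c: "set_add ?D N (KJ I) = carrier ?D" by (rule main[OF subset_refl Ns conjunct2[OF N]])
    note D = D.submoduleD(1)[OF Ns]
    show "N = carrier ?D"
    proof
      show "N \<subseteq> carrier ?D" using D by blast
      show "carrier ?D \<subseteq> N"
      proof
        fix x assume "x \<in> carrier ?D"
        then have "x \<in> set_add ?D N (KJ I)" using c by simp
        then obtain n where n: "n \<in> N" "x = n \<oplus>\<^bsub>?D\<^esub> \<zero>\<^bsub>?D\<^esub>" unfolding mem_set_add_iff z by blast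
        then show "x \<in> N" using D.r_zero[OF D[OF n(1)]] by simp
      qed
    qed
  qed
qed

text \<open>The radical is respected by the inclusions and projections of a direct sum decomposition, since homomorphisms map
  radicals into radicals; so it decomposes accordingly.\<close>

lemma head_direct_sum:
  assumes M: "op_module R M" and I: "finite I" and N: "\<And>r. r \<in> I \<Longrightarrow> op_module R (N r)"
    and \<pi>: "\<And>r. r \<in> I \<Longrightarrow> \<pi> r \<in> mod_hom R M (N r)" and \<iota>: "\<And>r. r \<in> I \<Longrightarrow> \<iota> r \<in> mod_hom R (N r) M"
    and \<pi>\<iota>: "\<And>r s y. r \<in> I \<Longrightarrow> s \<in> I \<Longrightarrow> y \<in> carrier (N s) \<Longrightarrow> \<pi> r (\<iota> s y) = (if r = s then y else \<zero>\<^bsub>N r\<^esub>)"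
    and \<iota>\<pi>: "\<And>x. x \<in> carrier M \<Longrightarrow> x = finsum M (\<lambda>r. \<iota> r (\<pi> r x)) I"
  shows "mod_isomorphic R (module_head R M) (dsum I (\<lambda>r. module_head R (N r)))"
proof -
  interpret M: op_module R M by fact
  let ?H = "\<lambda>r. module_head R (N r)" and ?c = "\<lambda>r. a_r_coset (N r) (module_radical R (N r))"
  have rs: "submodule (module_radical R (N r)) R (N r)" if "r \<in> I" for r by (rule op_module.submodule_radical[OF N[OF that]])
  have H: "op_module R (?H r)" if "r \<in> I" for r
    unfolding module_head_def by (rule op_module.op_module_quotient[OF N[OF that] rs[OF that]])
  have c: "?c r \<in> mod_hom R (N r) (?H r)" if "r \<in> I" for r
    unfolding module_head_def by (rule op_module.quotient_hom[OF N[OF that] rs[OF that]])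
  have c\<pi>: "(\<lambda>x. ?c r (\<pi> r x)) \<in> mod_hom R M (?H r)" if "r \<in> I" for r
    by (rule mod_hom_comp[OF \<pi>[OF that] c[OF that]])
  let ?f = "\<lambda>x. \<lambda>r\<in>I. ?c r (\<pi> r x)"
  have f: "?f \<in> mod_hom R M (dsum I ?H)"
    using mod_homD[OF c\<pi>] by (intro mod_homI) (auto simp: dsum_simps fun_eq_iff)
  have rad: "x \<in> module_radical R M \<longleftrightarrow> (\<forall>r\<in>I. \<pi> r x \<in> module_radical R (N r))" if x: "x \<in> carrier M" for x
  proof
    assume "x \<in> module_radical R M"
    then show "\<forall>r\<in>I. \<pi> r x \<in> module_radical R (N r)" using M.hom_radical \<pi> N by blast
  next
    assume *: "\<forall>r\<in>I. \<pi> r x \<in> module_radical R (N r)"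
    have "\<iota> r (\<pi> r x) \<in> module_radical R M" if "r \<in> I" for r
      using op_module.hom_radical[OF N[OF that] \<iota>[OF that] M] * that by blast
    then have "finsum M (\<lambda>r. \<iota> r (\<pi> r x)) I \<in> module_radical R M"
      by (intro M.submodule_finsum[OF M.submodule_radical I]) auto
    then show "x \<in> module_radical R M" using \<iota>\<pi>[OF x] by simp
  qed
  show ?thesis
    unfolding module_head_def[of R M]
  proof (rule M.quotient_isomorphic[OF M.submodule_radical f])
    show "abelian_group (dsum I ?H)" using H by (intro abelian_group_dsum) (simp add: op_module_def)
    show "?f ` carrier M = carrier (dsum I ?H)"
    proof
      show "?f ` carrier M \<subseteq> carrier (dsum I ?H)" using mod_homD(1)[OF f] by blast
      show "carrier (dsum I ?H) \<subseteq> ?f ` carrier M"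
      proof
        fix Y assume Y: "Y \<in> carrier (dsum I ?H)"
        have "\<exists>y\<in>carrier (N r). Y r = ?c r y" if "r \<in> I" for r
        proof -
          have "Y r \<in> carrier (?H r)" using Y that by (auto simp: dsum_simps)
          then show ?thesis using op_module.carrier_quotient[OF N[OF that] rs[OF that]] by (auto simp: module_head_def)
        qed
        then obtain y where y: "\<And>r. r \<in> I \<Longrightarrow> y r \<in> carrier (N r) \<and> Y r = ?c r (y r)" by metis
        let ?x = "finsum M (\<lambda>r. \<iota> r (y r)) I"
        have in\<iota>: "(\<lambda>r. \<iota> r (y r)) \<in> I \<rightarrow> carrier M" using y mod_homD(1)[OF \<iota>] by blast
        \<comment> \<open>Orthogonality of projections and inclusions leaves only the summand with
          \<open>r = s\<close>.\<close>
        have "\<pi> s ?x = y s" if s: "s \<in> I" for s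
        proof -
          interpret Ns: op_module R "N s" by (rule N[OF s])
          have "\<pi> s ?x = finsum (N s) (\<lambda>r. \<pi> s (\<iota> r (y r))) I"
            by (rule additive_finsum[OF M.abelian_group_axioms Ns.abelian_group_axioms])
               (use mod_homD[OF \<pi>[OF s]] in\<iota> I in auto)
          also have "\<dots> = finsum (N s) (\<lambda>r. if r = s then y s else \<zero>\<^bsub>N s\<^esub>) I"
            by (rule Ns.finsum_cong') (use s y in \<open>auto simp: \<pi>\<iota> Pi_iff\<close>)
          also have "\<dots> = y s" by (rule Ns.add.finprod_singleton_swap[OF s I]) (use y s in auto)
          finally show ?thesis .
        qed
        then have "?f ?x = Y" using y Y by (auto simp: fun_eq_iff dsum_simps PiE_iff extensional_def)
        moreover have "?x \<in> carrier M" using in\<iota> by simp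
        ultimately show "Y \<in> ?f ` carrier M" by blast
      qed
    qed
    fix x assume x: "x \<in> carrier M"
    have "?c r (\<pi> r x) = \<zero>\<^bsub>?H r\<^esub> \<longleftrightarrow> \<pi> r x \<in> module_radical R (N r)" if r: "r \<in> I" for r
    proof -
      interpret Nr: op_module R "N r" by (rule N[OF r])
      have p: "\<pi> r x \<in> carrier (N r)" using mod_homD(1)[OF \<pi>[OF r] x] .
      have "\<zero>\<^bsub>?H r\<^esub> = ?c r \<zero>\<^bsub>N r\<^esub>"
        using Nr.coset_zero[OF rs[OF r]] by (simp add: module_head_def quotient_module_def)
      moreover have "\<pi> r x \<ominus>\<^bsub>N r\<^esub> \<zero>\<^bsub>N r\<^esub> = \<pi> r x"
        using p Nr.add.inv_one by (simp add: a_minus_def Nr.r_zero)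
      ultimately show ?thesis using Nr.coset_eq_iff[OF rs[OF r] p, of "\<zero>\<^bsub>N r\<^esub>"] Nr.zero_closed by simp
    qed
    then show "?f x = \<zero>\<^bsub>dsum I ?H\<^esub> \<longleftrightarrow> x \<in> module_radical R M"
      unfolding rad[OF x] dsum_simps by (auto simp: fun_eq_iff restrict_def)
  qed
qed

section \<open>Superfluous submodules under a cyclic extension\<close>

text \<open>Orthogonality of the characters of a cyclic group of order \<open>p\<close>: the sum is
  a geometric series in \<zeta>^(i - i').\<close>

lemma sum_root_of_unity_powers:
  fixes \<zeta> :: "'k::field"
  assumes "\<zeta> ^ p = 1" "\<And>j. 0 < j \<Longrightarrow> j < p \<Longrightarrow> \<zeta> ^ j \<noteq> 1" "i < p" "i' < p"
  shows "(\<Sum>j<p. \<zeta> ^ (i * j) * inverse \<zeta> ^ (i' * j)) = (if i = i' then of_nat p else 0)"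
proof -
  have z0: "\<zeta> \<noteq> 0" using assms(1,3) by (cases "\<zeta> = 0") (auto simp: power_0_left)
  define w where "w = \<zeta> ^ i * inverse \<zeta> ^ i'"
  have s: "(\<Sum>j<p. \<zeta> ^ (i * j) * inverse \<zeta> ^ (i' * j)) = (\<Sum>j<p. w ^ j)"
    by (simp add: w_def power_mult power_mult_distrib)
  show ?thesis
  proof (cases "i = i'")
    case True
    then have "w = 1" using z0 by (simp add: w_def power_mult_distrib[symmetric])
    then show ?thesis using s True by simp
  next
    case False
    have "w \<noteq> 1"
    proof
      assume w1: "w = 1"
      have "\<zeta> ^ i = \<zeta> ^ i'" using w1 z0 by (simp add: w_def power_inverse field_simps)
      \<comment> \<open>Maximum and minimum keep the subtraction of natural numbers exact in both
        orders of \<open>i\<close> and \<open>i'\<close>.\<close>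
      then have e: "\<zeta> ^ (max i i' - min i i') = 1"
        using z0 by (cases "i \<le> i'") (simp_all add: power_diff max_def min_def)
      have "0 < max i i' - min i i'" "max i i' - min i i' < p" using False assms(3,4) by auto
      then show False using e assms(2) by blast
    qed
    moreover have "w ^ p = 1"
    proof -
      have "(\<zeta> ^ i) ^ p = 1" "(inverse \<zeta> ^ i') ^ p = 1"
        using assms(1) by (simp_all add: power_mult[symmetric] mult.commute[of _ p] power_inverse) (simp_all add: power_mult assms(1))
      then show ?thesis by (simp add: w_def power_mult_distrib)
    qed
    ultimately have "(\<Sum>j<p. w ^ j) = 0" using geometric_sum[of w p] by (simp add: lessThan_atLeast0)
    then show ?thesis using s False by simp
  qed
qed

text \<open>Scalars appear as operators \<open>sc c\<close>, in the role of \<open>c\<close> times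
  the unit, and are specified only through their effect on \<open>M\<close>.\<close>

locale scalar_module = op_module R M for R :: "('a, 'r) ring_scheme" (structure) and M :: "('a, 'b) module" (structure) +
  fixes sc :: "'k::field \<Rightarrow> 'a"
  assumes sc_closed: "sc c \<in> carrier R"
    and sc_one: "x \<in> carrier M \<Longrightarrow> sc 1 \<odot>\<^bsub>M\<^esub> x = x"
    and sc_add: "x \<in> carrier M \<Longrightarrow> sc (c + c') \<odot>\<^bsub>M\<^esub> x = sc c \<odot>\<^bsub>M\<^esub> x \<oplus>\<^bsub>M\<^esub> sc c' \<odot>\<^bsub>M\<^esub> x"
    and sc_mult: "x \<in> carrier M \<Longrightarrow> sc (c * c') \<odot>\<^bsub>M\<^esub> x = sc c \<odot>\<^bsub>M\<^esub> (sc c' \<odot>\<^bsub>M\<^esub> x)"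
    and sc_commute: "a \<in> carrier R \<Longrightarrow> x \<in> carrier M \<Longrightarrow> sc c \<odot>\<^bsub>M\<^esub> (a \<odot>\<^bsub>M\<^esub> x) = a \<odot>\<^bsub>M\<^esub> (sc c \<odot>\<^bsub>M\<^esub> x)"
begin

lemma sc_zero: "x \<in> carrier M \<Longrightarrow> sc 0 \<odot>\<^bsub>M\<^esub> x = \<zero>\<^bsub>M\<^esub>"
  using sc_add[of x 0 0] smult_closed[OF sc_closed, of x 0] by simp

lemma sc_sum:
  assumes "x \<in> carrier M" "finite J"
  shows "sc (\<Sum>j\<in>J. c j) \<odot>\<^bsub>M\<^esub> x = finsum M (\<lambda>j. sc (c j) \<odot>\<^bsub>M\<^esub> x) J"
  using assms(2)
proof (induction J rule: finite_induct)
  case empty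
  then show ?case using sc_zero[OF assms(1)] by simp
next
  case (insert j J)
  have "(\<lambda>j. sc (c j) \<odot>\<^bsub>M\<^esub> x) \<in> J \<rightarrow> carrier M" using smult_closed[OF sc_closed assms(1)] by auto
  then show ?case using insert assms(1) smult_closed[OF sc_closed assms(1)]
    by (subst M.finsum_insert) (auto simp: sc_add)
qed

end

text \<open>\<open>E\<close> is the action of a unit normalising the operators in \<open>R\<close>, with \<open>E\<^sup>p\<close> among them.\<close>

locale cyclic_extension = scalar_module R M sc
  for R :: "('a, 'r) ring_scheme" (structure) and M :: "('a, 'b) module" (structure) and sc :: "'k::field \<Rightarrow> 'a" +
  fixes E :: "'b \<Rightarrow> 'b" and m p :: nat and \<zeta> :: 'k
  assumes E_closed: "x \<in> carrier M \<Longrightarrow> E x \<in> carrier M"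
    and E_add: "x \<in> carrier M \<Longrightarrow> y \<in> carrier M \<Longrightarrow> E (x \<oplus>\<^bsub>M\<^esub> y) = E x \<oplus>\<^bsub>M\<^esub> E y"
    and E_power_m: "x \<in> carrier M \<Longrightarrow> (E ^^ m) x = x"
    and p_le_m: "p \<le> m" and p_pos: "0 < p"
    and E_normal: "a \<in> carrier R \<Longrightarrow> \<exists>a'\<in>carrier R. \<forall>x\<in>carrier M. a \<odot>\<^bsub>M\<^esub> E x = E (a' \<odot>\<^bsub>M\<^esub> x)"
    and E_power_p: "\<exists>a\<in>carrier R. \<forall>x\<in>carrier M. (E ^^ p) x = a \<odot>\<^bsub>M\<^esub> x"
    and E_sc: "x \<in> carrier M \<Longrightarrow> E (sc c \<odot>\<^bsub>M\<^esub> x) = sc c \<odot>\<^bsub>M\<^esub> E x"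
    and \<zeta>: "\<zeta> ^ p = 1" "\<And>j. 0 < j \<Longrightarrow> j < p \<Longrightarrow> \<zeta> ^ j \<noteq> 1" and p_invertible: "(of_nat p :: 'k) \<noteq> 0"
begin

lemma Ei_closed: "x \<in> carrier M \<Longrightarrow> (E ^^ i) x \<in> carrier M"
  by (induction i) (auto simp: E_closed)

lemma Ei_add: "x \<in> carrier M \<Longrightarrow> y \<in> carrier M \<Longrightarrow> (E ^^ i) (x \<oplus>\<^bsub>M\<^esub> y) = (E ^^ i) x \<oplus>\<^bsub>M\<^esub> (E ^^ i) y"
  by (induction i) (auto simp: E_add Ei_closed)

lemma Ei_normal: "a \<in> carrier R \<Longrightarrow> \<exists>a'\<in>carrier R. \<forall>x\<in>carrier M. a \<odot>\<^bsub>M\<^esub> (E ^^ i) x = (E ^^ i) (a' \<odot>\<^bsub>M\<^esub> x)"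
proof (induction i arbitrary: a)
  case 0
  then show ?case by auto
next
  case (Suc i)
  obtain a' where a': "a' \<in> carrier R" "\<forall>x\<in>carrier M. a \<odot>\<^bsub>M\<^esub> E x = E (a' \<odot>\<^bsub>M\<^esub> x)"
    using E_normal[OF Suc.prems] by blast
  obtain a'' where a'': "a'' \<in> carrier R" "\<forall>x\<in>carrier M. a' \<odot>\<^bsub>M\<^esub> (E ^^ i) x = (E ^^ i) (a'' \<odot>\<^bsub>M\<^esub> x)"
    using Suc.IH[OF a'(1)] by blast
  show ?case using a' a'' Ei_closed by (intro bexI[of _ a'']) auto
qed

text \<open>\<open>E^m\<close> is the identity on \<open>M\<close>, so \<open>E^(m - i)\<close>
  serves as the inverse of \<open>E^i\<close>.\<close>

lemma E_inverse: "i \<le> m \<Longrightarrow> x \<in> carrier M \<Longrightarrow> (E ^^ i) ((E ^^ (m - i)) x) = x"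
  using E_power_m[of x] by (metis funpow_add le_add_diff_inverse o_apply)

text \<open>If \<open>K\<close> is superfluous for the operators together with \<open>E\<close>, then it is so for the operators alone: in
  \<open>M\<^sup>p\<close>, with \<open>E\<close> acting on the \<open>j\<close>-th coordinate as \<open>\<zeta>\<^sup>jE\<close>, the tuples \<open>(\<Sum>\<^sub>i \<zeta>\<^sup>i\<^sup>jE\<^sup>iu\<^sub>i)\<^sub>j\<close> with
  \<open>u\<^sub>i \<in> U\<close> form a model of the module induced from \<open>U\<close>, and Fourier inversion recovers \<open>U\<close> from it.\<close>

lemma superfluous_restrict:
  assumes K: "submodule K R M" and KE: "\<And>x. x \<in> K \<Longrightarrow> E x \<in> K"
    and sup: "\<And>N. submodule N R M \<Longrightarrow> (\<And>x. x \<in> N \<Longrightarrow> E x \<in> N) \<Longrightarrow> set_add M N K = carrier M \<Longrightarrow> N = carrier M"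
  shows "superfluous R M K"
  unfolding superfluous_def
proof (intro conjI allI impI)
  show "submodule K R M" by (rule K)
  fix U assume "submodule U R M \<and> set_add M U K = carrier M"
  then have U: "submodule U R M" and UK: "set_add M U K = carrier M" by auto
  note KD = submoduleD[OF K] and UD = submoduleD[OF U]
  note smc = smult_closed[OF sc_closed]
  \<comment> \<open>One operator \<open>None\<close> is adjoined for \<open>E\<close>; what results
    is a bare set of operators, which suffices to speak of an \<open>op_module\<close>.\<close>
  define Op :: "'a option ring" where
    "Op = \<lparr>carrier = insert None (Some ` carrier R), mult = undefined, one = undefined, zero = undefined, add = undefined\<rparr>"
  \<comment> \<open>The \<open>j\<close>-th copy of \<open>M\<close>, on which \<open>E\<close> is
    twisted by the \<open>j\<close>-th character of the cyclic group of order
    \<open>p\<close>.\<close>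
  define Mj :: "nat \<Rightarrow> ('a option, 'b) module" where "Mj j = \<lparr>carrier = carrier M, mult = undefined, one = undefined,
      zero = \<zero>\<^bsub>M\<^esub>, add = add M,
      smult = (\<lambda>a x. case a of None \<Rightarrow> sc (\<zeta> ^ j) \<odot>\<^bsub>M\<^esub> E x | Some a \<Rightarrow> a \<odot>\<^bsub>M\<^esub> x)\<rparr>" for j
  have Mj_simps: "carrier (Mj j) = carrier M" "\<zero>\<^bsub>Mj j\<^esub> = \<zero>\<^bsub>M\<^esub>" "x \<oplus>\<^bsub>Mj j\<^esub> y = x \<oplus>\<^bsub>M\<^esub> y"
    "None \<odot>\<^bsub>Mj j\<^esub> x = sc (\<zeta> ^ j) \<odot>\<^bsub>M\<^esub> E x" "Some a \<odot>\<^bsub>Mj j\<^esub> x = a \<odot>\<^bsub>M\<^esub> x" for j x y a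
    by (simp_all add: Mj_def)
  have OpC: "carrier Op = insert None (Some ` carrier R)" by (simp add: Op_def)
  have ab: "abelian_group (Mj j)" for j
    by (rule abelian_groupI) (auto simp: Mj_simps M.a_ac intro: bexI[of _ "\<ominus>\<^bsub>M\<^esub> _"] M.l_neg)
  have opj: "op_module Op (Mj j)" for j
    using ab[of j]
  proof (rule op_module.intro, unfold_locales)
    fix a x assume a: "a \<in> carrier Op" and x: "x \<in> carrier (Mj j)"
    then show "a \<odot>\<^bsub>Mj j\<^esub> x \<in> carrier (Mj j)"
      by (auto simp: OpC Mj_simps smult_closed smc E_closed)
    fix y assume "y \<in> carrier (Mj j)"
    with a x show "a \<odot>\<^bsub>Mj j\<^esub> (x \<oplus>\<^bsub>Mj j\<^esub> y) = a \<odot>\<^bsub>Mj j\<^esub> x \<oplus>\<^bsub>Mj j\<^esub> a \<odot>\<^bsub>Mj j\<^esub> y"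
      by (auto simp: OpC Mj_simps smult_r_distr sc_closed E_closed E_add)
  qed
  have negj: "\<ominus>\<^bsub>Mj j\<^esub> x = \<ominus>\<^bsub>M\<^esub> x" if "x \<in> carrier M" for x j
    by (rule abelian_group.minus_equality[OF ab]) (simp_all add: that Mj_simps M.l_neg)
  have z0: "\<zeta> \<noteq> 0" using \<zeta>(1) p_pos by (cases "\<zeta> = 0") (auto simp: power_0_left)
  \<comment> \<open>A twist by the unit \<zeta>^j does not change which submodules are stable, so
    all copies have the same submodules, namely the \<open>E\<close>-stable ones.\<close>
  have subj: "submodule N Op (Mj j) \<longleftrightarrow> submodule N R M \<and> (\<forall>x\<in>N. E x \<in> N)" for N j
  proof
    assume N: "submodule N Op (Mj j)"
    note D = op_module.submoduleD[OF opj N]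
    have s: "submodule N R M"
    proof (rule submoduleI)
      fix x assume x: "x \<in> N"
      then have xM: "x \<in> carrier M" using D(1) by (simp add: Mj_simps)
      show "\<ominus>\<^bsub>M\<^esub> x \<in> N" using D(4)[OF x] by (simp add: negj[OF xM])
      show "a \<odot>\<^bsub>M\<^esub> x \<in> N" if "a \<in> carrier R" for a
        using D(5)[of "Some a", OF _ x] that by (simp add: OpC Mj_simps)
      show "x \<oplus>\<^bsub>M\<^esub> y \<in> N" if "y \<in> N" for y using D(3)[OF x that] by (simp add: Mj_simps)
    qed (use D(1,2) in \<open>auto simp: Mj_simps\<close>)
    have "E x \<in> N" if x: "x \<in> N" for x
    proof -
      have xM: "x \<in> carrier M" using submoduleD(1)[OF s x] .
      have "sc (\<zeta> ^ j) \<odot>\<^bsub>M\<^esub> E x \<in> N" using D(5)[of None x] x by (simp add: Mj_simps OpC)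
      then have "sc (inverse (\<zeta> ^ j)) \<odot>\<^bsub>M\<^esub> (sc (\<zeta> ^ j) \<odot>\<^bsub>M\<^esub> E x) \<in> N" by (rule submoduleD(5)[OF s sc_closed])
      then show ?thesis using sc_mult[OF E_closed[OF xM]] z0 sc_one[OF E_closed[OF xM]] by (metis left_inverse power_not_zero)
    qed
    with s show "submodule N R M \<and> (\<forall>x\<in>N. E x \<in> N)" by blast
  next
    assume N: "submodule N R M \<and> (\<forall>x\<in>N. E x \<in> N)"
    then have s: "submodule N R M" by blast
    note D = submoduleD[OF s]
    show "submodule N Op (Mj j)"
    proof (rule op_module.submoduleI[OF opj])
      show "a \<odot>\<^bsub>Mj j\<^esub> x \<in> N" if "a \<in> carrier Op" "x \<in> N" for a x
        using that N D(5) sc_closed by (auto simp: OpC Mj_simps)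
      show "\<ominus>\<^bsub>Mj j\<^esub> x \<in> N" if "x \<in> N" for x using D(4)[OF that] negj[OF D(1)[OF that]] by simp
    qed (use D(1-3) in \<open>auto simp: Mj_simps\<close>)
  qed
  have Kj: "superfluous Op (Mj j) K" for j
    unfolding superfluous_def subj using K KE sup by (auto simp: set_add_def' Mj_simps)
  let ?D = "dsum {..<p} Mj"
  have Ksup: "superfluous Op ?D {f \<in> carrier ?D. \<forall>j\<in>{..<p}. f j \<in> K}"
    by (rule dsum_superfluous) (auto intro: opj Kj)
  interpret D: op_module Op ?D by (rule op_module_dsum[OF opj])
  \<comment> \<open>A Fourier transform: \<open>u\<close> is a family of coefficients for the powers
    of \<open>E\<close>, and the \<open>j\<close>-th entry evaluates it at the \<open>j\<close>-th
    character.\<close>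
  define F where "F u = (\<lambda>j\<in>{..<p}. finsum M (\<lambda>i. sc (\<zeta> ^ (i * j)) \<odot>\<^bsub>M\<^esub> (E ^^ i) (u i)) {..<p})" for u
  have term_c: "sc c \<odot>\<^bsub>M\<^esub> (E ^^ i) x \<in> carrier M" if "x \<in> carrier M" for c i x
    using that smc Ei_closed by simp
  have F_c: "F u \<in> carrier ?D" if "\<And>i. i < p \<Longrightarrow> u i \<in> carrier M" for u
    using that term_c by (auto simp: F_def dsum_simps Mj_simps)
  have F_add: "F (\<lambda>i. u i \<oplus>\<^bsub>M\<^esub> v i) = F u \<oplus>\<^bsub>?D\<^esub> F v"
    if u: "\<And>i. i < p \<Longrightarrow> u i \<in> carrier M" and v: "\<And>i. i < p \<Longrightarrow> v i \<in> carrier M" for u v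
  proof -
    have "finsum M (\<lambda>i. sc (\<zeta> ^ (i * j)) \<odot>\<^bsub>M\<^esub> (E ^^ i) (u i \<oplus>\<^bsub>M\<^esub> v i)) {..<p}
        = finsum M (\<lambda>i. sc (\<zeta> ^ (i * j)) \<odot>\<^bsub>M\<^esub> (E ^^ i) (u i) \<oplus>\<^bsub>M\<^esub> sc (\<zeta> ^ (i * j)) \<odot>\<^bsub>M\<^esub> (E ^^ i) (v i)) {..<p}" for j
      by (rule M.finsum_cong') (auto simp: Ei_add smult_r_distr sc_closed Ei_closed u v term_c)
    also have "\<dots> j = finsum M (\<lambda>i. sc (\<zeta> ^ (i * j)) \<odot>\<^bsub>M\<^esub> (E ^^ i) (u i)) {..<p}
        \<oplus>\<^bsub>M\<^esub> finsum M (\<lambda>i. sc (\<zeta> ^ (i * j)) \<odot>\<^bsub>M\<^esub> (E ^^ i) (v i)) {..<p}" for j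
      by (rule M.finsum_addf) (auto simp: u v term_c)
    finally show ?thesis by (auto simp: F_def dsum_simps Mj_simps fun_eq_iff)
  qed
  define V where "V = F ` {u. \<forall>i<p. u i \<in> U}"
  have F_V: "F u \<in> V" if "\<And>i. i < p \<Longrightarrow> u i \<in> U" for u using that by (auto simp: V_def)
  have Vs: "submodule V Op ?D"
  proof (rule D.submoduleI)
    show "V \<subseteq> carrier ?D" using F_c UD(1) by (auto simp: V_def)
    have Ei0: "(E ^^ i) \<zero>\<^bsub>M\<^esub> = \<zero>\<^bsub>M\<^esub>" for i
      by (rule additive_zero[OF M.abelian_group_axioms M.abelian_group_axioms]) (auto simp: Ei_closed Ei_add)
    have "F (\<lambda>_. \<zero>\<^bsub>M\<^esub>) = \<zero>\<^bsub>?D\<^esub>"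
      by (auto simp: F_def Ei0 smult_zero[OF sc_closed] dsum_simps Mj_simps fun_eq_iff)
    then show "\<zero>\<^bsub>?D\<^esub> \<in> V" using F_V[of "\<lambda>_. \<zero>\<^bsub>M\<^esub>"] UD(2) by simp
    show "x \<oplus>\<^bsub>?D\<^esub> y \<in> V" if xy: "x \<in> V" "y \<in> V" for x y
    proof -
      obtain u v where "x = F u" "\<forall>i<p. u i \<in> U" "y = F v" "\<forall>i<p. v i \<in> U" using xy by (auto simp: V_def)
      then show ?thesis using F_add[of u v] F_V[of "\<lambda>i. u i \<oplus>\<^bsub>M\<^esub> v i"] UD(1,3) by simp
    qed
    have smV: "a \<odot>\<^bsub>?D\<^esub> x \<in> V" if a: "a \<in> carrier Op" and xV: "x \<in> V" for a x
    proof -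
      obtain u where u: "x = F u" "\<forall>i<p. u i \<in> U" using xV by (auto simp: V_def)
      have uM: "u i \<in> carrier M" if "i < p" for i using u UD(1) that by blast
      show ?thesis
      proof (cases a)
        case (Some b)
        then have b: "b \<in> carrier R" using a by (auto simp: OpC)
        obtain b' where b': "\<And>i. b' i \<in> carrier R" "\<And>i x. x \<in> carrier M \<Longrightarrow> b \<odot>\<^bsub>M\<^esub> (E ^^ i) x = (E ^^ i) (b' i \<odot>\<^bsub>M\<^esub> x)"
          using Ei_normal[OF b] by metis
        have "b \<odot>\<^bsub>M\<^esub> finsum M (\<lambda>i. sc (\<zeta> ^ (i * j)) \<odot>\<^bsub>M\<^esub> (E ^^ i) (u i)) {..<p}
            = finsum M (\<lambda>i. b \<odot>\<^bsub>M\<^esub> (sc (\<zeta> ^ (i * j)) \<odot>\<^bsub>M\<^esub> (E ^^ i) (u i))) {..<p}" for j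
          by (rule smult_finsum[OF b]) (auto simp: term_c uM)
        also have "\<dots> j = finsum M (\<lambda>i. sc (\<zeta> ^ (i * j)) \<odot>\<^bsub>M\<^esub> (E ^^ i) (b' i \<odot>\<^bsub>M\<^esub> u i)) {..<p}" for j
          by (rule M.finsum_cong')
             (auto simp: term_c uM smult_closed b' sc_commute[symmetric] b Ei_closed)
        finally have "a \<odot>\<^bsub>?D\<^esub> x = F (\<lambda>i. b' i \<odot>\<^bsub>M\<^esub> u i)"
          by (auto simp: Some u F_def dsum_simps Mj_simps fun_eq_iff)
        then show ?thesis using F_V[of "\<lambda>i. b' i \<odot>\<^bsub>M\<^esub> u i"] u b' UD(5) by simp
      next
        case None
        obtain b where b: "b \<in> carrier R" "\<And>x. x \<in> carrier M \<Longrightarrow> (E ^^ p) x = b \<odot>\<^bsub>M\<^esub> x"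
          using E_power_p by blast
        \<comment> \<open>Applying the twisted \<open>E\<close> raises every index by one. The top
          term acquires \<open>E^p\<close>, which is an operator \<open>b\<close> of
          \<open>R\<close>, and returns to index 0, the factor \<zeta>^(pj) being 1.\<close>
        define v where "v i = (if i = 0 then b \<odot>\<^bsub>M\<^esub> u (p - 1) else u (i - 1))" for i
        have vU: "v i \<in> U" if "i < p" for i using that u b UD(5) by (auto simp: v_def)
        have vM: "v i \<in> carrier M" if "i < p" for i using vU UD(1) that by blast
        have key: "sc (\<zeta> ^ j) \<odot>\<^bsub>M\<^esub> E (F u j) = F v j" if j: "j < p" for j
        proof -
          define T where "T i = sc (\<zeta> ^ (i * j)) \<odot>\<^bsub>M\<^esub> (E ^^ i) (v (if i = p then 0 else i))" for i
          have Tcl: "T i \<in> carrier M" if "i \<le> p" for i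
            unfolding T_def by (rule term_c, rule vM) (use that p_pos in auto)
          obtain q where q: "p = Suc q" using p_pos by (cases p) auto
          have "sc (\<zeta> ^ j) \<odot>\<^bsub>M\<^esub> E (F u j)
              = sc (\<zeta> ^ j) \<odot>\<^bsub>M\<^esub> finsum M (\<lambda>i. E (sc (\<zeta> ^ (i * j)) \<odot>\<^bsub>M\<^esub> (E ^^ i) (u i))) {..<p}"
            using j by (simp add: F_def, subst additive_finsum[OF M.abelian_group_axioms M.abelian_group_axioms])
               (auto simp: E_closed E_add term_c uM)
          also have "\<dots> = finsum M (\<lambda>i. sc (\<zeta> ^ j) \<odot>\<^bsub>M\<^esub> E (sc (\<zeta> ^ (i * j)) \<odot>\<^bsub>M\<^esub> (E ^^ i) (u i))) {..<p}"
            by (rule smult_finsum[OF sc_closed]) (auto simp: E_closed term_c uM)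
          also have "\<dots> = finsum M (\<lambda>i. sc (\<zeta> ^ (Suc i * j)) \<odot>\<^bsub>M\<^esub> (E ^^ Suc i) (u i)) {..<p}"
          proof (rule M.finsum_cong')
            fix i assume i: "i \<in> {..<p}"
            have c: "E ((E ^^ i) (u i)) \<in> carrier M" using uM i by (simp add: E_closed Ei_closed)
            show "sc (\<zeta> ^ j) \<odot>\<^bsub>M\<^esub> E (sc (\<zeta> ^ (i * j)) \<odot>\<^bsub>M\<^esub> (E ^^ i) (u i)) = sc (\<zeta> ^ (Suc i * j)) \<odot>\<^bsub>M\<^esub> (E ^^ Suc i) (u i)"
              using i uM c by (simp add: E_sc Ei_closed sc_mult[symmetric] power_add)
          qed (use uM term_c in \<open>auto simp del: funpow.simps\<close>)
          also have "\<dots> = finsum M (\<lambda>i. if i = q then T 0 else T (Suc i)) {..<p}"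
          proof (rule M.finsum_cong')
            show "(\<lambda>i. if i = q then T 0 else T (Suc i)) \<in> {..<p} \<rightarrow> carrier M"
              using Tcl q by auto
            fix i assume i: "i \<in> {..<p}"
            show "sc (\<zeta> ^ (Suc i * j)) \<odot>\<^bsub>M\<^esub> (E ^^ Suc i) (u i) = (if i = q then T 0 else T (Suc i))"
            proof (cases "i = q")
              case True
              have "sc (\<zeta> ^ (p * j)) = sc 1" using \<zeta>(1) by (simp add: power_mult)
              moreover have "(E ^^ p) (u q) = v 0" using b(2)[OF uM] q by (simp add: v_def)
              ultimately show ?thesis using True q p_pos by (simp add: T_def del: funpow.simps)
            next
              case False
              then show ?thesis using i q by (simp add: T_def v_def del: funpow.simps)
            qed
          qed simp
          also have "\<dots> = finsum M T {..<p}"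
          proof -
            \<comment> \<open>The cyclic successor on the indices below
              \<open>p = Suc q\<close>.\<close>
            have b: "bij_betw (\<lambda>i. if i = q then 0 else Suc i) {..<p} {..<p}"
              by (rule bij_betwI[where g = "\<lambda>i. if i = 0 then q else i - 1"]) (auto simp: q)
            have Tc: "T \<in> {..<p} \<rightarrow> carrier M" using Tcl by auto
            let ?h = "\<lambda>i. if i = q then 0 else Suc i"
            have h: "inj_on ?h {..<p}" "?h ` {..<p} = {..<p}" using b by (simp_all only: bij_betw_def)
            have "finsum M T (?h ` {..<p}) = finsum M (\<lambda>i. T (?h i)) {..<p}"
              by (rule M.finsum_reindex) (use h Tc in \<open>simp_all only:\<close>)
            then have "finsum M T {..<p} = finsum M (\<lambda>i. T (?h i)) {..<p}" by (simp only: h)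
            then show ?thesis by (simp add: if_distrib[of T])
          qed
          also have "\<dots> = F v j"
            unfolding F_def using j term_c vM
            by (simp, intro M.finsum_cong') (use vM term_c in \<open>auto simp: T_def\<close>)
          finally show ?thesis .
        qed
        then have "a \<odot>\<^bsub>?D\<^esub> x = F v"
          using F_c[OF vM] by (auto simp: None u dsum_simps Mj_simps fun_eq_iff PiE_iff extensional_def)
        then show ?thesis using F_V[of v] vU by simp
      qed
    qed
    show "a \<odot>\<^bsub>?D\<^esub> x \<in> V" if "a \<in> carrier Op" "x \<in> V" for a x using smV that .
    show "\<ominus>\<^bsub>?D\<^esub> x \<in> V" if xV: "x \<in> V" for x
    proof -
      have xD: "x \<in> carrier ?D" using xV F_c UD(1) by (auto simp: V_def)
      \<comment> \<open>The negative is the action of the scalar -1, so closure under the operators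
        covers it.\<close>
      have "\<ominus>\<^bsub>?D\<^esub> x = Some (sc (-1)) \<odot>\<^bsub>?D\<^esub> x"
      proof (rule D.minus_equality)
        have "sc (-1) \<odot>\<^bsub>M\<^esub> y \<oplus>\<^bsub>M\<^esub> y = \<zero>\<^bsub>M\<^esub>" if "y \<in> carrier M" for y
          using sc_add[OF that, of "-1" 1] sc_one[OF that] sc_zero[OF that] by simp
        then show "Some (sc (-1)) \<odot>\<^bsub>?D\<^esub> x \<oplus>\<^bsub>?D\<^esub> x = \<zero>\<^bsub>?D\<^esub>"
          using xD by (auto simp: dsum_simps Mj_simps fun_eq_iff PiE_iff)
        show "x \<in> carrier ?D" "Some (sc (-1)) \<odot>\<^bsub>?D\<^esub> x \<in> carrier ?D"
          using xD D.smult_closed[of "Some (sc (-1))" x] sc_closed by (auto simp: OpC)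
      qed
      then show ?thesis using smV[OF _ xV, of "Some (sc (-1))"] sc_closed by (simp add: OpC)
    qed
  qed
  \<comment> \<open>Fourier inversion: averaging over the characters isolates the term
    \<open>E^i (u i)\<close>, and \<open>E^(m - i)\<close> then undoes \<open>E^i\<close>.\<close>
  define G where "G y i = (E ^^ (m - i)) (finsum M (\<lambda>j. sc (inverse \<zeta> ^ (i * j) / of_nat p) \<odot>\<^bsub>M\<^esub> y j) {..<p})" for y i
  have Gc: "G y i \<in> carrier M" if "\<And>j. j < p \<Longrightarrow> y j \<in> carrier M" for y i
    unfolding G_def using that smc by (intro Ei_closed M.finsum_closed) auto
  have FG: "F (G y) = y" if y: "y \<in> carrier ?D" for y
  proof
    fix j'
    have yj: "y j \<in> carrier M" if "j < p" for j using y that by (auto simp: dsum_simps Mj_simps)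
    show "F (G y) j' = y j'"
    proof (cases "j' < p")
      case False
      then show ?thesis using y by (auto simp: F_def dsum_simps PiE_iff extensional_def)
    next
      case j': True
      have ts: "(\<lambda>j. sc (inverse \<zeta> ^ (i * j) / of_nat p) \<odot>\<^bsub>M\<^esub> y j) \<in> {..<p} \<rightarrow> carrier M" for i
        using yj smc by auto
      have "F (G y) j' = finsum M (\<lambda>i. sc (\<zeta> ^ (i * j')) \<odot>\<^bsub>M\<^esub> finsum M (\<lambda>j. sc (inverse \<zeta> ^ (i * j) / of_nat p) \<odot>\<^bsub>M\<^esub> y j) {..<p}) {..<p}"
        unfolding F_def G_def using j' p_le_m
        by (simp, intro M.finsum_cong') (auto simp: E_inverse M.finsum_closed ts intro!: smc)
      also have "\<dots> = finsum M (\<lambda>i. finsum M (\<lambda>j. sc (\<zeta> ^ (i * j') * (inverse \<zeta> ^ (i * j) / of_nat p)) \<odot>\<^bsub>M\<^esub> y j) {..<p}) {..<p}"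
        by (intro M.finsum_cong') (auto simp: smult_finsum sc_closed ts sc_mult[symmetric] yj smc intro!: M.finsum_cong' M.finsum_closed)
      also have "\<dots> = finsum M (\<lambda>j. finsum M (\<lambda>i. sc (\<zeta> ^ (i * j') * (inverse \<zeta> ^ (i * j) / of_nat p)) \<odot>\<^bsub>M\<^esub> y j) {..<p}) {..<p}"
        by (rule finsum_swap[OF M.abelian_group_axioms]) (auto intro!: smc yj)
      \<comment> \<open>For fixed \<open>j\<close> the inner sum is a character sum divided by
        \<open>p\<close>, equal to 1 if \<open>j = j'\<close> and to 0 otherwise.\<close>
      also have "\<dots> = finsum M (\<lambda>j. if j = j' then y j' else \<zero>\<^bsub>M\<^esub>) {..<p}"
      proof (rule M.finsum_cong')
        fix j assume j: "j \<in> {..<p}"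
        have "finsum M (\<lambda>i. sc (\<zeta> ^ (i * j') * (inverse \<zeta> ^ (i * j) / of_nat p)) \<odot>\<^bsub>M\<^esub> y j) {..<p}
            = sc (\<Sum>i<p. \<zeta> ^ (i * j') * (inverse \<zeta> ^ (i * j) / of_nat p)) \<odot>\<^bsub>M\<^esub> y j"
          using yj j by (subst sc_sum) auto
        also have "(\<Sum>i<p. \<zeta> ^ (i * j') * (inverse \<zeta> ^ (i * j) / of_nat p))
            = (\<Sum>i<p. \<zeta> ^ (j' * i) * inverse \<zeta> ^ (j * i)) / of_nat p"
          by (simp add: sum_divide_distrib mult.commute)
        also have "\<dots> = (if j' = j then 1 else 0)"
          using sum_root_of_unity_powers[OF \<zeta> j'] j p_invertible by simp
        finally show "finsum M (\<lambda>i. sc (\<zeta> ^ (i * j') * (inverse \<zeta> ^ (i * j) / of_nat p)) \<odot>\<^bsub>M\<^esub> y j) {..<p}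
            = (if j = j' then y j' else \<zero>\<^bsub>M\<^esub>)"
          using j yj sc_one sc_zero by auto
      qed (use yj j' in auto)
      also have "\<dots> = y j'"
        using j' yj by (subst M.add.finprod_singleton_swap[of j' "{..<p}" "\<lambda>_. y j'"]) auto
      finally show ?thesis .
    qed
  qed
  have VD: "V = carrier ?D"
  proof (rule D.superfluousD[OF Ksup Vs])
    fix y assume y: "y \<in> carrier ?D"
    then have yj: "y j \<in> carrier M" if "j < p" for j using that by (auto simp: dsum_simps Mj_simps)
    have "\<exists>u\<in>U. \<exists>k\<in>K. G y i = u \<oplus>\<^bsub>M\<^esub> k" for i
    proof -
      have "G y i \<in> set_add M U K" unfolding UK by (rule Gc[OF yj])
      then show ?thesis unfolding mem_set_add_iff .
    qed
    then obtain u k where uk: "\<And>i. u i \<in> U" "\<And>i. k i \<in> K" "\<And>i. G y i = u i \<oplus>\<^bsub>M\<^esub> k i" by metis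
    have uM: "u i \<in> carrier M" and kM: "k i \<in> carrier M" for i using uk UD(1) KD(1) by blast+
    have "G y = (\<lambda>i. u i \<oplus>\<^bsub>M\<^esub> k i)" using uk by auto
    then have e: "y = F u \<oplus>\<^bsub>?D\<^esub> F k" using FG[OF y] F_add[of u k] uM kM by simp
    have Ek: "(E ^^ i) x \<in> K" if "x \<in> K" for i x using that by (induction i) (auto simp: KE)
    have "F k j \<in> K" if "j < p" for j
      unfolding F_def using that uk Ek KD(5)[OF sc_closed]
      by (auto intro!: submodule_finsum[OF K])
    then have "F k \<in> {f \<in> carrier ?D. \<forall>j\<in>{..<p}. f j \<in> K}" using F_c[of k] kM by auto
    then show "\<exists>n\<in>V. \<exists>k\<in>{f \<in> carrier ?D. \<forall>j\<in>{..<p}. f j \<in> K}. y = n \<oplus>\<^bsub>?D\<^esub> k"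
      using e F_V[of u] uk by blast
  qed
  show "U = carrier M"
  proof
    show "U \<subseteq> carrier M" using UD(1) by blast
    show "carrier M \<subseteq> U"
    proof
      fix x assume x: "x \<in> carrier M"
      \<comment> \<open>A constant tuple is tested: averaging its entries over all characters leaves
        the term with \<open>i = 0\<close>, which is \<open>u 0\<close> and lies in
        \<open>U\<close>.\<close>
      have "(\<lambda>j\<in>{..<p}. x) \<in> V" unfolding VD using x by (auto simp: dsum_simps Mj_simps)
      then obtain u where u: "\<forall>i<p. u i \<in> U" "F u = (\<lambda>j\<in>{..<p}. x)" by (auto simp: V_def)
      have uM: "u i \<in> carrier M" if "i < p" for i using u UD(1) that by blast
      have "x = sc (\<Sum>j<p. 1 / of_nat p) \<odot>\<^bsub>M\<^esub> x" using p_invertible sc_one[OF x] by simp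
      also have "\<dots> = finsum M (\<lambda>j. sc (1 / of_nat p) \<odot>\<^bsub>M\<^esub> x) {..<p}" by (rule sc_sum[OF x]) simp
      also have "\<dots> = finsum M (\<lambda>j. sc (1 / of_nat p) \<odot>\<^bsub>M\<^esub> F u j) {..<p}"
        unfolding u(2) using x smc by (intro M.finsum_cong') auto
      also have "\<dots> = finsum M (\<lambda>j. finsum M (\<lambda>i. sc (1 / of_nat p * \<zeta> ^ (i * j)) \<odot>\<^bsub>M\<^esub> (E ^^ i) (u i)) {..<p}) {..<p}"
        unfolding F_def
        by (intro M.finsum_cong')
           (auto simp: smult_finsum sc_closed sc_mult[symmetric] uM term_c Ei_closed smc intro!: M.finsum_cong' M.finsum_closed)
      also have "\<dots> = finsum M (\<lambda>i. finsum M (\<lambda>j. sc (1 / of_nat p * \<zeta> ^ (i * j)) \<odot>\<^bsub>M\<^esub> (E ^^ i) (u i)) {..<p}) {..<p}"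
        by (rule finsum_swap[OF M.abelian_group_axioms]) (auto intro!: term_c uM)
      also have "\<dots> = finsum M (\<lambda>i. if i = 0 then u 0 else \<zero>\<^bsub>M\<^esub>) {..<p}"
      proof (rule M.finsum_cong')
        fix i assume i: "i \<in> {..<p}"
        have ec: "(E ^^ i) (u i) \<in> carrier M" using i uM Ei_closed by simp
        have "finsum M (\<lambda>j. sc (1 / of_nat p * \<zeta> ^ (i * j)) \<odot>\<^bsub>M\<^esub> (E ^^ i) (u i)) {..<p}
            = sc (\<Sum>j<p. 1 / of_nat p * \<zeta> ^ (i * j)) \<odot>\<^bsub>M\<^esub> (E ^^ i) (u i)"
          by (rule sc_sum[OF ec, symmetric]) simp
        also have "(\<Sum>j<p. 1 / of_nat p * \<zeta> ^ (i * j)) = (\<Sum>j<p. \<zeta> ^ (i * j) * inverse \<zeta> ^ (0 * j)) / of_nat p"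
          by (simp add: sum_divide_distrib)
        also have "\<dots> = (if i = 0 then 1 else 0)"
          using sum_root_of_unity_powers[OF \<zeta>, of i 0] i p_pos p_invertible by simp
        finally show "finsum M (\<lambda>j. sc (1 / of_nat p * \<zeta> ^ (i * j)) \<odot>\<^bsub>M\<^esub> (E ^^ i) (u i)) {..<p}
            = (if i = 0 then u 0 else \<zero>\<^bsub>M\<^esub>)"
          using ec sc_one[OF ec] sc_zero[OF ec] by auto
      qed (use uM p_pos in auto)
      also have "\<dots> = u 0"
        using uM p_pos by (subst M.add.finprod_singleton_swap[of 0 "{..<p}" "\<lambda>_. u 0"]) auto
      finally show "x \<in> U" using u p_pos by simp
    qed
  qed
qed

end

section \<open>Projective covers\<close>

text \<open>The dual basis form of finitely generated projectivity. The index set is arbitrary, so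
  that a basis over a subalgebra can be indexed by pairs.\<close>

definition dual_basis :: "('a, 'r) ring_scheme \<Rightarrow> ('a, 'b) module \<Rightarrow> 'j set \<Rightarrow> ('j \<Rightarrow> 'b \<Rightarrow> 'a) \<Rightarrow> ('j \<Rightarrow> 'b) \<Rightarrow> bool" where
  "dual_basis R P J \<phi> e \<longleftrightarrow> finite J \<and> (\<forall>j\<in>J. \<phi> j \<in> mod_hom R P (regular_module R) \<and> e j \<in> carrier P) \<and>
     (\<forall>x\<in>carrier P. x = finsum P (\<lambda>j. \<phi> j x \<odot>\<^bsub>P\<^esub> e j) J)"

lemma regular_module_simps [simp]:
  "carrier (regular_module R) = carrier R" "\<zero>\<^bsub>regular_module R\<^esub> = \<zero>\<^bsub>R\<^esub>"
  "x \<oplus>\<^bsub>regular_module R\<^esub> y = x \<oplus>\<^bsub>R\<^esub> y" "a \<odot>\<^bsub>regular_module R\<^esub> x = a \<otimes>\<^bsub>R\<^esub> x"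
  by (simp_all add: regular_module_def)

lemma op_module_regular:
  assumes "ring R"
  shows "op_module R (regular_module R)"
proof -
  interpret ring R by fact
  have "abelian_group (regular_module R)"
    by (rule abelian_groupI) (auto simp: a_ac intro: bexI[of _ "\<ominus>\<^bsub>R\<^esub> _"] l_neg)
  then show ?thesis by (rule op_module.intro, unfold_locales) (auto simp: r_distr)
qed

text \<open>The coordinates of the embedding into \<open>R^N\<close> and the images of the unit
  vectors under the retraction form a dual basis.\<close>

lemma projective_imp_dual_basis:
  assumes "projective_module R P"
  shows "\<exists>(N::nat) \<phi> e. dual_basis R P {..<N} \<phi> e"
proof -
  have P: "left_module R P" using assms by (simp add: projective_module_def)
  interpret P: left_module R P by fact
  let ?D = "\<lambda>N. dsum {..<N::nat} (\<lambda>_. regular_module R)"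
  obtain N i q where i: "i \<in> mod_hom R P (?D N)" and q: "q \<in> mod_hom R (?D N) P"
    and qi: "\<And>x. x \<in> carrier P \<Longrightarrow> q (i x) = x"
    using assms unfolding projective_module_def by blast
  have reg: "op_module R (regular_module R)" by (rule op_module_regular) (rule P.R.ring_axioms)
  then have rab: "abelian_group (regular_module R)" by (simp add: op_module_def)
  have D: "op_module R (?D N)" by (rule op_module_dsum) (rule reg)
  interpret D: op_module R "?D N" by (rule D)
  define u where "u j = (\<lambda>n\<in>{..<N}. if n = j then \<one>\<^bsub>R\<^esub> else \<zero>\<^bsub>R\<^esub>)" for j
  have uc: "u j \<in> carrier (?D N)" for j by (auto simp: u_def dsum_simps)
  have ic: "i x j \<in> carrier R" if "x \<in> carrier P" "j < N" for x j
    using mod_homD(1)[OF i that(1)] that(2) by (auto simp: dsum_simps)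
  have "dual_basis R P {..<N} (\<lambda>j x. i x j) (\<lambda>j. q (u j))"
    unfolding dual_basis_def
  proof (intro conjI ballI)
    fix j assume j: "j \<in> {..<N}"
    show "(\<lambda>x. i x j) \<in> mod_hom R P (regular_module R)"
      using mod_homD[OF i] ic j by (intro mod_homI) (auto simp: dsum_simps)
    show "q (u j) \<in> carrier P" by (rule mod_homD(1)[OF q uc])
  next
    fix x assume x: "x \<in> carrier P"
    have su: "i x j \<odot>\<^bsub>?D N\<^esub> u j \<in> carrier (?D N)" if "j < N" for j
      by (rule D.smult_closed[OF ic[OF x that] uc])
    have "i x = finsum (?D N) (\<lambda>j. i x j \<odot>\<^bsub>?D N\<^esub> u j) {..<N}"
    proof
      fix n
      show "i x n = finsum (?D N) (\<lambda>j. i x j \<odot>\<^bsub>?D N\<^esub> u j) {..<N} n"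
      proof (cases "n < N")
        case True
        have "finsum (?D N) (\<lambda>j. i x j \<odot>\<^bsub>?D N\<^esub> u j) {..<N} n
            = finsum (regular_module R) (\<lambda>j. (i x j \<odot>\<^bsub>?D N\<^esub> u j) n) {..<N}"
          using True su by (intro finsum_dsum) (auto simp: rab)
        also have "\<dots> = finsum (regular_module R) (\<lambda>j. if j = n then i x n else \<zero>\<^bsub>regular_module R\<^esub>) {..<N}"
          using ic[OF x] True
          by (intro abelian_monoid.finsum_cong') (auto simp: u_def dsum_simps abelian_group.axioms(1)[OF rab])
        also have "\<dots> = i x n"
        proof -
          interpret r: abelian_group "regular_module R" by (rule rab)
          show ?thesis
            using ic[OF x] True by (subst r.add.finprod_singleton_swap[of n "{..<N}" "\<lambda>_. i x n"]) auto
        qed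
        finally show ?thesis by simp
      next
        case False
        have "finsum (?D N) (\<lambda>j. i x j \<odot>\<^bsub>?D N\<^esub> u j) {..<N} \<in> carrier (?D N)"
          using su by (intro D.finsum_closed) auto
        moreover have "i x \<in> carrier (?D N)" by (rule mod_homD(1)[OF i x])
        ultimately show ?thesis using False by (auto simp: dsum_simps PiE_iff extensional_def)
      qed
    qed
    then have "q (i x) = q (finsum (?D N) (\<lambda>j. i x j \<odot>\<^bsub>?D N\<^esub> u j) {..<N})" by simp
    also have "\<dots> = finsum P (\<lambda>j. q (i x j \<odot>\<^bsub>?D N\<^esub> u j)) {..<N}"
      by (rule additive_finsum[OF D.abelian_group_axioms P.M.abelian_group_axioms])
         (use mod_homD[OF q] su in auto)
    also have "\<dots> = finsum P (\<lambda>j. i x j \<odot>\<^bsub>P\<^esub> q (u j)) {..<N}"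
      using mod_homD(1,3)[OF q] ic[OF x] uc by (intro P.M.finsum_cong') (auto intro: P.smult_closed)
    finally show "x = finsum P (\<lambda>j. i x j \<odot>\<^bsub>P\<^esub> q (u j)) {..<N}" using qi[OF x] by simp
  qed simp
  then show ?thesis by blast
qed

text \<open>It suffices to lift the finitely many values \<open>f (e j)\<close>; the coordinate maps
  extend the choice linearly.\<close>

lemma dual_basis_lift:
  assumes db: "dual_basis R P J \<phi> e" and P: "left_module R P" and X: "left_module R X" and Y: "abelian_group Y"
    and f: "f \<in> mod_hom R P Y" and g: "g \<in> mod_hom R X Y" "g ` carrier X = carrier Y"
  shows "\<exists>h\<in>mod_hom R P X. \<forall>x\<in>carrier P. g (h x) = f x"
proof -
  interpret P: left_module R P by fact
  interpret X: left_module R X by fact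
  interpret Y: abelian_group Y by fact
  have J: "finite J" and \<phi>: "\<And>j. j \<in> J \<Longrightarrow> \<phi> j \<in> mod_hom R P (regular_module R)"
    and e: "\<And>j. j \<in> J \<Longrightarrow> e j \<in> carrier P"
    and ex: "\<And>x. x \<in> carrier P \<Longrightarrow> x = finsum P (\<lambda>j. \<phi> j x \<odot>\<^bsub>P\<^esub> e j) J"
    using db by (auto simp: dual_basis_def)
  have \<phi>c: "\<phi> j x \<in> carrier R" if "j \<in> J" "x \<in> carrier P" for j x
    using mod_homD(1)[OF \<phi>] that by simp
  have "\<exists>y\<in>carrier X. g y = f (e j)" if "j \<in> J" for j
    using g(2) mod_homD(1)[OF f e[OF that]] by (metis imageE)
  then obtain y where y: "\<And>j. j \<in> J \<Longrightarrow> y j \<in> carrier X" "\<And>j. j \<in> J \<Longrightarrow> g (y j) = f (e j)" by metis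
  let ?h = "\<lambda>x. finsum X (\<lambda>j. \<phi> j x \<odot>\<^bsub>X\<^esub> y j) J"
  have tc: "\<phi> j x \<odot>\<^bsub>X\<^esub> y j \<in> carrier X" if "j \<in> J" "x \<in> carrier P" for j x
    using that \<phi>c y X.smult_closed by simp
  have "?h \<in> mod_hom R P X"
  proof (rule mod_homI)
    fix x assume x: "x \<in> carrier P"
    show "?h x \<in> carrier X" using tc x by auto
    show "?h (a \<odot>\<^bsub>P\<^esub> x) = a \<odot>\<^bsub>X\<^esub> ?h x" if a: "a \<in> carrier R" for a
    proof -
      have "a \<odot>\<^bsub>X\<^esub> ?h x = finsum X (\<lambda>j. a \<odot>\<^bsub>X\<^esub> (\<phi> j x \<odot>\<^bsub>X\<^esub> y j)) J"
        by (rule op_module.smult_finsum[OF left_module_imp_op_module[OF X] a _ J]) (use tc x in auto)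
      also have "\<dots> = ?h (a \<odot>\<^bsub>P\<^esub> x)"
        using mod_homD(3)[OF \<phi> a x] \<phi>c x y a P.smult_closed[OF a x]
        by (intro X.M.finsum_cong') (auto simp: X.smult_assoc intro!: tc)
      finally show ?thesis by simp
    qed
    fix x' assume x': "x' \<in> carrier P"
    have "?h (x \<oplus>\<^bsub>P\<^esub> x') = finsum X (\<lambda>j. \<phi> j x \<odot>\<^bsub>X\<^esub> y j \<oplus>\<^bsub>X\<^esub> \<phi> j x' \<odot>\<^bsub>X\<^esub> y j) J"
      using mod_homD(2)[OF \<phi> x x'] \<phi>c x x' y by (intro X.M.finsum_cong') (auto simp: X.smult_l_distr intro!: tc)
    also have "\<dots> = ?h x \<oplus>\<^bsub>X\<^esub> ?h x'" using tc x x' by (intro X.M.finsum_addf) auto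
    finally show "?h (x \<oplus>\<^bsub>P\<^esub> x') = ?h x \<oplus>\<^bsub>X\<^esub> ?h x'" .
  qed
  moreover have "g (?h x) = f x" if x: "x \<in> carrier P" for x
  proof -
    have "g (?h x) = finsum Y (\<lambda>j. g (\<phi> j x \<odot>\<^bsub>X\<^esub> y j)) J"
      by (rule additive_finsum[OF X.M.abelian_group_axioms Y]) (use mod_homD[OF g(1)] tc x J in auto)
    also have "\<dots> = finsum Y (\<lambda>j. f (\<phi> j x \<odot>\<^bsub>P\<^esub> e j)) J"
    proof (rule Y.finsum_cong')
      fix j assume j: "j \<in> J"
      show "g (\<phi> j x \<odot>\<^bsub>X\<^esub> y j) = f (\<phi> j x \<odot>\<^bsub>P\<^esub> e j)"
        using mod_homD(3)[OF g(1) \<phi>c[OF j x] y(1)[OF j]] mod_homD(3)[OF f \<phi>c[OF j x] e[OF j]] y(2)[OF j] by simp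
    qed (use mod_homD(1)[OF f P.smult_closed[OF \<phi>c[OF _ x] e]] in auto)
    also have "\<dots> = f (finsum P (\<lambda>j. \<phi> j x \<odot>\<^bsub>P\<^esub> e j) J)"
      by (rule additive_finsum[OF P.M.abelian_group_axioms Y, symmetric])
         (use mod_homD[OF f] \<phi>c[OF _ x] e J in \<open>auto intro: P.smult_closed\<close>)
    finally show ?thesis using ex[OF x] by simp
  qed
  ultimately show ?thesis by (intro bexI[of _ ?h] ballI)
qed

lemma (in op_module) hom_onto_superfluous:
  assumes P: "op_module R P" and h: "h \<in> mod_hom R M P" and \<pi>: "\<pi> \<in> mod_hom R P Y" and Y: "abelian_group Y"
    and sup: "superfluous R P {x \<in> carrier P. \<pi> x = \<zero>\<^bsub>Y\<^esub>}"
    and surj: "\<And>y. y \<in> carrier P \<Longrightarrow> \<exists>x\<in>carrier M. \<pi> (h x) = \<pi> y"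
  shows "h ` carrier M = carrier P"
proof -
  interpret P: op_module R P by fact
  interpret Y: abelian_group Y by fact
  show ?thesis
  proof (rule P.superfluousD[OF sup image_submodule[OF h P submodule_carrier]])
    fix y assume y: "y \<in> carrier P"
    obtain x where x: "x \<in> carrier M" "\<pi> (h x) = \<pi> y" using surj[OF y] by blast
    have hx: "h x \<in> carrier P" by (rule mod_homD(1)[OF h x(1)])
    have d: "h x \<oplus>\<^bsub>P\<^esub> (y \<ominus>\<^bsub>P\<^esub> h x) = y" by (rule P.add_diff_cancel[OF y hx])
    have dc: "y \<ominus>\<^bsub>P\<^esub> h x \<in> carrier P" using y hx by simp
    have "\<pi> (h x) \<oplus>\<^bsub>Y\<^esub> \<pi> (y \<ominus>\<^bsub>P\<^esub> h x) = \<pi> (h x)"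
      using mod_homD(2)[OF \<pi> hx dc] d x by simp
    then have "\<pi> (y \<ominus>\<^bsub>P\<^esub> h x) = \<zero>\<^bsub>Y\<^esub>"
      using mod_homD(1)[OF \<pi> hx] mod_homD(1)[OF \<pi> dc] by simp
    then show "\<exists>n\<in>h ` carrier M. \<exists>k\<in>{x \<in> carrier P. \<pi> x = \<zero>\<^bsub>Y\<^esub>}. y = n \<oplus>\<^bsub>P\<^esub> k"
      using d dc x by (intro bexI[of _ "h x"] bexI[of _ "y \<ominus>\<^bsub>P\<^esub> h x"]) auto
  qed
qed

lemma left_module_dsum:
  assumes "ring R" "\<And>i. i \<in> I \<Longrightarrow> left_module R (M i)"
  shows "left_module R (dsum I M)"
proof -
  interpret ring R by fact
  have "op_module R (dsum I M)" by (rule op_module_dsum) (rule left_module_imp_op_module[OF assms(2)])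
  then interpret D: op_module R "dsum I M" .
  note s = left_module.smult_l_distr[OF assms(2)] left_module.smult_assoc[OF assms(2)] left_module.smult_one[OF assms(2)]
  show ?thesis
    by (unfold_locales)
       (auto simp: D.smult_closed D.smult_r_distr, auto simp: dsum_simps s PiE_iff fun_eq_iff extensional_def)
qed

text \<open>Two projective covers of the same module are isomorphic, with the second one given componentwise: both composites of
  the lifts over the common quotient are onto since the kernels are superfluous.\<close>

lemma projective_cover_unique_dsum:
  assumes I: "finite I" and R: "ring R"
    and P: "left_module R P" and dbP: "dual_basis R P J \<phi> e"
    and L: "\<And>r. r \<in> I \<Longrightarrow> op_module R (L r)"
    and \<pi>: "\<pi> \<in> mod_hom R P (dsum I L)" "\<pi> ` carrier P = carrier (dsum I L)"
      "superfluous R P {x \<in> carrier P. \<pi> x = \<zero>\<^bsub>dsum I L\<^esub>}"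
    and Q: "\<And>r. r \<in> I \<Longrightarrow> projective_cover R (Q r) (L r)"
  shows "mod_isomorphic R P (dsum I Q)"
proof -
  let ?Y = "dsum I L" and ?Q = "dsum I Q"
  have Qp: "projective_module R (Q r)" if "r \<in> I" for r using Q[OF that] by (simp add: projective_cover_def)
  have Ql: "left_module R (Q r)" if "r \<in> I" for r using Qp[OF that] by (simp add: projective_module_def)
  have "\<forall>r\<in>I. \<exists>\<rho>. \<rho> \<in> mod_hom R (Q r) (L r) \<and> \<rho> ` carrier (Q r) = carrier (L r) \<and>
      superfluous R (Q r) {x \<in> carrier (Q r). \<rho> x = \<zero>\<^bsub>L r\<^esub>}"
    using Q unfolding projective_cover_def Bex_def by blast
  from bchoice[OF this] obtain \<rho> where \<rho>0: "\<forall>r\<in>I. \<rho> r \<in> mod_hom R (Q r) (L r) \<and> \<rho> r ` carrier (Q r) = carrier (L r) \<and>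
      superfluous R (Q r) {x \<in> carrier (Q r). \<rho> r x = \<zero>\<^bsub>L r\<^esub>}" ..
  have \<rho>: "\<rho> r \<in> mod_hom R (Q r) (L r)" "\<rho> r ` carrier (Q r) = carrier (L r)"
    "superfluous R (Q r) {x \<in> carrier (Q r). \<rho> r x = \<zero>\<^bsub>L r\<^esub>}" if "r \<in> I" for r
    using bspec[OF \<rho>0 that] by auto
  have Lab: "abelian_group (L r)" if "r \<in> I" for r using L[OF that] by (simp add: op_module_def)
  have Yab: "abelian_group ?Y" by (rule abelian_group_dsum[OF Lab])
  interpret Y: abelian_group ?Y by (rule Yab)
  have Qlm: "left_module R ?Q" by (rule left_module_dsum[OF R Ql])
  interpret P: op_module R P by (rule left_module_imp_op_module[OF P])
  interpret Q: op_module R ?Q by (rule left_module_imp_op_module[OF Qlm])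
  define \<rho>Q where "\<rho>Q x = (\<lambda>r\<in>I. \<rho> r (x r))" for x
  have \<rho>Q: "\<rho>Q \<in> mod_hom R ?Q ?Y"
    using mod_homD[OF \<rho>(1)] by (intro mod_homI) (auto simp: \<rho>Q_def dsum_simps PiE_iff fun_eq_iff)
  have \<rho>Qs: "\<rho>Q ` carrier ?Q = carrier ?Y"
  proof
    show "\<rho>Q ` carrier ?Q \<subseteq> carrier ?Y" using mod_homD(1)[OF \<rho>Q] by blast
    show "carrier ?Y \<subseteq> \<rho>Q ` carrier ?Q"
    proof
      fix y assume y: "y \<in> carrier ?Y"
      have "\<exists>x. x \<in> carrier (Q r) \<and> \<rho> r x = y r" if "r \<in> I" for r
      proof -
        have "y r \<in> \<rho> r ` carrier (Q r)" unfolding \<rho>(2)[OF that] using y that by (auto simp: dsum_simps)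
        then show ?thesis by (auto simp: image_iff)
      qed
      then have "\<forall>r\<in>I. \<exists>x. x \<in> carrier (Q r) \<and> \<rho> r x = y r" by (intro ballI)
      from bchoice[OF this] obtain x where x: "\<forall>r\<in>I. x r \<in> carrier (Q r) \<and> \<rho> r (x r) = y r" ..
      have "restrict x I \<in> carrier ?Q" using x by (auto simp: dsum_simps)
      moreover have "\<rho>Q (restrict x I) = y" using x y by (auto simp: \<rho>Q_def dsum_simps fun_eq_iff PiE_iff extensional_def)
      ultimately show "y \<in> \<rho>Q ` carrier ?Q" by blast
    qed
  qed
  have \<rho>Qk: "superfluous R ?Q {x \<in> carrier ?Q. \<rho>Q x = \<zero>\<^bsub>?Y\<^esub>}"
  proof -
    have "superfluous R ?Q {f \<in> carrier ?Q. \<forall>r\<in>I. f r \<in> {x \<in> carrier (Q r). \<rho> r x = \<zero>\<^bsub>L r\<^esub>}}"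
      by (rule dsum_superfluous[OF I left_module_imp_op_module[OF Ql] \<rho>(3)])
    moreover have "{f \<in> carrier ?Q. \<forall>r\<in>I. f r \<in> {x \<in> carrier (Q r). \<rho> r x = \<zero>\<^bsub>L r\<^esub>}} = {x \<in> carrier ?Q. \<rho>Q x = \<zero>\<^bsub>?Y\<^esub>}"
      by (auto simp: \<rho>Q_def dsum_simps fun_eq_iff PiE_iff restrict_def)
    ultimately show ?thesis by simp
  qed
  obtain f where f: "f \<in> mod_hom R P ?Q" "\<And>x. x \<in> carrier P \<Longrightarrow> \<rho>Q (f x) = \<pi> x"
    using dual_basis_lift[OF dbP P Qlm Yab \<pi>(1) \<rho>Q \<rho>Qs] by blast
  have fs: "f ` carrier P = carrier ?Q"
  proof (rule P.hom_onto_superfluous[OF Q.op_module_axioms f(1) \<rho>Q Yab \<rho>Qk])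
    fix y assume "y \<in> carrier ?Q"
    then have "\<rho>Q y \<in> \<pi> ` carrier P" using mod_homD(1)[OF \<rho>Q] \<pi>(2) by simp
    then show "\<exists>x\<in>carrier P. \<rho>Q (f x) = \<rho>Q y" using f(2) by (metis imageE)
  qed
  define s where "s r y = (\<lambda>i\<in>I. if i = r then y else \<zero>\<^bsub>Q i\<^esub>)" for r y
  note Qa = abelian_group_facts[OF op_module.axioms(1)[OF left_module_imp_op_module[OF Ql]]]
  have s: "s r \<in> mod_hom R (Q r) ?Q" if r: "r \<in> I" for r
    using r Qa op_module.smult_zero[OF left_module_imp_op_module[OF Ql]]
    by (intro mod_homI) (auto simp: s_def dsum_simps fun_eq_iff)
  \<comment> \<open>Each summand is projective on its own, so its inclusion lifts through
    \<open>f\<close>; the sum \<open>h\<close> of these lifts is a right inverse of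
    \<open>f\<close>.\<close>
  have "\<exists>h. h \<in> mod_hom R (Q r) P \<and> (\<forall>x\<in>carrier (Q r). f (h x) = s r x)" if r: "r \<in> I" for r
  proof -
    obtain N :: nat and \<psi> e' where "dual_basis R (Q r) {..<N} \<psi> e'" using projective_imp_dual_basis[OF Qp[OF r]] by blast
    from dual_basis_lift[OF this Ql[OF r] P Q.abelian_group_axioms s[OF r] f(1) fs] show ?thesis unfolding Bex_def .
  qed
  then have "\<forall>r\<in>I. \<exists>h. h \<in> mod_hom R (Q r) P \<and> (\<forall>x\<in>carrier (Q r). f (h x) = s r x)" by (intro ballI)
  from bchoice[OF this] obtain hr where hr0: "\<forall>r\<in>I. hr r \<in> mod_hom R (Q r) P \<and> (\<forall>x\<in>carrier (Q r). f (hr r x) = s r x)" ..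
  have hr: "hr r \<in> mod_hom R (Q r) P" "x \<in> carrier (Q r) \<Longrightarrow> f (hr r x) = s r x" if "r \<in> I" for r x
    using bspec[OF hr0 that] by auto
  define h where "h y = finsum P (\<lambda>r. hr r (y r)) I" for y
  have hc: "hr r (y r) \<in> carrier P" if "y \<in> carrier ?Q" "r \<in> I" for y r
    using that mod_homD(1)[OF hr(1)] by (auto simp: dsum_simps)
  have yc: "y r \<in> carrier (Q r)" if "y \<in> carrier ?Q" "r \<in> I" for y r using that by (auto simp: dsum_simps)
  have h: "h \<in> mod_hom R ?Q P"
  proof (rule mod_homI)
    fix y assume y: "y \<in> carrier ?Q"
    show "h y \<in> carrier P" using hc[OF y] by (auto simp: h_def)
    show "h (a \<odot>\<^bsub>?Q\<^esub> y) = a \<odot>\<^bsub>P\<^esub> h y" if a: "a \<in> carrier R" for a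
    proof -
      have "a \<odot>\<^bsub>P\<^esub> h y = finsum P (\<lambda>r. a \<odot>\<^bsub>P\<^esub> hr r (y r)) I"
        unfolding h_def by (rule P.smult_finsum[OF a _ I]) (use hc[OF y] in auto)
      also have "\<dots> = h (a \<odot>\<^bsub>?Q\<^esub> y)"
        unfolding h_def using hc[OF Q.smult_closed[OF a y]] mod_homD(3)[OF hr(1) a yc[OF y]]
        by (intro P.finsum_cong') (auto simp: dsum_simps)
      finally show ?thesis by simp
    qed
    fix y' assume y': "y' \<in> carrier ?Q"
    have "h (y \<oplus>\<^bsub>?Q\<^esub> y') = finsum P (\<lambda>r. hr r (y r) \<oplus>\<^bsub>P\<^esub> hr r (y' r)) I"
      unfolding h_def using hc[OF y] hc[OF y'] mod_homD(2)[OF hr(1) yc[OF y] yc[OF y']]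
      by (intro P.finsum_cong') (auto simp: dsum_simps)
    also have "\<dots> = h y \<oplus>\<^bsub>P\<^esub> h y'" unfolding h_def using hc[OF y] hc[OF y'] by (intro P.finsum_addf) auto
    finally show "h (y \<oplus>\<^bsub>?Q\<^esub> y') = h y \<oplus>\<^bsub>P\<^esub> h y'" .
  qed
  have fh: "f (h y) = y" if y: "y \<in> carrier ?Q" for y
  proof -
    have "f (h y) = finsum ?Q (\<lambda>r. f (hr r (y r))) I"
      unfolding h_def
      by (rule additive_finsum[OF P.abelian_group_axioms Q.abelian_group_axioms]) (use mod_homD[OF f(1)] hc[OF y] I in auto)
    also have "\<dots> = finsum ?Q (\<lambda>r. s r (y r)) I"
      using hr(2) yc[OF y] mod_homD(1)[OF s] by (intro Q.finsum_cong') auto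
    also have "\<dots> = y"
    proof
      fix i
      have c: "finsum ?Q (\<lambda>r. s r (y r)) I \<in> carrier ?Q"
        using yc[OF y] mod_homD(1)[OF s] by (intro Q.finsum_closed) auto
      show "finsum ?Q (\<lambda>r. s r (y r)) I i = y i"
      proof (cases "i \<in> I")
        case False
        then show ?thesis using c y by (auto simp: dsum_simps PiE_iff extensional_def)
      next
        case i: True
        interpret Qi: op_module R "Q i" by (rule left_module_imp_op_module[OF Ql[OF i]])
        have "finsum ?Q (\<lambda>r. s r (y r)) I i = finsum (Q i) (\<lambda>r. s r (y r) i) I"
          using yc[OF y] mod_homD(1)[OF s] i I
          by (intro finsum_dsum op_module.axioms(1)[OF left_module_imp_op_module[OF Ql]]) auto
        also have "\<dots> = finsum (Q i) (\<lambda>r. if r = i then y i else \<zero>\<^bsub>Q i\<^esub>) I"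
          using i yc[OF y i] by (intro Qi.finsum_cong') (auto simp: s_def)
        also have "\<dots> = y i"
          using i yc[OF y i] I by (subst Qi.add.finprod_singleton_swap[of i I "\<lambda>_. y i"]) auto
        finally show ?thesis .
      qed
    qed
    finally show ?thesis .
  qed
  have hs: "h ` carrier ?Q = carrier P"
  proof (rule Q.hom_onto_superfluous[OF P.op_module_axioms h \<pi>(1) Yab \<pi>(3)])
    fix y assume y: "y \<in> carrier P"
    have "\<pi> (h (f y)) = \<rho>Q (f (h (f y)))" using f(2)[OF mod_homD(1)[OF h mod_homD(1)[OF f(1) y]]] by simp
    also have "\<dots> = \<pi> y" using fh[OF mod_homD(1)[OF f(1) y]] f(2)[OF y] by simp
    finally show "\<exists>x\<in>carrier ?Q. \<pi> (h x) = \<pi> y" using mod_homD(1)[OF f(1) y] by blast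
  qed
  have "inj_on h (carrier ?Q)" using fh by (metis inj_onI)
  then have "mod_isomorphic R ?Q P"
    unfolding mod_isomorphic_def bij_betw_def using h hs by blast
  then show ?thesis by (rule mod_isomorphic_sym[OF Q.op_module_axioms])
qed

section \<open>Concatenation of diagrams\<close>

lemma diagramsD:
  assumes "D \<in> diagrams m a b"
  shows "s \<in> D \<Longrightarrow> fst s \<subseteq> nodes a b" "s \<in> D \<Longrightarrow> card (fst s) = 2" "s \<in> D \<Longrightarrow> snd s < m"
    and "v \<in> nodes a b \<Longrightarrow> \<exists>s. s \<in> D \<and> v \<in> fst s"
    and "s \<in> D \<Longrightarrow> s' \<in> D \<Longrightarrow> v \<in> fst s \<Longrightarrow> v \<in> fst s' \<Longrightarrow> s = s'"
proof -
  show *: "s \<in> D \<Longrightarrow> fst s \<subseteq> nodes a b" for s using assms by (fastforce simp: diagrams_def)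
  show "s \<in> D \<Longrightarrow> card (fst s) = 2" "s \<in> D \<Longrightarrow> snd s < m"
    using assms by (fastforce simp: diagrams_def)+
  show "v \<in> nodes a b \<Longrightarrow> \<exists>s. s \<in> D \<and> v \<in> fst s" using assms unfolding diagrams_def by blast
  show "s \<in> D \<Longrightarrow> s' \<in> D \<Longrightarrow> v \<in> fst s \<Longrightarrow> v \<in> fst s' \<Longrightarrow> s = s'"
    using assms *[of s] unfolding diagrams_def by blast
qed

lemma diagramsI:
  assumes "\<And>s. s \<in> D \<Longrightarrow> fst s \<subseteq> nodes a b \<and> card (fst s) = 2 \<and> snd s < m"
    and "\<And>v. v \<in> nodes a b \<Longrightarrow> \<exists>s. s \<in> D \<and> v \<in> fst s"
    and "\<And>s s' v. s \<in> D \<Longrightarrow> s' \<in> D \<Longrightarrow> v \<in> fst s \<Longrightarrow> v \<in> fst s' \<Longrightarrow> s = s'"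
  shows "D \<in> diagrams m a b"
proof -
  have "\<exists>!s. s \<in> D \<and> v \<in> fst s" if v: "v \<in> nodes a b" for v
    using assms(2)[OF v] assms(3) by metis
  then show ?thesis using assms(1) unfolding diagrams_def by fastforce
qed

lemma finite_nodes: "finite (nodes a b)" by (simp add: nodes_def)

lemma North_in_nodes [simp]: "North i \<in> nodes a b \<longleftrightarrow> i \<in> {1..a}"
  and South_in_nodes [simp]: "South i \<in> nodes a b \<longleftrightarrow> i \<in> {1..b}"
  by (auto simp: nodes_def)

lemma diagrams_subset: "D \<in> diagrams m a b \<Longrightarrow> D \<subseteq> Pow (nodes a b) \<times> {..<m}"
  using diagramsD(1,3) by fastforce

lemma finite_diagram: "D \<in> diagrams m a b \<Longrightarrow> finite D"
  using diagrams_subset finite_nodes by (metis finite_Pow_iff finite_SigmaI finite_lessThan finite_subset)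

lemma finite_diagrams: "finite (diagrams m a b)"
proof (rule finite_subset)
  show "diagrams m a b \<subseteq> Pow (Pow (nodes a b) \<times> {..<m})" using diagrams_subset by blast
qed (simp add: finite_nodes)

text \<open>A strand is determined by any one of its end nodes, so distinct strands cannot differ in
  the label alone.\<close>

lemma inj_on_fst_diagram: "D \<in> diagrams m a b \<Longrightarrow> inj_on fst D"
proof (rule inj_onI)
  fix s s' assume D: "D \<in> diagrams m a b" and s: "s \<in> D" "s' \<in> D" "fst s = fst s'"
  have "fst s \<noteq> {}" using diagramsD(2)[OF D s(1)] by auto
  then obtain v where "v \<in> fst s" by blast
  then show "s = s'" using diagramsD(5)[OF D s(1,2)] s(3) by simp
qed

section \<open>Connected components of a gluing\<close>

abbreviation glue_sym :: "diagram \<Rightarrow> diagram \<Rightarrow> ((node set \<times> nat) + (node set \<times> nat)) rel" where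
  "glue_sym x y \<equiv> glued x y \<union> (glued x y)\<inverse>"

lemma glue_sym_iff:
  "(z, z') \<in> glue_sym x y \<longleftrightarrow> (\<exists>s s' i. s \<in> x \<and> s' \<in> y \<and> South i \<in> fst s \<and> North i \<in> fst s' \<and>
     (z = Inl s \<and> z' = Inr s' \<or> z = Inr s' \<and> z' = Inl s))"
  unfolding glued_def by blast

lemma glue_sym_subset: "glue_sym x y \<subseteq> Sum_Type.Plus x y \<times> Sum_Type.Plus x y"
  by (auto simp: glued_def)

lemma equiv_glue: "equiv UNIV ((glue_sym x y)\<^sup>*)"
proof (rule equivI)
  show "sym ((glue_sym x y)\<^sup>*)" by (rule sym_rtrancl) (auto simp: sym_def)
qed (auto simp: refl_rtrancl trans_rtrancl)

text \<open>A covering family of subsets that are internally connected and closed under gluing must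
  be the family of equivalence classes; this is how components are computed explicitly.\<close>

lemma components_eqI:
  assumes "\<And>C. C \<in> \<C> \<Longrightarrow> C \<subseteq> Sum_Type.Plus x y"
    and conn: "\<And>C. C \<in> \<C> \<Longrightarrow> \<exists>z0\<in>C. \<forall>z\<in>C. (z0, z) \<in> (glue_sym x y)\<^sup>*"
    and closed: "\<And>C z z'. C \<in> \<C> \<Longrightarrow> z \<in> C \<Longrightarrow> (z, z') \<in> glue_sym x y \<Longrightarrow> z' \<in> C"
    and cover: "\<And>z. z \<in> Sum_Type.Plus x y \<Longrightarrow> \<exists>C\<in>\<C>. z \<in> C"
  shows "components x y = \<C>"
proof -
  let ?R = "(glue_sym x y)\<^sup>*"
  have cl: "?R `` {z} = C" if C: "C \<in> \<C>" and z: "z \<in> C" for C z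
  proof
    show "?R `` {z} \<subseteq> C"
    proof
      fix w assume "w \<in> ?R `` {z}"
      then have "(z, w) \<in> ?R" by simp
      then show "w \<in> C" by (induction rule: rtrancl_induct) (use z closed[OF C] in auto)
    qed
    obtain z0 where z0: "z0 \<in> C" "\<forall>z\<in>C. (z0, z) \<in> ?R" using conn[OF C] by blast
    show "C \<subseteq> ?R `` {z}"
    proof
      fix w assume "w \<in> C"
      then have "(z0, w) \<in> ?R" "(z0, z) \<in> ?R" using z0 z by auto
      then show "w \<in> ?R `` {z}" using equiv_glue[of x y] by (meson Image_singleton_iff equivE symE transE)
    qed
  qed
  show ?thesis
  proof
    show "components x y \<subseteq> \<C>"
    proof
      fix C assume "C \<in> components x y"
      then obtain z where z: "z \<in> Sum_Type.Plus x y" "C = ?R `` {z}" by (auto simp: components_def quotient_def)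
      then show "C \<in> \<C>" using cover cl by metis
    qed
    show "\<C> \<subseteq> components x y"
    proof
      fix C assume C: "C \<in> \<C>"
      then obtain z0 where z0: "z0 \<in> C" using conn by blast
      then have "z0 \<in> Sum_Type.Plus x y" using assms(1)[OF C] by blast
      then show "C \<in> components x y"
        using quotientI[of z0 "Sum_Type.Plus x y" ?R] unfolding components_def cl[OF C z0] by blast
    qed
  qed
qed

lemma componentsD:
  assumes "C \<in> components x y"
  shows "C \<subseteq> Sum_Type.Plus x y" "C \<noteq> {}"
    and "z \<in> C \<Longrightarrow> (z, z') \<in> glue_sym x y \<Longrightarrow> z' \<in> C"
    and "z \<in> C \<Longrightarrow> z' \<in> C \<Longrightarrow> (z, z') \<in> (glue_sym x y)\<^sup>*"
proof -
  let ?R = "(glue_sym x y)\<^sup>*"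
  obtain z0 where z0: "z0 \<in> Sum_Type.Plus x y" "C = ?R `` {z0}"
    using assms by (auto simp: components_def quotient_def)
  show "C \<subseteq> Sum_Type.Plus x y"
  proof
    fix w assume "w \<in> C"
    then have "(z0, w) \<in> ?R" using z0 by simp
    then show "w \<in> Sum_Type.Plus x y"
      by (induction rule: rtrancl_induct) (use z0 glue_sym_subset in blast)+
  qed
  show "C \<noteq> {}" using z0 by auto
  show "z \<in> C \<Longrightarrow> (z, z') \<in> glue_sym x y \<Longrightarrow> z' \<in> C"
    using z0 by (auto intro: rtrancl_into_rtrancl)
  show "z \<in> C \<Longrightarrow> z' \<in> C \<Longrightarrow> (z, z') \<in> ?R"
    using z0 equiv_glue[of x y] by (meson Image_singleton_iff equivE symE transE)
qed

lemma component_cover: "z \<in> Sum_Type.Plus x y \<Longrightarrow> \<exists>C\<in>components x y. z \<in> C"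
  unfolding components_def by (metis Image_singleton_iff quotientI rtrancl.rtrancl_refl)

lemma component_unique: "C \<in> components x y \<Longrightarrow> C' \<in> components x y \<Longrightarrow> z \<in> C \<Longrightarrow> z \<in> C' \<Longrightarrow> C = C'"
proof -
  assume C: "C \<in> components x y" "C' \<in> components x y" and z: "z \<in> C" "z \<in> C'"
  have "C \<in> UNIV // (glue_sym x y)\<^sup>*" "C' \<in> UNIV // (glue_sym x y)\<^sup>*"
    using C unfolding components_def quotient_def by auto
  then show "C = C'" using quotient_disj[OF equiv_glue] z by blast
qed

text \<open>A surjection that preserves and reflects gluing carries connected components onto
  connected components; it will be a relabelling of strands.\<close>

lemma components_iso:
  assumes h: "h ` Sum_Type.Plus x y = Sum_Type.Plus x' y'"
    and r: "\<And>u v. u \<in> Sum_Type.Plus x y \<Longrightarrow> v \<in> Sum_Type.Plus x y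
      \<Longrightarrow> (u, v) \<in> glue_sym x y \<longleftrightarrow> (h u, h v) \<in> glue_sym x' y'"
  shows "components x' y' = (`) h ` components x y"
proof (rule components_eqI)
  fix C' assume "C' \<in> (`) h ` components x y"
  then obtain C where C: "C \<in> components x y" "C' = h ` C" by blast
  note D = componentsD[OF C(1)]
  show "C' \<subseteq> Sum_Type.Plus x' y'" using D(1) C(2) h by blast
  obtain z0 where z0: "z0 \<in> C" using D(2) by blast
  have "(h z0, h z) \<in> (glue_sym x' y')\<^sup>*" if z: "z \<in> C" for z
  proof -
    have "(z0, z) \<in> (glue_sym x y)\<^sup>*" by (rule D(4)[OF z0 z])
    then show ?thesis
    proof (induction rule: rtrancl_induct)
      case (step u v)
      then have "u \<in> Sum_Type.Plus x y" "v \<in> Sum_Type.Plus x y" using glue_sym_subset by blast+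
      then have "(h u, h v) \<in> glue_sym x' y'" using r step(2) by blast
      then show ?case by (rule rtrancl.rtrancl_into_rtrancl[OF step(3)])
    qed simp
  qed
  then show "\<exists>z0\<in>C'. \<forall>z\<in>C'. (z0, z) \<in> (glue_sym x' y')\<^sup>*" using z0 C(2) by auto
  fix w w' assume w: "w \<in> C'" "(w, w') \<in> glue_sym x' y'"
  obtain u where u: "u \<in> C" "w = h u" using w C by blast
  have "w' \<in> Sum_Type.Plus x' y'" using w(2) glue_sym_subset by blast
  then obtain v where v: "v \<in> Sum_Type.Plus x y" "w' = h v" using h by blast
  have "(u, v) \<in> glue_sym x y" using r[of u v] u v w D(1) by blast
  then show "w' \<in> C'" using D(3)[OF u(1)] v C(2) by blast
next
  fix z assume "z \<in> Sum_Type.Plus x' y'"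
  then obtain u where u: "u \<in> Sum_Type.Plus x y" "z = h u" using h by blast
  obtain C where "C \<in> components x y" "u \<in> C" using component_cover[OF u(1)] by blast
  then have "h ` C \<in> (`) h ` components x y" "z \<in> h ` C" using u(2) by simp_all
  then show "\<exists>C\<in>(`) h ` components x y. z \<in> C" by (rule bexI[rotated])
qed

lemma finite_components: "finite x \<Longrightarrow> finite y \<Longrightarrow> finite (components x y)"
  unfolding components_def quotient_def by (auto intro!: finite_UN_I)

lemma finite_component: "finite x \<Longrightarrow> finite y \<Longrightarrow> C \<in> components x y \<Longrightarrow> finite C"
  using componentsD(1) finite_Plus by (metis finite_subset)

context
  fixes x y :: diagram and m a b c :: nat
  assumes x: "x \<in> diagrams m a b" and y: "y \<in> diagrams m b c"
begin

lemma ends_disjoint: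
  assumes "C \<in> components x y" "C' \<in> components x y" "v \<in> ends C" "v \<in> ends C'"
  shows "C = C'"
proof -
  have "\<exists>z. z \<in> C \<and> z \<in> C'"
  proof (cases v)
    case (North i)
    then obtain s s' where s: "Inl s \<in> C" "North i \<in> fst s" "Inl s' \<in> C'" "North i \<in> fst s'"
      using assms by (auto simp: ends_def)
    then have "s = s'" using componentsD(1)[OF assms(1)] componentsD(1)[OF assms(2)] diagramsD(5)[OF x] by blast
    then show ?thesis using s by blast
  next
    case (South i)
    then obtain s s' where s: "Inr s \<in> C" "South i \<in> fst s" "Inr s' \<in> C'" "South i \<in> fst s'"
      using assms by (auto simp: ends_def)
    then have "s = s'" using componentsD(1)[OF assms(1)] componentsD(1)[OF assms(2)] diagramsD(5)[OF y] by blast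
    then show ?thesis using s by blast
  qed
  then show ?thesis using component_unique assms by blast
qed

lemma finite_xy: "finite x" "finite y" by (rule finite_diagram[OF x], rule finite_diagram[OF y])

text \<open>Every middle node carries a strand on either side, and these two are glued, so a
  component meeting the node from above also meets it from below.\<close>

lemma middle_glued:
  assumes C: "C \<in> components x y"
  shows "(\<exists>s. Inl s \<in> C \<and> South i \<in> fst s) \<longleftrightarrow> (\<exists>s. Inr s \<in> C \<and> North i \<in> fst s)"
proof
  assume "\<exists>s. Inl s \<in> C \<and> South i \<in> fst s"
  then obtain s where s: "Inl s \<in> C" "South i \<in> fst s" by blast
  have sx: "s \<in> x" using s componentsD(1)[OF C] by blast
  then have "South i \<in> nodes a b" using diagramsD(1)[OF x] s by blast
  then have "North i \<in> nodes b c" by simp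
  then obtain s' where s': "s' \<in> y" "North i \<in> fst s'" using diagramsD(4)[OF y] by blast
  have "(Inl s, Inr s') \<in> glue_sym x y" using sx s s' unfolding glue_sym_iff by blast
  then show "\<exists>s. Inr s \<in> C \<and> North i \<in> fst s" using componentsD(3)[OF C s(1)] s' by blast
next
  assume "\<exists>s. Inr s \<in> C \<and> North i \<in> fst s"
  then obtain s where s: "Inr s \<in> C" "North i \<in> fst s" by blast
  have sy: "s \<in> y" using s componentsD(1)[OF C] by blast
  then have "North i \<in> nodes b c" using diagramsD(1)[OF y] s by blast
  then have "South i \<in> nodes a b" by simp
  then obtain s' where s': "s' \<in> x" "South i \<in> fst s'" using diagramsD(4)[OF x] by blast
  have "(Inr s, Inl s') \<in> glue_sym x y" using sy s s' unfolding glue_sym_iff by blast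
  then show "\<exists>s. Inl s \<in> C \<and> South i \<in> fst s" using componentsD(3)[OF C s(1)] s' by blast
qed

text \<open>A connected component with \<open>k\<close> strands uses at least \<open>k - 1\<close> middle nodes. Counting the \<open>2k\<close> strand ends then leaves at
  most two outer ones.\<close>

lemma card_component_le:
  assumes C: "C \<in> components x y"
  shows "card C \<le> card {i. \<exists>s s'. Inl s \<in> C \<and> South i \<in> fst s \<and> Inr s' \<in> C \<and> North i \<in> fst s'} + 1"
proof -
  define M where "M S = {i. \<exists>s s'. Inl s \<in> S \<and> South i \<in> fst s \<and> Inr s' \<in> S \<and> North i \<in> fst s'}"
    for S :: "((node set \<times> nat) + (node set \<times> nat)) set"
  have fC: "finite C" using finite_component finite_xy C by blast
  have Cz: "C \<subseteq> Sum_Type.Plus x y" using componentsD(1)[OF C] .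
  have fM: "finite (M S)" if "S \<subseteq> C" for S
  proof (rule finite_subset)
    show "M S \<subseteq> {1..b}"
    proof
      fix i assume "i \<in> M S"
      then obtain s where "Inl s \<in> S" "South i \<in> fst s" unfolding M_def by blast
      then have "s \<in> x" using \<open>S \<subseteq> C\<close> Cz by blast
      then have "South i \<in> nodes a b" using \<open>South i \<in> fst s\<close> diagramsD(1)[OF x] by blast
      then show "i \<in> {1..b}" by simp
    qed
  qed simp
  \<comment> \<open>A set of strands is grown inside \<open>C\<close> one strand at a time;
    connectedness always provides a strand glued to the current set, and each step uses up a new
    middle node.\<close>
  have "\<exists>S. S \<subseteq> C \<and> card S = Suc k \<and> Suc k \<le> card (M S) + 1" if "Suc k \<le> card C" for k
    using that
  proof (induction k)
    case 0
    obtain z where "z \<in> C" using componentsD(2)[OF C] by blast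
    then show ?case by (intro exI[of _ "{z}"]) auto
  next
    case (Suc k)
    then obtain S where S: "S \<subseteq> C" "card S = Suc k" "Suc k \<le> card (M S) + 1" by auto
    have fS: "finite S" using S(1) fC finite_subset by blast
    have "\<exists>z z'. z \<in> S \<and> z' \<in> C - S \<and> (z, z') \<in> glue_sym x y"
    proof (rule ccontr)
      assume neg: "\<not> ?thesis"
      obtain z0 where z0: "z0 \<in> S" using S(2) by (metis card.empty empty_iff nat.distinct(1) subsetI subset_antisym)
      have "C \<subseteq> S"
      proof
        fix w assume w: "w \<in> C"
        have "(z0, w) \<in> (glue_sym x y)\<^sup>*" using componentsD(4)[OF C] z0 S(1) w by blast
        then show "w \<in> S"
        proof (induction rule: rtrancl_induct)
          case (step u v)
          then have "v \<in> C" using componentsD(3)[OF C] S(1) by blast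
          then show ?case using step neg by blast
        qed (rule z0)
      qed
      then have "card C \<le> Suc k" using S fS card_mono by metis
      then show False using Suc.prems by simp
    qed
    then obtain z z' where z: "z \<in> S" "z' \<in> C - S" "(z, z') \<in> glue_sym x y" by blast
    obtain i where i: "i \<in> M (insert z' S)" "i \<notin> M S"
    proof -
      obtain s s' i where g: "s \<in> x" "s' \<in> y" "South i \<in> fst s" "North i \<in> fst s'"
        "z = Inl s \<and> z' = Inr s' \<or> z = Inr s' \<and> z' = Inl s" using z(3) unfolding glue_sym_iff by blast
      have "i \<in> M (insert z' S)" using g z(1) unfolding M_def by blast
      \<comment> \<open>If both strands at the node \<open>i\<close> were already in
        \<open>S\<close>, one of them would be \<open>z'\<close>.\<close>
      moreover have "i \<notin> M S"
      proof
        assume "i \<in> M S"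
        then obtain r r' where r: "Inl r \<in> S" "South i \<in> fst r" "Inr r' \<in> S" "North i \<in> fst r'"
          by (auto simp: M_def)
        have "r \<in> x" "r' \<in> y" using r S(1) Cz by blast+
        then have "r = s" "r' = s'" using g r diagramsD(5)[OF x] diagramsD(5)[OF y] by blast+
        then show False using g(5) r z(2) by auto
      qed
      ultimately show ?thesis using that by blast
    qed
    have SC: "insert z' S \<subseteq> C" using S z by blast
    have "insert i (M S) \<subseteq> M (insert z' S)" using i by (auto simp: M_def)
    then have "card (insert i (M S)) \<le> card (M (insert z' S))" using fM[OF SC] card_mono by blast
    then have "Suc (card (M S)) \<le> card (M (insert z' S))" using i(2) fM[OF S(1)] by simp
    then show ?case using S z fS SC by (intro exI[of _ "insert z' S"]) auto
  qed
  moreover have "card C > 0" using fC componentsD(2)[OF C] by (simp add: card_gt_0_iff)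
  ultimately obtain S where S: "S \<subseteq> C" "card S = card C" "card C \<le> card (M S) + 1"
    using Suc_pred[of "card C"] by (metis le_refl)
  then have "S = C" using fC card_subset_eq by blast
  then show ?thesis using S by (simp add: M_def)
qed

text \<open>Twice the number of strands is the number of outer ends plus twice the number of middle
  nodes. With the bound on the number of strands this leaves an even number of at most two outer
  ends, hence exactly two if there are any.\<close>

lemma card_ends:
  assumes C: "C \<in> components x y" and ne: "ends C \<noteq> {}"
  shows "card (ends C) = 2"
proof -
  let ?N = "\<lambda>s :: node set \<times> nat. {i. North i \<in> fst s}" and ?S = "\<lambda>s :: node set \<times> nat. {i. South i \<in> fst s}"
  define CL where "CL = {s. Inl s \<in> C}" define CR where "CR = {s. Inr s \<in> C}"
  have CLx: "CL \<subseteq> x" and CRy: "CR \<subseteq> y" using componentsD(1)[OF C] by (auto simp: CL_def CR_def)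
  have fin: "finite CL" "finite CR" using CLx CRy finite_xy finite_subset by blast+
  have "C = Inl ` CL \<union> Inr ` CR"
  proof -
    have "z \<in> Inl ` CL \<union> Inr ` CR" if "z \<in> C" for z using that by (cases z) (auto simp: CL_def CR_def)
    then show ?thesis by (auto simp: CL_def CR_def)
  qed
  then have "C = Sum_Type.Plus CL CR" by (simp add: Plus_def)
  then have cC: "card C = card CL + card CR" using card_Plus[OF fin] by simp
  have split: "card (?N s) + card (?S s) = 2 \<and> finite (?N s) \<and> finite (?S s)"
    if D: "D \<in> diagrams m a' b'" "s \<in> D" for s D a' b'
  proof -
    have f: "finite (fst s)" using diagramsD(2)[OF D] by (simp add: card_ge_0_finite)
    have e: "fst s = North ` ?N s \<union> South ` ?S s"
    proof -
      have "v \<in> North ` ?N s \<union> South ` ?S s" if "v \<in> fst s" for v using that by (cases v) auto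
      then show ?thesis by auto
    qed
    have fN: "finite (North ` ?N s)" "finite (South ` ?S s)" using f e by (metis finite_Un)+
    have "card (fst s) = card (North ` ?N s) + card (South ` ?S s)"
      by (subst e, rule card_Un_disjoint) (use fN in auto)
    then show ?thesis using diagramsD(2)[OF D] fN by (simp add: card_image inj_on_def finite_image_iff)
  qed
  have cU: "card (\<Union>s\<in>T. P s) = (\<Sum>s\<in>T. card (P s))"
    if D: "D \<in> diagrams m a' b'" and T: "T \<subseteq> D" and P: "P = ?N \<or> P = ?S" for T D a' b' P
  proof (rule card_UN_disjoint)
    show "finite T" using finite_diagram[OF D] T finite_subset by blast
    show "\<forall>i\<in>T. finite (P i)" using split[OF D] T P by blast
    show "\<forall>i\<in>T. \<forall>j\<in>T. i \<noteq> j \<longrightarrow> P i \<inter> P j = {}" using diagramsD(5)[OF D] T P by blast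
  qed
  let ?M = "{i. \<exists>s s'. Inl s \<in> C \<and> South i \<in> fst s \<and> Inr s' \<in> C \<and> North i \<in> fst s'}"
  have MS: "?M = (\<Union>s\<in>CL. ?S s)" and MN: "?M = (\<Union>s\<in>CR. ?N s)"
  proof -
    have "?M = {i. \<exists>s. Inl s \<in> C \<and> South i \<in> fst s}" "?M = {i. \<exists>s. Inr s \<in> C \<and> North i \<in> fst s}"
      using middle_glued[OF C] by blast+
    moreover have "(\<Union>s\<in>CL. ?S s) = {i. \<exists>s. Inl s \<in> C \<and> South i \<in> fst s}"
      "(\<Union>s\<in>CR. ?N s) = {i. \<exists>s. Inr s \<in> C \<and> North i \<in> fst s}"
      unfolding CL_def CR_def by blast+
    ultimately show "?M = (\<Union>s\<in>CL. ?S s)" "?M = (\<Union>s\<in>CR. ?N s)" by simp_all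
  qed
  have "(\<Sum>s\<in>CL. card (?N s) + card (?S s)) = (\<Sum>s\<in>CL. 2)"
    by (rule sum.cong[OF refl]) (use split[OF x] CLx in blast)
  then have "2 * card CL = (\<Sum>s\<in>CL. card (?N s) + card (?S s))" by simp
  also have "\<dots> = card (\<Union>s\<in>CL. ?N s) + card ?M"
    unfolding MS by (simp add: sum.distrib cU[OF x CLx])
  finally have L: "2 * card CL = card (\<Union>s\<in>CL. ?N s) + card ?M" .
  have "(\<Sum>s\<in>CR. card (?N s) + card (?S s)) = (\<Sum>s\<in>CR. 2)"
    by (rule sum.cong[OF refl]) (use split[OF y] CRy in blast)
  then have "2 * card CR = (\<Sum>s\<in>CR. card (?N s) + card (?S s))" by simp
  also have "\<dots> = card ?M + card (\<Union>s\<in>CR. ?S s)"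
    unfolding MN by (simp add: sum.distrib cU[OF y CRy])
  finally have R: "2 * card CR = card ?M + card (\<Union>s\<in>CR. ?S s)" .
  have e: "ends C = North ` (\<Union>s\<in>CL. ?N s) \<union> South ` (\<Union>s\<in>CR. ?S s)"
    unfolding ends_def CL_def CR_def image_def by blast
  have F: "finite (\<Union>s\<in>CL. ?N s)" "finite (\<Union>s\<in>CR. ?S s)"
    using split[OF x] split[OF y] CLx CRy fin by blast+
  have fe: "finite (ends C)" unfolding e using F by (intro finite_UnI finite_imageI)
  have "card (ends C) = card (North ` (\<Union>s\<in>CL. ?N s)) + card (South ` (\<Union>s\<in>CR. ?S s))"
    unfolding e by (rule card_Un_disjoint[OF finite_imageI[OF F(1)] finite_imageI[OF F(2)]]) blast
  then have ce: "card (ends C) = card (\<Union>s\<in>CL. ?N s) + card (\<Union>s\<in>CR. ?S s)"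
    by (subst (asm) (1 2) card_image) (simp_all add: inj_on_def)
  have "card (ends C) > 0" using fe ne by (simp add: card_gt_0_iff)
  moreover have "e = 2" if "2 * cl = a + mm" "2 * cr = mm + b" "e = a + b" "cl + cr \<le> mm + 1" "e > 0"
    for a mm b cl cr e :: nat using that by presburger
  ultimately show ?thesis using L R ce card_component_le[OF C] unfolding cC by blast
qed

lemma concatenation_diagrams: "m > 0 \<Longrightarrow> concatenation m x y \<in> diagrams m a c"
proof (rule diagramsI)
  assume m: "m > 0"
  fix s assume "s \<in> concatenation m x y"
  then obtain C where C: "C \<in> components x y" "ends C \<noteq> {}" "s = (ends C, component_label m C)"
    by (auto simp: concatenation_def)
  have "ends C \<subseteq> nodes a c"
  proof
    fix v assume "v \<in> ends C"
    then show "v \<in> nodes a c"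
      using componentsD(1)[OF C(1)] diagramsD(1)[OF x] diagramsD(1)[OF y] by (fastforce simp: ends_def)
  qed
  then show "fst s \<subseteq> nodes a c \<and> card (fst s) = 2 \<and> snd s < m"
    using C card_ends m by (auto simp: component_label_def)
next
  fix v assume v: "v \<in> nodes a c"
  have "\<exists>C\<in>components x y. v \<in> ends C"
  proof (cases v)
    case (North i)
    then have "v \<in> nodes a b" using v by simp
    then obtain s where "s \<in> x" "v \<in> fst s" using diagramsD(4)[OF x] by blast
    then obtain C where "C \<in> components x y" "Inl s \<in> C" using component_cover by blast
    then show ?thesis using \<open>v \<in> fst s\<close> North unfolding ends_def by blast
  next
    case (South i)
    then have "v \<in> nodes b c" using v by simp
    then obtain s where "s \<in> y" "v \<in> fst s" using diagramsD(4)[OF y] by blast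
    then obtain C where "C \<in> components x y" "Inr s \<in> C" using component_cover by blast
    then show ?thesis using \<open>v \<in> fst s\<close> South unfolding ends_def by blast
  qed
  then obtain C where C: "C \<in> components x y" "v \<in> ends C" by blast
  then have "(ends C, component_label m C) \<in> concatenation m x y" by (auto simp: concatenation_def)
  then show "\<exists>s. s \<in> concatenation m x y \<and> v \<in> fst s" using C(2) by (metis fst_conv)
next
  fix s s' v assume s: "s \<in> concatenation m x y" "s' \<in> concatenation m x y" "v \<in> fst s" "v \<in> fst s'"
  obtain C C' where C: "C \<in> components x y" "s = (ends C, component_label m C)"
    "C' \<in> components x y" "s' = (ends C', component_label m C')"
    using s(1,2) by (auto simp: concatenation_def)
  then have "C = C'" using ends_disjoint[OF C(1,3)] s(3,4) by simp
  then show "s = s'" using C by simp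
qed

text \<open>All labels are regrouped by components. Those without ends are the loops that
  concatenation removes, so their labels are added back; the congruence is modulo \<open>m\<close>
  because component labels are reduced.\<close>

lemma label_sum_concatenation:
  "(label_sum x + label_sum y) mod m = (label_sum (concatenation m x y) + (\<Sum>C\<in>loops x y. component_label m C)) mod m"
proof -
  define lab :: "(node set \<times> nat) + (node set \<times> nat) \<Rightarrow> nat" where
    "lab z = (case z of Inl s \<Rightarrow> snd s | Inr s \<Rightarrow> snd s)" for z
  let ?C = "components x y"
  have fC: "finite ?C" using finite_components finite_xy by blast
  have "label_sum x + label_sum y = (\<Sum>z\<in>Sum_Type.Plus x y. lab z)"
    unfolding label_sum_def Plus_def using finite_xy
    by (subst sum.union_disjoint) (auto simp: sum.reindex lab_def)
  also have "Sum_Type.Plus x y = \<Union>?C" using component_cover componentsD(1) by blast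
  also have "(\<Sum>z\<in>\<Union>?C. lab z) = (\<Sum>C\<in>?C. \<Sum>z\<in>C. lab z)"
  proof -
    have "\<forall>A\<in>?C. finite A" using finite_component[OF finite_xy] by blast
    moreover have "\<forall>A\<in>?C. \<forall>B\<in>?C. A \<noteq> B \<longrightarrow> A \<inter> B = {}" using component_unique by blast
    ultimately show ?thesis using sum.Union_disjoint[of ?C lab] by simp
  qed
  finally have "(label_sum x + label_sum y) mod m = (\<Sum>C\<in>?C. (\<Sum>z\<in>C. lab z) mod m) mod m"
    by (simp add: mod_sum_eq)
  also have "(\<Sum>C\<in>?C. (\<Sum>z\<in>C. lab z) mod m) = (\<Sum>C\<in>?C. component_label m C)"
    by (simp add: component_label_def lab_def)
  also have "\<dots> = (\<Sum>C\<in>{C\<in>?C. ends C \<noteq> {}} \<union> loops x y. component_label m C)"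
    unfolding loops_def by (rule sum.cong) blast+
  also have "\<dots> = (\<Sum>C\<in>{C\<in>?C. ends C \<noteq> {}}. component_label m C) + (\<Sum>C\<in>loops x y. component_label m C)"
    by (rule sum.union_disjoint) (use fC in \<open>auto simp: loops_def\<close>)
  also have "(\<Sum>C\<in>{C\<in>?C. ends C \<noteq> {}}. component_label m C) = label_sum (concatenation m x y)"
  proof -
    have e: "concatenation m x y = (\<lambda>C. (ends C, component_label m C)) ` {C\<in>?C. ends C \<noteq> {}}"
      by (auto simp: concatenation_def)
    have "inj_on (\<lambda>C. (ends C, component_label m C)) {C\<in>?C. ends C \<noteq> {}}"
    proof (rule inj_onI)
      fix C C' assume C: "C \<in> {C\<in>?C. ends C \<noteq> {}}" "C' \<in> {C\<in>?C. ends C \<noteq> {}}"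
        "(ends C, component_label m C) = (ends C', component_label m C')"
      then obtain v where "v \<in> ends C" "v \<in> ends C'" by auto
      then show "C = C'" using ends_disjoint C by blast
    qed
    then show ?thesis unfolding label_sum_def e by (simp add: sum.reindex)
  qed
  finally show ?thesis .
qed

end

subsection \<open>Changing labels\<close>

declare split_paired_Ex [simp del] split_paired_All [simp del]

lemma glue_sym_simps:
  "(Inl s, Inr s') \<in> glue_sym x y \<longleftrightarrow> s \<in> x \<and> s' \<in> y \<and> (\<exists>i. South i \<in> fst s \<and> North i \<in> fst s')"
  "(Inr s', Inl s) \<in> glue_sym x y \<longleftrightarrow> s \<in> x \<and> s' \<in> y \<and> (\<exists>i. South i \<in> fst s \<and> North i \<in> fst s')"
  "(Inl s, Inl r) \<notin> glue_sym x y" "(Inr s', Inr r') \<notin> glue_sym x y"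
  by (auto simp: glued_def)

text \<open>Adds \<open>j\<close> to the label of the strand at the node \<open>u\<close>. For
  \<open>North 1\<close> and \<open>South 1\<close> this will be multiplication by t_1^j from above
  and from below.\<close>

definition shift :: "nat \<Rightarrow> node \<Rightarrow> nat \<Rightarrow> diagram \<Rightarrow> diagram" where
  "shift m u j D = (\<lambda>s. (fst s, if u \<in> fst s then (snd s + j) mod m else snd s)) ` D"

lemma shift_diagrams: "m > 0 \<Longrightarrow> D \<in> diagrams m a b \<Longrightarrow> shift m u j D \<in> diagrams m a b"
proof (rule diagramsI)
  assume m: "m > 0" and D: "D \<in> diagrams m a b"
  show "fst s \<subseteq> nodes a b \<and> card (fst s) = 2 \<and> snd s < m" if "s \<in> shift m u j D" for s
    using that diagramsD(1-3)[OF D] m unfolding shift_def by force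
  show "\<exists>s. s \<in> shift m u j D \<and> v \<in> fst s" if v: "v \<in> nodes a b" for v
  proof -
    obtain s where "s \<in> D" "v \<in> fst s" using diagramsD(4)[OF D v] by blast
    then show ?thesis unfolding shift_def by (metis (no_types, lifting) fst_conv imageI)
  qed
  show "s = s'" if s: "s \<in> shift m u j D" "s' \<in> shift m u j D" "v \<in> fst s" "v \<in> fst s'" for s s' v
  proof -
    obtain r r' where r: "r \<in> D" "fst r = fst s" "r' \<in> D" "fst r' = fst s'"
      "s = (fst r, if u \<in> fst r then (snd r + j) mod m else snd r)"
      "s' = (fst r', if u \<in> fst r' then (snd r' + j) mod m else snd r')"
      using s(1,2) unfolding shift_def by fastforce
    then have "r = r'" using diagramsD(5)[OF D] s by metis
    then show ?thesis using r by metis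
  qed
qed

lemma shift_shift: "shift m u j (shift m u k D) = shift m u (j + k) D"
  unfolding shift_def image_image by (rule image_cong) (simp_all add: mod_simps add_ac)

lemma shift_multiple:
  assumes "D \<in> diagrams m a b" "m dvd j"
  shows "shift m u j D = D"
proof -
  have "(fst s, if u \<in> fst s then (snd s + j) mod m else snd s) = s" if "s \<in> D" for s
    using diagramsD(3)[OF assms(1) that] assms(2) by (auto simp: prod_eq_iff mod_add_eq[symmetric])
  then show ?thesis unfolding shift_def by simp
qed

lemma concatenation_image: "concatenation m x y = (\<lambda>C. (ends C, component_label m C)) ` {C \<in> components x y. ends C \<noteq> {}}"
  unfolding concatenation_def image_def by blast

lemma Collect_image: "{C \<in> f ` K. R C} = f ` {C \<in> K. R (f C)}"
  by blast

text \<open>At most one summand is altered, by \<open>j\<close> and up to a multiple of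
  \<open>m\<close>.\<close>

lemma sum_mod_shift:
  assumes "finite C" and f: "\<And>z. z \<in> C \<Longrightarrow> f z mod m = (lab z + (if P z then j else 0)) mod (m::nat)"
    and u: "\<And>z z'. z \<in> C \<Longrightarrow> z' \<in> C \<Longrightarrow> P z \<Longrightarrow> P z' \<Longrightarrow> z = z'"
  shows "(\<Sum>z\<in>C. f z) mod m = ((\<Sum>z\<in>C. lab z) mod m + (if \<exists>z\<in>C. P z then j else 0)) mod m"
proof -
  have "(\<Sum>z\<in>C. f z) mod m = (\<Sum>z\<in>C. f z mod m) mod m" by (simp add: mod_sum_eq)
  also have "\<dots> = (\<Sum>z\<in>C. (lab z + (if P z then j else 0)) mod m) mod m" using f by simp
  also have "\<dots> = ((\<Sum>z\<in>C. lab z) + (\<Sum>z\<in>C. if P z then j else 0)) mod m"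
    by (simp add: mod_sum_eq sum.distrib)
  also have "(\<Sum>z\<in>C. if P z then j else 0) = (if \<exists>z\<in>C. P z then j else 0)"
  proof (cases "\<exists>z\<in>C. P z")
    case True
    then obtain z0 where z0: "z0 \<in> C" "P z0" by blast
    have "(\<Sum>z\<in>C. if P z then j else 0) = (\<Sum>z\<in>C. if z = z0 then j else 0)"
      by (rule sum.cong[OF refl]) (use u z0 in metis)
    then show ?thesis using True z0 assms(1) by simp
  next
    case False
    then have "(\<Sum>z\<in>C. if P z then j else 0) = (\<Sum>z\<in>C. 0)" by (intro sum.cong) auto
    then show ?thesis using False by simp
  qed
  finally show ?thesis by (simp add: mod_add_left_eq)
qed

lemma label_sum_shift:
  assumes D: "D \<in> diagrams m a b" and u: "u \<in> nodes a b"
  shows "label_sum (shift m u j D) mod m = (label_sum D + j) mod m"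
proof -
  have "inj_on (\<lambda>s. (fst s, if u \<in> fst s then (snd s + j) mod m else snd s)) D"
    using inj_on_fst_diagram[OF D] by (auto simp: inj_on_def)
  then have "label_sum (shift m u j D) = (\<Sum>s\<in>D. if u \<in> fst s then (snd s + j) mod m else snd s)"
    unfolding label_sum_def shift_def by (subst sum.reindex) (simp_all add: comp_def)
  also have "\<dots> mod m = ((\<Sum>s\<in>D. snd s) mod m + (if \<exists>s\<in>D. u \<in> fst s then j else 0)) mod m"
    by (rule sum_mod_shift[OF finite_diagram[OF D]]) (use diagramsD(5)[OF D] in auto)
  also have "(if \<exists>s\<in>D. u \<in> fst s then j else 0) = j" using diagramsD(4)[OF D u] by auto
  finally show ?thesis by (simp add: label_sum_def mod_add_left_eq)
qed

lemma card_arcs_shift: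
  assumes D: "D \<in> diagrams m a b"
  shows "card (arcs (shift m u j D)) = card (arcs D)"
proof -
  let ?f = "\<lambda>s. (fst s, if u \<in> fst s then (snd s + j) mod m else snd s)"
  have "arcs (shift m u j D) = ?f ` arcs D" unfolding arcs_def shift_def by (auto simp del: ex_simps)
  moreover have "inj_on ?f (arcs D)"
    using inj_on_fst_diagram[OF D] by (auto simp: inj_on_def arcs_def)
  ultimately show ?thesis by (simp add: card_image)
qed

context
  fixes x y :: diagram and m a b c :: nat
  assumes x: "x \<in> diagrams m a b" and y: "y \<in> diagrams m b c"
begin

text \<open>Gluing depends on end nodes only, and a strand is determined by its end nodes; hence a
  change of labels induces a bijection of components that preserves their ends.\<close>

lemma relabel_components:
  fixes f g :: "node set \<times> nat \<Rightarrow> nat"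
  defines "h \<equiv> map_sum (\<lambda>s. (fst s, f s)) (\<lambda>s. (fst s, g s))"
  shows "components ((\<lambda>s. (fst s, f s)) ` x) ((\<lambda>s. (fst s, g s)) ` y) = (`) h ` components x y"
    and "ends (h ` C) = ends C"
    and "C \<in> components x y \<Longrightarrow>
      component_label m (h ` C) = (\<Sum>z\<in>C. case z of Inl s \<Rightarrow> f s | Inr s \<Rightarrow> g s) mod m"
    and "inj_on ((`) h) (components x y)"
proof -
  let ?x = "(\<lambda>s. (fst s, f s)) ` x" and ?y = "(\<lambda>s. (fst s, g s)) ` y"
  have hs: "h (Inl s) = Inl (fst s, f s)" "h (Inr s) = Inr (fst s, g s)" for s by (simp_all add: h_def)
  have inj: "inj_on h (Sum_Type.Plus x y)"
  proof (rule inj_onI)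
    fix u v assume u: "u \<in> Sum_Type.Plus x y" "v \<in> Sum_Type.Plus x y" "h u = h v"
    show "u = v"
      using u inj_on_fst_diagram[OF x] inj_on_fst_diagram[OF y]
      by (cases u; cases v) (auto simp: hs inj_on_def)
  qed
  show "components ?x ?y = (`) h ` components x y"
  proof (rule components_iso)
    show "h ` Sum_Type.Plus x y = Sum_Type.Plus ?x ?y"
      unfolding Plus_def image_Un image_image hs ..
    fix u v assume u: "u \<in> Sum_Type.Plus x y" "v \<in> Sum_Type.Plus x y"
    show "(u, v) \<in> glue_sym x y \<longleftrightarrow> (h u, h v) \<in> glue_sym ?x ?y"
      using u by (cases u; cases v) (auto simp del: Un_iff simp add: hs glue_sym_simps)
  qed
  have hl: "Inl r \<in> h ` C \<longleftrightarrow> (\<exists>s. Inl s \<in> C \<and> r = (fst s, f s))" for r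
  proof
    assume "Inl r \<in> h ` C"
    then obtain z where z: "z \<in> C" "Inl r = h z" by blast
    then show "\<exists>s. Inl s \<in> C \<and> r = (fst s, f s)" by (cases z) (auto simp: hs)
  next
    assume "\<exists>s. Inl s \<in> C \<and> r = (fst s, f s)"
    then obtain s where "Inl s \<in> C" "r = (fst s, f s)" by blast
    then show "Inl r \<in> h ` C" by (intro image_eqI[of _ _ "Inl s"]) (auto simp: hs)
  qed
  have hr: "Inr r \<in> h ` C \<longleftrightarrow> (\<exists>s. Inr s \<in> C \<and> r = (fst s, g s))" for r
  proof
    assume "Inr r \<in> h ` C"
    then obtain z where z: "z \<in> C" "Inr r = h z" by blast
    then show "\<exists>s. Inr s \<in> C \<and> r = (fst s, g s)" by (cases z) (auto simp: hs)
  next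
    assume "\<exists>s. Inr s \<in> C \<and> r = (fst s, g s)"
    then obtain s where "Inr s \<in> C" "r = (fst s, g s)" by blast
    then show "Inr r \<in> h ` C" by (intro image_eqI[of _ _ "Inr s"]) (auto simp: hs)
  qed
  show "ends (h ` C) = ends C"
  proof -
    have "(\<exists>r. Inl r \<in> h ` C \<and> P (fst r)) \<longleftrightarrow> (\<exists>s. Inl s \<in> C \<and> P (fst s))"
      "(\<exists>r. Inr r \<in> h ` C \<and> P (fst r)) \<longleftrightarrow> (\<exists>s. Inr s \<in> C \<and> P (fst s))" for P
      unfolding hl hr by auto
    then show ?thesis unfolding ends_def by simp
  qed
  show "component_label m (h ` C) = (\<Sum>z\<in>C. case z of Inl s \<Rightarrow> f s | Inr s \<Rightarrow> g s) mod m"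
    if C: "C \<in> components x y"
  proof -
    have "inj_on h C" using inj componentsD(1)[OF C] inj_on_subset by blast
    then have "(\<Sum>z\<in>h ` C. case z of Inl s \<Rightarrow> snd s | Inr s \<Rightarrow> snd s)
        = (\<Sum>z\<in>C. case h z of Inl s \<Rightarrow> snd s | Inr s \<Rightarrow> snd s)" by (simp add: sum.reindex)
    also have "\<dots> = (\<Sum>z\<in>C. case z of Inl s \<Rightarrow> f s | Inr s \<Rightarrow> g s)"
      by (rule sum.cong[OF refl]) (simp add: hs split: sum.splits)
    finally show ?thesis by (simp add: component_label_def)
  qed
  show "inj_on ((`) h) (components x y)"
  proof (rule inj_onI)
    fix C C' assume C: "C \<in> components x y" "C' \<in> components x y" "h ` C = h ` C'"
    then show "C = C'" using inj_on_image_eq_iff[OF inj componentsD(1)[OF C(1)] componentsD(1)[OF C(2)]] by simp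
  qed
qed

text \<open>\<open>L\<close> records the component labels after relabelling, so that the new product
  and its loop factor are both expressed over the components of the original pair.\<close>

lemma relabel_concatenation:
  fixes f g :: "node set \<times> nat \<Rightarrow> nat"
  assumes L: "\<And>C. C \<in> components x y \<Longrightarrow> (\<Sum>z\<in>C. case z of Inl s \<Rightarrow> f s | Inr s \<Rightarrow> g s) mod m = L C"
  shows "concatenation m ((\<lambda>s. (fst s, f s)) ` x) ((\<lambda>s. (fst s, g s)) ` y)
      = (\<lambda>C. (ends C, L C)) ` {C \<in> components x y. ends C \<noteq> {}}"
    and "loop_factor m p \<delta> ((\<lambda>s. (fst s, f s)) ` x) ((\<lambda>s. (fst s, g s)) ` y)
      = (\<Prod>C\<in>loops x y. loop_value p \<delta> (L C))"
proof -
  define h where "h = map_sum (\<lambda>s :: node set \<times> nat. (fst s, f s)) (\<lambda>s :: node set \<times> nat. (fst s, g s))"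
  note r = relabel_components[where f = f and g = g, folded h_def]
  have L': "component_label m (h ` C) = L C" if "C \<in> components x y" for C by (rule trans[OF r(3)[OF that] L[OF that]])
  have e: "{C \<in> (`) h ` components x y. Q (ends C)} = (`) h ` {C \<in> components x y. Q (ends C)}" for Q
    using Collect_image[of "(`) h" "components x y" "\<lambda>C. Q (ends C)"] by (simp only: r(2))
  have "concatenation m ((\<lambda>s. (fst s, f s)) ` x) ((\<lambda>s. (fst s, g s)) ` y)
      = (\<lambda>C. (ends C, component_label m C)) ` {C \<in> (`) h ` components x y. ends C \<noteq> {}}"
    unfolding concatenation_image r(1) ..
  also have "\<dots> = (\<lambda>C. (ends (h ` C), component_label m (h ` C))) ` {C \<in> components x y. ends C \<noteq> {}}"
    unfolding e[of "\<lambda>X. X \<noteq> {}"] image_image ..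
  also have "\<dots> = (\<lambda>C. (ends C, L C)) ` {C \<in> components x y. ends C \<noteq> {}}"
    by (rule image_cong) (simp_all add: r(2) L')
  finally show "concatenation m ((\<lambda>s. (fst s, f s)) ` x) ((\<lambda>s. (fst s, g s)) ` y)
      = (\<lambda>C. (ends C, L C)) ` {C \<in> components x y. ends C \<noteq> {}}" .
  have "loops ((\<lambda>s. (fst s, f s)) ` x) ((\<lambda>s. (fst s, g s)) ` y) = (`) h ` loops x y"
    unfolding loops_def r(1) e[of "\<lambda>X. X = {}"] ..
  moreover have "inj_on ((`) h) (loops x y)" by (rule inj_on_subset[OF r(4)]) (auto simp: loops_def)
  ultimately have "loop_factor m p \<delta> ((\<lambda>s. (fst s, f s)) ` x) ((\<lambda>s. (fst s, g s)) ` y)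
      = (\<Prod>C\<in>loops x y. loop_value p \<delta> (component_label m (h ` C)))"
    unfolding loop_factor_def by (simp add: prod.reindex)
  also have "\<dots> = (\<Prod>C\<in>loops x y. loop_value p \<delta> (L C))"
    by (rule prod.cong[OF refl]) (simp add: L' loops_def)
  finally show "loop_factor m p \<delta> ((\<lambda>s. (fst s, f s)) ` x) ((\<lambda>s. (fst s, g s)) ` y)
      = (\<Prod>C\<in>loops x y. loop_value p \<delta> (L C))" .
qed

lemma shift_left:
  shows "concatenation m (shift m u j x) y
      = (\<lambda>C. (ends C, (component_label m C + (if \<exists>s. Inl s \<in> C \<and> u \<in> fst s then j else 0)) mod m)) ` {C \<in> components x y. ends C \<noteq> {}}"
    and "loop_factor m p \<delta> (shift m u j x) y
      = (\<Prod>C\<in>loops x y. loop_value p \<delta> ((component_label m C + (if \<exists>s. Inl s \<in> C \<and> u \<in> fst s then j else 0)) mod m))"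
proof -
  have L: "(\<Sum>z\<in>C. case z of Inl s \<Rightarrow> (if u \<in> fst s then (snd s + j) mod m else snd s) | Inr s \<Rightarrow> snd s) mod m
      = (component_label m C + (if \<exists>s. Inl s \<in> C \<and> u \<in> fst s then j else 0)) mod m" if C: "C \<in> components x y" for C
  proof -
    let ?P = "\<lambda>z :: (node set \<times> nat) + (node set \<times> nat). case z of Inl s \<Rightarrow> u \<in> fst s | Inr s \<Rightarrow> False"
    have "(\<Sum>z\<in>C. case z of Inl s \<Rightarrow> (if u \<in> fst s then (snd s + j) mod m else snd s) | Inr s \<Rightarrow> snd s) mod m
        = ((\<Sum>z\<in>C. case z of Inl s \<Rightarrow> snd s | Inr s \<Rightarrow> snd s) mod m + (if \<exists>z\<in>C. ?P z then j else 0)) mod m"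
    proof (rule sum_mod_shift)
      show "finite C" by (rule finite_component[OF finite_diagram[OF x] finite_diagram[OF y] C])
      fix z z' assume z: "z \<in> C" "z' \<in> C" "?P z" "?P z'"
      obtain s where s: "z = Inl s" "u \<in> fst s" using z(3) by (cases z) auto
      obtain s' where s': "z' = Inl s'" "u \<in> fst s'" using z(4) by (cases z') auto
      have "s \<in> x" "s' \<in> x" using componentsD(1)[OF C] z(1,2) s(1) s'(1) by blast+
      then show "z = z'" using diagramsD(5)[OF x _ _ s(2) s'(2)] s(1) s'(1) by simp
    qed (auto split: sum.splits)
    moreover have "(\<exists>z\<in>C. ?P z) \<longleftrightarrow> (\<exists>s. Inl s \<in> C \<and> u \<in> fst s)"
    proof
      assume "\<exists>z\<in>C. ?P z"
      then obtain z where "z \<in> C" "?P z" by blast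
      then show "\<exists>s. Inl s \<in> C \<and> u \<in> fst s" by (cases z) auto
    next
      assume "\<exists>s. Inl s \<in> C \<and> u \<in> fst s"
      then obtain s where "Inl s \<in> C" "u \<in> fst s" by blast
      then show "\<exists>z\<in>C. ?P z" by (intro bexI[of _ "Inl s"]) simp_all
    qed
    ultimately show ?thesis by (simp add: component_label_def)
  qed
  have y': "(\<lambda>s. (fst s, snd s)) ` y = y" by simp
  show "concatenation m (shift m u j x) y
      = (\<lambda>C. (ends C, (component_label m C + (if \<exists>s. Inl s \<in> C \<and> u \<in> fst s then j else 0)) mod m)) ` {C \<in> components x y. ends C \<noteq> {}}"
    using relabel_concatenation(1)[OF L] unfolding y' shift_def[symmetric] .
  show "loop_factor m p \<delta> (shift m u j x) y
      = (\<Prod>C\<in>loops x y. loop_value p \<delta> ((component_label m C + (if \<exists>s. Inl s \<in> C \<and> u \<in> fst s then j else 0)) mod m))"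
    using relabel_concatenation(2)[OF L] unfolding y' shift_def[symmetric] .
qed

lemma shift_right:
  shows "concatenation m x (shift m u j y)
      = (\<lambda>C. (ends C, (component_label m C + (if \<exists>s. Inr s \<in> C \<and> u \<in> fst s then j else 0)) mod m)) ` {C \<in> components x y. ends C \<noteq> {}}"
    and "loop_factor m p \<delta> x (shift m u j y)
      = (\<Prod>C\<in>loops x y. loop_value p \<delta> ((component_label m C + (if \<exists>s. Inr s \<in> C \<and> u \<in> fst s then j else 0)) mod m))"
proof -
  have L: "(\<Sum>z\<in>C. case z of Inl s \<Rightarrow> snd s | Inr s \<Rightarrow> (if u \<in> fst s then (snd s + j) mod m else snd s)) mod m
      = (component_label m C + (if \<exists>s. Inr s \<in> C \<and> u \<in> fst s then j else 0)) mod m" if C: "C \<in> components x y" for C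
  proof -
    let ?P = "\<lambda>z :: (node set \<times> nat) + (node set \<times> nat). case z of Inl s \<Rightarrow> False | Inr s \<Rightarrow> u \<in> fst s"
    have "(\<Sum>z\<in>C. case z of Inl s \<Rightarrow> snd s | Inr s \<Rightarrow> (if u \<in> fst s then (snd s + j) mod m else snd s)) mod m
        = ((\<Sum>z\<in>C. case z of Inl s \<Rightarrow> snd s | Inr s \<Rightarrow> snd s) mod m + (if \<exists>z\<in>C. ?P z then j else 0)) mod m"
    proof (rule sum_mod_shift)
      show "finite C" by (rule finite_component[OF finite_diagram[OF x] finite_diagram[OF y] C])
      fix z z' assume z: "z \<in> C" "z' \<in> C" "?P z" "?P z'"
      obtain s where s: "z = Inr s" "u \<in> fst s" using z(3) by (cases z) auto
      obtain s' where s': "z' = Inr s'" "u \<in> fst s'" using z(4) by (cases z') auto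
      have "s \<in> y" "s' \<in> y" using componentsD(1)[OF C] z(1,2) s(1) s'(1) by blast+
      then show "z = z'" using diagramsD(5)[OF y _ _ s(2) s'(2)] s(1) s'(1) by simp
    qed (auto split: sum.splits)
    moreover have "(\<exists>z\<in>C. ?P z) \<longleftrightarrow> (\<exists>s. Inr s \<in> C \<and> u \<in> fst s)"
    proof
      assume "\<exists>z\<in>C. ?P z"
      then obtain z where "z \<in> C" "?P z" by blast
      then show "\<exists>s. Inr s \<in> C \<and> u \<in> fst s" by (cases z) auto
    next
      assume "\<exists>s. Inr s \<in> C \<and> u \<in> fst s"
      then obtain s where "Inr s \<in> C" "u \<in> fst s" by blast
      then show "\<exists>z\<in>C. ?P z" by (intro bexI[of _ "Inr s"]) simp_all
    qed
    ultimately show ?thesis by (simp add: component_label_def)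
  qed
  have x': "(\<lambda>s. (fst s, snd s)) ` x = x" by simp
  show "concatenation m x (shift m u j y)
      = (\<lambda>C. (ends C, (component_label m C + (if \<exists>s. Inr s \<in> C \<and> u \<in> fst s then j else 0)) mod m)) ` {C \<in> components x y. ends C \<noteq> {}}"
    using relabel_concatenation(1)[OF L] unfolding x' shift_def[symmetric] .
  show "loop_factor m p \<delta> x (shift m u j y)
      = (\<Prod>C\<in>loops x y. loop_value p \<delta> ((component_label m C + (if \<exists>s. Inr s \<in> C \<and> u \<in> fst s then j else 0)) mod m))"
    using relabel_concatenation(2)[OF L] unfolding x' shift_def[symmetric] .
qed

lemma component_label_mod: "component_label m C mod m = component_label m C"
  by (simp add: component_label_def)

text \<open>An outer node lies on a component with ends and never on a closed loop, so the loop
  factor is unaffected and the shift passes to the product.\<close>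

lemma concatenation_shift_North:
  "concatenation m (shift m (North i) j x) y = shift m (North i) j (concatenation m x y)"
  "loop_factor m p \<delta> (shift m (North i) j x) y = loop_factor m p \<delta> x y"
proof -
  have e: "(\<exists>s. Inl s \<in> C \<and> North i \<in> fst s) \<longleftrightarrow> North i \<in> ends C" for C unfolding ends_def by blast
  show "concatenation m (shift m (North i) j x) y = shift m (North i) j (concatenation m x y)"
  proof -
    have r: "shift m (North i) j (concatenation m x y) = (\<lambda>C. (ends C, if North i \<in> ends C then (component_label m C + j) mod m else component_label m C)) ` {C \<in> components x y. ends C \<noteq> {}}"
      unfolding concatenation_image[of m x y] shift_def image_image by (simp only: fst_conv snd_conv)
    show ?thesis unfolding shift_left(1) e r
      by (rule image_cong[OF refl]) (simp add: component_label_mod)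
  qed
  show "loop_factor m p \<delta> (shift m (North i) j x) y = loop_factor m p \<delta> x y"
    unfolding shift_left(2) e unfolding loop_factor_def
    by (rule prod.cong[OF refl]) (simp add: component_label_mod loops_def)
qed

lemma concatenation_shift_South:
  "concatenation m x (shift m (South i) j y) = shift m (South i) j (concatenation m x y)"
  "loop_factor m p \<delta> x (shift m (South i) j y) = loop_factor m p \<delta> x y"
proof -
  have e: "(\<exists>s. Inr s \<in> C \<and> South i \<in> fst s) \<longleftrightarrow> South i \<in> ends C" for C unfolding ends_def by blast
  show "concatenation m x (shift m (South i) j y) = shift m (South i) j (concatenation m x y)"
  proof -
    have r: "shift m (South i) j (concatenation m x y) = (\<lambda>C. (ends C, if South i \<in> ends C then (component_label m C + j) mod m else component_label m C)) ` {C \<in> components x y. ends C \<noteq> {}}"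
      unfolding concatenation_image[of m x y] shift_def image_image by (simp only: fst_conv snd_conv)
    show ?thesis unfolding shift_right(1) e r
      by (rule image_cong[OF refl]) (simp add: component_label_mod)
  qed
  show "loop_factor m p \<delta> x (shift m (South i) j y) = loop_factor m p \<delta> x y"
    unfolding shift_right(2) e unfolding loop_factor_def
    by (rule prod.cong[OF refl]) (simp add: component_label_mod loops_def)
qed

text \<open>The two strands meeting at a middle node belong to one component, possibly a loop;
  whichever of them receives the label, that component gains \<open>j\<close> exactly once.\<close>

lemma concatenation_shift_middle:
  "concatenation m (shift m (South i) j x) y = concatenation m x (shift m (North i) j y)"
  "loop_factor m p \<delta> (shift m (South i) j x) y = loop_factor m p \<delta> x (shift m (North i) j y)"
proof -
  show "concatenation m (shift m (South i) j x) y = concatenation m x (shift m (North i) j y)"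
    unfolding shift_left(1) shift_right(1)
    by (rule image_cong) (simp_all add: middle_glued[OF x y])
  show "loop_factor m p \<delta> (shift m (South i) j x) y = loop_factor m p \<delta> x (shift m (North i) j y)"
    unfolding shift_left(2) shift_right(2)
    by (rule prod.cong[OF refl]) (simp add: middle_glued[OF x y] loops_def)
qed

end

subsection \<open>The action of the group diagrams\<close>

text \<open>The element of G(m,1,N) with underlying permutation \<pi> and labels indexed by northern
  nodes; placing the diagram of \<pi>' below it gives the permutation
  \<open>\<pi>' \<circ> \<pi>\<close>.\<close>

definition perm_diagram :: "nat \<Rightarrow> (nat \<Rightarrow> nat) \<Rightarrow> (nat \<Rightarrow> nat) \<Rightarrow> diagram" where
  "perm_diagram N \<pi> z = (\<lambda>i. ({North i, South (\<pi> i)}, z i)) ` {1..N}"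

primrec rename :: "(nat \<Rightarrow> nat) \<Rightarrow> node \<Rightarrow> node" where
  "rename \<pi> (North i) = North i"
| "rename \<pi> (South i) = South (\<pi> i)"

text \<open>Closed form of multiplication by a group diagram from below. The sum over southern ends
  has one term for a through-strand, two for a southern arc and none for a northern arc.\<close>

definition right_act :: "nat \<Rightarrow> (nat \<Rightarrow> nat) \<Rightarrow> (nat \<Rightarrow> nat) \<Rightarrow> diagram \<Rightarrow> diagram" where
  "right_act m \<pi> z x = (\<lambda>s. (rename \<pi> ` fst s, (snd s + (\<Sum>i\<in>{i. South i \<in> fst s}. z i)) mod m)) ` x"

lemma rename_inj: "inj \<pi> \<Longrightarrow> inj (rename \<pi>)"
proof (rule injI)
  fix u v assume "inj \<pi>" "rename \<pi> u = rename \<pi> v"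
  then show "u = v" by (cases u; cases v) (auto dest: injD)
qed

lemma South_rename: "{i. South i \<in> rename \<pi> ` e} = \<pi> ` {i. South i \<in> e}"
proof -
  have "South i \<in> rename \<pi> ` e \<longleftrightarrow> i \<in> \<pi> ` {i. South i \<in> e}" for i
  proof
    assume "South i \<in> rename \<pi> ` e"
    then obtain u where u: "u \<in> e" "South i = rename \<pi> u" by blast
    then show "i \<in> \<pi> ` {i. South i \<in> e}" by (cases u) auto
  next
    assume "i \<in> \<pi> ` {i. South i \<in> e}"
    then obtain j where "South j \<in> e" "i = \<pi> j" by blast
    then show "South i \<in> rename \<pi> ` e" by (intro image_eqI[of _ _ "South j"]) auto
  qed
  then show ?thesis by blast
qed

lemma perm_diagram_group:
  assumes \<pi>: "\<pi> permutes {1..N}" and z: "\<And>i. i \<in> {1..N} \<Longrightarrow> z i < m"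
  shows "perm_diagram N \<pi> z \<in> group_diagrams m N"
proof -
  have "perm_diagram N \<pi> z \<in> diagrams m N N"
  proof (rule diagramsI)
    fix s assume "s \<in> perm_diagram N \<pi> z"
    then obtain i where i: "i \<in> {1..N}" "s = ({North i, South (\<pi> i)}, z i)" by (auto simp: perm_diagram_def)
    then show "fst s \<subseteq> nodes N N \<and> card (fst s) = 2 \<and> snd s < m"
      using permutes_in_image[OF \<pi>] z by simp
  next
    fix v assume v: "v \<in> nodes N N"
    show "\<exists>s. s \<in> perm_diagram N \<pi> z \<and> v \<in> fst s"
    proof (cases v)
      case (North i)
      then show ?thesis using v by (intro exI[of _ "({North i, South (\<pi> i)}, z i)"]) (simp add: perm_diagram_def)
    next
      case (South j)
      then have "j \<in> {1..N}" using v by simp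
      then obtain i where i: "i \<in> {1..N}" "j = \<pi> i" using permutes_image[OF \<pi>] by blast
      then show ?thesis using South by (intro exI[of _ "({North i, South (\<pi> i)}, z i)"]) (simp add: perm_diagram_def)
    qed
  next
    fix s s' v assume "s \<in> perm_diagram N \<pi> z" "s' \<in> perm_diagram N \<pi> z" "v \<in> fst s" "v \<in> fst s'"
    then show "s = s'" using permutes_inj[OF \<pi>] by (auto simp: perm_diagram_def inj_eq)
  qed
  moreover have "arcs (perm_diagram N \<pi> z) = {}" by (auto simp: arcs_def perm_diagram_def doubleton_eq_iff)
  ultimately show ?thesis by (simp add: group_diagrams_def)
qed

lemma group_diagrams_perm:
  assumes w: "w \<in> group_diagrams m N"
  shows "\<exists>\<pi> z. \<pi> permutes {1..N} \<and> (\<forall>i\<in>{1..N}. z i < m) \<and> w = perm_diagram N \<pi> z"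
proof -
  have D: "w \<in> diagrams m N N" and na: "arcs w = {}" using w by (auto simp: group_diagrams_def)
  have strand: "\<exists>i j. fst s = {North i, South j}" if "s \<in> w" for s using na that unfolding arcs_def by blast
  have "\<exists>j l. ({North i, South j}, l) \<in> w" if "i \<in> {1..N}" for i
  proof -
    have "North i \<in> nodes N N" using that by simp
    then obtain s where s: "s \<in> w" "North i \<in> fst s" using diagramsD(4)[OF D] by blast
    obtain i' j where "fst s = {North i', South j}" using strand[OF s(1)] by blast
    then have "s = ({North i, South j}, snd s)" using s(2) by (auto simp: prod_eq_iff)
    then show ?thesis using s(1) by metis
  qed
  then have "\<forall>i\<in>{1..N}. \<exists>jl. ({North i, South (fst jl)}, snd jl) \<in> w" by (metis fst_conv snd_conv)
  from bchoice[OF this] obtain f where f: "\<forall>i\<in>{1..N}. ({North i, South (fst (f i))}, snd (f i)) \<in> w" ..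
  define \<pi> where "\<pi> i = (if i \<in> {1..N} then fst (f i) else i)" for i
  define z where "z i = snd (f i)" for i
  have w1: "({North i, South (\<pi> i)}, z i) \<in> w" if "i \<in> {1..N}" for i using f that by (simp add: \<pi>_def z_def)
  have \<pi>in: "\<pi> i \<in> {1..N}" if "i \<in> {1..N}" for i
    using diagramsD(1)[OF D w1[OF that]] by simp
  have inj: "inj_on \<pi> {1..N}"
  proof (rule inj_onI)
    fix i j assume "i \<in> {1..N}" "j \<in> {1..N}" "\<pi> i = \<pi> j"
    then have "({North i, South (\<pi> i)}, z i) = ({North j, South (\<pi> j)}, z j)"
      by (intro diagramsD(5)[OF D w1 w1, of _ _ "South (\<pi> i)"]) auto
    then show "i = j" by (auto simp: doubleton_eq_iff)
  qed
  have "bij_betw \<pi> {1..N} {1..N}"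
    unfolding bij_betw_def using inj endo_inj_surj[of "{1..N}" \<pi>] \<pi>in by blast
  then have p: "\<pi> permutes {1..N}" by (rule bij_imp_permutes) (auto simp: \<pi>_def)
  have "w = perm_diagram N \<pi> z"
  proof
    show "perm_diagram N \<pi> z \<subseteq> w" using w1 by (auto simp: perm_diagram_def)
    show "w \<subseteq> perm_diagram N \<pi> z"
    proof
      fix s assume s: "s \<in> w"
      obtain i j where ij: "fst s = {North i, South j}" using strand[OF s] by blast
      have i: "i \<in> {1..N}" using diagramsD(1)[OF D s] ij by simp
      have "s = ({North i, South (\<pi> i)}, z i)"
        by (rule diagramsD(5)[OF D s w1[OF i], of "North i"]) (auto simp: ij)
      then show "s \<in> perm_diagram N \<pi> z" using i by (auto simp: perm_diagram_def)
    qed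
  qed
  moreover have "\<forall>i\<in>{1..N}. z i < m" using diagramsD(3)[OF D w1] by auto
  ultimately show ?thesis using p by blast
qed

lemma id_diagram_perm: "id_diagram N = perm_diagram N id (\<lambda>_. 0)"
  unfolding id_diagram_def perm_diagram_def by auto

lemma id_diagram_group: "m > 0 \<Longrightarrow> id_diagram N \<in> group_diagrams m N"
  unfolding id_diagram_perm by (rule perm_diagram_group) (auto simp: permutes_id)

lemma group_diagrams_subset: "w \<in> group_diagrams m N \<Longrightarrow> w \<in> diagrams m N N"
  by (simp add: group_diagrams_def)

text \<open>Each component consists of one strand of \<open>x\<close> and the group strands attached
  to its southern ends; none is closed, as both ends of the strand survive under the
  permutation.\<close>

lemma
  assumes x: "x \<in> diagrams m a b" and \<pi>: "\<pi> permutes {1..b}"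
  shows concatenation_perm: "concatenation m x (perm_diagram b \<pi> z) = right_act m \<pi> z x"
    and loops_perm: "loops x (perm_diagram b \<pi> z) = {}"
proof -
  let ?w = "perm_diagram b \<pi> z"
  let ?t = "\<lambda>i. ({North i, South (\<pi> i)}, z i)"
  define Cs where "Cs s = insert (Inl s) ((\<lambda>i. Inr (?t i)) ` {i. South i \<in> fst s})" for s :: "node set \<times> nat"
  have Si: "i \<in> {1..b}" if "s \<in> x" "South i \<in> fst s" for s i
  proof -
    have "South i \<in> nodes a b" using diagramsD(1)[OF x that(1)] that(2) by blast
    then show ?thesis by simp
  qed
  have sub: "{i. South i \<in> fst s} \<subseteq> {1..b}" if "s \<in> x" for s using Si[OF that] by blast
  have fin: "finite {i. South i \<in> fst s}" if "s \<in> x" for s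
    by (rule finite_subset[OF sub[OF that]]) simp
  have comp: "components x ?w = Cs ` x"
  proof (rule components_eqI)
    fix C assume "C \<in> Cs ` x"
    then obtain s where s: "s \<in> x" "C = Cs s" by blast
    have t: "?t i \<in> ?w" if "South i \<in> fst s" for i using Si[OF s(1) that] by (simp add: perm_diagram_def)
    show "C \<subseteq> Sum_Type.Plus x ?w" unfolding s(2) Cs_def using s(1) t by blast
    have g: "(Inl s, Inr (?t i)) \<in> glue_sym x ?w" if "South i \<in> fst s" for i
      unfolding glue_sym_simps using s(1) that Si[OF s(1) that] by (auto simp: perm_diagram_def)
    show "\<exists>z0\<in>C. \<forall>z\<in>C. (z0, z) \<in> (glue_sym x ?w)\<^sup>*"
    proof (intro bexI[of _ "Inl s"] ballI)
      fix u assume "u \<in> C"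
      then consider "u = Inl s" | i where "South i \<in> fst s" "u = Inr (?t i)" using s by (auto simp: Cs_def)
      then show "(Inl s, u) \<in> (glue_sym x ?w)\<^sup>*"
        by cases (auto intro: r_into_rtrancl g[THEN r_into_rtrancl] simp del: Un_iff)
    qed (use s in \<open>simp add: Cs_def\<close>)
    fix u v assume u: "u \<in> C" and uv: "(u, v) \<in> glue_sym x ?w"
    consider (a) "u = Inl s" | (b) i where "South i \<in> fst s" "u = Inr (?t i)" using s u by (auto simp: Cs_def)
    then show "v \<in> C"
    proof cases
      case a
      then obtain s' where v: "v = Inr s'" using uv by (cases v) (auto simp del: Un_iff simp: glue_sym_simps)
      then have "s' \<in> ?w" "\<exists>i. South i \<in> fst s \<and> North i \<in> fst s'" using uv a by (simp_all del: Un_iff add: glue_sym_simps)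
      then show ?thesis using v s by (auto simp: perm_diagram_def Cs_def)
    next
      case b
      then obtain r where v: "v = Inl r" using uv by (cases v) (auto simp del: Un_iff simp: glue_sym_simps)
      then have "r \<in> x" "\<exists>j. South j \<in> fst r \<and> North j \<in> fst (?t i)" using uv b by (simp_all only: glue_sym_simps)
      then have "r = s" using diagramsD(5)[OF x _ s(1) _ b(1)] by auto
      then show ?thesis using v s by (simp add: Cs_def)
    qed
  next
    fix u assume u: "u \<in> Sum_Type.Plus x ?w"
    show "\<exists>C\<in>Cs ` x. u \<in> C"
    proof (cases u)
      case (Inl s)
      then show ?thesis using u by (auto simp: Cs_def)
    next
      case (Inr s')
      then obtain i where i: "i \<in> {1..b}" "s' = ?t i" using u by (auto simp: perm_diagram_def)
      have "South i \<in> nodes a b" using i(1) by simp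
      then obtain s where "s \<in> x" "South i \<in> fst s" using diagramsD(4)[OF x] by blast
      then show ?thesis using Inr i by (auto simp: Cs_def)
    qed
  qed
  have ends: "ends (Cs s) = rename \<pi> ` fst s" for s
  proof -
    have "v \<in> ends (Cs s) \<longleftrightarrow> v \<in> rename \<pi> ` fst s" for v
    proof (cases v)
      case (North i)
      have "North i \<in> rename \<pi> ` fst s \<longleftrightarrow> North i \<in> fst s"
      proof
        assume "North i \<in> rename \<pi> ` fst s"
        then obtain u where "u \<in> fst s" "North i = rename \<pi> u" by blast
        then show "North i \<in> fst s" by (cases u) auto
      qed (auto intro: image_eqI[of _ _ "North i"])
      then show ?thesis unfolding North ends_def Cs_def by auto
    next
      case (South i)
      have "South i \<in> rename \<pi> ` fst s \<longleftrightarrow> i \<in> \<pi> ` {i. South i \<in> fst s}" using South_rename[of \<pi> "fst s"] by blast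
      then show ?thesis unfolding South ends_def Cs_def by auto
    qed
    then show ?thesis by blast
  qed
  have ne: "ends (Cs s) \<noteq> {}" if "s \<in> x" for s
    using diagramsD(2)[OF x that] unfolding ends by auto
  then show "loops x ?w = {}" unfolding loops_def comp by blast
  have lab: "component_label m (Cs s) = (snd s + (\<Sum>i\<in>{i. South i \<in> fst s}. z i)) mod m" if s: "s \<in> x" for s
  proof -
    have inj: "inj_on (\<lambda>i. Inr (?t i) :: (node set \<times> nat) + (node set \<times> nat)) {i. South i \<in> fst s}" by (auto simp: inj_on_def doubleton_eq_iff)
    have "(\<Sum>u\<in>Cs s. case u of Inl s \<Rightarrow> snd s | Inr s \<Rightarrow> snd s)
        = snd s + (\<Sum>u\<in>(\<lambda>i. Inr (?t i) :: (node set \<times> nat) + (node set \<times> nat)) ` {i. South i \<in> fst s}. case u of Inl s \<Rightarrow> snd s | Inr s \<Rightarrow> snd s)"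
      unfolding Cs_def using fin[OF s] by (subst sum.insert) auto
    also have "(\<Sum>u\<in>(\<lambda>i. Inr (?t i) :: (node set \<times> nat) + (node set \<times> nat)) ` {i. South i \<in> fst s}. case u of Inl s \<Rightarrow> snd s | Inr s \<Rightarrow> snd s)
        = (\<Sum>i\<in>{i. South i \<in> fst s}. z i)" by (simp add: sum.reindex[OF inj])
    finally show ?thesis by (simp add: component_label_def)
  qed
  have "{C \<in> Cs ` x. ends C \<noteq> {}} = Cs ` x" using ne by blast
  then show "concatenation m x ?w = right_act m \<pi> z x"
    unfolding concatenation_image comp right_act_def
    by (simp add: image_image ends) (rule image_cong[OF refl], simp add: lab)
qed

lemma right_act_perm_diagram:
  "right_act m \<pi>' z' (perm_diagram N \<pi> z) = perm_diagram N (\<pi>' \<circ> \<pi>) (\<lambda>i. (z i + z' (\<pi> i)) mod m)"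
proof -
  have "{j. South j \<in> {North i, South k}} = {k}" for i k by auto
  then show ?thesis unfolding right_act_def perm_diagram_def image_image by simp
qed

lemma concatenation_perm_perm:
  assumes "\<pi> permutes {1..N}" "\<And>i. i \<in> {1..N} \<Longrightarrow> z i < m" "\<pi>' permutes {1..N}"
  shows "concatenation m (perm_diagram N \<pi> z) (perm_diagram N \<pi>' z') = perm_diagram N (\<pi>' \<circ> \<pi>) (\<lambda>i. (z i + z' (\<pi> i)) mod m)"
  using concatenation_perm[OF group_diagrams_subset[OF perm_diagram_group[OF assms(1,2)]] assms(3)]
    right_act_perm_diagram by simp

lemma right_act_right_act:
  assumes "inj \<pi>"
  shows "right_act m \<pi>' z' (right_act m \<pi> z x) = right_act m (\<pi>' \<circ> \<pi>) (\<lambda>i. (z i + z' (\<pi> i)) mod m) x"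
  unfolding right_act_def image_image
proof (rule image_cong[OF refl])
  fix s :: "node set \<times> nat"
  have r: "rename \<pi>' ` rename \<pi> ` fst s = rename (\<pi>' \<circ> \<pi>) ` fst s"
  proof -
    have "rename \<pi>' (rename \<pi> u) = rename (\<pi>' \<circ> \<pi>) u" for u by (cases u) auto
    then show ?thesis by (simp add: image_image)
  qed
  let ?I = "{i. South i \<in> fst s}"
  have "(\<Sum>i\<in>{i. South i \<in> rename \<pi> ` fst s}. z' i) = (\<Sum>i\<in>?I. z' (\<pi> i))"
    unfolding South_rename using assms by (subst sum.reindex) (auto simp: inj_on_def inj_def)
  then have "((snd s + (\<Sum>i\<in>?I. z i)) mod m + (\<Sum>i\<in>{i. South i \<in> rename \<pi> ` fst s}. z' i)) mod m
      = (snd s + (\<Sum>i\<in>?I. z i + z' (\<pi> i))) mod m"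
    by (simp add: mod_simps sum.distrib add_ac)
  also have "\<dots> = (snd s + (\<Sum>i\<in>?I. (z i + z' (\<pi> i)) mod m)) mod m"
    by (rule mod_add_cong[OF refl]) (rule mod_sum_eq[symmetric])
  finally show "(rename \<pi>' ` fst (rename \<pi> ` fst s, (snd s + (\<Sum>i\<in>?I. z i)) mod m),
      (snd (rename \<pi> ` fst s, (snd s + (\<Sum>i\<in>?I. z i)) mod m) +
       (\<Sum>i\<in>{i. South i \<in> fst (rename \<pi> ` fst s, (snd s + (\<Sum>i\<in>?I. z i)) mod m)}. z' i)) mod m)
    = (rename (\<pi>' \<circ> \<pi>) ` fst s, (snd s + (\<Sum>i\<in>?I. (z i + z' (\<pi> i)) mod m)) mod m)"
    using r by simp
qed

lemma right_act_id: "x \<in> diagrams m a b \<Longrightarrow> right_act m id (\<lambda>_. 0) x = x"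
proof -
  assume x: "x \<in> diagrams m a b"
  have "rename id u = u" for u by (cases u) auto
  then have "(rename id ` fst s, (snd s + (\<Sum>i\<in>{i. South i \<in> fst s}. 0)) mod m) = s" if "s \<in> x" for s
    using diagramsD(3)[OF x that] by (simp add: prod_eq_iff)
  then show ?thesis unfolding right_act_def by simp
qed

text \<open>Multiplication by group diagrams from below is the action \<open>right_act\<close>, and
  its action law is the form of associativity on which the factorisation into dangles rests.
  Northern and southern ends keep their sides, so arcs stay arcs.\<close>

lemma
  assumes x: "x \<in> diagrams m a b" and w: "w \<in> group_diagrams m b"
  shows concatenation_group_assoc: "w' \<in> group_diagrams m b \<Longrightarrow>
      concatenation m (concatenation m x w) w' = concatenation m x (concatenation m w w')"
    and loops_group: "loops x w = {}"
    and card_arcs_group: "card (arcs (concatenation m x w)) = card (arcs x)"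
    and concatenation_group_strands: "\<exists>\<pi> z. \<pi> permutes {1..b} \<and> (\<forall>i\<in>{1..b}. z i < m) \<and> w = perm_diagram b \<pi> z \<and>
      concatenation m x w = right_act m \<pi> z x"
proof -
  obtain \<pi> z where p: "\<pi> permutes {1..b}" "\<And>i. i \<in> {1..b} \<Longrightarrow> z i < m" "w = perm_diagram b \<pi> z"
    using group_diagrams_perm[OF w] by blast
  have xw: "concatenation m x w = right_act m \<pi> z x" unfolding p(3) by (rule concatenation_perm[OF x p(1)])
  then show "\<exists>\<pi> z. \<pi> permutes {1..b} \<and> (\<forall>i\<in>{1..b}. z i < m) \<and> w = perm_diagram b \<pi> z \<and>
      concatenation m x w = right_act m \<pi> z x" using p by blast
  show "loops x w = {}" unfolding p(3) by (rule loops_perm[OF x p(1)])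
  have m: "m > 0 \<or> x = {}" using diagramsD(3)[OF x] by fastforce
  show "concatenation m (concatenation m x w) w' = concatenation m x (concatenation m w w')" if w': "w' \<in> group_diagrams m b"
  proof -
    obtain \<pi>' z' where p': "\<pi>' permutes {1..b}" "\<And>i. i \<in> {1..b} \<Longrightarrow> z' i < m" "w' = perm_diagram b \<pi>' z'"
      using group_diagrams_perm[OF w'] by blast
    have "concatenation m x w \<in> diagrams m a b"
    proof (cases "m > 0")
      case True
      then show ?thesis using concatenation_diagrams[OF x group_diagrams_subset[OF w]] by blast
    next
      case False
      then have "x = {}" using m by blast
      then show ?thesis using x unfolding xw by (simp add: right_act_def)
    qed
    then have "concatenation m (concatenation m x w) w' = right_act m \<pi>' z' (right_act m \<pi> z x)"
      unfolding p'(3) xw by (rule concatenation_perm[OF _ p'(1)])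
    also have "\<dots> = right_act m (\<pi>' \<circ> \<pi>) (\<lambda>i. (z i + z' (\<pi> i)) mod m) x"
      by (rule right_act_right_act[OF permutes_inj[OF p(1)]])
    also have "\<dots> = concatenation m x (perm_diagram b (\<pi>' \<circ> \<pi>) (\<lambda>i. (z i + z' (\<pi> i)) mod m))"
      by (rule concatenation_perm[OF x permutes_compose[OF p(1) p'(1)], symmetric])
    also have "\<dots> = concatenation m x (concatenation m w w')"
      unfolding p(3) p'(3) by (simp only: concatenation_perm_perm[OF p(1,2) p'(1)])
    finally show ?thesis .
  qed
  show "card (arcs (concatenation m x w)) = card (arcs x)"
  proof -
    let ?f = "\<lambda>s. (rename \<pi> ` fst s, (snd s + (\<Sum>i\<in>{i. South i \<in> fst s}. z i)) mod m)"
    have inj: "inj (rename \<pi>)" by (rule rename_inj[OF permutes_inj[OF p(1)]])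
    have e: "(\<exists>i j. rename \<pi> ` e = {North i, South j}) \<longleftrightarrow> (\<exists>i j. e = {North i, South j})" for e
    proof
      assume "\<exists>i j. rename \<pi> ` e = {North i, South j}"
      then obtain i j where ij: "rename \<pi> ` e = {North i, South j}" by blast
      have "{North i, South j} = rename \<pi> ` {North i, South (inv_into UNIV \<pi> j)}"
        using permutes_inverses(1)[OF p(1)] by simp
      then have "e = {North i, South (inv_into UNIV \<pi> j)}" using ij inj_image_eq_iff[OF inj] by metis
      then show "\<exists>i j. e = {North i, South j}" by blast
    next
      assume "\<exists>i j. e = {North i, South j}"
      then obtain i j where "e = {North i, South j}" by blast
      then have "rename \<pi> ` e = {North i, South (\<pi> j)}" by simp
      then show "\<exists>i j. rename \<pi> ` e = {North i, South j}" by blast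
    qed
    have "arcs (right_act m \<pi> z x) = ?f ` arcs x"
      unfolding arcs_def right_act_def Collect_image by (simp add: e)
    moreover have "inj_on ?f (arcs x)"
    proof (rule inj_onI)
      fix s s' assume s: "s \<in> arcs x" "s' \<in> arcs x" "?f s = ?f s'"
      then have "fst s = fst s'" using inj_image_eq_iff[OF inj] by simp
      then show "s = s'" using s inj_on_fst_diagram[OF x] by (auto simp: arcs_def inj_on_def)
    qed
    ultimately show ?thesis unfolding xw by (simp add: card_image)
  qed
qed

lemma concatenation_id_right:
  assumes "x \<in> diagrams m a b"
  shows "concatenation m x (id_diagram b) = x" "loops x (id_diagram b) = {}"
  using concatenation_perm[OF assms permutes_id, of "\<lambda>_. 0"] loops_perm[OF assms permutes_id, of "\<lambda>_. 0"]
    right_act_id[OF assms] by (simp_all add: id_diagram_perm id_def)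

lemma group_inverse:
  assumes w: "w \<in> group_diagrams m N"
  shows "\<exists>w'\<in>group_diagrams m N. concatenation m w w' = id_diagram N \<and> concatenation m w' w = id_diagram N"
proof -
  obtain \<pi> z where p: "\<pi> permutes {1..N}" "\<And>i. i \<in> {1..N} \<Longrightarrow> z i < m" "w = perm_diagram N \<pi> z"
    using group_diagrams_perm[OF w] by blast
  \<comment> \<open>The strand of the inverse that starts at \<open>i\<close> cancels the label of
    the strand arriving there, which is indexed by the preimage of \<open>i\<close>; the outer
    \<open>mod m\<close> turns \<open>m\<close> into 0.\<close>
  let ?\<pi> = "inv_into UNIV \<pi>" and ?z = "\<lambda>i. (m - z (inv_into UNIV \<pi> i)) mod m"
  have i: "inv_into UNIV \<pi> permutes {1..N}" by (rule permutes_inv[OF p(1)])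
  have in1: "inv_into UNIV \<pi> j \<in> {1..N}" if "j \<in> {1..N}" for j using permutes_in_image[OF i] that by simp
  have zl: "?z j < m" if "j \<in> {1..N}" for j using p(2)[OF in1[OF that]] by simp
  have z0: "(z j + (m - z j) mod m) mod m = 0" "((m - z j) mod m + z j) mod m = 0" if "j \<in> {1..N}" for j
    using p(2)[OF that] by (simp_all add: mod_simps)
  have "concatenation m w (perm_diagram N ?\<pi> ?z) = perm_diagram N (?\<pi> \<circ> \<pi>) (\<lambda>i. (z i + ?z (\<pi> i)) mod m)"
    unfolding p(3) by (rule concatenation_perm_perm[OF p(1,2) i])
  also have "\<dots> = id_diagram N"
    unfolding id_diagram_perm perm_diagram_def
    by (rule image_cong[OF refl]) (use z0 permutes_inverses[OF p(1)] in simp)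
  finally have 1: "concatenation m w (perm_diagram N ?\<pi> ?z) = id_diagram N" .
  have "concatenation m (perm_diagram N ?\<pi> ?z) w = perm_diagram N (\<pi> \<circ> ?\<pi>) (\<lambda>i. (?z i + z (?\<pi> i)) mod m)"
    unfolding p(3) by (rule concatenation_perm_perm[OF i zl p(1)])
  also have "\<dots> = id_diagram N"
    unfolding id_diagram_perm perm_diagram_def
    by (rule image_cong[OF refl]) (use z0 in1 permutes_inverses[OF p(1)] in simp)
  finally show ?thesis using 1 perm_diagram_group[OF i zl]
    by (intro bexI[of _ "perm_diagram N ?\<pi> ?z"] conjI)
qed

text \<open>The mirror image of the computation for group diagrams from below, carried out for the
  identity.\<close>

lemma concatenation_id_left:
  assumes y: "y \<in> diagrams m b c"
  shows "concatenation m (id_diagram b) y = y" "loops (id_diagram b) y = {}"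
proof -
  let ?w = "id_diagram b"
  let ?t = "\<lambda>i. ({North i, South i}, 0::nat)"
  define Cs where "Cs s = insert (Inr s) ((\<lambda>i. Inl (?t i)) ` {i. North i \<in> fst s})" for s :: "node set \<times> nat"
  have w: "?w = ?t ` {1..b}" by (auto simp: id_diagram_def)
  have Si: "i \<in> {1..b}" if "s \<in> y" "North i \<in> fst s" for s i
  proof -
    have "North i \<in> nodes b c" using diagramsD(1)[OF y that(1)] that(2) by blast
    then show ?thesis by simp
  qed
  have sub: "{i. North i \<in> fst s} \<subseteq> {1..b}" if "s \<in> y" for s using Si[OF that] by blast
  have fin: "finite {i. North i \<in> fst s}" if "s \<in> y" for s
    by (rule finite_subset[OF sub[OF that]]) simp
  have comp: "components ?w y = Cs ` y"
  proof (rule components_eqI)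
    fix C assume "C \<in> Cs ` y"
    then obtain s where s: "s \<in> y" "C = Cs s" by blast
    have t: "?t i \<in> ?w" if "North i \<in> fst s" for i using Si[OF s(1) that] by (simp add: w)
    show "C \<subseteq> Sum_Type.Plus ?w y" unfolding s(2) Cs_def using s(1) t by blast
    have g: "(Inr s, Inl (?t i)) \<in> glue_sym ?w y" if "North i \<in> fst s" for i
      unfolding glue_sym_simps using s(1) that Si[OF s(1) that] by (auto simp: w)
    show "\<exists>z0\<in>C. \<forall>z\<in>C. (z0, z) \<in> (glue_sym ?w y)\<^sup>*"
    proof (intro bexI[of _ "Inr s"] ballI)
      fix u assume "u \<in> C"
      then consider "u = Inr s" | i where "North i \<in> fst s" "u = Inl (?t i)" using s by (auto simp: Cs_def)
      then show "(Inr s, u) \<in> (glue_sym ?w y)\<^sup>*"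
        by cases (auto intro: r_into_rtrancl g[THEN r_into_rtrancl] simp del: Un_iff)
    qed (use s in \<open>simp add: Cs_def\<close>)
    fix u v assume u: "u \<in> C" and uv: "(u, v) \<in> glue_sym ?w y"
    consider (a) "u = Inr s" | (b) i where "North i \<in> fst s" "u = Inl (?t i)" using s u by (auto simp: Cs_def)
    then show "v \<in> C"
    proof cases
      case a
      then obtain s' where v: "v = Inl s'" using uv by (cases v) (auto simp del: Un_iff simp: glue_sym_simps)
      then have "s' \<in> ?w" "\<exists>i. South i \<in> fst s' \<and> North i \<in> fst s" using uv a by (simp_all del: Un_iff add: glue_sym_simps)
      then show ?thesis using v s by (auto simp: w Cs_def)
    next
      case b
      then obtain r where v: "v = Inr r" using uv by (cases v) (auto simp del: Un_iff simp: glue_sym_simps)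
      then have "r \<in> y" "\<exists>j. South j \<in> fst (?t i) \<and> North j \<in> fst r" using uv b by (simp_all only: glue_sym_simps)
      then have "r = s" using diagramsD(5)[OF y _ s(1) _ b(1)] by auto
      then show ?thesis using v s by (simp add: Cs_def)
    qed
  next
    fix u assume u: "u \<in> Sum_Type.Plus ?w y"
    show "\<exists>C\<in>Cs ` y. u \<in> C"
    proof (cases u)
      case (Inr s)
      then show ?thesis using u by (auto simp: Cs_def)
    next
      case (Inl s')
      then obtain i where i: "i \<in> {1..b}" "s' = ?t i" using u by (auto simp: w)
      have "North i \<in> nodes b c" using i(1) by simp
      then obtain s where "s \<in> y" "North i \<in> fst s" using diagramsD(4)[OF y] by blast
      then show ?thesis using Inl i by (auto simp: Cs_def)
    qed
  qed
  have ends: "ends (Cs s) = fst s" for s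
  proof -
    have "v \<in> ends (Cs s) \<longleftrightarrow> v \<in> fst s" for v
      by (cases v) (auto simp: ends_def Cs_def)
    then show ?thesis by blast
  qed
  have ne: "ends (Cs s) \<noteq> {}" if "s \<in> y" for s
    using diagramsD(2)[OF y that] unfolding ends by auto
  then show "loops ?w y = {}" unfolding loops_def comp by blast
  have lab: "component_label m (Cs s) = snd s" if s: "s \<in> y" for s
  proof -
    have "(\<Sum>u\<in>Cs s. case u of Inl s \<Rightarrow> snd s | Inr s \<Rightarrow> snd s)
        = snd s + (\<Sum>u\<in>(\<lambda>i. Inl (?t i) :: (node set \<times> nat) + (node set \<times> nat)) ` {i. North i \<in> fst s}. case u of Inl s \<Rightarrow> snd s | Inr s \<Rightarrow> snd s)"
      unfolding Cs_def using fin[OF s] by (subst sum.insert) auto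
    also have "(\<Sum>u\<in>(\<lambda>i. Inl (?t i) :: (node set \<times> nat) + (node set \<times> nat)) ` {i. North i \<in> fst s}. case u of Inl s \<Rightarrow> snd s | Inr s \<Rightarrow> snd s) = (0::nat)"
      by (rule sum.neutral) auto
    finally show ?thesis using diagramsD(3)[OF y s] by (simp add: component_label_def)
  qed
  have "{C \<in> Cs ` y. ends C \<noteq> {}} = Cs ` y" using ne by blast
  then have "concatenation m ?w y = (\<lambda>s. (fst s, component_label m (Cs s))) ` y"
    unfolding concatenation_image comp by (simp add: image_image ends)
  also have "\<dots> = (\<lambda>s. s) ` y" by (rule image_cong[OF refl]) (simp add: lab)
  finally show "concatenation m ?w y = y" by simp
qed

subsection \<open>Decomposition into a dangle and a group diagram\<close>

lemma group_concatenation: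
  assumes "w \<in> group_diagrams m N" "w' \<in> group_diagrams m N"
  shows "concatenation m w w' \<in> group_diagrams m N"
proof -
  obtain \<pi> z where p: "\<pi> permutes {1..N}" "\<And>i. i \<in> {1..N} \<Longrightarrow> z i < m" "w = perm_diagram N \<pi> z"
    using group_diagrams_perm[OF assms(1)] by blast
  obtain \<pi>' z' where p': "\<pi>' permutes {1..N}" "\<And>i. i \<in> {1..N} \<Longrightarrow> z' i < m" "w' = perm_diagram N \<pi>' z'"
    using group_diagrams_perm[OF assms(2)] by blast
  have "(z i + z' (\<pi> i)) mod m < m" if "i \<in> {1..N}" for i using p(2)[OF that] by (cases "m = 0") auto
  then have "perm_diagram N (\<pi>' \<circ> \<pi>) (\<lambda>i. (z i + z' (\<pi> i)) mod m) \<in> group_diagrams m N"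
    by (intro perm_diagram_group permutes_compose[OF p(1) p'(1)])
  then show ?thesis unfolding p(3) p'(3) by (simp only: concatenation_perm_perm[OF p(1,2) p'(1)])
qed

text \<open>With \<open>n + N = 2 (N + l)\<close> nodes there are \<open>N + l\<close> strands. At
  most \<open>l\<close> of them are arcs, which leaves at least \<open>N\<close> through-strands,
  and \<open>N\<close> southern nodes admit no more.\<close>

lemma free_lines:
  assumes c: "c \<in> diagrams m n N" and n: "n = N + 2 * l" and l: "card (arcs c) \<le> l"
  shows "card (arcs c) = l" and "j \<in> {1..N} \<Longrightarrow> \<exists>i lab. ({North i, South j}, lab) \<in> c"
proof -
  have fc: "finite c" by (rule finite_diagram[OF c])
  have ac: "arcs c \<subseteq> c" by (auto simp: arcs_def)
  let ?F = "c - arcs c"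
  have strand: "\<exists>i j. fst s = {North i, South j}" if "s \<in> ?F" for s using that unfolding arcs_def by blast
  have "2 * card c = (\<Sum>s\<in>c. card (fst s))" using diagramsD(2)[OF c] by simp
  also have "\<dots> = card (\<Union>s\<in>c. fst s)"
  proof (rule card_UN_disjoint[symmetric])
    show "\<forall>i\<in>c. finite (fst i)" using diagramsD(1)[OF c] finite_nodes finite_subset by blast
    show "\<forall>i\<in>c. \<forall>j\<in>c. i \<noteq> j \<longrightarrow> fst i \<inter> fst j = {}" using diagramsD(5)[OF c] by blast
  qed (rule fc)
  also have "(\<Union>s\<in>c. fst s) = nodes n N" using diagramsD(1,4)[OF c] by blast
  also have "card (nodes n N) = n + N"
  proof -
    have "card (North ` {1..n} \<union> South ` {1..N}) = card (North ` {1..n}) + card (South ` {1..N})"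
      by (rule card_Un_disjoint) auto
    then show ?thesis by (simp add: nodes_def card_image inj_on_def)
  qed
  finally have cc: "card c = N + l" using n by simp
  have cF: "card ?F = card c - card (arcs c)" by (rule card_Diff_subset[OF finite_subset[OF ac fc] ac])
  define g where "g s = (SOME j. South j \<in> fst s)" for s :: "node set \<times> nat"
  have g: "South (g s) \<in> fst s" if sF: "s \<in> ?F" for s
  proof -
    obtain i j where "fst s = {North i, South j}" using strand[OF sF] by blast
    then show ?thesis unfolding g_def by (intro someI[of "\<lambda>j. South j \<in> fst s" j]) simp
  qed
  have inj: "inj_on g ?F"
  proof (rule inj_onI)
    fix s s' assume s: "s \<in> ?F" "s' \<in> ?F" "g s = g s'"
    then show "s = s'" using diagramsD(5)[OF c _ _ g[OF s(1)]] g[OF s(2)] by simp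
  qed
  have im: "g ` ?F \<subseteq> {1..N}"
  proof
    fix j assume "j \<in> g ` ?F"
    then obtain s where s: "s \<in> ?F" "j = g s" by blast
    then have "South j \<in> nodes n N" using g[OF s(1)] diagramsD(1)[OF c] by blast
    then show "j \<in> {1..N}" by simp
  qed
  have "card ?F \<le> N" using card_mono[OF _ im] card_image[OF inj] by simp
  moreover have "card ?F \<ge> N" using cF cc l by simp
  ultimately have F: "card ?F = N" by simp
  then show "card (arcs c) = l" using cF cc l by simp
  have "g ` ?F = {1..N}" by (rule card_subset_eq[OF _ im]) (simp_all add: card_image[OF inj] F)
  then show "\<exists>i lab. ({North i, South j}, lab) \<in> c" if j: "j \<in> {1..N}"
  proof -
    obtain s where s: "s \<in> ?F" "j = g s" using \<open>g ` ?F = {1..N}\<close> j by blast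
    obtain i j' where ij: "fst s = {North i, South j'}" using strand[OF s(1)] by blast
    have "j' = j" using g[OF s(1)] ij s(2) by simp
    then have "s = ({North i, South j}, snd s)" using ij by (simp add: prod_eq_iff)
    then show ?thesis using s(1) by (metis DiffD1)
  qed
qed

lemma non_arc_iff: "s \<in> c - arcs c \<longleftrightarrow> s \<in> c \<and> (\<exists>i j. fst s = {North i, South j})"
  unfolding arcs_def by blast

lemma dangleD:
  assumes v: "v \<in> dangles m n l" and n: "n = N + 2 * l"
  shows "v \<in> diagrams m n N" "card (arcs v) = l"
    and "s \<in> v \<Longrightarrow> fst s = {North i, South j} \<Longrightarrow> snd s = 0"
    and "s \<in> v \<Longrightarrow> s' \<in> v \<Longrightarrow> fst s = {North i, South j} \<Longrightarrow> fst s' = {North i', South j'} \<Longrightarrow> i < i' \<Longrightarrow> j < j'"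
proof -
  have N: "n - 2 * l = N" using n by simp
  show "v \<in> diagrams m n N" "card (arcs v) = l" using v unfolding dangles_def N by blast+
  show "s \<in> v \<Longrightarrow> fst s = {North i, South j} \<Longrightarrow> snd s = 0"
    using v non_arc_iff[of s v] unfolding dangles_def by blast
  show "s \<in> v \<Longrightarrow> s' \<in> v \<Longrightarrow> fst s = {North i, South j} \<Longrightarrow> fst s' = {North i', South j'} \<Longrightarrow> i < i' \<Longrightarrow> j < j'"
    using v unfolding dangles_def by blast
qed

lemma right_act_strand:
  assumes x: "x \<in> diagrams m a b" and \<pi>: "\<pi> permutes {1..b}"
    and s: "s \<in> right_act m \<pi> z x" "fst s = {North i, South j'}"
  shows "\<exists>j l. ({North i, South j}, l) \<in> x \<and> j' = \<pi> j \<and> snd s = (l + z j) mod m"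
proof -
  obtain r where r: "r \<in> x" "s = (rename \<pi> ` fst r, (snd r + (\<Sum>i\<in>{i. South i \<in> fst r}. z i)) mod m)"
    using s(1) unfolding right_act_def by blast
  let ?j = "inv_into UNIV \<pi> j'"
  have pj: "\<pi> ?j = j'" by (rule permutes_inverses(1)[OF \<pi>])
  have "rename \<pi> ` fst r = rename \<pi> ` {North i, South ?j}" using r(2) s(2) pj by simp
  then have fr: "fst r = {North i, South ?j}"
    unfolding inj_image_eq_iff[OF rename_inj[OF permutes_inj[OF \<pi>]]] .
  then have "{k. South k \<in> fst r} = {?j}" by auto
  then have l: "snd s = (snd r + z ?j) mod m" using r(2) by simp
  have "r = ({North i, South ?j}, snd r)" using fr by (simp add: prod_eq_iff)
  then have rx: "({North i, South ?j}, snd r) \<in> x" using r(1) by simp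
  then show ?thesis using pj l by metis
qed

text \<open>The free lines of \<open>c\<close> are uncrossed and stripped of their labels by a group
  diagram placed below; the result is a dangle, and the inverse group diagram restores
  \<open>c\<close>.\<close>

lemma decomposition_exists:
  assumes m: "m > 0" and c: "c \<in> diagrams m n N" and n: "n = N + 2 * l" and l: "card (arcs c) \<le> l"
  shows "\<exists>v\<in>dangles m n l. \<exists>w\<in>group_diagrams m N. concatenation m v w = c"
proof -
  have "\<forall>j\<in>{1..N}. \<exists>il. ({North (fst il), South j}, snd il) \<in> c"
    using free_lines(2)[OF c n l] by (metis fst_conv snd_conv)
  from bchoice[OF this] obtain f where f: "\<forall>j\<in>{1..N}. ({North (fst (f j)), South j}, snd (f j)) \<in> c" ..
  define \<kappa> where "\<kappa> j = fst (f j)" for j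
  define lab where "lab j = snd (f j)" for j
  have cs: "({North (\<kappa> j), South j}, lab j) \<in> c" if "j \<in> {1..N}" for j using f that by (simp add: \<kappa>_def lab_def)
  have inj: "inj_on \<kappa> {1..N}"
  proof (rule inj_onI)
    fix i j assume ij: "i \<in> {1..N}" "j \<in> {1..N}" "\<kappa> i = \<kappa> j"
    have "({North (\<kappa> i), South i}, lab i) = ({North (\<kappa> j), South j}, lab j)"
      by (rule diagramsD(5)[OF c cs[OF ij(1)] cs[OF ij(2)], of "North (\<kappa> i)"]) (simp_all add: ij(3))
    then show "i = j" by (auto simp: doubleton_eq_iff)
  qed
  \<comment> \<open>The rank of the northern end among all free lines: renumbering the southern
    nodes by it makes the lines non-crossing.\<close>
  define \<rho> where "\<rho> j = (if j \<in> {1..N} then card {j' \<in> {1..N}. \<kappa> j' \<le> \<kappa> j} else j)" for j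
  have mono: "\<rho> j < \<rho> j'" if j: "j \<in> {1..N}" "j' \<in> {1..N}" "\<kappa> j < \<kappa> j'" for j j'
  proof -
    have "j' \<in> {i \<in> {1..N}. \<kappa> i \<le> \<kappa> j'}" "j' \<notin> {i \<in> {1..N}. \<kappa> i \<le> \<kappa> j}" using j by auto
    moreover have "{i \<in> {1..N}. \<kappa> i \<le> \<kappa> j} \<subseteq> {i \<in> {1..N}. \<kappa> i \<le> \<kappa> j'}" using j(3) by auto
    ultimately have "{i \<in> {1..N}. \<kappa> i \<le> \<kappa> j} \<subset> {i \<in> {1..N}. \<kappa> i \<le> \<kappa> j'}" by blast
    then show ?thesis using j by (simp add: \<rho>_def psubset_card_mono)
  qed
  have \<rho>in: "\<rho> j \<in> {1..N}" if j: "j \<in> {1..N}" for j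
  proof -
    have "card {i \<in> {1..N}. \<kappa> i \<le> \<kappa> j} \<le> card {1..N}" by (rule card_mono) auto
    moreover have "card {i \<in> {1..N}. \<kappa> i \<le> \<kappa> j} > 0" using j by (auto simp: card_gt_0_iff)
    ultimately show ?thesis using j by (simp add: \<rho>_def)
  qed
  have "inj_on \<rho> {1..N}"
  proof (rule inj_onI)
    fix i j assume ij: "i \<in> {1..N}" "j \<in> {1..N}" "\<rho> i = \<rho> j"
    then have "\<kappa> i = \<kappa> j" using mono[of i j] mono[of j i] by (metis linorder_neqE_nat less_irrefl)
    then show "i = j" using inj ij by (auto dest: inj_onD)
  qed
  then have "bij_betw \<rho> {1..N} {1..N}"
    unfolding bij_betw_def using endo_inj_surj[of "{1..N}" \<rho>] \<rho>in by blast
  then have \<rho>: "\<rho> permutes {1..N}" by (rule bij_imp_permutes) (auto simp: \<rho>_def)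
  \<comment> \<open>The negative of the label modulo \<open>m\<close>, so that every free line
    becomes unlabelled.\<close>
  define z where "z j = (m - lab j) mod m" for j
  have labm: "lab j < m" if "j \<in> {1..N}" for j using diagramsD(3)[OF c cs[OF that]] by simp
  have zm: "z j < m" for j using m by (simp add: z_def)
  define w' where "w' = perm_diagram N \<rho> z"
  have w': "w' \<in> group_diagrams m N" unfolding w'_def by (rule perm_diagram_group[OF \<rho> zm])
  define v where "v = concatenation m c w'"
  have vr: "v = right_act m \<rho> z c" unfolding v_def w'_def by (rule concatenation_perm[OF c \<rho>])
  have vD: "v \<in> diagrams m n N" unfolding v_def by (rule concatenation_diagrams[OF c group_diagrams_subset[OF w'] m])
  have H: "\<exists>j\<in>{1..N}. i = \<kappa> j \<and> j' = \<rho> j \<and> snd s = 0" if s: "s \<in> v" "fst s = {North i, South j'}" for s i j'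
  proof -
    obtain j k where j: "j' = \<rho> j" "({North i, South j}, k) \<in> c" "snd s = (k + z j) mod m"
      using right_act_strand[OF c \<rho>, of s z i j'] s unfolding vr by blast
    have jN: "j \<in> {1..N}" using diagramsD(1)[OF c j(2)] by simp
    have e: "({North i, South j}, k) = ({North (\<kappa> j), South j}, lab j)"
      by (rule diagramsD(5)[OF c j(2) cs[OF jN], of "South j"]) simp_all
    then have "i = \<kappa> j" "k = lab j" by (auto simp: doubleton_eq_iff)
    moreover have "(lab j + z j) mod m = 0" using labm[OF jN] by (simp add: z_def mod_simps)
    ultimately show ?thesis using j jN by auto
  qed
  have vd: "v \<in> dangles m n l"
  proof -
    have N: "n - 2 * l = N" using n by simp
    have "card (arcs v) = l" unfolding v_def card_arcs_group[OF c w'] by (rule free_lines(1)[OF c n l])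
    moreover have "snd s = 0" if "s \<in> v - arcs v" for s
      using that H unfolding non_arc_iff by blast
    moreover have "j < j'" if "s \<in> v" "s' \<in> v" "fst s = {North i, South j}" "fst s' = {North i', South j'}" "i < i'" for s s' i j i' j'
      using H[OF that(1,3)] H[OF that(2,4)] mono that(5) by blast
    ultimately show ?thesis unfolding dangles_def N using vD by blast
  qed
  obtain w where w: "w \<in> group_diagrams m N" "concatenation m w' w = id_diagram N"
    using group_inverse[OF w'] by blast
  have "concatenation m v w = concatenation m c (concatenation m w' w)"
    unfolding v_def by (rule concatenation_group_assoc[OF c w' w(1)])
  also have "\<dots> = c" unfolding w(2) by (rule concatenation_id_right(1)[OF c])
  finally show ?thesis using vd w(1) by blast
qed

text \<open>An increasing self-map satisfies \<open>j \<le> \<pi> j\<close>, and a permutation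
  preserves the sum of all points, which forces equality everywhere.\<close>

lemma permutes_mono_id:
  assumes \<pi>: "\<pi> permutes {1..N::nat}" and mono: "\<And>j j'. j \<in> {1..N} \<Longrightarrow> j' \<in> {1..N} \<Longrightarrow> j < j' \<Longrightarrow> \<pi> j < \<pi> j'"
  shows "\<pi> = id"
proof -
  have ge: "j \<le> \<pi> j" if "j \<in> {1..N}" for j
    using that
  proof (induction j)
    case (Suc j)
    show ?case
    proof (cases "j = 0")
      case True
      then show ?thesis using permutes_in_image[OF \<pi>, of "Suc j"] Suc.prems by simp
    next
      case False
      then have "j \<le> \<pi> j" "\<pi> j < \<pi> (Suc j)" using Suc mono[of j "Suc j"] by auto
      then show ?thesis by simp
    qed
  qed simp
  have "\<pi> j = j" if j: "j \<in> {1..N}" for j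
  proof (rule ccontr)
    assume "\<pi> j \<noteq> j"
    then have "j < \<pi> j" using ge[OF j] by simp
    then have "(\<Sum>i\<in>{1..N}. i) < (\<Sum>i\<in>{1..N}. \<pi> i)"
      using ge j by (intro sum_strict_mono_ex1) auto
    moreover have "(\<Sum>i\<in>{1..N}. \<pi> i) = (\<Sum>i\<in>{1..N}. i)"
      using sum.permute[OF \<pi>, of "\<lambda>i. i"] by (simp add: o_def)
    ultimately show False by simp
  qed
  then show ?thesis using permutes_not_in[OF \<pi>] by (metis eq_id_iff)
qed

text \<open>The free lines of both dangles are unlabelled and non-crossing, which leaves no room for
  a label or an inversion in \<open>w\<close>.\<close>

lemma dangle_rigid:
  assumes n: "n = N + 2 * l" and v: "v \<in> dangles m n l" and v2: "v2 \<in> dangles m n l"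
    and w: "w \<in> group_diagrams m N" and e: "concatenation m v w = v2"
  shows "w = id_diagram N" "v = v2"
proof -
  note D = dangleD[OF v n] and D2 = dangleD[OF v2 n]
  obtain \<pi> z where p: "\<pi> permutes {1..N}" "\<And>i. i \<in> {1..N} \<Longrightarrow> z i < m" "w = perm_diagram N \<pi> z"
    "concatenation m v w = right_act m \<pi> z v"
    using concatenation_group_strands[OF D(1) w] by blast
  have l: "card (arcs v) \<le> l" using D(2) by simp
  have "\<forall>j\<in>{1..N}. \<exists>i. ({North i, South j}, 0) \<in> v"
  proof
    fix j assume "j \<in> {1..N}"
    then obtain i k where ik: "({North i, South j}, k) \<in> v" using free_lines(2)[OF D(1) n l] by blast
    then have "k = 0" using D(3)[OF ik, of i j] by simp
    then show "\<exists>i. ({North i, South j}, 0) \<in> v" using ik by blast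
  qed
  from bchoice[OF this] obtain \<kappa> where \<kappa>: "\<forall>j\<in>{1..N}. ({North (\<kappa> j), South j}, 0) \<in> v" ..
  \<comment> \<open>The free line of \<open>v\<close> ending at \<open>j\<close> continues through
    \<open>w\<close> to \<open>\<pi> j\<close> and picks up the label \<open>z j\<close>.\<close>
  have s2: "({North (\<kappa> j), South (\<pi> j)}, z j) \<in> v2" if j: "j \<in> {1..N}" for j
  proof -
    have "{i. South i \<in> {North (\<kappa> j), South j}} = {j}" by auto
    then have "({North (\<kappa> j), South (\<pi> j)}, z j) \<in> right_act m \<pi> z v"
      unfolding right_act_def using p(2)[OF j]
      by (intro image_eqI[OF _ bspec[OF \<kappa> j]]) simp
    then show ?thesis using p(4) e by simp
  qed
  have z: "z j = 0" if "j \<in> {1..N}" for j using D2(3)[OF s2[OF that]] by simp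
  have "\<pi> = id"
  proof (rule permutes_mono_id[OF p(1)])
    fix j j' assume j: "j \<in> {1..N}" "j' \<in> {1..N}" "j < j'"
    have "\<kappa> j \<noteq> \<kappa> j'"
    proof
      assume k: "\<kappa> j = \<kappa> j'"
      have "({North (\<kappa> j), South j}, 0) = ({North (\<kappa> j'), South j'}, 0::nat)"
        by (rule diagramsD(5)[OF D(1) bspec[OF \<kappa> j(1)] bspec[OF \<kappa> j(2)], of "North (\<kappa> j)"]) (simp_all add: k)
      then show False using j(3) by (auto simp: doubleton_eq_iff)
    qed
    moreover have "\<not> \<kappa> j' < \<kappa> j"
      using D(4)[OF bspec[OF \<kappa> j(2)] bspec[OF \<kappa> j(1)], of "\<kappa> j'" j' "\<kappa> j" j] j(3) by auto
    ultimately have "\<kappa> j < \<kappa> j'" by simp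
    then show "\<pi> j < \<pi> j'"
      using D2(4)[OF s2[OF j(1)] s2[OF j(2)], of "\<kappa> j" "\<pi> j" "\<kappa> j'" "\<pi> j'"] by simp
  qed
  then show wid: "w = id_diagram N"
    unfolding p(3) id_diagram_perm perm_diagram_def by (intro image_cong) (simp_all add: z)
  show "v = v2" using e concatenation_id_right(1)[OF D(1)] unfolding wid by simp
qed

text \<open>Dividing by \<open>w2\<close> reduces the claim to rigidity, where one dangle arises
  from another by a group diagram.\<close>

lemma decomposition_unique:
  assumes n: "n = N + 2 * l" and v: "v \<in> dangles m n l" and v2: "v2 \<in> dangles m n l"
    and w: "w \<in> group_diagrams m N" and w2: "w2 \<in> group_diagrams m N"
    and e: "concatenation m v w = concatenation m v2 w2"
  shows "v = v2" "w = w2"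
proof -
  note D = dangleD(1)[OF v n] and D2 = dangleD(1)[OF v2 n] and W = group_diagrams_subset
  obtain w' where w': "w' \<in> group_diagrams m N" "concatenation m w2 w' = id_diagram N" "concatenation m w' w2 = id_diagram N"
    using group_inverse[OF w2] by blast
  let ?u = "concatenation m w w'"
  have u: "?u \<in> group_diagrams m N" by (rule group_concatenation[OF w w'(1)])
  have "concatenation m v ?u = concatenation m (concatenation m v2 w2) w'"
    using concatenation_group_assoc[OF D w w'(1)] e by simp
  also have "\<dots> = v2"
    unfolding concatenation_group_assoc[OF D2 w2 w'(1)] w'(2) by (rule concatenation_id_right(1)[OF D2])
  finally have 1: "concatenation m v ?u = v2" .
  show "v = v2" by (rule dangle_rigid(2)[OF n v v2 u 1])
  have "?u = id_diagram N" by (rule dangle_rigid(1)[OF n v v2 u 1])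
  then have "concatenation m ?u w2 = w2" using concatenation_id_left(1)[OF W[OF w2]] by simp
  moreover have "concatenation m ?u w2 = w"
    unfolding concatenation_group_assoc[OF W[OF w] w'(1) w2] w'(3) by (rule concatenation_id_right(1)[OF W[OF w]])
  ultimately show "w = w2" by simp
qed

section \<open>The Coxeter presentation of the symmetric group\<close>

text \<open>The product \<open>f (j + d - 1) \<circ> ... \<circ> f j\<close>; for adjacent
  transpositions it is the cycle that takes \<open>j\<close> to \<open>j + d\<close>.\<close>

primrec descend :: "(nat \<Rightarrow> 'u \<Rightarrow> 'u) \<Rightarrow> nat \<Rightarrow> nat \<Rightarrow> 'u \<Rightarrow> 'u" where
  "descend f j 0 = id"
| "descend f j (Suc d) = f (j + d) \<circ> descend f j d"

declare descend.simps [simp del]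

lemma descend_simps [simp]: "descend f j 0 = id" "descend f j (Suc d) = f (j + d) \<circ> descend f j d"
  by (simp_all add: descend.simps fun_eq_iff)

text \<open>Normal forms: products of the coset representatives \<open>f k \<circ> \<dots> \<circ> f j\<close> of the subgroup fixing \<open>k + 1\<close>.\<close>

primrec normal_forms :: "(nat \<Rightarrow> 'u \<Rightarrow> 'u) \<Rightarrow> nat \<Rightarrow> ('u \<Rightarrow> 'u) set" where
  "normal_forms f 0 = {id}"
| "normal_forms f (Suc k) = {q \<circ> descend f j d | q j d. q \<in> normal_forms f k \<and> 1 \<le> j \<and> j + d = Suc k}"

lemma descend_Suc_right: "descend f j (Suc d) = descend f (Suc j) d \<circ> f j"
proof (induction d)
  case (Suc d)
  have "descend f j (Suc (Suc d)) = f (j + Suc d) \<circ> descend f j (Suc d)" by (rule descend_simps(2))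
  also have "\<dots> = f (j + Suc d) \<circ> (descend f (Suc j) d \<circ> f j)" by (simp only: Suc)
  also have "\<dots> = descend f (Suc j) (Suc d) \<circ> f j" by (simp add: o_assoc)
  finally show ?case .
qed simp

definition coxeter_relations :: "(nat \<Rightarrow> 'u \<Rightarrow> 'u) \<Rightarrow> nat \<Rightarrow> bool" where
  "coxeter_relations f K \<longleftrightarrow> (\<forall>i\<in>{1..<K}. f i \<circ> f i = id) \<and>
     (\<forall>i\<in>{1..<K}. \<forall>j\<in>{1..<K}. Suc i < j \<longrightarrow> f i \<circ> f j = f j \<circ> f i) \<and>
     (\<forall>i\<in>{1..<K}. Suc i < K \<longrightarrow> f i \<circ> f (Suc i) \<circ> f i = f (Suc i) \<circ> f i \<circ> f (Suc i))"

lemma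
  assumes "coxeter_relations f K"
  shows coxeter_square: "i \<in> {1..<K} \<Longrightarrow> f i \<circ> f i = id"
    and coxeter_commute: "i \<in> {1..<K} \<Longrightarrow> j \<in> {1..<K} \<Longrightarrow> Suc i < j \<or> Suc j < i \<Longrightarrow> f i \<circ> f j = f j \<circ> f i"
    and coxeter_braid: "i \<in> {1..<K} \<Longrightarrow> Suc i < K \<Longrightarrow> f i \<circ> f (Suc i) \<circ> f i = f (Suc i) \<circ> f i \<circ> f (Suc i)"
  using assms unfolding coxeter_relations_def by (blast, metis, blast)

lemma descend_commute:
  assumes f: "coxeter_relations f K" and i: "i \<in> {1..<K}"
    and j: "1 \<le> j" "j + d \<le> K" and far: "Suc i < j \<or> j + d \<le> i - 1"
  shows "descend f j d \<circ> f i = f i \<circ> descend f j d"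
  using j(2) far
proof (induction d)
  case (Suc d)
  have IH: "descend f j d \<circ> f i = f i \<circ> descend f j d" by (rule Suc.IH) (use Suc.prems in auto)
  have c: "f (j + d) \<circ> f i = f i \<circ> f (j + d)"
    by (rule coxeter_commute[OF f]) (use Suc.prems i j(1) in auto)
  have "descend f j (Suc d) \<circ> f i = f (j + d) \<circ> (f i \<circ> descend f j d)" using IH by (simp add: o_assoc[symmetric])
  also have "\<dots> = (f i \<circ> f (j + d)) \<circ> descend f j d" using c by (simp add: o_assoc)
  finally show ?case by (simp only: descend_simps o_assoc)
qed simp

text \<open>One braid relation carries a generator from the interior of the range through the
  product and lowers its index by one; the remaining factors commute with it.\<close>

lemma descend_inner:
  assumes f: "coxeter_relations f K" and i: "j < i" "i < j + d" and j: "1 \<le> j" "j + d \<le> K"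
  shows "descend f j d \<circ> f i = f (i - 1) \<circ> descend f j d"
  using i(2) j(2)
proof (induction d)
  case (Suc d)
  show ?case
  proof (cases "i < j + d")
    case True
    then have IH: "descend f j d \<circ> f i = f (i - 1) \<circ> descend f j d"
      by (intro Suc.IH) (use Suc.prems in auto)
    have c: "f (j + d) \<circ> f (i - 1) = f (i - 1) \<circ> f (j + d)"
      by (rule coxeter_commute[OF f]) (use Suc.prems i(1) j(1) True in auto)
    have "descend f j (Suc d) \<circ> f i = f (j + d) \<circ> (f (i - 1) \<circ> descend f j d)" using IH by (simp add: o_assoc[symmetric])
    also have "\<dots> = (f (i - 1) \<circ> f (j + d)) \<circ> descend f j d" using c by (simp add: o_assoc)
    finally show ?thesis by (simp only: descend_simps o_assoc)
  next
    case False
    then have ie: "i = j + d" using Suc.prems by simp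
    then obtain e where d: "d = Suc e" using i(1) by (cases d) auto
    have i1: "i = Suc (j + e)" using ie d by simp
    have c: "descend f j e \<circ> f i = f i \<circ> descend f j e"
      by (rule descend_commute[OF f]) (use Suc.prems i(1) i1 j(1) in auto)
    have b: "f (j + e) \<circ> f i \<circ> f (j + e) = f i \<circ> f (j + e) \<circ> f i"
      unfolding i1 by (rule coxeter_braid[OF f]) (use Suc.prems i1 j(1) in auto)
    have D: "descend f j (Suc d) = f i \<circ> (f (j + e) \<circ> descend f j e)" using d i1 by simp
    have "descend f j (Suc d) \<circ> f i = f i \<circ> (f (j + e) \<circ> (descend f j e \<circ> f i))" unfolding D by (simp add: o_assoc)
    also have "\<dots> = (f i \<circ> f (j + e) \<circ> f i) \<circ> descend f j e" unfolding c by (simp add: o_assoc)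
    also have "\<dots> = f (j + e) \<circ> descend f j (Suc d)" unfolding b[symmetric] D by (simp add: o_assoc)
    finally show ?thesis by (simp add: i1 fun_eq_iff)
  qed
qed (use i in simp)

text \<open>According to the position of \<open>i\<close> relative to \<open>j\<close>, the
  generator \<open>f i\<close> on the right commutes past the last factor, lengthens it, shortens
  it, or passes through it as \<open>f (i - 1)\<close>; what emerges on the left is absorbed by the
  induction hypothesis.\<close>

lemma normal_forms_closed:
  assumes f: "coxeter_relations f K"
  shows "k \<le> K \<Longrightarrow> x \<in> normal_forms f k \<Longrightarrow> i \<in> {1..<k} \<Longrightarrow> x \<circ> f i \<in> normal_forms f k"
proof (induction k arbitrary: x i)
  case (Suc k)
  obtain q j d where x: "x = q \<circ> descend f j d" "q \<in> normal_forms f k" "1 \<le> j" "j + d = Suc k"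
    using Suc.prems(2) by auto
  have NI: "q' \<circ> descend f j' d' \<in> normal_forms f (Suc k)"
    if "q' \<in> normal_forms f k" "1 \<le> j'" "j' + d' = Suc k" for q' j' d' using that by auto
  have jK: "j + d \<le> K" and iK: "i \<in> {1..<K}" using x(4) Suc.prems by auto
  consider "Suc i < j" | "Suc i = j" | "i = j" | "j < i" by linarith
  then show ?case
  proof cases
    case 1
    then have "x \<circ> f i = (q \<circ> f i) \<circ> descend f j d"
      using descend_commute[OF f iK x(3) jK] by (simp add: x(1) o_assoc[symmetric])
    moreover have "q \<circ> f i \<in> normal_forms f k" by (rule Suc.IH[OF _ x(2)]) (use Suc.prems 1 x(4) in auto)
    ultimately show ?thesis using NI x(3,4) by metis
  next
    case 2
    then have "x \<circ> f i = q \<circ> descend f i (Suc d)" unfolding descend_Suc_right x(1) by (simp add: o_assoc)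
    moreover have "i + Suc d = Suc k" using x(4) 2 by simp
    ultimately show ?thesis using NI x(2) Suc.prems(3) by (metis atLeastLessThan_iff)
  next
    case 3
    then obtain e where d: "d = Suc e" using x(4) Suc.prems(3) by (cases d) auto
    have "x \<circ> f i = q \<circ> descend f (Suc j) e \<circ> (f j \<circ> f j)"
      unfolding x(1) d descend_Suc_right using 3 by (simp add: o_assoc)
    also have "\<dots> = q \<circ> descend f (Suc j) e" using coxeter_square[OF f, of j] iK 3 by simp
    finally have e: "x \<circ> f i = q \<circ> descend f (Suc j) e" .
    show ?thesis unfolding e by (rule NI[OF x(2)]) (use x(4) d in auto)
  next
    case 4
    have "x \<circ> f i = (q \<circ> f (i - 1)) \<circ> descend f j d"
      using descend_inner[OF f 4 _ x(3) jK] Suc.prems(3) x(4) by (simp add: x(1) o_assoc[symmetric])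
    moreover have "q \<circ> f (i - 1) \<in> normal_forms f k"
      by (rule Suc.IH[OF _ x(2)]) (use x(3) Suc.prems 4 in auto)
    ultimately show ?thesis using NI x(3,4) by metis
  qed
qed simp

section \<open>Adjacent transpositions and the homomorphism defined by generators\<close>

abbreviation adjacent :: "nat \<Rightarrow> nat \<Rightarrow> nat" where
  "adjacent i \<equiv> Transposition.transpose i (Suc i)"

lemma coxeter_adjacent: "coxeter_relations adjacent K"
  unfolding coxeter_relations_def by (auto simp: fun_eq_iff Transposition.transpose_def)

lemma adjacent_permutes: "i \<in> {1..<K} \<Longrightarrow> adjacent i permutes {1..K}"
  by (rule permutes_swap_id) auto

lemma descend_adjacent:
  assumes "1 \<le> j" "j + d = Suc k"
  shows "descend adjacent j d permutes {1..Suc k}" "descend adjacent j d j = Suc k"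
proof -
  have "descend adjacent j d permutes {1..j + d} \<and> descend adjacent j d j = j + d"
  proof (induction d)
    case 0
    show ?case by (auto simp: permutes_def)
  next
    case (Suc d)
    have "adjacent (j + d) permutes {1..j + Suc d}" by (rule adjacent_permutes) (use assms in auto)
    moreover have "descend adjacent j d permutes {1..j + Suc d}"
      by (rule permutes_subset[OF conjunct1[OF Suc]]) auto
    ultimately have "descend adjacent j (Suc d) permutes {1..j + Suc d}" using permutes_compose by (metis descend_simps(2))
    then show ?case using Suc by (simp add: o_def)
  qed
  then show "descend adjacent j d permutes {1..Suc k}" "descend adjacent j d j = Suc k" using assms by simp_all
qed

text \<open>\<open>j\<close> is the preimage of \<open>k + 1\<close>; dividing by the cycle that
  takes \<open>j\<close> there leaves a permutation of the first \<open>k\<close> points.\<close>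

lemma permutes_Suc_decompose:
  assumes "\<pi> permutes {1..Suc k}"
  shows "\<exists>q j d. q permutes {1..k} \<and> 1 \<le> j \<and> j + d = Suc k \<and> \<pi> = q \<circ> descend adjacent j d"
proof -
  obtain j where j: "j \<in> {1..Suc k}" "\<pi> j = Suc k" using permutes_image[OF assms] by (metis atLeastAtMost_iff imageE le_add1 order_refl plus_1_eq_Suc)
  define d where "d = Suc k - j"
  let ?c = "descend adjacent j d"
  have jd: "1 \<le> j" "j + d = Suc k" using j by (auto simp: d_def)
  note c = descend_adjacent[OF jd]
  have ic: "inv_into UNIV ?c permutes {1..Suc k}" by (rule permutes_inv[OF c(1)])
  define q where "q = \<pi> \<circ> inv_into UNIV ?c"
  have "q permutes {1..Suc k}" unfolding q_def by (rule permutes_compose[OF ic assms])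
  moreover have "q (Suc k) = Suc k"
    using c(2) permutes_inverses(2)[OF c(1), of j] j(2) by (simp add: q_def)
  ultimately have "q permutes {1..k}"
    by (elim permutes_superset) (auto simp: le_Suc_eq)
  moreover have "\<pi> = q \<circ> ?c" unfolding q_def using permutes_inverses(2)[OF c(1)] by (simp add: fun_eq_iff)
  ultimately show ?thesis using jd by blast
qed

lemma permutes_adjacent_induct [consumes 1, case_names id step]:
  assumes "\<pi> permutes {1..N}" and id: "P id"
    and step: "\<And>\<sigma> i. \<sigma> permutes {1..N} \<Longrightarrow> P \<sigma> \<Longrightarrow> i \<in> {1..<N} \<Longrightarrow> P (\<sigma> \<circ> adjacent i)"
  shows "P \<pi>"
proof -
  have "\<pi> permutes {1..k} \<Longrightarrow> P \<pi>" if "k \<le> N" for k \<pi>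
    using that
  proof (induction k arbitrary: \<pi>)
    case 0
    then show ?case using id by (simp add: id_def)
  next
    case (Suc k)
    obtain q j d where q: "q permutes {1..k}" "1 \<le> j" "j + d = Suc k" "\<pi> = q \<circ> descend adjacent j d"
      using permutes_Suc_decompose[OF Suc.prems(1)] by blast
    have "q permutes {1..N} \<and> P q" using Suc q(1) permutes_subset[OF q(1), of "{1..N}"] by auto
    then have "q \<circ> descend adjacent j d permutes {1..N} \<and> P (q \<circ> descend adjacent j d)"
      using q(2,3)
    proof (induction d arbitrary: j)
      case (Suc d)
      have IH: "q \<circ> descend adjacent (Suc j) d permutes {1..N} \<and> P (q \<circ> descend adjacent (Suc j) d)"
        by (rule Suc.IH) (use Suc.prems in auto)
      have j: "j \<in> {1..<N}" using Suc.prems(2,3) \<open>Suc k \<le> N\<close> by auto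
      have e: "q \<circ> descend adjacent j (Suc d) = (q \<circ> descend adjacent (Suc j) d) \<circ> adjacent j"
        unfolding descend_Suc_right by (simp add: o_assoc)
      show ?case unfolding e using IH step j permutes_compose[OF adjacent_permutes[OF j]] by blast
    qed simp
    then show ?case unfolding q(4) by (rule conjunct2)
  qed
  then show ?thesis using assms(1) by blast
qed

lemma map_prod_eq_iff: "map_prod p P = map_prod p' P' \<longleftrightarrow> p = p' \<and> P = P'"
  by (auto simp: fun_eq_iff split_paired_All)

lemma descend_map_prod: "descend (\<lambda>i. map_prod (f i) (g i)) j d = map_prod (descend f j d) (descend g j d)"
proof (induction d)
  case (Suc d)
  then show ?case by (simp only: descend_simps map_prod_compose)
qed (simp add: prod.map_id0 id_def)

lemma normal_forms_map_prod:
  "x \<in> normal_forms (\<lambda>i. map_prod (adjacent i) (g i)) k \<Longrightarrow> \<exists>p P. x = map_prod p P \<and> p permutes {1..k}"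
proof (induction k arbitrary: x)
  case 0
  then have "x = map_prod id id" by (simp add: prod.map_id0 id_def)
  then show ?case using permutes_id by blast
next
  case (Suc k)
  obtain q j d where q: "x = q \<circ> descend (\<lambda>i. map_prod (adjacent i) (g i)) j d"
    "q \<in> normal_forms (\<lambda>i. map_prod (adjacent i) (g i)) k" "1 \<le> j" "j + d = Suc k" using Suc.prems by auto
  obtain p P where p: "q = map_prod p P" "p permutes {1..k}" using Suc.IH[OF q(2)] by blast
  have "x = map_prod (p \<circ> descend adjacent j d) (P \<circ> descend g j d)"
    unfolding q(1) p(1) descend_map_prod by (simp add: map_prod_compose[symmetric])
  moreover have "p \<circ> descend adjacent j d permutes {1..Suc k}"
    using permutes_compose[OF descend_adjacent(1)[OF q(3,4)] permutes_subset[OF p(2)]] by auto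
  ultimately show ?case by blast
qed

text \<open>The first component of a normal form determines \<open>j\<close> as the preimage of
  \<open>k + 1\<close>, then the shorter factor, and so by induction the second component: normal
  forms are the graph of a function.\<close>

lemma normal_forms_single_valued:
  "map_prod p P \<in> normal_forms (\<lambda>i. map_prod (adjacent i) (g i)) k
    \<Longrightarrow> map_prod p P' \<in> normal_forms (\<lambda>i. map_prod (adjacent i) (g i)) k \<Longrightarrow> P = P'"
proof (induction k arbitrary: p P P')
  case 0
  then show ?case by (simp add: prod.map_id0[symmetric] map_prod_eq_iff)
next
  case (Suc k)
  let ?h = "\<lambda>i. map_prod (adjacent i) (g i)"
  have *: "\<exists>q Q j d. map_prod q Q \<in> normal_forms ?h k \<and> q permutes {1..k} \<and> 1 \<le> j \<and> j + d = Suc k \<and>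
      p = q \<circ> descend adjacent j d \<and> R = Q \<circ> descend g j d" if R: "map_prod p R \<in> normal_forms ?h (Suc k)" for R
  proof -
    obtain x j d where x: "map_prod p R = x \<circ> descend ?h j d" "x \<in> normal_forms ?h k" "1 \<le> j" "j + d = Suc k"
      using R by auto
    obtain q Q where q: "x = map_prod q Q" "q permutes {1..k}" using normal_forms_map_prod[OF x(2)] by blast
    have "map_prod p R = map_prod (q \<circ> descend adjacent j d) (Q \<circ> descend g j d)"
      unfolding x(1) q(1) descend_map_prod by (simp add: map_prod_compose[symmetric])
    then show ?thesis using x q unfolding map_prod_eq_iff by blast
  qed
  obtain q Q j d where q: "map_prod q Q \<in> normal_forms ?h k" "q permutes {1..k}" "1 \<le> j" "j + d = Suc k"
      "p = q \<circ> descend adjacent j d" "P = Q \<circ> descend g j d" using *[OF Suc.prems(1)] by blast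
  obtain q' Q' j' d' where q': "map_prod q' Q' \<in> normal_forms ?h k" "q' permutes {1..k}" "1 \<le> j'" "j' + d' = Suc k"
      "p = q' \<circ> descend adjacent j' d'" "P' = Q' \<circ> descend g j' d'" using *[OF Suc.prems(2)] by blast
  have pj: "p j = Suc k" using q(5) descend_adjacent(2)[OF q(3,4)] permutes_not_in[OF q(2), of "Suc k"] by simp
  have pj': "p j' = Suc k" using q'(5) descend_adjacent(2)[OF q'(3,4)] permutes_not_in[OF q'(2), of "Suc k"] by simp
  have "inj p"
    unfolding q(5) using permutes_inj[OF q(2)] permutes_inj[OF descend_adjacent(1)[OF q(3,4)]] by (rule inj_compose)
  then have j: "j = j'" using pj pj' by (metis injD)
  then have d: "d = d'" using q(4) q'(4) by simp
  have "q = q'"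
  proof -
    have "surj (descend adjacent j d)" by (rule permutes_surj[OF descend_adjacent(1)[OF q(3,4)]])
    moreover have "q \<circ> descend adjacent j d = q' \<circ> descend adjacent j d" using q(5) q'(5) j d by simp
    ultimately show ?thesis by (metis (no_types, lifting) comp_assoc comp_id surj_iff)
  qed
  then show ?case using Suc.IH[of q Q Q'] q q' j d by simp
qed

text \<open>Each \<open>adjacent i\<close> is paired with \<open>g i\<close>. Normal forms in the
  pairs are closed under multiplication by pairs, reach every permutation in the first component and
  are single-valued, so reading off the second component is a homomorphism.\<close>

theorem coxeter_presentation:
  fixes g :: "nat \<Rightarrow> 'u \<Rightarrow> 'u"
  assumes g: "coxeter_relations g N"
  obtains \<Phi> where "\<Phi> id = id" "\<And>i. i \<in> {1..<N} \<Longrightarrow> \<Phi> (adjacent i) = g i"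
    and "\<And>\<pi> \<sigma>. \<pi> permutes {1..N} \<Longrightarrow> \<sigma> permutes {1..N} \<Longrightarrow> \<Phi> (\<pi> \<circ> \<sigma>) = \<Phi> \<pi> \<circ> \<Phi> \<sigma>"
proof -
  define h where "h i = map_prod (adjacent i) (g i)" for i
  have h: "coxeter_relations h N"
  proof -
    have a: "id = map_prod id id" by (rule prod.map_id0[symmetric])
    show ?thesis
      using g coxeter_adjacent[of N] unfolding coxeter_relations_def h_def map_prod_compose[symmetric] a map_prod_eq_iff
      by blast
  qed
  define \<Phi> where "\<Phi> \<pi> = (THE P. map_prod \<pi> P \<in> normal_forms h N)" for \<pi>
  have eqI: "\<Phi> \<pi> = P" if "map_prod \<pi> P \<in> normal_forms h N" for \<pi> P
    unfolding \<Phi>_def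
  proof (rule the_equality[of "\<lambda>P. map_prod \<pi> P \<in> normal_forms h N"])
    show "map_prod \<pi> P \<in> normal_forms h N" by (rule that)
    fix P' assume "map_prod \<pi> P' \<in> normal_forms h N"
    then show "P' = P" using that normal_forms_single_valued[of \<pi> P' g N P] by (simp add: h_def[abs_def])
  qed
  have id_in: "id \<in> normal_forms f k" for f :: "nat \<Rightarrow> 'w \<Rightarrow> 'w" and k
  proof (induction k)
    case 0
    show ?case unfolding normal_forms.simps by (rule insertI1)
  next
    case (Suc k)
    have e: "id = id \<circ> descend f (Suc k) 0" by (rule ext) simp
    show ?case unfolding normal_forms.simps
      by (rule CollectI, rule exI[of _ id], rule exI[of _ "Suc k"], rule exI[of _ 0], rule conjI[OF e], rule conjI[OF Suc]) simp
  qed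
  have m_id: "map_prod id id \<in> normal_forms h N" using id_in[of h N] by (simp add: prod.map_id0)
  have stepc: "map_prod (\<pi> \<circ> adjacent i) (P \<circ> g i) \<in> normal_forms h N"
    if "map_prod \<pi> P \<in> normal_forms h N" "i \<in> {1..<N}" for \<pi> P i
    using normal_forms_closed[OF h le_refl that] by (simp add: h_def map_prod_compose[symmetric])
  have mem: "map_prod \<pi> (\<Phi> \<pi>) \<in> normal_forms h N" if "\<pi> permutes {1..N}" for \<pi>
    using that
  proof (induction rule: permutes_adjacent_induct)
    case id
    show ?case using m_id eqI[OF m_id] by metis
  next
    case (step \<sigma> i)
    then have "map_prod (\<sigma> \<circ> adjacent i) (\<Phi> \<sigma> \<circ> g i) \<in> normal_forms h N" using stepc by blast
    then show ?case using eqI by metis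
  qed
  have \<Phi>step: "\<Phi> (\<pi> \<circ> adjacent i) = \<Phi> \<pi> \<circ> g i" if "\<pi> permutes {1..N}" "i \<in> {1..<N}" for \<pi> i
    by (rule eqI[OF stepc[OF mem[OF that(1)] that(2)]])
  have \<Phi>id: "\<Phi> id = id" by (rule eqI[OF m_id])
  show thesis
  proof (rule that[of \<Phi>])
    show "\<Phi> id = id" by (rule \<Phi>id)
    show "\<Phi> (adjacent i) = g i" if "i \<in> {1..<N}" for i
      using \<Phi>step[OF permutes_id that] \<Phi>id by (metis id_comp)
    show "\<Phi> (\<pi> \<circ> \<sigma>) = \<Phi> \<pi> \<circ> \<Phi> \<sigma>" if \<pi>: "\<pi> permutes {1..N}" and "\<sigma> permutes {1..N}" for \<pi> \<sigma>
      using that(2)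
    proof (induction rule: permutes_adjacent_induct)
      case id
      show ?case using \<Phi>id by (metis comp_id)
    next
      case (step \<sigma> i)
      have "\<Phi> (\<pi> \<circ> (\<sigma> \<circ> adjacent i)) = \<Phi> (\<pi> \<circ> \<sigma>) \<circ> g i"
        using \<Phi>step[OF permutes_compose[OF step(1) \<pi>] step(2)] by (metis o_assoc)
      also have "\<dots> = \<Phi> \<pi> \<circ> \<Phi> (\<sigma> \<circ> adjacent i)" unfolding step(3) \<Phi>step[OF step(1,2)] by (metis o_assoc)
      finally show ?case .
    qed
  qed
qed

section \<open>Standard tableaux\<close>

definition is_cell :: "tableau \<Rightarrow> nat \<times> nat \<times> nat \<Rightarrow> bool" where
  "is_cell T = (\<lambda>(c, i, j). c < length T \<and> i < length (T ! c) \<and> j < length (T ! c ! i))"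

definition entry :: "tableau \<Rightarrow> nat \<times> nat \<times> nat \<Rightarrow> nat" where
  "entry T = (\<lambda>(c, i, j). T ! c ! i ! j)"

lemma position_alt: "position T x = (THE p. is_cell T p \<and> entry T p = x)"
  unfolding position_def is_cell_def entry_def by (rule arg_cong[of _ _ The]) (auto simp: fun_eq_iff)

section \<open>Exchanging consecutive entries of a filling\<close>

lemma swap_fun: "id(i := Suc i, Suc i := i) = adjacent i"
  by (auto simp: fun_eq_iff Transposition.transpose_def)

lemma swap_entries_alt: "swap_entries i T = map (map (map (adjacent i))) T"
  unfolding swap_entries_def swap_fun ..

lemma swap_shape: "map (map length) (swap_entries i T) = map (map length) T"
  by (simp add: swap_entries_alt o_def)

lemma is_cell_swap: "is_cell (swap_entries i T) p \<longleftrightarrow> is_cell T p"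
  by (cases p) (auto simp: is_cell_def swap_entries_alt)

lemma entry_swap: "is_cell T p \<Longrightarrow> entry (swap_entries i T) p = adjacent i (entry T p)"
  by (cases p) (auto simp: is_cell_def entry_def swap_entries_alt)

text \<open>Unconditional, even for fillings with repeated entries: both sides are definite
  descriptions with equivalent defining conditions.\<close>

lemma position_swap: "position (swap_entries i T) x = position T (adjacent i x)"
proof -
  have "is_cell (swap_entries i T) p \<and> entry (swap_entries i T) p = x \<longleftrightarrow> is_cell T p \<and> entry T p = adjacent i x" for p
    unfolding is_cell_swap using entry_swap[of T p i] by (metis transpose_involutory)
  then show ?thesis unfolding position_alt by simp
qed

lemma swap_entries_invol: "swap_entries i (swap_entries i T) = T"
  by (simp add: swap_entries_alt o_def)

lemma swap_entries_commute:
  "Suc i < j \<Longrightarrow> swap_entries i (swap_entries j T) = swap_entries j (swap_entries i T)"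
proof -
  assume "Suc i < j"
  then have "adjacent i (adjacent j x) = adjacent j (adjacent i x)" for x
    by (auto simp: Transposition.transpose_def)
  then show ?thesis by (simp add: swap_entries_alt o_def)
qed

lemma swap_entries_braid:
  "swap_entries i (swap_entries (Suc i) (swap_entries i T))
    = swap_entries (Suc i) (swap_entries i (swap_entries (Suc i) T))"
proof -
  have "adjacent i (adjacent (Suc i) (adjacent i x)) = adjacent (Suc i) (adjacent i (adjacent (Suc i) x))" for x
    by (auto simp: Transposition.transpose_def)
  then show ?thesis by (simp add: swap_entries_alt o_def)
qed

lemma distinct_concat_nth:
  "distinct (concat xs) \<Longrightarrow> i < length xs \<Longrightarrow> j < length xs \<Longrightarrow> a \<in> set (xs ! i) \<Longrightarrow> a \<in> set (xs ! j) \<Longrightarrow> i = j"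
proof (induction xs arbitrary: i j)
  case (Cons x xs)
  have x: "a \<in> set x \<Longrightarrow> a \<in> set (xs ! k) \<Longrightarrow> k < length xs \<Longrightarrow> False" for k
    using Cons.prems(1) by (auto dest: nth_mem)
  show ?case
  proof (cases i; cases j)
    fix i' j' assume "i = Suc i'" "j = Suc j'"
    then show ?thesis using Cons by simp
  qed (use Cons.prems x in auto)
qed simp

lemma cell_unique:
  assumes d: "distinct (concat (concat T))" and p: "is_cell T p" "is_cell T q" "entry T p = entry T q"
  shows "p = q"
proof -
  obtain c i j c' i' j' where pq: "p = (c, i, j)" "q = (c', i', j')" by (cases p; cases q) auto
  have cc: "concat (concat T) = concat (map concat T)" by (induction T) auto
  have V: "c < length T" "i < length (T ! c)" "j < length (T ! c ! i)"
    "c' < length T" "i' < length (T ! c')" "j' < length (T ! c' ! i')" "T ! c ! i ! j = T ! c' ! i' ! j'"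
    using p by (auto simp: pq is_cell_def entry_def)
  have m1: "T ! c ! i ! j \<in> set (T ! c ! i)" "T ! c ! i ! j \<in> set (T ! c' ! i')"
    by (rule nth_mem[OF V(3)]) (unfold V(7), rule nth_mem[OF V(6)])
  have m2: "T ! c ! i ! j \<in> set (concat (T ! c))" "T ! c ! i ! j \<in> set (concat (T ! c'))"
    unfolding set_concat by (rule UN_I, rule nth_mem[OF V(2)], rule m1(1), rule UN_I, rule nth_mem[OF V(5)], rule m1(2))
  have c: "c = c'"
    using distinct_concat_nth[of "map concat T" c c' "T ! c ! i ! j"] d V m2 by (simp add: cc)
  have dc: "distinct (concat (T ! c))"
  proof -
    have "concat (T ! c) \<in> set (map concat T)" using V(1) by simp
    moreover have "\<forall>ys\<in>set (map concat T). distinct ys" using d unfolding cc distinct_concat_iff by blast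
    ultimately show ?thesis by blast
  qed
  have i: "i = i'" using distinct_concat_nth[OF dc, of i i' "T ! c ! i ! j"] V m1 c by simp
  have "distinct (T ! c ! i)" using dc V(2) unfolding distinct_concat_iff by simp
  then have "j = j'" using V c i by (simp add: nth_eq_iff_index_eq)
  then show ?thesis using c i pq by simp
qed

lemma cell_exists:
  assumes "x \<in> set (concat (concat T))"
  shows "\<exists>p. is_cell T p \<and> entry T p = x"
proof -
  obtain R where R: "R \<in> set (concat T)" "x \<in> set R" using assms by auto
  obtain C where C: "C \<in> set T" "R \<in> set C" using R by auto
  obtain c where c: "c < length T" "T ! c = C" using C(1) by (auto simp: in_set_conv_nth)
  obtain i where i: "i < length C" "C ! i = R" using C(2) by (auto simp: in_set_conv_nth)
  obtain j where j: "j < length R" "R ! j = x" using R(2) by (auto simp: in_set_conv_nth)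
  show ?thesis by (rule exI[of _ "(c, i, j)"]) (simp add: is_cell_def entry_def c i j)
qed

lemma std_tableauxD:
  assumes "T \<in> std_tableaux lam"
  shows "map (map length) T = lam" "distinct (concat (concat T))" "set (concat (concat T)) = {1..mp_size lam}"
    and "c < length T \<Longrightarrow> i < length (T ! c) \<Longrightarrow> sorted_wrt (<) (T ! c ! i)"
    and "c < length T \<Longrightarrow> Suc i < length (T ! c) \<Longrightarrow> j < length (T ! c ! Suc i) \<Longrightarrow> T ! c ! i ! j < T ! c ! Suc i ! j"
  using assms unfolding std_tableaux_def by blast+

lemma position_props:
  assumes T: "T \<in> std_tableaux lam" and x: "x \<in> {1..mp_size lam}"
  shows "is_cell T (position T x)" "entry T (position T x) = x"
proof -
  have "x \<in> set (concat (concat T))" unfolding std_tableauxD(3)[OF T] by (rule x)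
  then obtain p where p: "is_cell T p" "entry T p = x" using cell_exists by blast
  have "position T x = p" unfolding position_alt
    by (rule the_equality) (use p cell_unique[OF std_tableauxD(2)[OF T]] in auto)
  then show "is_cell T (position T x)" "entry T (position T x) = x" using p by simp_all
qed

lemma position_eqI:
  assumes T: "T \<in> std_tableaux lam" and "is_cell T p" "entry T p = x"
  shows "position T x = p"
  unfolding position_alt by (rule the_equality) (use assms cell_unique[OF std_tableauxD(2)[OF T]] in auto)

lemma concat_same_shape: "concat xs = concat ys \<Longrightarrow> map length xs = map length ys \<Longrightarrow> xs = ys"
proof (induction xs arbitrary: ys)
  case (Cons x xs)
  then obtain y ys' where "ys = y # ys'" "length x = length y" "map length xs = map length ys'" by auto
  then show ?case using Cons by simp
qed simp

text \<open>For a fixed shape a tableau is determined by its reading word, a word of fixed length in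
  a finite alphabet.\<close>

lemma finite_std_tableaux: "finite (std_tableaux lam)"
proof (rule finite_imageD)
  have len: "length (concat (concat T)) = mp_size lam" if "T \<in> std_tableaux lam" for T
  proof -
    have "length (concat (concat T)) = card (set (concat (concat T)))"
      by (rule distinct_card[symmetric, OF std_tableauxD(2)[OF that]])
    then show ?thesis using std_tableauxD(3)[OF that] by simp
  qed
  show "finite ((\<lambda>T. concat (concat T)) ` std_tableaux lam)"
  proof (rule finite_subset)
    show "(\<lambda>T. concat (concat T)) ` std_tableaux lam \<subseteq> {xs. set xs \<subseteq> {1..mp_size lam} \<and> length xs = mp_size lam}"
      using len std_tableauxD(3) by auto
  qed (rule finite_lists_length_eq, simp)
  show "inj_on (\<lambda>T. concat (concat T)) (std_tableaux lam)"
  proof (rule inj_onI)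
    fix T U assume T: "T \<in> std_tableaux lam" "U \<in> std_tableaux lam" "concat (concat T) = concat (concat U)"
    have l: "map (map length) T = map (map length) U" using std_tableauxD(1)[OF T(1)] std_tableauxD(1)[OF T(2)] by simp
    have "map length (concat T) = map length (concat U)" using l by (simp add: map_concat)
    then have "concat T = concat U" by (rule concat_same_shape[OF T(3)])
    moreover have "map length T = map length U" using arg_cong[OF l, of "map length"] by (simp add: o_def)
    ultimately show "T = U" by (rule concat_same_shape)
  qed
qed

text \<open>The inverse axial distance as a function of two positions alone. Row minus column is
  minus the usual content; two cells on one diagonal give 1/0, which is 0.\<close>

definition content_inverse :: "nat \<times> nat \<times> nat \<Rightarrow> nat \<times> nat \<times> nat \<Rightarrow> 'k::field_char_0" where
  "content_inverse a b = (if fst a \<noteq> fst b then 0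
     else 1 / of_int ((int (fst (snd a)) - int (snd (snd a))) - (int (fst (snd b)) - int (snd (snd b)))))"

lemma inv_axial_content: "inv_axial T i = content_inverse (position T i) (position T (Suc i))"
  by (simp add: inv_axial_def content_inverse_def comp_of_def row_of_def col_of_def)

lemma content_inverse_swap: "content_inverse b a = - content_inverse a b"
  by (simp add: content_inverse_def minus_divide_right)

text \<open>The values 1 and -1 single out neighbouring diagonals of one component; the value 0, for
  different components or for 1/0, stays clear of both.\<close>

lemma content_inverse_unit:
  "content_inverse a b = (1::'k) \<or> content_inverse a b = (-1::'k::field_char_0) \<longleftrightarrow> fst a = fst b \<and>
    \<bar>(int (fst (snd a)) - int (snd (snd a))) - (int (fst (snd b)) - int (snd (snd b)))\<bar> = 1"
proof -
  have "1 / (of_int d :: 'k) = 1 \<or> 1 / (of_int d :: 'k) = -1 \<longleftrightarrow> \<bar>d\<bar> = 1" for d :: int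
  proof -
    have "1 / (of_int d :: 'k) = 1 \<longleftrightarrow> d = 1" by (metis div_by_1 divide_eq_1_iff of_int_1 of_int_eq_iff)
    moreover have "1 / (of_int d :: 'k) = -1 \<longleftrightarrow> d = -1"
    proof
      assume "1 / (of_int d :: 'k) = -1"
      then have "1 = - (of_int d :: 'k)" by (cases "(of_int d :: 'k) = 0") (auto simp: field_simps)
      then have "(of_int d :: 'k) = of_int (-1)" by (metis minus_minus of_int_1 of_int_minus)
      then show "d = -1" by (simp only: of_int_eq_iff)
    qed simp
    ultimately show ?thesis by auto
  qed
  note * = this
  show ?thesis
  proof (cases "fst a = fst b")
    case True
    then show ?thesis unfolding content_inverse_def using *[of "(int (fst (snd a)) - int (snd (snd a))) - (int (fst (snd b)) - int (snd (snd b)))"]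
      by (simp only: refl if_False not_True_eq_False simp_thms)
  next
    case False
    then show ?thesis by (simp add: content_inverse_def)
  qed
qed

text \<open>Partial fractions, \<open>1/(PQ) = 1/(P+Q) (1/P + 1/Q)\<close>, for the axial distances
  \<open>P\<close>, \<open>Q\<close> and \<open>P+Q\<close> among three entries. If the components
  are not all equal, at least two of the three inverses vanish. The braid relation comes down to
  this identity.\<close>

lemma content_inverse_relation:
  fixes x y z :: "'k::field_char_0"
  assumes ab: "fst a = fst b \<Longrightarrow> int (fst (snd a)) - int (snd (snd a)) \<noteq> int (fst (snd b)) - int (snd (snd b))"
    and bc: "fst b = fst c \<Longrightarrow> int (fst (snd b)) - int (snd (snd b)) \<noteq> int (fst (snd c)) - int (snd (snd c))"
    and ac: "fst a = fst c \<Longrightarrow> int (fst (snd a)) - int (snd (snd a)) \<noteq> int (fst (snd c)) - int (snd (snd c))"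
    and x: "x = content_inverse a b" and y: "y = content_inverse b c" and z: "z = content_inverse a c"
  shows "x * y = z * (x + y)"
proof (cases "fst a = fst b \<and> fst b = fst c")
  case True
  define p where "p = (int (fst (snd a)) - int (snd (snd a))) - (int (fst (snd b)) - int (snd (snd b)))"
  define q where "q = (int (fst (snd b)) - int (snd (snd b))) - (int (fst (snd c)) - int (snd (snd c)))"
  have pq: "p \<noteq> 0" "q \<noteq> 0" "p + q \<noteq> 0" using True ab bc ac by (auto simp: p_def q_def)
  have "x = 1 / of_int p" "y = 1 / of_int q" "z = 1 / of_int (p + q)"
    using True unfolding x y z content_inverse_def by (simp_all add: p_def q_def)
  moreover have "(of_int p :: 'k) \<noteq> 0" "(of_int q :: 'k) \<noteq> 0" "(of_int p + of_int q :: 'k) \<noteq> 0"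
    using pq by (simp_all flip: of_int_add)
  moreover have "1 / P * (1 / Q) = 1 / (P + Q) * (1 / P + 1 / Q)" if "P \<noteq> 0" "Q \<noteq> 0" "P + Q \<noteq> 0" for P Q :: 'k
    using that by (simp add: field_simps)
  ultimately show ?thesis by simp
next
  case False
  then show ?thesis unfolding x y z content_inverse_def by auto
qed

section \<open>Diagonals and standardness for partition shapes\<close>

locale partition_shape =
  fixes lam :: multipartition
  assumes partition: "\<And>\<mu>. \<mu> \<in> set lam \<Longrightarrow> is_partition \<mu>"
begin

text \<open>The upper left neighbourhood of a cell stays inside the shape because row lengths
  decrease; the two entries are compared through the corner \<open>(i, j')\<close>.\<close>

lemma entry_mono:
  assumes T: "T \<in> std_tableaux lam" and v: "is_cell T (c, i', j')" and le: "i \<le> i'" "j \<le> j'"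
  shows "is_cell T (c, i, j)" "(i, j) \<noteq> (i', j') \<Longrightarrow> entry T (c, i, j) < entry T (c, i', j')"
proof -
  note D = std_tableauxD[OF T]
  have c: "c < length T" "i' < length (T ! c)" "j' < length (T ! c ! i')" using v by (auto simp: is_cell_def)
  have lamc: "map length (T ! c) = lam ! c" "lam ! c \<in> set lam"
    using D(1) c(1) by (metis nth_map, metis length_map nth_mem)
  have len: "length (T ! c ! b) \<le> length (T ! c ! a)" if "a \<le> b" "b < length (T ! c)" for a b
  proof (cases "a = b")
    case False
    then have "a < b" using that by simp
    moreover have "sorted_wrt (\<ge>) (map length (T ! c))" using partition[OF lamc(2)] lamc(1) by (simp add: is_partition_def)
    ultimately show ?thesis using that sorted_wrt_nth_less[of "(\<ge>)" "map length (T ! c)" a b] by simp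
  qed simp
  have l: "i < length (T ! c)" "j' < length (T ! c ! i)" "j < length (T ! c ! i)"
    using le c len[of i i'] by auto
  then show "is_cell T (c, i, j)" using c by (simp add: is_cell_def)
  have col: "T ! c ! i ! j' \<le> T ! c ! b ! j' \<and> (i < b \<longrightarrow> T ! c ! i ! j' < T ! c ! b ! j')"
    if "i \<le> b" "b \<le> i'" for b
    using that
  proof (induction b rule: dec_induct)
    case (step b)
    have "T ! c ! b ! j' < T ! c ! Suc b ! j'"
      by (rule D(5)[OF c(1)]) (use step.prems c len[of "Suc b" i'] in auto)
    then show ?case using step by auto
  qed simp
  have row: "j < j' \<Longrightarrow> T ! c ! i ! j < T ! c ! i ! j'"
    using sorted_wrt_nth_less[OF D(4)[OF c(1) l(1)]] l by simp
  show "entry T (c, i, j) < entry T (c, i', j')" if "(i, j) \<noteq> (i', j')"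
  proof (cases "j < j'")
    case True
    then show ?thesis using row col[of i'] le by (simp add: entry_def)
  next
    case False
    then have "j = j'" "i < i'" using le that by auto
    then show ?thesis using col[of i'] by (simp add: entry_def)
  qed
qed

text \<open>A step down a diagonal passes two different cells, right of and below the first one,
  with entries strictly in between. Entries on one diagonal thus differ by at least 3, and the axial
  distances among three consecutive entries of one component do not vanish.\<close>

lemma same_content_far:
  assumes T: "T \<in> std_tableaux lam" and x: "x \<in> {1..mp_size lam}" and y: "y \<in> {1..mp_size lam}" and xy: "x < y" "y < x + 3"
    and f: "fst (position T x) = fst (position T y)"
  shows "int (fst (snd (position T x))) - int (snd (snd (position T x))) \<noteq> int (fst (snd (position T y))) - int (snd (snd (position T y)))"
proof
  assume e: "int (fst (snd (position T x))) - int (snd (snd (position T x))) = int (fst (snd (position T y))) - int (snd (snd (position T y)))"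
  obtain c r s where p: "position T x = (c, r, s)" by (cases "position T x") auto
  obtain r' s' where q: "position T y = (c, r', s')" using f p by (cases "position T y") auto
  have px: "is_cell T (c, r, s)" "entry T (c, r, s) = x" using position_props[OF T x] p by auto
  have py: "is_cell T (c, r', s')" "entry T (c, r', s') = y" using position_props[OF T y] q by auto
  have d: "int r - int s = int r' - int s'" using e p q by simp
  consider "r = r'" | "r < r'" | "r' < r" by linarith
  then show False
  proof cases
    case 1
    then have "s = s'" using d by simp
    then show False using px py 1 xy by simp
  next
    case 2
    then have s: "s < s'" using d by simp
    have 1: "is_cell T (c, r, Suc s)" "entry T (c, r, Suc s) < y"
      using entry_mono[OF T py(1), of r "Suc s"] 2 s py(2) by auto
    have 3: "is_cell T (c, Suc r, s)" "entry T (c, Suc r, s) < y"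
      using entry_mono[OF T py(1), of "Suc r" s] 2 s py(2) by auto
    have 4: "x < entry T (c, r, Suc s)" "x < entry T (c, Suc r, s)"
      using entry_mono(2)[OF T 1(1), of r s] entry_mono(2)[OF T 3(1), of r s] px(2) by auto
    have "entry T (c, r, Suc s) = entry T (c, Suc r, s)" using 1 3 4 xy by linarith
    then show False using cell_unique[OF std_tableauxD(2)[OF T] 1(1) 3(1)] by simp
  next
    case 3
    then have s: "s' < s" using d by simp
    have "y < x" using entry_mono(2)[OF T px(1), of r' s'] 3 s px(2) py(2) by auto
    then show False using xy by simp
  qed
qed

text \<open>Exchanging \<open>i\<close> and \<open>i + 1\<close> destroys standardness exactly when
  they occupy horizontally or vertically neighbouring cells, which is the case of axial distance 1
  or -1.\<close>

lemma swap_std_iff: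
  assumes T: "T \<in> std_tableaux lam" and i: "i \<in> {1..<mp_size lam}"
  shows "swap_entries i T \<in> std_tableaux lam \<longleftrightarrow> \<not> (inv_axial T i = (1::'k::field_char_0) \<or> inv_axial T i = (-1::'k))"
proof
  have iN: "i \<in> {1..mp_size lam}" "Suc i \<in> {1..mp_size lam}" using i by auto
  note pi = position_props[OF T iN(1)] and pj = position_props[OF T iN(2)]
  assume T': "swap_entries i T \<in> std_tableaux lam"
  show "\<not> (inv_axial T i = (1::'k) \<or> inv_axial T i = (-1::'k))"
  proof
    assume "inv_axial T i = (1::'k) \<or> inv_axial T i = (-1::'k)"
    then have u: "fst (position T i) = fst (position T (Suc i))"
      "\<bar>(int (fst (snd (position T i))) - int (snd (snd (position T i)))) - (int (fst (snd (position T (Suc i)))) - int (snd (snd (position T (Suc i)))))\<bar> = 1"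
      unfolding inv_axial_content content_inverse_unit by auto
    obtain c r s where p: "position T i = (c, r, s)" by (cases "position T i") auto
    obtain r' s' where q: "position T (Suc i) = (c, r', s')" using u(1) p by (cases "position T (Suc i)") auto
    have d: "\<bar>(int r - int s) - (int r' - int s')\<bar> = 1" using u(2) p q by simp
    have cp: "is_cell T (c, r, s)" "entry T (c, r, s) = i" "is_cell T (c, r', s')" "entry T (c, r', s') = Suc i"
      using pi pj p q by auto
    have cs: "is_cell (swap_entries i T) (c, r, s)" "entry (swap_entries i T) (c, r, s) = Suc i"
      "is_cell (swap_entries i T) (c, r', s')" "entry (swap_entries i T) (c, r', s') = i"
      using cp entry_swap[OF cp(1), of i] entry_swap[OF cp(3), of i] by (simp_all add: is_cell_swap)
    have ne: "(r, s) \<noteq> (r', s')" using cp by auto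
    \<comment> \<open>Cells that are incomparable in the product order are at least two diagonals
      apart.\<close>
    consider "r \<le> r'" "s \<le> s'" | "r' \<le> r" "s' \<le> s" using d by linarith
    then show False
    proof cases
      case 1
      then show False using entry_mono(2)[OF T' cs(3), of r s] cs ne by auto
    next
      case 2
      then show False using entry_mono(2)[OF T cp(1), of r' s'] cp ne by auto
    qed
  qed
next
  assume nu: "\<not> (inv_axial T i = (1::'k) \<or> inv_axial T i = (-1::'k))"
  let ?T = "swap_entries i T"
  note D = std_tableauxD[OF T]
  have unit: "False" if p: "position T i = (c, r, s)" and q: "position T (Suc i) = (c, r', s')"
    and d: "\<bar>(int r - int s) - (int r' - int s')\<bar> = 1" for c r s r' s'
    using nu unfolding inv_axial_content content_inverse_unit using p q d by simp
  have cc: "concat (concat ?T) = map (adjacent i) (concat (concat T))"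
    by (simp add: swap_entries_alt map_concat)
  have ad: "adjacent i permutes {1..mp_size lam}" by (rule adjacent_permutes[OF i])
  \<comment> \<open>An adjacent transposition reverses the pair \<open>i < Suc i\<close> and no
    other pair.\<close>
  have less: "adjacent i a < adjacent i b" if "a < b" "\<not> (a = i \<and> b = Suc i)" for a b
    using that by (auto simp: Transposition.transpose_def)
  show "?T \<in> std_tableaux lam"
    unfolding std_tableaux_def
  proof (intro CollectI conjI allI impI)
    show "map (map length) ?T = lam" using D(1) swap_shape by simp
    show "distinct (concat (concat ?T))" unfolding cc using D(2) by (simp add: distinct_map)
    show "set (concat (concat ?T)) = {1..mp_size lam}"
      unfolding cc set_map D(3) by (rule permutes_image[OF ad])
    fix c assume c: "c < length ?T"
    then have c': "c < length T" by (simp add: swap_entries_alt)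
    show "sorted_wrt (<) (?T ! c ! r)" if r: "r < length (?T ! c)" for r
    proof -
      have r': "r < length (T ! c)" using r c' by (simp add: swap_entries_alt)
      have e: "?T ! c ! r = map (adjacent i) (T ! c ! r)" using r' c' by (simp add: swap_entries_alt)
      have s: "sorted_wrt (<) (T ! c ! r)" by (rule D(4)[OF c' r'])
      have "adjacent i (T ! c ! r ! s) < adjacent i (T ! c ! r ! Suc s)" if sl: "Suc s < length (T ! c ! r)" for s
      proof (rule less)
        show "T ! c ! r ! s < T ! c ! r ! Suc s" using sorted_wrt_nth_less[OF s, of s "Suc s"] sl by simp
        show "\<not> (T ! c ! r ! s = i \<and> T ! c ! r ! Suc s = Suc i)"
        proof
          assume a: "T ! c ! r ! s = i \<and> T ! c ! r ! Suc s = Suc i"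
          have "position T i = (c, r, s)" "position T (Suc i) = (c, r, Suc s)"
            using a sl c' r' by (auto intro!: position_eqI[OF T] simp: is_cell_def entry_def)
          then show False by (rule unit) simp
        qed
      qed
      then show ?thesis unfolding e by (subst sorted_wrt_iff_nth_Suc_transp) auto
    qed
    fix r s assume rs: "Suc r < length (?T ! c) \<and> s < length (?T ! c ! Suc r)"
    then have r': "Suc r < length (T ! c)" using c' by (simp add: swap_entries_alt)
    have s': "s < length (T ! c ! Suc r)" using rs c' r' by (simp add: swap_entries_alt)
    have v2: "is_cell T (c, Suc r, s)" using c' r' s' by (simp add: is_cell_def)
    have v1: "is_cell T (c, r, s)" by (rule entry_mono(1)[OF T v2]) auto
    have "adjacent i (T ! c ! r ! s) < adjacent i (T ! c ! Suc r ! s)"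
    proof (rule less)
      show "T ! c ! r ! s < T ! c ! Suc r ! s" by (rule D(5)[OF c' r' s'])
      show "\<not> (T ! c ! r ! s = i \<and> T ! c ! Suc r ! s = Suc i)"
      proof
        assume a: "T ! c ! r ! s = i \<and> T ! c ! Suc r ! s = Suc i"
        have "position T i = (c, r, s)" "position T (Suc i) = (c, Suc r, s)"
          using a v1 v2 by (auto intro!: position_eqI[OF T] simp: entry_def)
        then show False by (rule unit) simp
      qed
    qed
    then show "?T ! c ! r ! s < ?T ! c ! Suc r ! s"
      using entry_swap[OF v1, of i] entry_swap[OF v2, of i] by (simp add: entry_def)
  qed
qed

end

section \<open>The seminormal representation\<close>

text \<open>To make the off-diagonal coefficient vanish exactly when the swapped tableau is not standard, \<open>1 + 1/a\<close> is replaced by \<open>0\<close> for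
  \<open>a = \<plusminus>1\<close>. The relations then hold for the unrestricted operators on all fillings, by rational function identities.\<close>

definition off_diagonal :: "'k::field \<Rightarrow> 'k" where
  "off_diagonal x = (if x = 1 \<or> x = -1 then 0 else 1 + x)"

text \<open>The modified coefficient keeps the product identity, as \<open>1 - x * x\<close>
  vanishes at 1 and -1 too; the identity makes the swap operators involutions.\<close>

lemma off_diagonal_product: "off_diagonal x * off_diagonal (- x) = 1 - x * x"
proof (cases "x = 1 \<or> x = -1")
  case True
  then show ?thesis by (auto simp: off_diagonal_def)
next
  case False
  then have "- x \<noteq> 1" "- x \<noteq> -1" by (metis minus_minus, metis minus_minus)
  then show ?thesis using False by (simp add: off_diagonal_def algebra_simps)
qed

text \<open>The action of s_i on functions of fillings: the value at \<open>T\<close> is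
  \<open>G\<close>, extended linearly, at \<open>s_i T\<close> with the modified coefficient. In
  this form the relations need no case distinction on standardness.\<close>

definition swap_op :: "nat \<Rightarrow> (tableau \<Rightarrow> 'k::field_char_0) \<Rightarrow> tableau \<Rightarrow> 'k" where
  "swap_op i G T = inv_axial T i * G T + off_diagonal (inv_axial T i) * G (swap_entries i T)"

lemma position_swap_simps:
  "position (swap_entries i T) i = position T (Suc i)"
  "position (swap_entries i T) (Suc i) = position T i"
  "j \<noteq> i \<Longrightarrow> j \<noteq> Suc i \<Longrightarrow> position (swap_entries i T) j = position T j"
  by (simp_all add: position_swap Transposition.transpose_def)

lemma inv_axial_swap: "inv_axial (swap_entries i T) i = - inv_axial T i"
  unfolding inv_axial_content position_swap_simps by (rule content_inverse_swap)

lemma inv_axial_swap_far: "Suc i < j \<or> Suc j < i \<Longrightarrow> inv_axial (swap_entries i T) j = inv_axial T j"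
  unfolding inv_axial_content by (auto simp: position_swap_simps)

lemma swap_op_square: "swap_op i (swap_op i G) T = G T"
proof -
  let ?x = "inv_axial T i"
  have "swap_op i (swap_op i G) T = ?x * (?x * G T + off_diagonal ?x * G (swap_entries i T))
      + off_diagonal ?x * (- ?x * G (swap_entries i T) + off_diagonal (- ?x) * G T)"
    by (simp add: swap_op_def inv_axial_swap swap_entries_invol)
  also have "\<dots> = (?x * ?x + off_diagonal ?x * off_diagonal (- ?x)) * G T" by (simp add: algebra_simps)
  finally show ?thesis by (simp add: off_diagonal_product)
qed

lemma swap_op_commute: "Suc i < j \<Longrightarrow> swap_op i (swap_op j G) T = swap_op j (swap_op i G) T"
  using swap_entries_commute[of i j T] by (simp add: swap_op_def inv_axial_swap_far algebra_simps)

text \<open>\<open>x\<close>, \<open>y\<close>, \<open>z\<close> are the inverse axial distances of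
  the pairs \<open>(i, i+1)\<close>, \<open>(i+1, i+2)\<close>, \<open>(i, i+2)\<close>, which the
  exchanges only permute up to sign. The two sides differ by a multiple of
  \<open>x * y - z * (x + y)\<close>.\<close>

lemma swap_op_braid:
  fixes G :: "tableau \<Rightarrow> 'k::field_char_0"
  assumes rel: "inv_axial T i * inv_axial T (Suc i)
      = content_inverse (position T i) (position T (Suc (Suc i))) * (inv_axial T i + inv_axial T (Suc i) :: 'k)"
  shows "swap_op i (swap_op (Suc i) (swap_op i G)) T = swap_op (Suc i) (swap_op i (swap_op (Suc i) G)) T"
proof -
  define x :: 'k where "x = inv_axial T i"
  define y :: 'k where "y = inv_axial T (Suc i)"
  define z :: 'k where "z = content_inverse (position T i) (position T (Suc (Suc i)))"
  let ?s = "swap_entries i" and ?t = "swap_entries (Suc i)"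
  let ?e = "off_diagonal :: 'k \<Rightarrow> 'k"
  have X: "inv_axial T i = x" "inv_axial T (Suc i) = y" "inv_axial (?s T) i = - x" "inv_axial (?t T) (Suc i) = - y"
    "inv_axial (?s T) (Suc i) = z" "inv_axial (?t T) i = z"
    "inv_axial (?s (?t T)) (Suc i) = x" "inv_axial (?t (?s T)) i = y"
    by (simp_all add: x_def y_def z_def inv_axial_swap) (simp_all add: inv_axial_content position_swap_simps)
  have L: "swap_op i (swap_op (Suc i) (swap_op i G)) T
      = x * (y * (x * G T + ?e x * G (?s T)) + ?e y * (z * G (?t T) + ?e z * G (?s (?t T))))
      + ?e x * (z * (- x * G (?s T) + ?e (- x) * G T) + ?e z * (y * G (?t (?s T)) + ?e y * G (?s (?t (?s T)))))"
    by (simp add: swap_op_def X swap_entries_invol)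
  have R: "swap_op (Suc i) (swap_op i (swap_op (Suc i) G)) T
      = y * (x * (y * G T + ?e y * G (?t T)) + ?e x * (z * G (?s T) + ?e z * G (?t (?s T))))
      + ?e y * (z * (- y * G (?t T) + ?e (- y) * G T) + ?e z * (x * G (?s (?t T)) + ?e x * G (?s (?t (?s T)))))"
    by (simp add: swap_op_def X swap_entries_invol swap_entries_braid)
  have h: "x * y - z * (x + y) = 0" using rel by (simp add: x_def y_def z_def)
  have "swap_op i (swap_op (Suc i) (swap_op i G)) T - swap_op (Suc i) (swap_op i (swap_op (Suc i) G)) T
      = G T * ((x * y) * (x - y) + z * (?e x * ?e (- x) - ?e y * ?e (- y)))
        + (G (?s T) * ?e x - G (?t T) * ?e y) * (x * y - z * (x + y))"
    unfolding L R by (simp add: algebra_simps)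
  also have "\<dots> = G T * ((x * y - z * (x + y)) * (x - y)) + (G (?s T) * ?e x - G (?t T) * ?e y) * (x * y - z * (x + y))"
    unfolding off_diagonal_product by (simp add: algebra_simps)
  also have "\<dots> = 0" unfolding h by simp
  finally show ?thesis by simp
qed

context partition_shape
begin

abbreviation "S \<equiv> std_tableaux lam"
abbreviation "N \<equiv> mp_size lam"

text \<open>Extended by the identity off the standard tableaux, so that the Coxeter relations hold
  as equations between operators on all functions.\<close>

definition std_op :: "nat \<Rightarrow> (tableau \<Rightarrow> 'k::field_char_0) \<Rightarrow> tableau \<Rightarrow> 'k" where
  "std_op i G T = (if T \<in> S then swap_op i G T else G T)"

lemma off_diagonal_std:
  assumes "T \<in> S" "i \<in> {1..<N}"
  shows "off_diagonal (inv_axial T i :: 'k::field_char_0) = (if swap_entries i T \<in> S then 1 + inv_axial T i else 0)"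
  using swap_std_iff[OF assms, where 'k = 'k] by (auto simp: off_diagonal_def)

text \<open>The coefficient of the exchanged filling vanishes when that filling is not standard, so
  values off the standard tableaux never enter.\<close>

lemma swap_op_cong:
  assumes "T \<in> S" "i \<in> {1..<N}" "\<And>U. U \<in> S \<Longrightarrow> G U = G' U"
  shows "swap_op i G T = (swap_op i G' T :: 'k::field_char_0)"
  using assms off_diagonal_std[OF assms(1,2), where 'k = 'k] by (auto simp: swap_op_def)

lemma std_op_coxeter: "coxeter_relations (std_op :: nat \<Rightarrow> (tableau \<Rightarrow> 'k::field_char_0) \<Rightarrow> tableau \<Rightarrow> 'k) N"
proof -
  have two: "std_op i (std_op j G) T = swap_op i (swap_op j G) T"
    if "T \<in> S" "i \<in> {1..<N}" for i j T and G :: "tableau \<Rightarrow> 'k"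
    using that swap_op_cong[OF that, of "std_op j G" "swap_op j G"] by (simp add: std_op_def)
  have three: "std_op i (std_op j (std_op k G)) T = swap_op i (swap_op j (swap_op k G)) T"
    if "T \<in> S" "i \<in> {1..<N}" "j \<in> {1..<N}" for i j k T and G :: "tableau \<Rightarrow> 'k"
    using that two[of _ j k G] swap_op_cong[OF that(1,2), of "std_op j (std_op k G)" "swap_op j (swap_op k G)"]
    by (simp add: std_op_def)
  have out: "T \<notin> S \<Longrightarrow> std_op i G T = G T" for i T and G :: "tableau \<Rightarrow> 'k" by (simp add: std_op_def)
  \<comment> \<open>Those of three consecutive entries that share a component lie on distinct
    diagonals, so the partial fraction identity applies.\<close>
  have braid: "inv_axial T i * inv_axial T (Suc i)
      = content_inverse (position T i) (position T (Suc (Suc i))) * (inv_axial T i + inv_axial T (Suc i) :: 'k)"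
    if T: "T \<in> S" and i: "i \<in> {1..<N}" "Suc i < N" for T i
    by (rule content_inverse_relation[OF _ _ _ inv_axial_content inv_axial_content refl])
       (rule same_content_far[OF T]; use i in simp)+
  show ?thesis
    unfolding coxeter_relations_def
  proof (intro conjI ballI impI ext)
    fix i G T assume i: "i \<in> {1..<N}"
    show "(std_op i \<circ> std_op i) G T = id (G :: tableau \<Rightarrow> 'k) T"
      using two[OF _ i] out by (cases "T \<in> S") (auto simp: swap_op_square)
    show "(std_op i \<circ> std_op j) G T = (std_op j \<circ> std_op i) (G :: tableau \<Rightarrow> 'k) T" if "j \<in> {1..<N}" "Suc i < j" for j
      using two[OF _ i] two[OF _ that(1)] out swap_op_commute[OF that(2)] by (cases "T \<in> S") auto
    show "(std_op i \<circ> std_op (Suc i) \<circ> std_op i) G T = (std_op (Suc i) \<circ> std_op i \<circ> std_op (Suc i)) (G :: tableau \<Rightarrow> 'k) T"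
      if "Suc i < N"
      using three[OF _ i, of T "Suc i" i G] three[of T "Suc i" i "Suc i" G] out that i swap_op_braid[OF braid[OF _ i that], of T G]
      by (cases "T \<in> S") auto
  qed
qed

text \<open>\<open>M \<pi>\<close> is the matrix of the operator that the Coxeter presentation
  attaches to \<pi>. The last property, that a nonzero coefficient transports components along
  \<pi>, is what will make the labels act compatibly.\<close>

lemma permutation_matrices:
  obtains M :: "(nat \<Rightarrow> nat) \<Rightarrow> tableau \<Rightarrow> tableau \<Rightarrow> 'k::field_char_0"
  where "\<And>T U. M id T U = (if T = U then 1 else 0)"
    and "\<And>i T U. i \<in> {1..<N} \<Longrightarrow> T \<in> S \<Longrightarrow> U \<in> S \<Longrightarrow> M (adjacent i) T U =
        (if U = T then inv_axial T i else 0) + (if U = swap_entries i T then 1 + inv_axial T i else 0)"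
    and "\<And>\<pi> \<sigma> T U. \<pi> permutes {1..N} \<Longrightarrow> \<sigma> permutes {1..N} \<Longrightarrow> T \<in> S \<Longrightarrow> U \<in> S
        \<Longrightarrow> M (\<pi> \<circ> \<sigma>) T U = (\<Sum>V\<in>S. M \<pi> T V * M \<sigma> V U)"
    and "\<And>\<pi> T U j. \<pi> permutes {1..N} \<Longrightarrow> T \<in> S \<Longrightarrow> U \<in> S \<Longrightarrow> M \<pi> T U \<noteq> 0 \<Longrightarrow> j \<in> {1..N} \<Longrightarrow> comp_of U j = comp_of T (\<pi> j)"
proof -
  obtain \<Phi> :: "(nat \<Rightarrow> nat) \<Rightarrow> (tableau \<Rightarrow> 'k) \<Rightarrow> tableau \<Rightarrow> 'k" where \<Phi>: "\<Phi> id = id"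
    "\<And>i. i \<in> {1..<N} \<Longrightarrow> \<Phi> (adjacent i) = std_op i"
    "\<And>\<pi> \<sigma>. \<pi> permutes {1..N} \<Longrightarrow> \<sigma> permutes {1..N} \<Longrightarrow> \<Phi> (\<pi> \<circ> \<sigma>) = \<Phi> \<pi> \<circ> \<Phi> \<sigma>"
    using coxeter_presentation[OF std_op_coxeter[where 'k = 'k]] by blast
  \<comment> \<open>Indicator functions turn operators on functions into matrices.\<close>
  define dl where "dl U = (\<lambda>V. if V = U then 1 else 0 :: 'k)" for U :: tableau
  define M where "M \<pi> T U = \<Phi> \<pi> (dl U) T" for \<pi> T U
  have fS: "finite S" by (rule finite_std_tableaux)
  have M_id: "M id T U = (if T = U then 1 else 0)" for T U by (simp add: M_def \<Phi>(1) dl_def)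
  have M_adj: "M (adjacent i) T U = (if U = T then inv_axial T i else 0) + (if U = swap_entries i T then 1 + inv_axial T i else 0)"
    if "i \<in> {1..<N}" "T \<in> S" "U \<in> S" for i T U
    using that off_diagonal_std[OF that(2,1), where 'k = 'k]
    by (auto simp: M_def \<Phi>(2) std_op_def swap_op_def dl_def)
  have expand: "std_op i G T = (\<Sum>U\<in>S. M (adjacent i) T U * G U)" if i: "i \<in> {1..<N}" and T: "T \<in> S" for i T G
  proof -
    have "(\<Sum>U\<in>S. M (adjacent i) T U * G U) = (\<Sum>U\<in>S. (if U = T then inv_axial T i * G T else 0)
        + (if U = swap_entries i T then (1 + inv_axial T i) * G (swap_entries i T) else 0))"
      by (rule sum.cong[OF refl]) (auto simp: M_adj[OF i T] algebra_simps)
    also have "\<dots> = inv_axial T i * G T + (if swap_entries i T \<in> S then (1 + inv_axial T i) * G (swap_entries i T) else 0)"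
      unfolding sum.distrib sum.delta'[OF fS] sum.delta[OF fS] using T by simp
    also have "\<dots> = std_op i G T"
      using T off_diagonal_std[OF T i, where 'k = 'k] by (simp add: std_op_def swap_op_def)
    finally show ?thesis by simp
  qed
  \<comment> \<open>Linearity is not part of the presentation; it is inherited from the generators
    by induction over adjacent transpositions.\<close>
  have lin: "\<Phi> \<pi> G T = (\<Sum>U\<in>S. M \<pi> T U * G U)" if "\<pi> permutes {1..N}" "T \<in> S" for \<pi> G T
    using that
  proof (induction arbitrary: G T rule: permutes_adjacent_induct)
    case id
    have "(\<Sum>U\<in>S. (if T = U then 1 else 0) * G U) = (\<Sum>U\<in>S. if T = U then G U else 0)"
      by (rule sum.cong[OF refl]) simp
    also have "\<dots> = G T" using id(1) fS by simp
    finally have "\<Phi> id G T = (\<Sum>U\<in>S. M id T U * G U)" unfolding M_id \<Phi>(1) by simp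
    then show ?case .
  next
    case (step \<sigma> i)
    have c: "\<Phi> (\<sigma> \<circ> adjacent i) G T = (\<Sum>V\<in>S. M \<sigma> T V * std_op i G V)" for G
      using \<Phi>(3)[OF step(1) adjacent_permutes[OF step(2)]] \<Phi>(2)[OF step(2)] step(3)[OF step(4)] by simp
    have "(\<Sum>U\<in>S. M (\<sigma> \<circ> adjacent i) T U * G U) = (\<Sum>U\<in>S. (\<Sum>V\<in>S. M \<sigma> T V * std_op i (dl U) V) * G U)"
      unfolding M_def[of "\<sigma> \<circ> adjacent i"] c ..
    also have "\<dots> = (\<Sum>V\<in>S. \<Sum>U\<in>S. M \<sigma> T V * std_op i (dl U) V * G U)"
      by (subst sum.swap) (simp add: sum_distrib_right)
    also have "\<dots> = (\<Sum>V\<in>S. M \<sigma> T V * (\<Sum>U\<in>S. M (adjacent i) V U * G U))"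
      by (simp add: sum_distrib_left mult.assoc M_def[of "adjacent i"] \<Phi>(2)[OF step(2)])
    also have "\<dots> = (\<Sum>V\<in>S. M \<sigma> T V * std_op i G V)"
      by (rule sum.cong[OF refl]) (simp add: expand[OF step(2)])
    finally show ?case unfolding c by (rule sym)
  qed
  have M_mult: "M (\<pi> \<circ> \<sigma>) T U = (\<Sum>V\<in>S. M \<pi> T V * M \<sigma> V U)"
    if "\<pi> permutes {1..N}" "\<sigma> permutes {1..N}" "T \<in> S" for \<pi> \<sigma> T U
    using lin[OF that(1,3), of "\<Phi> \<sigma> (dl U)"] \<Phi>(3)[OF that(1,2)] by (simp add: M_def)
  have M_comp: "\<forall>j\<in>{1..N}. comp_of U j = comp_of T (\<pi> j)"
    if "\<pi> permutes {1..N}" "T \<in> S" "U \<in> S" "M \<pi> T U \<noteq> 0" for \<pi> T U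
    using that
  proof (induction arbitrary: T U rule: permutes_adjacent_induct)
    case id
    from id(3) have "T = U" unfolding M_id by (metis (full_types))
    then show ?case by simp
  next
    case (step \<sigma> i)
    have "(\<Sum>V\<in>S. M \<sigma> T V * M (adjacent i) V U) \<noteq> 0"
      using step(6) unfolding M_mult[OF step(1) adjacent_permutes[OF step(2)] step(4)] .
    then obtain V where V: "V \<in> S" "M \<sigma> T V * M (adjacent i) V U \<noteq> 0" by (meson sum.not_neutral_contains_not_neutral)
    then have 1: "\<forall>j\<in>{1..N}. comp_of V j = comp_of T (\<sigma> j)" using step(3)[OF step(4) V(1)] by auto
    \<comment> \<open>A diagonal coefficient is nonzero only if \<open>i\<close> and
      \<open>i + 1\<close> share a component, and then exchanging them changes no component.\<close>
    have "comp_of U j = comp_of V (adjacent i j)" for j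
    proof (cases "U = swap_entries i V")
      case True
      then show ?thesis by (simp add: comp_of_def position_swap)
    next
      case False
      then have "U = V" "inv_axial V i \<noteq> (0::'k)" using V(2) M_adj[OF step(2) V(1) step(5)] by (auto split: if_splits)
      then have "comp_of V i = comp_of V (Suc i)" by (auto simp: inv_axial_def split: if_splits)
      then show ?thesis using \<open>U = V\<close> by (auto simp: Transposition.transpose_def)
    qed
    moreover have "adjacent i j \<in> {1..N}" if "j \<in> {1..N}" for j
      using permutes_in_image[OF adjacent_permutes[OF step(2)]] that by blast
    ultimately show ?case using 1 by simp
  qed
  show thesis by (rule that[of M]) (use M_id M_adj M_mult M_comp in blast)+
qed

end

section \<open>Generators of G(m,1,N), existence and uniqueness of the seminormal form\<close>

lemma t1_diagram_perm: "t1_diagram m N = perm_diagram N id (\<lambda>i. if i = 1 then 1 mod m else 0)" if "N \<ge> 1"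
proof -
  have "{1..N} = insert 1 {2..N}" using that by auto
  moreover have "{({North i, South i}, 0) | i. i \<in> {2..N}}
      = (\<lambda>i. ({North i, South (id i)}, if i = 1 then 1 mod m else 0)) ` {2..N}"
    unfolding setcompr_eq_image by (rule image_cong) auto
  ultimately show ?thesis unfolding t1_diagram_def perm_diagram_def by (simp only: image_insert id_apply if_True refl)
qed

lemma s_diagram_perm: "s_diagram N i = perm_diagram N (adjacent i) (\<lambda>_. 0)"
  unfolding s_diagram_def perm_diagram_def swap_fun setcompr_eq_image Collect_mem_eq ..

lemma perm_diagram_cong:
  "(\<And>i. i \<in> {1..N} \<Longrightarrow> \<pi> i = \<pi>' i \<and> z i = z' i) \<Longrightarrow> perm_diagram N \<pi> z = perm_diagram N \<pi>' z'"
  unfolding perm_diagram_def by (rule image_cong) auto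

lemma perm_diagram_inject:
  assumes "\<pi> permutes {1..N}" "\<pi>' permutes {1..N}" "perm_diagram N \<pi> z = perm_diagram N \<pi>' z'"
  shows "\<pi> = \<pi>'" "i \<in> {1..N} \<Longrightarrow> z i = z' i"
proof -
  have *: "\<pi> i = \<pi>' i \<and> z i = z' i" if "i \<in> {1..N}" for i
  proof -
    have "({North i, South (\<pi> i)}, z i) \<in> perm_diagram N \<pi> z"
      unfolding perm_diagram_def by (rule image_eqI[OF refl that])
    then have "({North i, South (\<pi> i)}, z i) \<in> perm_diagram N \<pi>' z'" unfolding assms(3) .
    then obtain j where "({North i, South (\<pi> i)}, z i) = ({North j, South (\<pi>' j)}, z' j)"
      unfolding perm_diagram_def by (rule imageE)
    then show ?thesis by (auto simp: doubleton_eq_iff)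
  qed
  show "\<pi> = \<pi>'"
  proof
    fix i show "\<pi> i = \<pi>' i" using *[of i] permutes_not_in[OF assms(1), of i] permutes_not_in[OF assms(2), of i] by metis
  qed
  show "i \<in> {1..N} \<Longrightarrow> z i = z' i" using * by blast
qed

text \<open>t_1 and the s_i generate: permutations come from the s_i, a unit label at
  \<open>j + 1\<close> from one at \<open>j\<close> by conjugation with s_j, arbitrary labels as
  products of unit labels, and a diagram is its labels placed above its permutation.\<close>

lemma group_diagram_induct [consumes 2, case_names id t s mult]:
  assumes m: "m > 0" and w: "w \<in> group_diagrams m N" and id: "P (id_diagram N)" and t1: "1 \<le> N \<Longrightarrow> P (t1_diagram m N)"
    and s: "\<And>i. i \<in> {1..<N} \<Longrightarrow> P (s_diagram N i)"
    and mult: "\<And>w w'. w \<in> group_diagrams m N \<Longrightarrow> w' \<in> group_diagrams m N \<Longrightarrow> P w \<Longrightarrow> P w' \<Longrightarrow> P (concatenation m w w')"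
  shows "P w"
proof -
  let ?d = "perm_diagram N"
  have grp: "?d \<pi> z \<in> group_diagrams m N" if "\<pi> permutes {1..N}" "\<And>i. i \<in> {1..N} \<Longrightarrow> z i < m" for \<pi> z
    by (rule perm_diagram_group[OF that])
  have conc: "concatenation m (?d \<pi> z) (?d \<pi>' z') = ?d (\<pi>' \<circ> \<pi>) (\<lambda>i. (z i + z' (\<pi> i)) mod m)"
    if "\<pi> permutes {1..N}" "\<pi>' permutes {1..N}" "\<And>i. i \<in> {1..N} \<Longrightarrow> z i < m" for \<pi> \<pi>' z z'
    using concatenation_perm_perm[of \<pi> N z m \<pi>' z'] that by simp
  have z0: "0 < m" by (rule m)
  have perm: "P (?d \<pi> (\<lambda>_. 0))" if "\<pi> permutes {1..N}" for \<pi>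
    using that
  proof (induction rule: permutes_adjacent_induct)
    case id
    show ?case using assms(3) unfolding id_diagram_perm .
  next
    case (step \<sigma> i)
    have a: "adjacent i permutes {1..N}" by (rule adjacent_permutes[OF step(2)])
    have e: "concatenation m (?d (adjacent i) (\<lambda>_. 0)) (?d \<sigma> (\<lambda>_. 0)) = ?d (\<sigma> \<circ> adjacent i) (\<lambda>_. 0)"
      using conc[OF a step(1) m] by simp
    show ?case unfolding e[symmetric]
      by (rule mult) (use grp[OF a] grp[OF step(1)] m s[OF step(2)] step(3) in \<open>auto simp: s_diagram_perm\<close>)
  qed
  \<comment> \<open>The reduced value \<open>1 mod m\<close> also covers \<open>m = 1\<close>, where
    0 is the only label.\<close>
  define u where "u j i = (if i = j then 1 mod m else 0)" for i j :: nat
  have um: "u j i < m" for i j using m by (simp add: u_def)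
  have unit: "j \<in> {1..N} \<Longrightarrow> P (?d id (u j))" for j
  proof (induction j)
    case (Suc j)
    show ?case
    proof (cases "j = 0")
      case True
      then have u: "u (Suc j) = (\<lambda>i. if i = 1 then 1 mod m else 0)" by (simp add: u_def fun_eq_iff)
      have "1 \<le> N" using Suc.prems True by simp
      from t1[OF this] show ?thesis unfolding u t1_diagram_perm[OF \<open>1 \<le> N\<close>] .
    next
      case False
      then have j: "j \<in> {1..N}" "j \<in> {1..<N}" using Suc.prems by auto
      have a: "adjacent j permutes {1..N}" by (rule adjacent_permutes[OF j(2)])
      have Ps: "P (?d (adjacent j) (\<lambda>_. 0))" using s[OF j(2)] by (simp add: s_diagram_perm)
      have "P (concatenation m (concatenation m (?d (adjacent j) (\<lambda>_. 0)) (?d id (u j))) (?d (adjacent j) (\<lambda>_. 0)))"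
        by (intro mult group_concatenation grp a permutes_id Ps Suc.IH j(1) um z0)
      also have "concatenation m (?d (adjacent j) (\<lambda>_. 0)) (?d id (u j)) = ?d (adjacent j) (\<lambda>i. u j (adjacent j i))"
        using conc[OF a permutes_id, of "\<lambda>_. 0" "u j"] m um by (simp add: id_def o_def)
      also have "concatenation m (?d (adjacent j) (\<lambda>i. u j (adjacent j i))) (?d (adjacent j) (\<lambda>_. 0))
          = ?d (adjacent j \<circ> adjacent j) (\<lambda>i. (u j (adjacent j i) + 0) mod m)"
        by (rule conc[OF a a]) (rule um)
      also have "\<dots> = ?d id (u (Suc j))"
        by (rule perm_diagram_cong) (auto simp: u_def Transposition.transpose_def)
      finally show ?thesis .
    qed
  qed simp
  have lab: "P (?d id z)" if "\<And>i. i \<in> {1..N} \<Longrightarrow> z i < m" for z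
    using that
  \<comment> \<open>Induction on the total label, removing one unit at a time.\<close>
  proof (induction "\<Sum>i\<in>{1..N}. z i" arbitrary: z)
    case 0
    then have "?d id z = ?d id (\<lambda>_. 0)" by (intro perm_diagram_cong) auto
    then show ?case using perm[OF permutes_id] by (simp only:)
  next
    case (Suc k)
    have "\<exists>j\<in>{1..N}. z j \<noteq> 0" using Suc.hyps(2) by (metis nat.distinct(1) sum.neutral)
    then obtain j where j: "j \<in> {1..N}" "z j \<noteq> 0" by blast
    define z' where "z' = z(j := z j - 1)"
    have "(\<Sum>i\<in>{1..N}. z i) = z j + (\<Sum>i\<in>{1..N} - {j}. z i)" using j(1) by (intro sum.remove) auto
    moreover have "(\<Sum>i\<in>{1..N}. z' i) = z' j + (\<Sum>i\<in>{1..N} - {j}. z' i)" using j(1) by (intro sum.remove) auto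
    moreover have "(\<Sum>i\<in>{1..N} - {j}. z' i) = (\<Sum>i\<in>{1..N} - {j}. z i)" by (intro sum.cong) (auto simp: z'_def)
    ultimately have k: "k = (\<Sum>i\<in>{1..N}. z' i)" using Suc.hyps(2) j(2) by (simp add: z'_def)
    have z'm: "z' i < m" if "i \<in> {1..N}" for i
      using Suc.prems[OF that] less_imp_diff_less[OF Suc.prems[OF j(1)], of 1] by (simp add: z'_def)
    have "P (concatenation m (?d id z') (?d id (u j)))"
      by (intro mult grp permutes_id Suc.hyps(1)[OF k] unit[OF j(1)] um z'm)
    also have "concatenation m (?d id z') (?d id (u j)) = ?d (id \<circ> id) (\<lambda>i. (z' i + u j (id i)) mod m)"
      by (rule conc[OF permutes_id permutes_id z'm])
    also have "\<dots> = ?d id z"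
    proof (rule perm_diagram_cong)
      fix i assume i: "i \<in> {1..N}"
      have "(z' i + u j i) mod m = z i"
      proof (cases "i = j")
        case True
        have "(z j - 1 + 1 mod m) mod m = (z j - 1 + 1) mod m" by (simp add: mod_simps)
        then show ?thesis using True j(2) Suc.prems[OF i] by (simp add: z'_def u_def)
      qed (use Suc.prems[OF i] in \<open>simp add: z'_def u_def\<close>)
      then show "(id \<circ> id) i = id i \<and> (z' i + u j (id i)) mod m = z i" by simp
    qed
    finally show ?case .
  qed
  obtain \<pi> z where p: "\<pi> permutes {1..N}" "\<And>i. i \<in> {1..N} \<Longrightarrow> z i < m" "w = ?d \<pi> z"
    using group_diagrams_perm[OF w] by blast
  have "P (concatenation m (?d id z) (?d \<pi> (\<lambda>_. 0)))"
    by (intro mult grp permutes_id p(1,2) lab perm z0)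
  also have "concatenation m (?d id z) (?d \<pi> (\<lambda>_. 0)) = ?d (\<pi> \<circ> id) (\<lambda>i. (z i + 0) mod m)"
    by (rule conc[OF permutes_id p(1) p(2)])
  also have "\<dots> = w" unfolding p(3) by (rule perm_diagram_cong) (use p(2) in simp)
  finally show ?thesis .
qed

lemma power_mod_root:
  fixes \<xi> :: "'k::field"
  assumes "\<xi> ^ m = 1" "a mod m = b mod m"
  shows "\<xi> ^ (a * c) = \<xi> ^ (b * c)"
proof -
  have "\<xi> ^ a = \<xi> ^ (a mod m)" for a
    using assms(1) by (metis (no_types, lifting) div_mult_mod_eq mult.commute mult_1 power_add power_mult power_one)
  then show ?thesis using assms(2) by (metis power_mult)
qed

context partition_shape
begin

text \<open>The diagram with permutation \<pi> and labels \<open>z\<close> is given the matrix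
  \<open>M \<pi>\<close> times a diagonal matrix, in which a unit label at \<open>i\<close>
  contributes \<xi> to the power of the component containing \<open>i\<close>.\<close>

lemma seminormal_exists:
  fixes \<xi> :: "'k::field_char_0"
  assumes \<xi>: "\<xi> ^ m = 1" and m: "m > 0"
  shows "\<exists>\<rho>. is_seminormal m \<xi> lam \<rho>"
proof -
  obtain M :: "(nat \<Rightarrow> nat) \<Rightarrow> tableau \<Rightarrow> tableau \<Rightarrow> 'k" where
    M_id: "\<And>T U. M id T U = (if T = U then 1 else 0)"
    and M_adj: "\<And>i T U. i \<in> {1..<N} \<Longrightarrow> T \<in> S \<Longrightarrow> U \<in> S \<Longrightarrow> M (adjacent i) T U =
        (if U = T then inv_axial T i else 0) + (if U = swap_entries i T then 1 + inv_axial T i else 0)"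
    and M_mult: "\<And>\<pi> \<sigma> T U. \<pi> permutes {1..N} \<Longrightarrow> \<sigma> permutes {1..N} \<Longrightarrow> T \<in> S \<Longrightarrow> U \<in> S
        \<Longrightarrow> M (\<pi> \<circ> \<sigma>) T U = (\<Sum>V\<in>S. M \<pi> T V * M \<sigma> V U)"
    and M_comp: "\<And>\<pi> T U j. \<pi> permutes {1..N} \<Longrightarrow> T \<in> S \<Longrightarrow> U \<in> S \<Longrightarrow> M \<pi> T U \<noteq> 0 \<Longrightarrow> j \<in> {1..N} \<Longrightarrow> comp_of U j = comp_of T (\<pi> j)"
    using permutation_matrices[where 'k = 'k] by blast
  let ?G = "group_diagrams m N" and ?d = "perm_diagram N"
  define ex where "ex z U = (\<Prod>i\<in>{1..N}. \<xi> ^ (z i * comp_of U i))" for z :: "nat \<Rightarrow> nat" and U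
  \<comment> \<open>A permutation and labels representing \<open>w\<close> are chosen; the
    permutation is unique and so are the labels on \<open>{1..N}\<close>, where \<open>ex\<close>
    reads them.\<close>
  define \<rho> where "\<rho> w T U = (if w \<in> ?G \<and> T \<in> S \<and> U \<in> S then
      (let (\<pi>, z) = (SOME (\<pi>, z). \<pi> permutes {1..N} \<and> w = ?d \<pi> z) in M \<pi> T U * ex z U) else 0)" for w T U
  have ex_cong: "ex z U = ex z' U" if "\<And>i. i \<in> {1..N} \<Longrightarrow> z i mod m = z' i mod m" for z z' U
    unfolding ex_def by (rule prod.cong[OF refl]) (rule power_mod_root[OF \<xi> that])
  have \<rho>d: "\<rho> (?d \<pi> z) T U = M \<pi> T U * ex z U"
    if p: "\<pi> permutes {1..N}" "\<And>i. i \<in> {1..N} \<Longrightarrow> z i < m" and T: "T \<in> S" "U \<in> S" for \<pi> z T U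
  proof -
    let ?Q = "\<lambda>(\<pi>', z'). \<pi>' permutes {1..N} \<and> ?d \<pi> z = ?d \<pi>' z'"
    obtain \<pi>' z' where q: "(SOME q. ?Q q) = (\<pi>', z')" by (cases "SOME q. ?Q q") auto
    have "?Q (SOME q. ?Q q)" by (rule someI[of ?Q "(\<pi>, z)"]) (use p in simp)
    then have "\<pi>' permutes {1..N}" "?d \<pi> z = ?d \<pi>' z'" unfolding q by auto
    then have "\<pi> = \<pi>'" "\<And>i. i \<in> {1..N} \<Longrightarrow> z i = z' i" using perm_diagram_inject[OF p(1)] by blast+
    then have "M \<pi>' T U * ex z' U = M \<pi> T U * ex z U" using ex_cong[of z' z U] by simp
    then show ?thesis unfolding \<rho>_def using perm_diagram_group[OF p] T q by simp
  qed
  have "is_seminormal m \<xi> lam \<rho>"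
    unfolding is_seminormal_def Let_def
  proof (intro conjI allI ballI impI)
    show "w \<in> ?G" "T \<in> S" "U \<in> S" if "\<rho> w T U \<noteq> 0" for w T U
      using that unfolding \<rho>_def by (auto split: if_splits)
  next
    fix T U assume T: "T \<in> S" "U \<in> S"
    have "\<rho> (?d id (\<lambda>_. 0)) T U = M id T U * ex (\<lambda>_. 0) U" by (rule \<rho>d[OF permutes_id _ T]) (rule m)
    then show "\<rho> (id_diagram N) T U = (if U = T then 1 else 0)"
      unfolding id_diagram_perm by (auto simp: M_id ex_def)
  next
    fix w w' T U assume w: "w \<in> ?G" "w' \<in> ?G" and T: "T \<in> S" "U \<in> S"
    obtain \<pi> z where p: "\<pi> permutes {1..N}" "\<And>i. i \<in> {1..N} \<Longrightarrow> z i < m" "w = ?d \<pi> z"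
      using group_diagrams_perm[OF w(1)] by blast
    obtain \<pi>' z' where p': "\<pi>' permutes {1..N}" "\<And>i. i \<in> {1..N} \<Longrightarrow> z' i < m" "w' = ?d \<pi>' z'"
      using group_diagrams_perm[OF w(2)] by blast
    let ?z = "\<lambda>i. (z i + z' (\<pi> i)) mod m"
    have "\<rho> (concatenation m w w') T U = \<rho> (?d (\<pi>' \<circ> \<pi>) ?z) T U"
      unfolding p(3) p'(3) by (simp only: concatenation_perm_perm[OF p(1,2) p'(1)])
    also have "\<dots> = M (\<pi>' \<circ> \<pi>) T U * ex ?z U"
      by (rule \<rho>d[OF permutes_compose[OF p(1) p'(1)] _ T]) (use m in simp)
    also have "\<dots> = (\<Sum>V\<in>S. M \<pi>' T V * M \<pi> V U * ex ?z U)"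
      unfolding M_mult[OF p'(1) p(1) T] by (simp add: sum_distrib_right)
    also have "\<dots> = (\<Sum>V\<in>S. \<rho> w' T V * \<rho> w V U)"
    proof (rule sum.cong[OF refl])
      fix V assume V: "V \<in> S"
      have r: "\<rho> w V U = M \<pi> V U * ex z U" unfolding p(3) by (rule \<rho>d[OF p(1) _ V T(2)]) (rule p(2))
      have r': "\<rho> w' T V = M \<pi>' T V * ex z' V" unfolding p'(3) by (rule \<rho>d[OF p'(1) _ T(1) V]) (rule p'(2))
      \<comment> \<open>The labels of the lower diagram are evaluated at \<open>V\<close> but have
        to be read off at \<open>U\<close>. A nonzero coefficient transports the components from one
        to the other; for a zero coefficient both sides vanish.\<close>
      have "M \<pi> V U * ex ?z U = ex z' V * (M \<pi> V U * ex z U)"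
      proof (cases "M \<pi> V U = 0")
        case False
        have c: "comp_of U i = comp_of V (\<pi> i)" if "i \<in> {1..N}" for i by (rule M_comp[OF p(1) V T(2) False that])
        have "ex z' V = (\<Prod>i\<in>{1..N}. \<xi> ^ (z' (\<pi> i) * comp_of V (\<pi> i)))"
          unfolding ex_def using prod.permute[OF p(1), of "\<lambda>i. \<xi> ^ (z' i * comp_of V i)"] by (simp add: o_def)
        also have "\<dots> = (\<Prod>i\<in>{1..N}. \<xi> ^ (z' (\<pi> i) * comp_of U i))" by (rule prod.cong[OF refl]) (simp add: c)
        finally have "ex z' V * ex z U = (\<Prod>i\<in>{1..N}. \<xi> ^ ((z i + z' (\<pi> i)) * comp_of U i))"
          unfolding ex_def by (simp add: prod.distrib[symmetric] power_add[symmetric] algebra_simps)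
        also have "\<dots> = ex ?z U" unfolding ex_def
          by (rule prod.cong[OF refl]) (rule power_mod_root[OF \<xi>], simp)
        finally show ?thesis by (simp add: mult_ac)
      qed simp
      then show "M \<pi>' T V * M \<pi> V U * ex ?z U = \<rho> w' T V * \<rho> w V U"
        unfolding r r' mult.assoc by (rule arg_cong)
    qed
    finally show "\<rho> (concatenation m w w') T U = (\<Sum>V\<in>S. \<rho> w' T V * \<rho> w V U)" .
  next
    fix T U assume N1: "1 \<le> N" and T: "T \<in> S" "U \<in> S"
    let ?u = "\<lambda>i :: nat. if i = 1 then 1 mod m else 0"
    have "\<rho> (t1_diagram m N) T U = M id T U * ex ?u U"
      unfolding t1_diagram_perm[OF N1] by (rule \<rho>d[OF permutes_id _ T]) (use m in simp)
    also have "ex ?u U = (\<Prod>i\<in>{1..N}. if i = 1 then \<xi> ^ comp_of U 1 else 1)"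
      unfolding ex_def
    proof (rule prod.cong[OF refl])
      fix i show "\<xi> ^ (?u i * comp_of U i) = (if i = 1 then \<xi> ^ comp_of U 1 else 1)"
        using power_mod_root[OF \<xi>, of "1 mod m" 1 "comp_of U 1"] by simp
    qed
    also have "\<dots> = \<xi> ^ comp_of U 1" using N1 by (subst prod.delta) auto
    finally show "\<rho> (t1_diagram m N) T U = (if U = T then \<xi> ^ comp_of T 1 else 0)" unfolding M_id by auto
  next
    fix i T U assume i: "i \<in> {1..<N}" and T: "T \<in> S" "U \<in> S"
    have "\<rho> (s_diagram N i) T U = M (adjacent i) T U * ex (\<lambda>_. 0) U"
      unfolding s_diagram_perm by (rule \<rho>d[OF adjacent_permutes[OF i] _ T]) (rule m)
    then show "\<rho> (s_diagram N i) T U = (if U = T then inv_axial T i else 0) + (if U = swap_entries i T then 1 + inv_axial T i else 0)"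
      using M_adj[OF i T] by (simp add: ex_def)
  qed
  then show ?thesis by blast
qed

end

text \<open>Two solutions agree on the generators, hence on all group diagrams, and both are zero
  elsewhere by convention.\<close>

lemma seminormal_unique:
  assumes m: "m > 0" and 1: "is_seminormal m \<xi> lam \<rho>" and 2: "is_seminormal m \<xi> lam \<rho>'"
  shows "\<rho> = \<rho>'"
proof -
  let ?N = "mp_size lam" and ?S = "std_tableaux lam"
  have P: "\<forall>T\<in>?S. \<forall>U\<in>?S. \<rho> w T U = \<rho>' w T U" if "w \<in> group_diagrams m ?N" for w
    using m that
  proof (induction rule: group_diagram_induct)
    case id
    then show ?case using 1 2 unfolding is_seminormal_def Let_def by simp
  next
    case t
    then show ?case using 1 2 unfolding is_seminormal_def Let_def by simp
  next
    case (s i)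
    then show ?case using 1 2 unfolding is_seminormal_def Let_def by simp
  next
    case (mult w w')
    then show ?case using 1 2 unfolding is_seminormal_def Let_def by simp
  qed
  have s1: "\<forall>w T U. \<rho> w T U \<noteq> 0 \<longrightarrow> w \<in> group_diagrams m ?N \<and> T \<in> ?S \<and> U \<in> ?S"
    using 1 unfolding is_seminormal_def Let_def by (rule conjunct1)
  have s2: "\<forall>w T U. \<rho>' w T U \<noteq> 0 \<longrightarrow> w \<in> group_diagrams m ?N \<and> T \<in> ?S \<and> U \<in> ?S"
    using 2 unfolding is_seminormal_def Let_def by (rule conjunct1)
  have z: "\<not> (w \<in> group_diagrams m ?N \<and> T \<in> ?S \<and> U \<in> ?S) \<Longrightarrow> \<rho> w T U = 0 \<and> \<rho>' w T U = 0" for w T U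
    using s1 s2 by blast
  show ?thesis
  proof (intro ext)
    fix w T U show "\<rho> w T U = \<rho>' w T U"
      using P z by (cases "w \<in> group_diagrams m ?N \<and> T \<in> ?S \<and> U \<in> ?S") auto
  qed
qed

lemma seminormal_is_seminormal:
  fixes \<xi> :: "'k::field_char_0"
  assumes "\<And>\<mu>. \<mu> \<in> set lam \<Longrightarrow> is_partition \<mu>" "\<xi> ^ m = 1" "m > 0"
  shows "is_seminormal m \<xi> lam (seminormal m \<xi> lam)"
proof -
  interpret partition_shape lam by unfold_locales (rule assms(1))
  show ?thesis
    unfolding seminormal_def
    using seminormal_exists[OF assms(2,3)] seminormal_unique[OF assms(3)] by (metis theI)
qed

section \<open>The standard modules\<close>

text \<open>Pushforward of coefficients, that is, the linear extension of \<open>h\<close> to formal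
  sums over \<open>K\<close>.\<close>

definition push :: "'x set \<Rightarrow> ('x \<Rightarrow> 'x) \<Rightarrow> ('x \<Rightarrow> 'k::field) \<Rightarrow> 'x \<Rightarrow> 'k" where
  "push K h a Y = (\<Sum>X\<in>K. if h X = Y then a X else 0)"

lemma sum_push:
  assumes "finite K" "h ` K \<subseteq> K"
  shows "(\<Sum>Y\<in>K. push K h a Y * F Y) = (\<Sum>X\<in>K. a X * F (h X))"
proof -
  have "(\<Sum>Y\<in>K. push K h a Y * F Y) = (\<Sum>Y\<in>K. \<Sum>X\<in>K. if h X = Y then a X * F Y else 0)"
    by (simp add: push_def sum_distrib_right if_distrib[of "\<lambda>x. x * _"] cong: if_cong)
  also have "\<dots> = (\<Sum>X\<in>K. \<Sum>Y\<in>K. if h X = Y then a X * F Y else 0)" by (rule sum.swap)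
  also have "\<dots> = (\<Sum>X\<in>K. a X * F (h X))"
    by (rule sum.cong[OF refl]) (use assms in \<open>auto simp: sum.delta'\<close>)
  finally show ?thesis .
qed

text \<open>The diagram of t_1^j, written as a shift of the identity so that products with it reduce
  to shifts.\<close>

definition td :: "nat \<Rightarrow> nat \<Rightarrow> nat \<Rightarrow> diagram" where
  "td m n j = shift m (North 1) j (id_diagram n)"

definition single :: "diagram \<Rightarrow> diagram \<Rightarrow> 'k::field" where
  "single X = (\<lambda>D. if D = X then 1 else 0)"

lemma td_diagrams: "m > 0 \<Longrightarrow> td m n j \<in> diagrams m n n"
  unfolding td_def by (intro shift_diagrams group_diagrams_subset[OF id_diagram_group])

locale standard_module_data =
  fixes m p n N l :: nat and \<xi> :: "'k::field_char_0" and \<delta> :: "nat \<Rightarrow> 'k" and lam :: multipartition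
  assumes m: "m > 0" and n0: "n > 0" and \<xi>: "\<xi> ^ m = 1" and partitions: "\<And>\<mu>. \<mu> \<in> set lam \<Longrightarrow> is_partition \<mu>"
    and N: "N = mp_size lam" and n: "n = N + 2 * l"
begin

abbreviation "Dg \<equiv> diagrams m n n"
abbreviation "Da \<equiv> dangles m n l"
abbreviation "G \<equiv> group_diagrams m N"
abbreviation "S \<equiv> std_tableaux lam"
abbreviation "\<rho> \<equiv> seminormal m \<xi> lam"
abbreviation "A \<equiv> std_action_basis m p \<xi> \<delta> n lam"
abbreviation "Bs \<equiv> std_basis m n lam"
abbreviation "lf \<equiv> loop_factor m p \<delta>"

lemma l_eq: "(n - mp_size lam) div 2 = l" using n N by simp

lemma std_basis_eq: "Bs = Da \<times> S" unfolding std_basis_def l_eq ..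

lemma finite_S: "finite S" by (rule finite_std_tableaux)

lemma dangle: "v \<in> Da \<Longrightarrow> v \<in> diagrams m n N" by (rule dangleD(1)[OF _ n])

lemma finite_dangles: "finite Da"
  by (rule finite_subset[OF _ finite_diagrams[of m n N]]) (use dangle in blast)

lemma finite_std_basis: "finite Bs"
  unfolding std_basis_eq using finite_dangles finite_S by simp

lemma seminormal:
  "\<rho> w T U \<noteq> 0 \<Longrightarrow> w \<in> G \<and> T \<in> S \<and> U \<in> S"
  "T \<in> S \<Longrightarrow> U \<in> S \<Longrightarrow> \<rho> (id_diagram N) T U = (if U = T then 1 else 0)"
  "w \<in> G \<Longrightarrow> w' \<in> G \<Longrightarrow> T \<in> S \<Longrightarrow> U \<in> S \<Longrightarrow> \<rho> (concatenation m w w') T U = (\<Sum>V\<in>S. \<rho> w' T V * \<rho> w V U)"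
proof -
  have *: "is_seminormal m \<xi> lam \<rho>" by (rule seminormal_is_seminormal[OF partitions \<xi> m])
  show "\<rho> w T U \<noteq> 0 \<Longrightarrow> w \<in> G \<and> T \<in> S \<and> U \<in> S"
    using * unfolding is_seminormal_def Let_def N by blast
  show "T \<in> S \<Longrightarrow> U \<in> S \<Longrightarrow> \<rho> (id_diagram N) T U = (if U = T then 1 else 0)"
    using * unfolding is_seminormal_def Let_def N by blast
  show "w \<in> G \<Longrightarrow> w' \<in> G \<Longrightarrow> T \<in> S \<Longrightarrow> U \<in> S \<Longrightarrow> \<rho> (concatenation m w w') T U = (\<Sum>V\<in>S. \<rho> w' T V * \<rho> w V U)"
    using * unfolding is_seminormal_def Let_def N by blast
qed

text \<open>The vector \<open>v' \<otimes> w T\<close> attached to a diagram \<open>c\<close> that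
  factors as \<open>v'\<close> above \<open>w\<close>, and zero if \<open>c\<close> has too many
  arcs; the action is a loop factor times such a vector.\<close>

definition vec :: "diagram \<Rightarrow> tableau \<Rightarrow> diagram \<times> tableau \<Rightarrow> 'k" where
  "vec c T = (\<lambda>(u, U). if card (arcs c) > l then 0
     else let (v', w) = (THE (v', w). v' \<in> Da \<and> w \<in> G \<and> concatenation m v' w = c) in if u = v' then \<rho> w T U else 0)"

lemma action_vec: "A X (v, T) b = lf X v * vec (concatenation m X v) T b"
proof -
  have "(n - N) div 2 = l" using n by simp
  then show ?thesis
    unfolding std_action_basis_def vec_def Let_def N[symmetric] by (cases b) (simp add: case_prod_beta)
qed

lemma vec_many_arcs: "card (arcs c) > l \<Longrightarrow> vec c T b = 0"
  unfolding vec_def by (cases b) simp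

lemma vec_decomposed:
  assumes v: "v \<in> Da" and w: "w \<in> G"
  shows "vec (concatenation m v w) T (u, U) = (if u = v then \<rho> w T U else 0)"
proof -
  have "card (arcs (concatenation m v w)) = l"
    using card_arcs_group[OF dangle[OF v] w] dangleD(2)[OF v n] by simp
  moreover have "(THE (v', w'). v' \<in> Da \<and> w' \<in> G \<and> concatenation m v' w' = concatenation m v w) = (v, w)"
  proof (rule the_equality)
    show "case (v, w) of (v', w') \<Rightarrow> v' \<in> Da \<and> w' \<in> G \<and> concatenation m v' w' = concatenation m v w" using v w by simp
  next
    fix q assume "case q of (v', w') \<Rightarrow> v' \<in> Da \<and> w' \<in> G \<and> concatenation m v' w' = concatenation m v w"
    then obtain v' w' where q: "q = (v', w')" "v' \<in> Da" "w' \<in> G" "concatenation m v' w' = concatenation m v w" by (cases q) auto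
    show "q = (v, w)" using decomposition_unique[OF n q(2) v q(3) w q(4)] q(1) by simp
  qed
  ultimately show ?thesis unfolding vec_def by simp
qed

lemma vec_cases:
  assumes c: "c \<in> diagrams m n N"
  obtains "card (arcs c) > l" | v w where "v \<in> Da" "w \<in> G" "c = concatenation m v w"
  using decomposition_exists[OF m c n] by (metis not_le)

lemma vec_dangle:
  assumes "v \<in> Da" "T \<in> S"
  shows "vec v T b = (if b = (v, T) then 1 else 0)"
proof -
  obtain u U where b: "b = (u, U)" by (cases b)
  have i: "id_diagram N \<in> G" by (rule id_diagram_group[OF m])
  have "vec v T (u, U) = (if u = v then \<rho> (id_diagram N) T U else 0)"
    using vec_decomposed[OF assms(1) i] concatenation_id_right(1)[OF dangle[OF assms(1)]] by simp
  then show ?thesis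
    using seminormal(1)[of "id_diagram N" T U] seminormal(2)[OF assms(2), of U] assms(2) b by (cases "U \<in> S") auto
qed

lemma vec_nonzero:
  assumes "c \<in> diagrams m n N" "vec c T b \<noteq> 0"
  shows "b \<in> Bs"
proof -
  obtain u U where b: "b = (u, U)" by (cases b)
  show ?thesis
  proof (rule vec_cases[OF assms(1)])
    assume "card (arcs c) > l"
    then show ?thesis using assms(2) vec_many_arcs by simp
  next
    fix v w assume v: "v \<in> Da" "w \<in> G" "c = concatenation m v w"
    then have "u = v" "\<rho> w T U \<noteq> 0" using assms(2) unfolding b v(3) vec_decomposed[OF v(1,2)] by (auto split: if_splits)
    then show ?thesis using seminormal(1) v(1) unfolding b std_basis_eq by blast
  qed
qed

lemma sum_basis: "(\<Sum>b\<in>Bs. F b) = (\<Sum>u\<in>Da. \<Sum>U\<in>S. F (u, U))"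
  unfolding std_basis_eq by (simp add: sum.cartesian_product)

lemma sum_vec_decomposed:
  assumes v: "v \<in> Da" and w: "w \<in> G"
  shows "(\<Sum>b\<in>Bs. vec (concatenation m v w) T b * F b) = (\<Sum>U\<in>S. \<rho> w T U * F (v, U))"
proof -
  have "(\<Sum>b\<in>Bs. vec (concatenation m v w) T b * F b) = (\<Sum>u\<in>Da. if u = v then (\<Sum>U\<in>S. \<rho> w T U * F (v, U)) else 0)"
    unfolding sum_basis vec_decomposed[OF v w] by (rule sum.cong[OF refl]) auto
  then show ?thesis using v finite_dangles by simp
qed

text \<open>The factorisation of \<open>c\<close> absorbs a group diagram placed below into its
  group part, so that diagram acts on the tableau factor.\<close>

lemma vec_group:
  assumes c: "c \<in> diagrams m n N" and w: "w \<in> G" and T: "T \<in> S"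
  shows "vec (concatenation m c w) T b = (\<Sum>V\<in>S. \<rho> w T V * vec c V b)"
proof (rule vec_cases[OF c])
  assume "card (arcs c) > l"
  then show ?thesis using card_arcs_group[OF c w] by (simp add: vec_many_arcs)
next
  fix v w0 assume v: "v \<in> Da" "w0 \<in> G" "c = concatenation m v w0"
  obtain u U where b: "b = (u, U)" by (cases b)
  have e: "concatenation m c w = concatenation m v (concatenation m w0 w)"
    unfolding v(3) by (rule concatenation_group_assoc[OF dangle[OF v(1)] v(2) w])
  show ?thesis
  proof (cases "U \<in> S")
    case True
    then show ?thesis
      unfolding b e vec_decomposed[OF v(1) group_concatenation[OF v(2) w]] unfolding v(3) vec_decomposed[OF v(1,2)]
      using seminormal(3)[OF v(2) w T True] by simp
  next
    case False
    then have "\<rho> w' V U = 0" for w' V using seminormal(1) by blast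
    then show ?thesis
      unfolding b e vec_decomposed[OF v(1) group_concatenation[OF v(2) w]] unfolding v(3) vec_decomposed[OF v(1,2)] by simp
  qed
qed

text \<open>A label added at a northern node leaves the group part of the factorisation alone, so
  t_1^j may be applied before or after passing to vectors.\<close>

lemma vec_shift_North:
  assumes c: "c \<in> diagrams m n N" and T: "T \<in> S"
  shows "(\<Sum>(u, U)\<in>Bs. vec c T (u, U) * vec (shift m (North 1) j u) U b) = vec (shift m (North 1) j c) T b"
proof (rule vec_cases[OF c])
  assume "card (arcs c) > l"
  then show ?thesis using card_arcs_shift[OF c, of "North 1" j] by (simp add: vec_many_arcs)
next
  fix v w assume v: "v \<in> Da" "w \<in> G" "c = concatenation m v w"
  have "(\<Sum>(u, U)\<in>Bs. vec c T (u, U) * vec (shift m (North 1) j u) U b)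
      = (\<Sum>U\<in>S. \<rho> w T U * vec (shift m (North 1) j v) U b)"
    unfolding v(3) using sum_vec_decomposed[OF v(1,2), of T "\<lambda>(u, U). vec (shift m (North 1) j u) U b"] by (simp add: case_prod_beta)
  also have "\<dots> = vec (concatenation m (shift m (North 1) j v) w) T b"
    by (rule vec_group[OF shift_diagrams[OF m dangle[OF v(1)]] v(2) T, symmetric])
  also have "concatenation m (shift m (North 1) j v) w = shift m (North 1) j c"
    unfolding v(3) by (rule concatenation_shift_North(1)[OF dangle[OF v(1)] group_diagrams_subset[OF v(2)]])
  finally show ?thesis .
qed

text \<open>If node 1 lies on an arc, the shifted diagram is again a dangle and \<open>w\<close> is
  trivial. If it lies on a free line, the label slides to the southern end of that line and becomes
  a label of \<open>w\<close>.\<close>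

lemma shifted_dangle:
  assumes v: "v \<in> Da"
  obtains u w where "u \<in> Da" "w \<in> G" "shift m (North 1) j v = concatenation m u w"
    "\<And>X. X \<in> Dg \<Longrightarrow> concatenation m X (shift m (North 1) j v) = concatenation m (concatenation m X u) w"
    "\<And>X. X \<in> Dg \<Longrightarrow> lf X (shift m (North 1) j v) = lf X u"
proof -
  have vd: "v \<in> diagrams m n N" by (rule dangle[OF v])
  have iG: "id_diagram N \<in> G" by (rule id_diagram_group[OF m])
  have "North 1 \<in> nodes n N" using n0 by simp
  then obtain s where s: "s \<in> v" "North 1 \<in> fst s" using diagramsD(4)[OF vd] by blast
  show thesis
  proof (cases "s \<in> arcs v")
    case True
    let ?u = "shift m (North 1) j v"
    have only: "r = s" if "r \<in> v" "North 1 \<in> fst r" for r using diagramsD(5)[OF vd that(1) s(1) that(2) s(2)] .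
    have ud: "?u \<in> diagrams m n N" by (rule shift_diagrams[OF m vd])
    have "?u \<in> Da"
      unfolding dangles_def
    proof (intro CollectI conjI ballI allI impI)
      show "?u \<in> diagrams m n (n - 2 * l)" using ud n by simp
      show "card (arcs ?u) = l" using card_arcs_shift[OF vd] dangleD(2)[OF v n] by simp
    next
      fix r assume r: "r \<in> ?u - arcs ?u"
      then obtain i k where ik: "fst r = {North i, South k}" unfolding non_arc_iff by blast
      from r obtain r0 where r0: "r0 \<in> v" "fst r = fst r0" "snd r = (if North 1 \<in> fst r0 then (snd r0 + j) mod m else snd r0)"
        unfolding shift_def by auto
      have "r0 \<noteq> s" using True ik r0(2) unfolding arcs_def by auto
      then have "North 1 \<notin> fst r0" using only r0(1) by blast
      then show "snd r = 0" using dangleD(3)[OF v n r0(1)] ik r0(2,3) by simp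
    next
      fix r r' i k i' k' assume r: "r \<in> ?u" "r' \<in> ?u" "fst r = {North i, South k} \<and> fst r' = {North i', South k'} \<and> i < i'"
      then obtain r0 r0' where "r0 \<in> v" "r0' \<in> v" "fst r = fst r0" "fst r' = fst r0'" unfolding shift_def by auto
      then show "k < k'" using dangleD(4)[OF v n, of r0 r0' i k i' k'] r(3) by simp
    qed
    then show thesis
      using that[OF _ iG] concatenation_id_right(1)[OF ud]
      by (metis concatenation_id_right(1) concatenation_diagrams[OF _ ud m])
  next
    case False
    then obtain i k where ik: "fst s = {North i, South k}" using s(1) unfolding arcs_def by blast
    then have i: "i = 1" using s(2) by simp
    have k: "k \<in> {1..N}" using diagramsD(1)[OF vd s(1)] ik by simp
    let ?w = "shift m (South k) j (id_diagram N)"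
    \<comment> \<open>The label belongs to the strand, whichever of its two ends is named.\<close>
    have e: "shift m (North 1) j v = shift m (South k) j v"
      unfolding shift_def
    proof (rule image_cong[OF refl])
      fix r assume r: "r \<in> v"
      have "North 1 \<in> fst r \<longleftrightarrow> r = s" using diagramsD(5)[OF vd r s(1) _ s(2)] s(2) by blast
      moreover have "South k \<in> fst r \<longleftrightarrow> r = s" using diagramsD(5)[OF vd r s(1), of "South k"] ik by auto
      ultimately show "(fst r, if North 1 \<in> fst r then (snd r + j) mod m else snd r)
          = (fst r, if South k \<in> fst r then (snd r + j) mod m else snd r)" by simp
    qed
    have idd: "id_diagram N \<in> diagrams m N N" by (rule group_diagrams_subset[OF iG])
    have cs: "concatenation m x ?w = shift m (South k) j x" if x: "x \<in> diagrams m n N" for x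
      using concatenation_shift_South(1)[OF x idd] concatenation_id_right(1)[OF x] by simp
    have wd: "?w \<in> diagrams m N N" by (rule shift_diagrams[OF m idd])
    have "card (arcs ?w) = 0" using card_arcs_shift[OF idd, of "South k" j] iG by (simp add: group_diagrams_def)
    moreover have "finite (arcs ?w)" using finite_diagram[OF wd] by (simp add: arcs_def)
    ultimately have wG: "?w \<in> G" using wd by (simp add: group_diagrams_def)
    show thesis
    proof (rule that[OF v wG])
      show "shift m (North 1) j v = concatenation m v ?w" unfolding e cs[OF vd] ..
      show "concatenation m X (shift m (North 1) j v) = concatenation m (concatenation m X v) ?w" if X: "X \<in> Dg" for X
        unfolding e cs[OF concatenation_diagrams[OF X vd m]] by (rule concatenation_shift_South(1)[OF X vd])
      show "lf X (shift m (North 1) j v) = lf X v" if X: "X \<in> Dg" for X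
        unfolding e by (rule concatenation_shift_South(2)[OF X vd])
    qed
  qed
qed

lemma td_concatenation:
  assumes "u \<in> diagrams m n c"
  shows "concatenation m (td m n j) u = shift m (North 1) j u" "lf (td m n j) u = 1"
proof -
  have i: "id_diagram n \<in> diagrams m n n" by (rule group_diagrams_subset[OF id_diagram_group[OF m]])
  show "concatenation m (td m n j) u = shift m (North 1) j u"
    unfolding td_def concatenation_shift_North(1)[OF i assms] concatenation_id_left(1)[OF assms] ..
  show "lf (td m n j) u = 1"
    unfolding td_def concatenation_shift_North(2)[OF i assms] by (simp add: loop_factor_def concatenation_id_left(2)[OF assms])
qed

text \<open>One of the two instances of the module law in which a factor is a power of t_1; it holds
  because a northern shift of \<open>X\<close> commutes with placing \<open>X\<close> above a
  dangle.\<close>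

lemma action_td_left:
  assumes X: "X \<in> Dg" and b: "b \<in> Bs"
  shows "(\<Sum>b'\<in>Bs. A X b b' * A (td m n j) b' b'') = A (shift m (North 1) j X) b b''"
proof -
  obtain v T where b: "b = (v, T)" "v \<in> Da" "T \<in> S" using b unfolding std_basis_eq by auto
  have c: "concatenation m X v \<in> diagrams m n N" by (rule concatenation_diagrams[OF X dangle[OF b(2)] m])
  have "A X b b' * A (td m n j) b' b'' = lf X v * (case b' of (u, U) \<Rightarrow> vec (concatenation m X v) T (u, U) * vec (shift m (North 1) j u) U b'')"
    if b': "b' \<in> Bs" for b'
    using b' unfolding std_basis_eq by (auto simp: b(1) action_vec td_concatenation[OF dangle])
  then have "(\<Sum>b'\<in>Bs. A X b b' * A (td m n j) b' b'')
      = lf X v * (\<Sum>(u, U)\<in>Bs. vec (concatenation m X v) T (u, U) * vec (shift m (North 1) j u) U b'')"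
    by (simp add: sum_distrib_left)
  also have "\<dots> = lf X v * vec (shift m (North 1) j (concatenation m X v)) T b''"
    unfolding vec_shift_North[OF c b(3)] ..
  also have "\<dots> = A (shift m (North 1) j X) b b''"
    unfolding b(1) action_vec concatenation_shift_North[OF X dangle[OF b(2)]] ..
  finally show ?thesis .
qed

text \<open>The label that t_1^j puts on the dangle at node 1 slides across the middle node into
  \<open>X\<close>. The shifted dangle is factored beforehand, because it need not be a basis
  element.\<close>

lemma action_td_right:
  assumes X: "X \<in> Dg" and b: "b \<in> Bs"
  shows "(\<Sum>b'\<in>Bs. A (td m n j) b b' * A X b' b'') = A (shift m (South 1) j X) b b''"
proof -
  obtain v T where b: "b = (v, T)" "v \<in> Da" "T \<in> S" using b unfolding std_basis_eq by auto
  obtain u w where u: "u \<in> Da" "w \<in> G" "shift m (North 1) j v = concatenation m u w"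
    "concatenation m X (shift m (North 1) j v) = concatenation m (concatenation m X u) w"
    "lf X (shift m (North 1) j v) = lf X u"
    using shifted_dangle[OF b(2), of j] X by metis
  have "(\<Sum>b'\<in>Bs. A (td m n j) b b' * A X b' b'') = (\<Sum>b'\<in>Bs. vec (concatenation m u w) T b' * A X b' b'')"
    unfolding b(1) action_vec td_concatenation[OF dangle[OF b(2)]] u(3) by simp
  also have "\<dots> = (\<Sum>U\<in>S. \<rho> w T U * A X (u, U) b'')" by (rule sum_vec_decomposed[OF u(1,2)])
  also have "\<dots> = lf X u * (\<Sum>U\<in>S. \<rho> w T U * vec (concatenation m X u) U b'')"
    by (simp add: action_vec sum_distrib_left mult_ac)
  also have "\<dots> = lf X u * vec (concatenation m (concatenation m X u) w) T b''"
    unfolding vec_group[OF concatenation_diagrams[OF X dangle[OF u(1)] m] u(2) b(3)] ..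
  also have "\<dots> = A (shift m (South 1) j X) b b''"
    unfolding b(1) action_vec concatenation_shift_middle[OF X dangle[OF b(2)]] u(4,5) ..
  finally show ?thesis .
qed

section \<open>The standard module as a space of coefficient functions\<close>

abbreviation "\<Delta> \<equiv> Delta_bar m p \<xi> \<delta> n lam"
abbreviation "act \<equiv> (\<lambda>a f. a \<odot>\<^bsub>\<Delta>\<^esub> f)"

lemma Delta_bar_simps:
  "carrier \<Delta> = {f. \<forall>b. f b \<noteq> 0 \<longrightarrow> b \<in> Bs}" "\<zero>\<^bsub>\<Delta>\<^esub> = (\<lambda>b. 0)" "f \<oplus>\<^bsub>\<Delta>\<^esub> g = (\<lambda>b. f b + g b)"
  "act a f b' = (\<Sum>X\<in>Dg. \<Sum>b\<in>Bs. a X * f b * A X b b')"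
  by (simp_all add: Delta_bar_def)

lemma action_nonzero: "X \<in> Dg \<Longrightarrow> b \<in> Bs \<Longrightarrow> A X b b' \<noteq> 0 \<Longrightarrow> b' \<in> Bs"
  using vec_nonzero[OF concatenation_diagrams[OF _ dangle m], of X _ _ b']
  by (cases b) (simp add: action_vec std_basis_eq, blast)

lemma act_closed: "act a f \<in> carrier \<Delta>"
  unfolding Delta_bar_simps(1)
proof (intro CollectI allI impI)
  fix b' assume "act a f b' \<noteq> 0"
  then obtain X where X: "X \<in> Dg" "(\<Sum>b\<in>Bs. a X * f b * A X b b') \<noteq> 0"
    unfolding Delta_bar_simps(4) by (rule sum.not_neutral_contains_not_neutral)
  then obtain b where "b \<in> Bs" "a X * f b * A X b b' \<noteq> 0" by (meson sum.not_neutral_contains_not_neutral)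
  then show "b' \<in> Bs" using action_nonzero[OF X(1)] by simp
qed

lemma abelian_group_Delta_bar: "abelian_group \<Delta>"
proof (rule abelian_groupI)
  show "\<exists>y\<in>carrier \<Delta>. y \<oplus>\<^bsub>\<Delta>\<^esub> x = \<zero>\<^bsub>\<Delta>\<^esub>" if "x \<in> carrier \<Delta>" for x
    by (rule bexI[of _ "\<lambda>b. - x b"]) (use that in \<open>auto simp: Delta_bar_simps\<close>)
  show "x \<oplus>\<^bsub>\<Delta>\<^esub> y \<in> carrier \<Delta>" if "x \<in> carrier \<Delta>" "y \<in> carrier \<Delta>" for x y
    using that unfolding Delta_bar_simps mem_Collect_eq by (metis add.right_neutral)
qed (auto simp: Delta_bar_simps add_ac)

lemma act_add_left: "act (\<lambda>X. a X + b X) f = act a f \<oplus>\<^bsub>\<Delta>\<^esub> act b f"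
  by (rule ext) (simp add: Delta_bar_simps sum.distrib algebra_simps)

lemma act_add_right: "act a (\<lambda>b. f b + g b) = (\<lambda>b. act a f b + act a g b)"
  by (rule ext) (simp add: Delta_bar_simps sum.distrib algebra_simps)

lemma act_scale: "act (\<lambda>X. c * a X) f = (\<lambda>b. c * act a f b)" "act a (\<lambda>b. c * f b) = (\<lambda>b. c * act a f b)"
  by (rule ext, simp add: Delta_bar_simps sum_distrib_left mult_ac)+

lemma act_td: "act (single (td m n j)) f b' = (\<Sum>b\<in>Bs. f b * A (td m n j) b b')"
proof -
  have "act (single (td m n j)) f b' = (\<Sum>X\<in>Dg. if X = td m n j then (\<Sum>b\<in>Bs. f b * A X b b') else 0)"
    unfolding Delta_bar_simps(4) by (rule sum.cong[OF refl]) (simp add: single_def)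
  then show ?thesis using td_diagrams[OF m] finite_diagrams by simp
qed

lemma act_td_zero:
  assumes "f \<in> carrier \<Delta>"
  shows "act (single (td m n 0)) f = f"
proof
  fix b'
  have t: "td m n 0 = id_diagram n"
    unfolding td_def by (rule shift_multiple[OF group_diagrams_subset[OF id_diagram_group[OF m]]]) simp
  have "A (td m n 0) b b' = (if b' = b then 1 else 0)" if "b \<in> Bs" for b
    using that unfolding std_basis_eq
    by (auto simp: action_vec td_concatenation[OF dangle] shift_multiple[OF dangle] vec_dangle)
  then have "act (single (td m n 0)) f b' = (\<Sum>b\<in>Bs. if b' = b then f b else 0)"
    unfolding act_td by (intro sum.cong[OF refl]) simp
  then show "act (single (td m n 0)) f b' = f b'"
    using assms finite_std_basis by (auto simp: Delta_bar_simps(1))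
qed

lemma act_push:
  assumes "h ` Dg \<subseteq> Dg"
  shows "act (push Dg h a) f b' = (\<Sum>X\<in>Dg. \<Sum>b\<in>Bs. a X * f b * A (h X) b b')"
  unfolding Delta_bar_simps(4)
  using sum_push[OF finite_diagrams assms, of a "\<lambda>X. \<Sum>b\<in>Bs. f b * A X b b'"] by (simp add: sum_distrib_left mult.assoc)

lemma act_td_left: "act (single (td m n j)) (act a f) = act (push Dg (shift m (North 1) j) a) f"
proof
  fix b'
  have "act (single (td m n j)) (act a f) b' = (\<Sum>b\<in>Bs. \<Sum>X\<in>Dg. \<Sum>b0\<in>Bs. a X * f b0 * (A X b0 b * A (td m n j) b b'))"
    unfolding act_td unfolding Delta_bar_simps(4) by (simp add: sum_distrib_right mult.assoc)
  also have "\<dots> = (\<Sum>X\<in>Dg. \<Sum>b0\<in>Bs. \<Sum>b\<in>Bs. a X * f b0 * (A X b0 b * A (td m n j) b b'))"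
    by (rule trans[OF sum.swap sum.cong[OF refl sum.swap]])
  also have "\<dots> = (\<Sum>X\<in>Dg. \<Sum>b0\<in>Bs. a X * f b0 * A (shift m (North 1) j X) b0 b')"
    by (intro sum.cong[OF refl]) (simp add: sum_distrib_left[symmetric] action_td_left)
  finally show "act (single (td m n j)) (act a f) b' = act (push Dg (shift m (North 1) j) a) f b'"
    using act_push shift_diagrams[OF m] by (simp add: image_subset_iff)
qed

lemma act_td_right: "act a (act (single (td m n j)) f) = act (push Dg (shift m (South 1) j) a) f"
proof
  fix b'
  have "act a (act (single (td m n j)) f) b' = (\<Sum>X\<in>Dg. \<Sum>b\<in>Bs. \<Sum>b0\<in>Bs. a X * f b0 * (A (td m n j) b0 b * A X b b'))"
    unfolding Delta_bar_simps(4)[where a = a] act_td by (simp add: sum_distrib_right sum_distrib_left mult_ac)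
  also have "\<dots> = (\<Sum>X\<in>Dg. \<Sum>b0\<in>Bs. \<Sum>b\<in>Bs. a X * f b0 * (A (td m n j) b0 b * A X b b'))"
    by (rule sum.cong[OF refl], rule sum.swap)
  also have "\<dots> = (\<Sum>X\<in>Dg. \<Sum>b0\<in>Bs. a X * f b0 * A (shift m (South 1) j X) b0 b')"
    by (intro sum.cong[OF refl]) (simp add: sum_distrib_left[symmetric] action_td_right)
  finally show "act a (act (single (td m n j)) f) b' = act (push Dg (shift m (South 1) j) a) f b'"
    using act_push shift_diagrams[OF m] by (simp add: image_subset_iff)
qed

end

section \<open>Rotation of tableaux\<close>

text \<open>\<open>length xs - k mod length xs\<close> is the inverse rotation as a natural number;
  for a multiple of the length it is a full turn.\<close>

lemma rotate_inverse: "rotate (length xs - k mod length xs) (rotate k xs) = xs"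
proof (cases "xs = []")
  case False
  then have "(length xs - k mod length xs + k) mod length xs = 0"
    by (metis add.commute add_diff_inverse_nat length_greater_0_conv less_imp_le_nat mod_add_left_eq mod_less_divisor mod_self not_le)
  then show ?thesis by (simp add: rotate_rotate)
qed simp

lemma inj_rotate: "inj (rotate k)"
  by (rule injI) (metis length_rotate rotate_inverse)

lemma surj_rotate: "surj (rotate k)"
  unfolding rotate_def by (metis bij_fn bij_rotate1 bij_is_surj)

lemma rotate_funpow: "(rotate d ^^ k) xs = rotate (d * k) xs"
  by (induction k) (simp_all add: rotate_rotate add.commute)

lemma concat_rotate:
  obtains ys zs where "concat xs = ys @ zs" "concat (rotate k xs) = zs @ ys"
  using that[of "concat (take (k mod length xs) xs)" "concat (drop (k mod length xs) xs)"]
  by (metis append_take_drop_id concat_append rotate_drop_take)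

lemma mp_size_rotate: "mp_size (rotate k lam) = mp_size lam"
proof -
  let ?xs = "map sum_list lam" and ?a = "k mod length lam"
  have "sum_list (rotate k ?xs) = sum_list (drop ?a ?xs) + sum_list (take ?a ?xs)" by (simp add: rotate_drop_take)
  also have "\<dots> = sum_list ?xs" by (metis add.commute append_take_drop_id sum_list_append)
  finally show ?thesis unfolding mp_size_def rotate_map .
qed

lemma rotate_std_tableaux:
  assumes T: "T \<in> std_tableaux lam"
  shows "rotate k T \<in> std_tableaux (rotate k lam)"
proof -
  obtain ys zs where c: "concat T = ys @ zs" "concat (rotate k T) = zs @ ys" by (rule concat_rotate)
  have e: "distinct (concat (concat (rotate k T)))" "set (concat (concat (rotate k T))) = {1..mp_size lam}"
    using std_tableauxD(2,3)[OF T] unfolding c by auto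
  have nth: "rotate k T ! a = T ! ((k + a) mod length T)" "(k + a) mod length T < length T" if "a < length T" for a
    using that by (simp add: nth_rotate, intro mod_less_divisor, linarith)
  show ?thesis
    unfolding std_tableaux_def
  proof (intro CollectI conjI allI impI)
    show "map (map length) (rotate k T) = rotate k lam" using std_tableauxD(1)[OF T] by (metis rotate_map)
    show "distinct (concat (concat (rotate k T)))" by (rule e)
    show "set (concat (concat (rotate k T))) = {1..mp_size (rotate k lam)}" unfolding mp_size_rotate by (rule e)
    fix a i assume a: "a < length (rotate k T)" "i < length (rotate k T ! a)"
    then show "sorted_wrt (<) (rotate k T ! a ! i)" using nth[of a] std_tableauxD(4)[OF T] by simp
  next
    fix a i j assume a: "a < length (rotate k T)" "Suc i < length (rotate k T ! a) \<and> j < length (rotate k T ! a ! Suc i)"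
    then show "rotate k T ! a ! i ! j < rotate k T ! a ! Suc i ! j" using nth[of a] std_tableauxD(5)[OF T] by simp
  qed
qed

lemma rotate_index:
  fixes L :: nat
  assumes "c < L"
  shows "(k + (c + (L - k mod L)) mod L) mod L = c"
proof -
  have "k mod L < L" using assms by simp
  then have "k mod L + (c + (L - k mod L)) = c + L" by linarith
  then have "(k mod L + (c + (L - k mod L))) mod L = c" using assms by simp
  then show ?thesis by (metis mod_add_left_eq mod_add_right_eq)
qed

text \<open>Component \<open>c\<close> becomes component \<open>c - k\<close> modulo the number of
  components, the difference being written with natural numbers.\<close>

lemma position_rotate:
  assumes T: "T \<in> std_tableaux lam" and x: "x \<in> {1..mp_size lam}"
  shows "position (rotate k T) x = (case position T x of (c, i, j) \<Rightarrow> ((c + (length lam - k mod length lam)) mod length lam, i, j))"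
proof -
  obtain c i j where p: "position T x = (c, i, j)" by (cases "position T x")
  have L: "length T = length lam" using std_tableauxD(1)[OF T] by (metis length_map)
  have cell: "is_cell T (c, i, j)" "entry T (c, i, j) = x" using position_props[OF T x] unfolding p .
  then have c: "c < length lam" unfolding is_cell_def L by simp
  let ?c = "(c + (length lam - k mod length lam)) mod length lam"
  have c': "?c < length T" unfolding L using c by (intro mod_less_divisor) linarith
  have n: "rotate k T ! ?c = T ! c" unfolding nth_rotate[OF c'] unfolding L rotate_index[OF c] ..
  have "position (rotate k T) x = (?c, i, j)"
    using cell c' n by (intro position_eqI[OF rotate_std_tableaux[OF T]]) (simp_all add: is_cell_def entry_def)
  then show ?thesis using p by simp
qed

lemma inv_axial_rotate:
  assumes T: "T \<in> std_tableaux lam" and i: "i \<in> {1..<mp_size lam}"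
  shows "inv_axial (rotate k T) i = inv_axial T i"
proof -
  have x: "i \<in> {1..mp_size lam}" "Suc i \<in> {1..mp_size lam}" using i by auto
  have L: "length T = length lam" using std_tableauxD(1)[OF T] by (metis length_map)
  have b: "fst (position T i) < length lam" "fst (position T (Suc i)) < length lam"
    using position_props(1)[OF T x(1)] position_props(1)[OF T x(2)] L by (auto simp: is_cell_def split: prod.splits)
  have f: "fst (position (rotate k T) y) = (fst (position T y) + (length lam - k mod length lam)) mod length lam"
    "snd (position (rotate k T) y) = snd (position T y)" if "y \<in> {1..mp_size lam}" for y
    unfolding position_rotate[OF T that] by (simp_all add: case_prod_beta)
  have "fst (position (rotate k T) i) = fst (position (rotate k T) (Suc i)) \<longleftrightarrow> fst (position T i) = fst (position T (Suc i))"
    unfolding f(1)[OF x(1)] f(1)[OF x(2)] using rotate_index[OF b(1), of k] rotate_index[OF b(2), of k] by metis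
  then show ?thesis
    unfolding inv_axial_content content_inverse_def by (simp add: f(2)[OF x(1)] f(2)[OF x(2)])
qed

lemma swap_entries_rotate: "swap_entries i (rotate k T) = rotate k (swap_entries i T)"
  unfolding swap_entries_def by (rule rotate_map[symmetric])

lemma label_sum_perm_diagram: "label_sum (perm_diagram N \<pi> z) = (\<Sum>i\<in>{1..N}. z i)"
proof -
  have "inj_on (\<lambda>i. ({North i, South (\<pi> i)}, z i)) {1..N}" by (rule inj_onI) (auto simp: doubleton_eq_iff)
  then show ?thesis unfolding label_sum_def perm_diagram_def by (subst sum.reindex) (simp_all add: o_def)
qed

lemma label_sum_group:
  assumes x: "x \<in> diagrams m a b" and w: "w \<in> group_diagrams m b"
  shows "label_sum (concatenation m x w) mod m = (label_sum x + label_sum w) mod m"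
  using label_sum_concatenation[OF x group_diagrams_subset[OF w]] loops_group[OF x w] by simp

lemma rotate_fixed_inverse:
  assumes "rotate k lam = lam"
  shows "rotate (length lam - k mod length lam) lam = lam"
  by (metis assms rotate_inverse)

lemma rotate_std_iff:
  assumes k: "rotate k lam = lam"
  shows "rotate k T \<in> std_tableaux lam \<longleftrightarrow> T \<in> std_tableaux lam"
proof
  assume T: "rotate k T \<in> std_tableaux lam"
  have "length T = length lam" using std_tableauxD(1)[OF T] by (metis length_map length_rotate)
  then show "T \<in> std_tableaux lam"
    using rotate_std_tableaux[OF T, of "length lam - k mod length lam"] rotate_fixed_inverse[OF k] by (metis rotate_inverse)
qed (use rotate_std_tableaux[of T lam k] k in simp)

lemma bij_betw_rotate_std:
  assumes k: "rotate k lam = lam"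
  shows "bij_betw (rotate k) (std_tableaux lam) (std_tableaux lam)"
proof (rule bij_betwI')
  fix T U show "rotate k T = rotate k U \<longleftrightarrow> T = U" using inj_rotate by (metis injD)
next
  fix T assume "T \<in> std_tableaux lam" then show "rotate k T \<in> std_tableaux lam" using rotate_std_iff[OF k] by simp
next
  fix U assume U: "U \<in> std_tableaux lam"
  obtain T where "U = rotate k T" using surj_rotate[of k] by (metis surjD)
  then show "\<exists>T\<in>std_tableaux lam. U = rotate k T" using U rotate_std_iff[OF k] by blast
qed

text \<open>Rotation by \<open>k\<close> lowers all components by \<open>k\<close> and so multiplies
  the eigenvalue of t_1 by \<xi>^(-k); the twist by the label sum restores it. The twisted rotated
  matrices then satisfy the conditions that characterise the seminormal form, and uniqueness gives
  equality.\<close>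

lemma seminormal_rotate:
  fixes \<xi> :: "'k::field_char_0"
  assumes part: "\<And>\<mu>. \<mu> \<in> set lam \<Longrightarrow> is_partition \<mu>" and \<xi>: "\<xi> ^ m = 1" and m: "m > 0"
    and L: "length lam = m" and k: "rotate k lam = lam"
  shows "seminormal m \<xi> lam w T U = \<xi> ^ (label_sum w * k) * seminormal m \<xi> lam w (rotate k T) (rotate k U)"
proof -
  let ?\<rho> = "seminormal m \<xi> lam" and ?N = "mp_size lam" and ?S = "std_tableaux lam" and ?G = "group_diagrams m (mp_size lam)"
  let ?\<rho>' = "\<lambda>w T U. \<xi> ^ (label_sum w * k) * ?\<rho> w (rotate k T) (rotate k U)"
  have s: "is_seminormal m \<xi> lam ?\<rho>" by (rule seminormal_is_seminormal[OF part \<xi> m])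
  note s' = s[unfolded is_seminormal_def Let_def]
  have eq: "rotate k T = rotate k U \<longleftrightarrow> T = U" for T U :: tableau using inj_rotate by (metis injD)
  note r = rotate_std_iff[OF k]
  have "is_seminormal m \<xi> lam ?\<rho>'"
    unfolding is_seminormal_def Let_def
  proof (intro conjI allI ballI impI)
    fix w T U assume "?\<rho>' w T U \<noteq> 0"
    then have "?\<rho> w (rotate k T) (rotate k U) \<noteq> 0" by auto
    then have "w \<in> ?G" "rotate k T \<in> ?S" "rotate k U \<in> ?S" using s' by blast+
    then show "w \<in> ?G" "T \<in> ?S" "U \<in> ?S" unfolding r by blast+
  next
    fix T U assume T: "T \<in> ?S" "U \<in> ?S"
    have "label_sum (id_diagram ?N) = 0" unfolding id_diagram_perm label_sum_perm_diagram by simp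
    moreover have "?\<rho> (id_diagram ?N) (rotate k T) (rotate k U) = (if rotate k U = rotate k T then 1 else 0)"
      using s' T unfolding r[symmetric, of T] r[symmetric, of U] by blast
    ultimately show "?\<rho>' (id_diagram ?N) T U = (if U = T then 1 else 0)" using eq by simp
  next
    fix w w' T U assume w: "w \<in> ?G" "w' \<in> ?G" and T: "T \<in> ?S" "U \<in> ?S"
    have "?\<rho> (concatenation m w w') (rotate k T) (rotate k U) = (\<Sum>V\<in>?S. ?\<rho> w' (rotate k T) V * ?\<rho> w V (rotate k U))"
      using s' w T unfolding r[symmetric, of T] r[symmetric, of U] by blast
    \<comment> \<open>Rotation permutes the standard tableaux of a shape that it fixes, so the
      summation index may be rotated.\<close>
    also have "\<dots> = (\<Sum>V\<in>?S. ?\<rho> w' (rotate k T) (rotate k V) * ?\<rho> w (rotate k V) (rotate k U))"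
      by (rule sum.reindex_bij_betw[OF bij_betw_rotate_std[OF k], symmetric])
    finally have c: "?\<rho> (concatenation m w w') (rotate k T) (rotate k U)
        = (\<Sum>V\<in>?S. ?\<rho> w' (rotate k T) (rotate k V) * ?\<rho> w (rotate k V) (rotate k U))" .
    have "\<xi> ^ (label_sum (concatenation m w w') * k) = \<xi> ^ ((label_sum w + label_sum w') * k)"
      by (rule power_mod_root[OF \<xi> label_sum_group[OF group_diagrams_subset[OF w(1)] w(2)]])
    also have "\<dots> = \<xi> ^ (label_sum w * k) * \<xi> ^ (label_sum w' * k)" by (simp add: power_add algebra_simps)
    finally show "?\<rho>' (concatenation m w w') T U = (\<Sum>V\<in>?S. ?\<rho>' w' T V * ?\<rho>' w V U)"
      unfolding c by (simp add: sum_distrib_left mult_ac)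
  next
    fix T U assume N1: "1 \<le> ?N" and T: "T \<in> ?S" "U \<in> ?S"
    have x: "1 \<in> {1..?N}" using N1 by simp
    have "(\<Sum>i\<in>{1..?N}. if i = 1 then 1 mod m else 0) = 1 mod m" using N1 by simp
    then have ls: "label_sum (t1_diagram m ?N) = 1 mod m" unfolding t1_diagram_perm[OF N1] label_sum_perm_diagram .
    have "?\<rho> (t1_diagram m ?N) (rotate k T) (rotate k U) = (if rotate k U = rotate k T then \<xi> ^ comp_of (rotate k T) 1 else 0)"
      using s' N1 T unfolding r[symmetric, of T] r[symmetric, of U] by blast
    moreover have "\<xi> ^ (1 mod m * k) * \<xi> ^ comp_of (rotate k T) 1 = \<xi> ^ comp_of T 1"
    proof -
      have cT: "comp_of T 1 < m"
        using position_props(1)[OF T(1) x] std_tableauxD(1)[OF T(1)] L unfolding comp_of_def is_cell_def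
        by (metis (mono_tags, lifting) case_prod_beta length_map)
      have cr: "comp_of (rotate k T) 1 = (comp_of T 1 + (m - k mod m)) mod m"
        unfolding comp_of_def position_rotate[OF T(1) x] L by (simp add: case_prod_beta)
      have "\<xi> ^ (1 mod m * k) = \<xi> ^ (1 * k)" by (rule power_mod_root[OF \<xi>]) simp
      then have "\<xi> ^ (1 mod m * k) * \<xi> ^ comp_of (rotate k T) 1 = \<xi> ^ ((k + comp_of (rotate k T) 1) * 1)" by (simp add: power_add)
      also have "\<dots> = \<xi> ^ (comp_of T 1 * 1)"
        by (rule power_mod_root[OF \<xi>]) (unfold cr rotate_index[OF cT], simp only: mod_less[OF cT])
      finally show ?thesis by simp
    qed
    ultimately show "?\<rho>' (t1_diagram m ?N) T U = (if U = T then \<xi> ^ comp_of T 1 else 0)" unfolding ls using eq by auto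
  next
    fix i T U assume i: "i \<in> {1..<?N}" and T: "T \<in> ?S" "U \<in> ?S"
    have ls: "label_sum (s_diagram ?N i) = 0" unfolding s_diagram_perm label_sum_perm_diagram by simp
    have "?\<rho> (s_diagram ?N i) (rotate k T) (rotate k U) =
        (if rotate k U = rotate k T then inv_axial (rotate k T) i else 0) +
        (if rotate k U = swap_entries i (rotate k T) then 1 + inv_axial (rotate k T) i else 0)"
      using s' i T unfolding r[symmetric, of T] r[symmetric, of U] by blast
    then show "?\<rho>' (s_diagram ?N i) T U = (if U = T then inv_axial T i else 0) + (if U = swap_entries i T then 1 + inv_axial T i else 0)"
      unfolding ls inv_axial_rotate[OF T(1) i] swap_entries_rotate eq by simp
  qed
  then have "?\<rho> = ?\<rho>'" by (rule seminormal_unique[OF m s])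
  then show ?thesis by (rule fun_cong[OF fun_cong[OF fun_cong]])
qed

section \<open>The operator \<open>\<sigma>\<^sup>t\<close>\<close>

lemma sigma_map_funpow:
  "(sigma_map d \<xi> ^^ k) f (v, U) = \<xi> ^ (d * k * label_sum v) * f (v, (inv_into UNIV (rotate d) ^^ k) U)"
  by (induction k arbitrary: U) (simp_all add: sigma_map_def power_add[symmetric] algebra_simps funpow_swap1[of "inv_into UNIV (rotate d)"])

lemma rotate_inv_funpow:
  "(inv_into UNIV (rotate d) ^^ k) (rotate (d * k) U) = U" "rotate (d * k) ((inv_into UNIV (rotate d) ^^ k) U) = U"
proof -
  have 1: "inv_into UNIV (rotate d) (rotate d V) = V" for V :: "'a list" by (rule inv_into_f_f[OF inj_rotate UNIV_I])
  have "(inv_into UNIV (rotate d) ^^ k) ((rotate d ^^ k) V) = V" for V :: "'a list"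
    by (induction k arbitrary: V) (simp_all add: funpow_swap1 1)
  then show *: "(inv_into UNIV (rotate d) ^^ k) (rotate (d * k) U) = U" for U :: "'a list" unfolding rotate_funpow .
  obtain V where "U = rotate (d * k) V" using surj_rotate by (metis surjD)
  then show "rotate (d * k) ((inv_into UNIV (rotate d) ^^ k) U) = U" using * by simp
qed

lemma sum_Suc_cyclic:
  fixes h :: "nat \<Rightarrow> 'a::ab_group_add"
  assumes "h q = h 0"
  shows "(\<Sum>j<q. h (Suc j)) = (\<Sum>j<q. h j)"
proof -
  have "(\<Sum>j<q. h j) + h q = h 0 + (\<Sum>j<q. h (Suc j))"
    using sum.lessThan_Suc_shift[of h q] unfolding sum.lessThan_Suc .
  then show ?thesis using assms by (simp add: add.commute)
qed

locale standard_module_stabilizer = standard_module_data m p n N l \<xi> \<delta> lam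
  for m p n N l :: nat and \<xi> :: "'k::field_char_0" and \<delta> lam +
  fixes d t :: nat
  assumes primitive: "primitive_root_of_unity m \<xi>" and mpd: "m = p * d" and td: "t dvd p" and p0: "p > 0" and L: "length lam = m" and fixed: "rotate (d * t) lam = lam"
begin

abbreviation "\<tau> \<equiv> rotate (d * t)"
abbreviation "\<tau>' \<equiv> inv_into UNIV (rotate d) ^^ t"

definition Es :: "(diagram \<times> tableau \<Rightarrow> 'k) \<Rightarrow> diagram \<times> tableau \<Rightarrow> 'k" where
  "Es f = (sigma_map d \<xi> ^^ t) f"

lemma Es_apply: "Es f (v, U) = \<xi> ^ (label_sum v * (d * t)) * f (v, \<tau>' U)"
  unfolding Es_def sigma_map_funpow by (simp add: mult_ac)

text \<open>\<xi>^(dty) = 1 whenever \<open>p\<close> divides \<open>y\<close>, so the labels of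
  \<open>X\<close> and of the loops drop out of the twist. What is left compares the label sum of
  \<open>v\<close> with those of the resulting dangle and of \<open>w\<close>, and the share of
  \<open>w\<close> is the twist in \<open>seminormal_rotate\<close>.\<close>

lemma action_Es:
  assumes X: "X \<in> Dg" "p dvd label_sum X" and v: "v \<in> Da"
  shows "\<xi> ^ (label_sum u * (d * t)) * A X (v, T) (u, U) = \<xi> ^ (label_sum v * (d * t)) * A X (v, \<tau> T) (u, \<tau> U)"
proof (cases "lf X v = 0")
  case True
  then show ?thesis by (simp add: action_vec)
next
  case False
  have fl: "finite (loops X v)"
    unfolding loops_def using finite_components[OF finite_xy[OF X(1) dangle[OF v]]] by simp
  \<comment> \<open>A nonzero loop factor excludes loops whose label is not divisible by
    \<open>p\<close>.\<close>
  have "p dvd component_label m C" if "C \<in> loops X v" for C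
    using False that fl unfolding loop_factor_def loop_value_def by (auto split: if_splits)
  then have pl: "p dvd (\<Sum>C\<in>loops X v. component_label m C)" by (rule dvd_sum)
  have c: "concatenation m X v \<in> diagrams m n N" by (rule concatenation_diagrams[OF X(1) dangle[OF v] m])
  have "vec (concatenation m X v) T (u, U) * \<xi> ^ (label_sum u * (d * t)) = \<xi> ^ (label_sum v * (d * t)) * vec (concatenation m X v) (\<tau> T) (u, \<tau> U)"
  proof (rule vec_cases[OF c])
    assume "card (arcs (concatenation m X v)) > l"
    then show ?thesis by (simp add: vec_many_arcs)
  next
    fix v' w assume w: "v' \<in> Da" "w \<in> G" "concatenation m X v = concatenation m v' w"
    let ?q = "\<Sum>C\<in>loops X v. component_label m C"
    have "(label_sum X + label_sum v) mod m = (label_sum (concatenation m X v) + ?q) mod m"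
      by (rule label_sum_concatenation[OF X(1) dangle[OF v]])
    also have "\<dots> = (label_sum v' + label_sum w + ?q) mod m"
      using label_sum_group[OF dangle[OF w(1)] w(2)] unfolding w(3) by (metis mod_add_left_eq)
    finally have mm: "(label_sum X + label_sum v) mod m = (label_sum v' + label_sum w + ?q) mod m" .
    have "\<xi> ^ ((label_sum X + label_sum v) * (d * t)) = \<xi> ^ ((label_sum v' + label_sum w + ?q) * (d * t))"
      by (rule power_mod_root[OF \<xi> mm])
    moreover have "\<xi> ^ (y * (d * t)) = 1" if py: "p dvd y" for y
    proof -
      obtain z where "y = p * z" by (rule dvdE[OF py])
      then have "\<xi> ^ (y * (d * t)) = (\<xi> ^ m) ^ (z * t)" unfolding mpd power_mult[symmetric] by (simp add: mult_ac)
      then show ?thesis by (simp add: \<xi>)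
    qed
    ultimately have e: "\<xi> ^ (label_sum v * (d * t)) = \<xi> ^ (label_sum v' * (d * t)) * \<xi> ^ (label_sum w * (d * t))"
      using X(2) pl by (simp add: distrib_right power_add)
    have r: "\<rho> w T U = \<xi> ^ (label_sum w * (d * t)) * \<rho> w (\<tau> T) (\<tau> U)"
      by (rule seminormal_rotate[OF partitions \<xi> m L fixed])
    show ?thesis
      unfolding w(3) vec_decomposed[OF w(1,2)] e r by simp
  qed
  then show ?thesis unfolding action_vec by (simp add: mult_ac)
qed

lemma Es_act:
  assumes a: "a \<in> carrier (brauer_mpn m p n \<delta>)"
  shows "act a (Es f) = Es (act a f)"
proof (rule ext)
  fix b' :: "diagram \<times> tableau"
  \<comment> \<open>The tableau is written as a rotation, so that the inverse rotation inside
    \<open>Es\<close> cancels.\<close>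
  obtain u U where b': "b' = (u, \<tau> U)" using rotate_inv_funpow(2)[of d t "snd b'"] by (metis prod.collapse)
  have aX: "X \<in> Dg \<and> p dvd label_sum X" if "a X \<noteq> 0" for X using a that by (simp add: brauer_mpn_def brauer_span_def)
  have "act a (Es f) b' = (\<Sum>X\<in>Dg. \<Sum>v\<in>Da. \<Sum>T\<in>S. a X * Es f (v, T) * A X (v, T) (u, \<tau> U))"
    unfolding Delta_bar_simps(4) sum_basis b' ..
  also have "\<dots> = (\<Sum>X\<in>Dg. \<Sum>v\<in>Da. \<Sum>T\<in>S. a X * Es f (v, \<tau> T) * A X (v, \<tau> T) (u, \<tau> U))"
    by (intro sum.cong[OF refl] sum.reindex_bij_betw[OF bij_betw_rotate_std[OF fixed], symmetric])
  also have "\<dots> = (\<Sum>X\<in>Dg. \<Sum>v\<in>Da. \<Sum>T\<in>S. \<xi> ^ (label_sum u * (d * t)) * (a X * f (v, T) * A X (v, T) (u, U)))"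
  proof (rule sum.cong[OF refl], rule sum.cong[OF refl], rule sum.cong[OF refl])
    fix X v T assume X: "X \<in> Dg" and v: "v \<in> Da"
    show "a X * Es f (v, \<tau> T) * A X (v, \<tau> T) (u, \<tau> U) = \<xi> ^ (label_sum u * (d * t)) * (a X * f (v, T) * A X (v, T) (u, U))"
    proof (cases "a X = 0")
      case False
      have "a X * Es f (v, \<tau> T) * A X (v, \<tau> T) (u, \<tau> U)
          = a X * f (v, T) * (\<xi> ^ (label_sum v * (d * t)) * A X (v, \<tau> T) (u, \<tau> U))"
        unfolding Es_apply rotate_inv_funpow by (simp add: mult_ac)
      then show ?thesis unfolding action_Es[OF X _ v, symmetric, OF conjunct2[OF aX[OF False]]] by (simp add: mult_ac)
    qed simp
  qed
  also have "\<dots> = Es (act a f) b'"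
    unfolding b' Es_apply rotate_inv_funpow Delta_bar_simps(4) sum_basis by (simp add: sum_distrib_left)
  finally show "act a (Es f) b' = Es (act a f) b'" .
qed

lemma Es_closed:
  assumes f: "f \<in> carrier \<Delta>"
  shows "Es f \<in> carrier \<Delta>"
  unfolding Delta_bar_simps(1)
proof (intro CollectI allI impI)
  fix b assume b: "Es f b \<noteq> 0"
  obtain v U where vU: "b = (v, \<tau> U)" using rotate_inv_funpow(2)[of d t "snd b"] by (metis prod.collapse)
  then have "f (v, U) \<noteq> 0" using b by (simp add: Es_apply rotate_inv_funpow)
  then have "v \<in> Da" "U \<in> S" using f unfolding Delta_bar_simps(1) std_basis_eq by auto
  then show "b \<in> Bs" using vU rotate_std_iff[OF fixed] unfolding std_basis_eq by simp
qed

lemma Es_add: "Es (\<lambda>b. f b + g b) = (\<lambda>b. Es f b + Es g b)"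
  proof
  fix b show "Es (\<lambda>b. f b + g b) b = Es f b + Es g b" by (cases b) (simp add: Es_apply algebra_simps)
qed

lemma Es_scale: "Es (\<lambda>b. c * f b) = (\<lambda>b. c * Es f b)"
proof
  fix b show "Es (\<lambda>b. c * f b) b = c * Es f b" by (cases b) (simp add: Es_apply)
qed

section \<open>Decomposition of the standard module into eigenspaces\<close>

definition q :: nat where "q = p div t"
text \<open>A primitive \<open>q\<close>-th root of unity; the eigenvalue \<xi>^(dtr) is its
  \<open>r\<close>-th power.\<close>

definition \<eta> :: 'k where "\<eta> = \<xi> ^ (d * t)"

lemma tq: "t * q = p" unfolding q_def using td by simp

lemma q0: "q > 0" using tq p0 by (metis gr0I mult_is_0 less_irrefl)

lemma Es_funpow: "(Es ^^ j) f = (sigma_map d \<xi> ^^ (t * j)) f"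
proof (induction j)
  case (Suc j)
  then show ?case by (simp add: Es_def funpow_add o_def)
qed simp

text \<open>The \<open>q\<close>-th power is inverse rotation by \<open>d * p = m\<close>, trivial
  on lists of length \<open>m\<close>, with a twist by a power of \<xi>^m = 1.\<close>

lemma Es_power_q:
  assumes f: "f \<in> carrier \<Delta>"
  shows "(Es ^^ q) f = f"
proof
  fix b :: "diagram \<times> tableau"
  obtain v U where b: "b = (v, U)" by (cases b)
  let ?V = "(inv_into UNIV (rotate d) ^^ p) U"
  have U: "U = rotate m ?V" using rotate_inv_funpow(2)[of d p U] mpd by (simp add: mult.commute)
  have "\<xi> ^ (d * p * label_sum v) = 1" using \<xi> mpd by (metis mult.commute power_mult power_one)
  then have e: "(Es ^^ q) f (v, U) = f (v, ?V)" unfolding Es_funpow tq sigma_map_funpow by simp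
  have "f (v, ?V) = f (v, U)"
  proof (cases "length U = m")
    case True
    then have "length ?V = m" using U by (metis length_rotate)
    then show ?thesis using U by simp
  next
    case False
    then have "length ?V \<noteq> m" using U by (metis length_rotate)
    \<comment> \<open>A list of any other length is not a standard tableau of the shape, and
      \<open>f\<close> vanishes there.\<close>
    have "f (v, W) = 0" if "length W \<noteq> m" for W
      using f that std_tableauxD(1)[of W lam] L unfolding Delta_bar_simps(1) std_basis_eq by (metis (mono_tags, lifting) length_map mem_Collect_eq mem_Sigma_iff)
    then show ?thesis using False \<open>length ?V \<noteq> m\<close> by simp
  qed
  then show "(Es ^^ q) f b = f b" using e b by simp
qed

lemma Es_funpow_props:
  "f \<in> carrier \<Delta> \<Longrightarrow> (Es ^^ j) f \<in> carrier \<Delta>"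
  "(Es ^^ j) (\<lambda>b. f b + g b) = (\<lambda>b. (Es ^^ j) f b + (Es ^^ j) g b)"
  "a \<in> carrier (brauer_mpn m p n \<delta>) \<Longrightarrow> (Es ^^ j) (act a f) = act a ((Es ^^ j) f)"
  by (induction j) (simp_all add: Es_closed Es_add Es_act)

abbreviation "\<Delta>r \<equiv> Delta m p d \<xi> \<delta> n lam t"

lemma Delta_simps:
  "carrier (\<Delta>r r) = {f \<in> carrier \<Delta>. Es f = (\<lambda>b. \<eta> ^ r * f b)}" "\<zero>\<^bsub>\<Delta>r r\<^esub> = (\<lambda>b. 0)" "f \<oplus>\<^bsub>\<Delta>r r\<^esub> g = (\<lambda>b. f b + g b)"
  "a \<in> carrier (brauer_mpn m p n \<delta>) \<Longrightarrow> a \<odot>\<^bsub>\<Delta>r r\<^esub> f = act a f"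
  by (auto simp: Delta_def restrict_scalars_def Es_def \<eta>_def power_mult[symmetric] Delta_bar_simps(2,3) mult_ac)

lemma Es_eigen: "f \<in> carrier (\<Delta>r r) \<Longrightarrow> (Es ^^ j) f = (\<lambda>b. \<eta> ^ (r * j) * f b)"
proof (induction j)
  case (Suc j)
  then have e: "Es f = (\<lambda>b. \<eta> ^ r * f b)" by (simp add: Delta_simps(1))
  have "(Es ^^ Suc j) f = Es (\<lambda>b. \<eta> ^ (r * j) * f b)" using Suc by simp
  also have "\<dots> = (\<lambda>b. \<eta> ^ (r * Suc j) * f b)" unfolding Es_scale e by (simp add: power_add mult_ac)
  finally show ?case .
qed simp

text \<open>The spectral projection of \<sigma>^t for the eigenvalue
  \<open>\<eta> ^ r\<close>.\<close>

definition \<pi> :: "nat \<Rightarrow> (diagram \<times> tableau \<Rightarrow> 'k) \<Rightarrow> diagram \<times> tableau \<Rightarrow> 'k" where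
  "\<pi> r f b = (\<Sum>j<q. inverse \<eta> ^ (r * j) * (Es ^^ j) f b) / of_nat q"

lemma \<eta>: "\<eta> ^ q = 1" "0 < j \<Longrightarrow> j < q \<Longrightarrow> \<eta> ^ j \<noteq> 1" "\<eta> \<noteq> 0"
proof -
  have dt: "d * t * q = m" using tq mpd by (simp add: mult_ac)
  show e: "\<eta> ^ q = 1" unfolding \<eta>_def power_mult[symmetric] dt by (rule \<xi>)
  show "\<eta> ^ j \<noteq> 1" if j: "0 < j" "j < q"
  proof -
    have "d * t > 0" using dt m by (metis gr0I mult_is_0 less_irrefl)
    then have "0 < d * t * j" "d * t * j < m" using j dt by (simp, metis mult_less_cancel1)
    then show ?thesis using primitive unfolding \<eta>_def power_mult[symmetric] primitive_root_of_unity_def by blast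
  qed
  show "\<eta> \<noteq> 0" using e q0 by (metis power_0_left less_irrefl zero_neq_one)
qed

lemma \<pi>_closed:
  assumes f: "f \<in> carrier \<Delta>"
  shows "\<pi> r f \<in> carrier \<Delta>"
  using Es_funpow_props(1)[OF f] unfolding Delta_bar_simps(1) \<pi>_def by (auto intro!: sum.neutral)

lemma Es_sum: "Es (\<lambda>b. \<Sum>j\<in>J. c j * F j b) = (\<lambda>b. \<Sum>j\<in>J. c j * Es (F j) b)"
proof
  fix b show "Es (\<lambda>b. \<Sum>j\<in>J. c j * F j b) b = (\<Sum>j\<in>J. c j * Es (F j) b)"
    by (cases b) (simp add: Es_apply sum_distrib_left mult_ac)
qed

text \<open>Applying \<open>Es\<close> shifts the summation index by one, and the summand is
  periodic in that index with period \<open>q\<close>.\<close>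

lemma \<pi>_eigen:
  assumes f: "f \<in> carrier \<Delta>"
  shows "\<pi> r f \<in> carrier (\<Delta>r r)"
proof -
  have "Es (\<pi> r f) b = \<eta> ^ r * \<pi> r f b" for b
  proof -
    let ?h = "\<lambda>j. \<eta> ^ r * inverse \<eta> ^ (r * j) * (Es ^^ j) f b"
    have "inverse \<eta> ^ (r * q) = 1" using \<eta>(1) by (metis inverse_1 mult.commute power_inverse power_mult power_one)
    then have hq: "?h q = ?h 0" by (simp add: Es_power_q[OF f])
    have s: "(\<Sum>j<q. ?h (Suc j)) = (\<Sum>j<q. ?h j)" by (rule sum_Suc_cyclic[of ?h, OF hq])
    have h: "?h (Suc j) = inverse \<eta> ^ (r * j) * Es ((Es ^^ j) f) b" for j
      using \<eta>(3) by (simp add: power_add field_simps)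
    have "\<pi> r f = (\<lambda>b. inverse (of_nat q) * (\<Sum>j<q. inverse \<eta> ^ (r * j) * (Es ^^ j) f b))"
      by (rule ext) (simp add: \<pi>_def field_simps)
    then have "Es (\<pi> r f) b = inverse (of_nat q) * (\<Sum>j<q. inverse \<eta> ^ (r * j) * Es ((Es ^^ j) f) b)"
      by (simp add: Es_scale Es_sum)
    also have "\<dots> = inverse (of_nat q) * (\<Sum>j<q. ?h j)" unfolding h[symmetric] s ..
    also have "\<dots> = \<eta> ^ r * \<pi> r f b" by (simp add: \<pi>_def sum_distrib_left divide_inverse mult_ac)
    finally show ?thesis .
  qed
  then show ?thesis unfolding Delta_simps(1) using \<pi>_closed[OF f] by auto
qed

lemma finsum_Delta_bar:
  assumes "finite I" "F \<in> I \<rightarrow> carrier \<Delta>"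
  shows "finsum \<Delta> F I = (\<lambda>b. \<Sum>i\<in>I. F i b)"
proof -
  interpret abelian_group \<Delta> by (rule abelian_group_Delta_bar)
  show ?thesis using assms
    by (induction I rule: finite_induct) (simp_all add: Delta_bar_simps(2,3) Pi_def)
qed

text \<open>Character orthogonality in \<open>r\<close> leaves only the zeroth power of
  \<open>Es\<close>.\<close>

lemma sum_\<pi>:
  assumes f: "f \<in> carrier \<Delta>"
  shows "(\<Sum>r<q. \<pi> r f b) = f b"
proof -
  have "(\<Sum>r<q. \<pi> r f b) = (\<Sum>r<q. \<Sum>j<q. inverse \<eta> ^ (r * j) * (Es ^^ j) f b) / of_nat q"
    unfolding \<pi>_def by (rule sum_divide_distrib[symmetric])
  also have "(\<Sum>r<q. \<Sum>j<q. inverse \<eta> ^ (r * j) * (Es ^^ j) f b) = (\<Sum>j<q. \<Sum>r<q. inverse \<eta> ^ (r * j) * (Es ^^ j) f b)"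
    by (rule sum.swap)
  also have "\<dots> = (\<Sum>j<q. (\<Sum>r<q. \<eta> ^ (0 * r) * inverse \<eta> ^ (j * r)) * (Es ^^ j) f b)"
    by (simp add: sum_distrib_left mult.commute)
  also have "\<dots> = (\<Sum>j<q. if j = 0 then of_nat q * f b else 0)"
    by (rule sum.cong[OF refl]) (subst sum_root_of_unity_powers[OF \<eta>(1,2) q0], auto)
  also have "\<dots> = of_nat q * f b" using q0 by simp
  finally show ?thesis using q0 by simp
qed

text \<open>On an eigenvector the projection becomes a character sum.\<close>

lemma \<pi>_orthogonal:
  assumes f: "f \<in> carrier (\<Delta>r s)" and r: "r < q" "s < q"
  shows "\<pi> r f = (if r = s then f else (\<lambda>b. 0))"
proof
  fix b
  have "\<pi> r f b = (\<Sum>j<q. \<eta> ^ (s * j) * inverse \<eta> ^ (r * j)) * f b / of_nat q"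
    unfolding \<pi>_def Es_eigen[OF f] by (simp add: sum_distrib_left mult_ac)
  also have "\<dots> = (if r = s then f else (\<lambda>b. 0)) b"
    using q0 by (subst sum_root_of_unity_powers[OF \<eta>(1,2) r(2,1)]) auto
  finally show "\<pi> r f b = (if r = s then f else (\<lambda>b. 0)) b" .
qed

abbreviation "Ap \<equiv> brauer_mpn m p n \<delta>"

lemma op_module_Delta_bar: "op_module Rr \<Delta>"
proof -
  interpret abelian_group \<Delta> by (rule abelian_group_Delta_bar)
  show ?thesis
    by unfold_locales (simp_all add: act_closed act_add_right Delta_bar_simps(3))
qed

lemma Delta_closed:
  "f \<in> carrier (\<Delta>r r) \<Longrightarrow> g \<in> carrier (\<Delta>r r) \<Longrightarrow> (\<lambda>b. f b + g b) \<in> carrier (\<Delta>r r)"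
  "f \<in> carrier (\<Delta>r r) \<Longrightarrow> (\<lambda>b. c * f b) \<in> carrier (\<Delta>r r)"
  "a \<in> carrier Ap \<Longrightarrow> f \<in> carrier (\<Delta>r r) \<Longrightarrow> act a f \<in> carrier (\<Delta>r r)"
proof -
  interpret abelian_group \<Delta> by (rule abelian_group_Delta_bar)
  show "f \<in> carrier (\<Delta>r r) \<Longrightarrow> g \<in> carrier (\<Delta>r r) \<Longrightarrow> (\<lambda>b. f b + g b) \<in> carrier (\<Delta>r r)"
    using a_closed[of f g] unfolding Delta_bar_simps(3) Delta_simps(1) by (simp add: Es_add distrib_left)
  show "f \<in> carrier (\<Delta>r r) \<Longrightarrow> (\<lambda>b. c * f b) \<in> carrier (\<Delta>r r)"
    unfolding Delta_simps(1) by (simp add: Es_scale mult_ac) (simp add: Delta_bar_simps(1))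
  show "a \<in> carrier Ap \<Longrightarrow> f \<in> carrier (\<Delta>r r) \<Longrightarrow> act a f \<in> carrier (\<Delta>r r)"
    unfolding Delta_simps(1) by (simp add: act_closed Es_act[symmetric] act_scale(2))
qed

lemma op_module_Delta: "op_module Ap (\<Delta>r r)"
proof -
  interpret abelian_group "\<Delta>r r"
  proof (rule abelian_groupI)
    show "\<exists>y\<in>carrier (\<Delta>r r). y \<oplus>\<^bsub>\<Delta>r r\<^esub> x = \<zero>\<^bsub>\<Delta>r r\<^esub>" if "x \<in> carrier (\<Delta>r r)" for x
      by (rule bexI[OF _ Delta_closed(2)[OF that, of "-1"]]) (simp add: Delta_simps)
    show "\<zero>\<^bsub>\<Delta>r r\<^esub> \<in> carrier (\<Delta>r r)"
      using Es_scale[of 0 "\<lambda>b. 0"] by (simp add: Delta_simps Delta_bar_simps(1))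
  qed (simp_all add: Delta_simps(2,3) Delta_closed(1) add_ac)
  show ?thesis
    by unfold_locales (simp_all add: Delta_simps(3,4) Delta_closed act_add_right)
qed

text \<open>The spectral projections are homomorphisms over \<open>A\<close> because
  \<open>Es\<close> commutes with \<open>A\<close>; with the inclusions of the eigenspaces they form
  a direct sum decomposition.\<close>

theorem head_Delta_bar: "mod_isomorphic Ap (module_head Ap \<Delta>) (dsum {r. r < q} (\<lambda>r. module_head Ap (\<Delta>r r)))"
proof (rule head_direct_sum[OF op_module_Delta_bar _ op_module_Delta])
  show "finite {r. r < q}" by simp
  have e: "(Es ^^ j) (act a f) b = act a ((Es ^^ j) f) b" if "a \<in> carrier Ap" for a f j b
    by (simp only: Es_funpow_props(3)[OF that])
  have lin: "act a (\<lambda>b. \<Sum>j\<in>J. c j * F j b) = (\<lambda>b. \<Sum>j\<in>J. c j * act a (F j) b)" for a c F and J :: "nat set"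
  proof (induction J rule: infinite_finite_induct)
    case (insert x J)
    then show ?case by (simp add: act_add_right act_scale(2))
  qed (simp_all add: Delta_bar_simps(4))
  show "\<pi> r \<in> mod_hom Ap \<Delta> (\<Delta>r r)" for r
  proof (rule mod_homI)
    show "\<pi> r x \<in> carrier (\<Delta>r r)" if "x \<in> carrier \<Delta>" for x by (rule \<pi>_eigen[OF that])
    show "\<pi> r (x \<oplus>\<^bsub>\<Delta>\<^esub> y) = \<pi> r x \<oplus>\<^bsub>\<Delta>r r\<^esub> \<pi> r y" for x y
      unfolding Delta_simps(3) Delta_bar_simps(3)
      by (rule ext) (simp add: \<pi>_def Es_funpow_props(2) distrib_left sum.distrib add_divide_distrib)
    show "\<pi> r (act a x) = a \<odot>\<^bsub>\<Delta>r r\<^esub> \<pi> r x" if a: "a \<in> carrier Ap" for a x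
    proof -
      have p: "\<pi> r x = (\<lambda>b. inverse (of_nat q) * (\<Sum>j<q. inverse \<eta> ^ (r * j) * (Es ^^ j) x b))" for x
        by (rule ext) (simp add: \<pi>_def field_simps)
      show ?thesis unfolding Delta_simps(4)[OF a] p act_scale(2) lin e[OF a] ..
    qed
  qed
  show "(\<lambda>x. x) \<in> mod_hom Ap (\<Delta>r r) \<Delta>" for r
    by (rule mod_homI) (simp_all add: Delta_simps Delta_bar_simps(3))
  show "\<pi> r y = (if r = s then y else \<zero>\<^bsub>\<Delta>r r\<^esub>)" if "r \<in> {r. r < q}" "s \<in> {r. r < q}" "y \<in> carrier (\<Delta>r s)" for r s y
    using \<pi>_orthogonal[OF that(3)] that(1,2) by (simp add: Delta_simps(2))
  show "x = finsum \<Delta> (\<lambda>r. \<pi> r x) {r. r < q}" if x: "x \<in> carrier \<Delta>" for x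
  proof -
    have "finsum \<Delta> (\<lambda>r. \<pi> r x) {..<q} = (\<lambda>b. \<Sum>r<q. \<pi> r x b)"
      by (rule finsum_Delta_bar) (use \<pi>_closed[OF x] in auto)
    also have "\<dots> = x" by (rule ext) (rule sum_\<pi>[OF x])
    finally show ?thesis unfolding lessThan_def by (rule sym)
  qed
qed

end

section \<open>Radicals under a cyclic extension\<close>

context cyclic_extension
begin

text \<open>The normalisation read in the other direction, obtained from it for the inverse power
  \<open>E^(m - i)\<close>.\<close>

lemma Ei_normal':
  assumes i: "i \<le> m" and a: "a \<in> carrier R"
  shows "\<exists>a'\<in>carrier R. \<forall>x\<in>carrier M. (E ^^ i) (a \<odot>\<^bsub>M\<^esub> x) = a' \<odot>\<^bsub>M\<^esub> (E ^^ i) x"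
proof -
  obtain a' where a': "a' \<in> carrier R" "\<And>x. x \<in> carrier M \<Longrightarrow> a \<odot>\<^bsub>M\<^esub> (E ^^ (m - i)) x = (E ^^ (m - i)) (a' \<odot>\<^bsub>M\<^esub> x)"
    using Ei_normal[OF a, of "m - i"] by auto
  show ?thesis
  proof (rule bexI[OF _ a'(1)], rule ballI)
    fix x assume x: "x \<in> carrier M"
    have "(E ^^ (m - i)) ((E ^^ i) x) = x" using E_inverse[of "m - i", OF _ x] i by simp
    then have "(E ^^ i) (a \<odot>\<^bsub>M\<^esub> x) = (E ^^ i) ((E ^^ (m - i)) (a' \<odot>\<^bsub>M\<^esub> (E ^^ i) x))"
      using a'(2)[OF Ei_closed[OF x, of i]] by simp
    also have "\<dots> = a' \<odot>\<^bsub>M\<^esub> (E ^^ i) x"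
      by (rule E_inverse[OF i smult_closed[OF a'(1) Ei_closed[OF x]]])
    finally show "(E ^^ i) (a \<odot>\<^bsub>M\<^esub> x) = a' \<odot>\<^bsub>M\<^esub> (E ^^ i) x" .
  qed
qed

lemma preimage_Ei_submodule:
  assumes i: "i \<le> m" and N: "submodule N R M"
  shows "submodule {y \<in> carrier M. (E ^^ i) y \<in> N} R M"
proof (rule submoduleI)
  have add: "(E ^^ i) (x \<oplus>\<^bsub>M\<^esub> y) = (E ^^ i) x \<oplus>\<^bsub>M\<^esub> (E ^^ i) y" if "x \<in> carrier M" "y \<in> carrier M" for x y by (rule Ei_add[OF that])
  have zero: "(E ^^ i) \<zero>\<^bsub>M\<^esub> = \<zero>\<^bsub>M\<^esub>"
    using add[of "\<zero>\<^bsub>M\<^esub>" "\<zero>\<^bsub>M\<^esub>"] Ei_closed[of "\<zero>\<^bsub>M\<^esub>" i] by simp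
  show "{y \<in> carrier M. (E ^^ i) y \<in> N} \<subseteq> carrier M" by auto
  show "\<zero>\<^bsub>M\<^esub> \<in> {y \<in> carrier M. (E ^^ i) y \<in> N}" using zero submoduleD(2)[OF N] by simp
  show "x \<oplus>\<^bsub>M\<^esub> y \<in> {y \<in> carrier M. (E ^^ i) y \<in> N}" if "x \<in> {y \<in> carrier M. (E ^^ i) y \<in> N}" "y \<in> {y \<in> carrier M. (E ^^ i) y \<in> N}" for x y
    using that add submoduleD(3)[OF N] by simp
  show "\<ominus>\<^bsub>M\<^esub> x \<in> {y \<in> carrier M. (E ^^ i) y \<in> N}" if x: "x \<in> {y \<in> carrier M. (E ^^ i) y \<in> N}" for x
  proof -
    have xc: "x \<in> carrier M" using x by simp
    have "(E ^^ i) x \<oplus>\<^bsub>M\<^esub> (E ^^ i) (\<ominus>\<^bsub>M\<^esub> x) = \<zero>\<^bsub>M\<^esub>" using add[OF xc M.a_inv_closed[OF xc]] zero xc by (simp add: M.r_neg)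
    then have "(E ^^ i) (\<ominus>\<^bsub>M\<^esub> x) = \<ominus>\<^bsub>M\<^esub> ((E ^^ i) x)"
      using M.minus_equality[of "(E ^^ i) (\<ominus>\<^bsub>M\<^esub> x)" "(E ^^ i) x"] Ei_closed xc by (simp add: M.a_comm)
    then show ?thesis using x xc submoduleD(4)[OF N] by simp
  qed
  show "a \<odot>\<^bsub>M\<^esub> x \<in> {y \<in> carrier M. (E ^^ i) y \<in> N}" if "a \<in> carrier R" "x \<in> {y \<in> carrier M. (E ^^ i) y \<in> N}" for a x
  proof -
    have x: "x \<in> carrier M" "(E ^^ i) x \<in> N" using that(2) by auto
    obtain a' where "a' \<in> carrier R" "(E ^^ i) (a \<odot>\<^bsub>M\<^esub> x) = a' \<odot>\<^bsub>M\<^esub> (E ^^ i) x"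
      using bspec[OF _ x(1)] Ei_normal'[OF i \<open>a \<in> carrier R\<close>] by blast
    then show ?thesis using that(1) x smult_closed submoduleD(5)[OF N] by simp
  qed
qed

text \<open>\<open>E\<close> is a bijection with inverse \<open>E^(m - 1)\<close> that normalises
  the operators, so it permutes the submodules and with them the maximal ones.\<close>

lemma preimage_maximal:
  assumes m: "m > 0" and N: "maximal_submodule R M N"
  shows "maximal_submodule R M {y \<in> carrier M. E y \<in> N}"
proof -
  let ?N = "{y \<in> carrier M. E y \<in> N}"
  have Ns: "submodule N R M" and Nne: "N \<noteq> carrier M"
    and Nmax: "\<And>N'. submodule N' R M \<Longrightarrow> N \<subseteq> N' \<Longrightarrow> N' = N \<or> N' = carrier M"
    using N unfolding maximal_submodule_def by auto
  have inv: "E ((E ^^ (m - 1)) x) = x" "(E ^^ (m - 1)) (E x) = x" if "x \<in> carrier M" for x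
    using E_inverse[of 1, OF _ that] E_inverse[of "m - 1", OF _ that] m by simp_all
  have Nc: "x \<in> N \<Longrightarrow> x \<in> carrier M" for x by (rule submoduleD(1)[OF Ns])
  have s: "submodule ?N R M" using preimage_Ei_submodule[of 1, OF _ Ns] m by simp
  show ?thesis
    unfolding maximal_submodule_def
  proof (intro conjI allI impI)
    show "submodule ?N R M" by (rule s)
    show "?N \<noteq> carrier M"
    proof
      assume "?N = carrier M"
      then have "x \<in> N" if "x \<in> carrier M" for x using inv(1)[OF that] Ei_closed[OF that, of "m - 1"] by (metis (no_types, lifting) mem_Collect_eq)
      then show False using Nne Nc by blast
    qed
    fix N' assume "submodule N' R M \<and> ?N \<subseteq> N'"
    then have N': "submodule N' R M" "?N \<subseteq> N'" by auto
    let ?N2 = "{y \<in> carrier M. (E ^^ (m - 1)) y \<in> N'}"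
    have "submodule ?N2 R M" by (rule preimage_Ei_submodule[OF _ N'(1)]) simp
    moreover have "N \<subseteq> ?N2"
    proof
      fix x assume x: "x \<in> N"
      then have "(E ^^ (m - 1)) x \<in> ?N" using inv(1)[OF Nc[OF x]] Ei_closed[OF Nc[OF x]] by simp
      then show "x \<in> ?N2" using N'(2) Nc[OF x] by blast
    qed
    ultimately consider "?N2 = N" | "?N2 = carrier M" using Nmax by blast
    then show "N' = ?N \<or> N' = carrier M"
    proof cases
      case 1
      have "y \<in> ?N" if y: "y \<in> N'" for y
      proof -
        have yc: "y \<in> carrier M" by (rule submoduleD(1)[OF N'(1) y])
        have "E y \<in> ?N2" using inv(2)[OF yc] y E_closed[OF yc] by simp
        then show ?thesis unfolding 1 using yc by simp
      qed
      then show ?thesis using N'(2) by blast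
    next
      case 2
      have "y \<in> N'" if y: "y \<in> carrier M" for y
      proof -
        have "E y \<in> ?N2" unfolding 2 by (rule E_closed[OF y])
        then show ?thesis using inv(2)[OF y] by simp
      qed
      then have "N' = carrier M" using submoduleD(1)[OF N'(1)] by blast
      then show ?thesis ..
    qed
  qed
qed

lemma radical_extension:
  assumes m: "m > 0" and R': "op_module R' M"
    and sub: "\<And>N. submodule N R' M \<longleftrightarrow> submodule N R M \<and> (\<forall>x\<in>N. E x \<in> N)"
    and G: "finite G" "G \<subseteq> carrier M" "\<And>N. submodule N R M \<Longrightarrow> G \<subseteq> N \<Longrightarrow> N = carrier M"
  shows "module_radical R' M = module_radical R M"
proof -
  interpret R': op_module R' M by fact
  let ?r = "module_radical R M" and ?r' = "module_radical R' M"
  have in_rad: "K \<subseteq> module_radical Q M" if K: "superfluous Q M K" and Q: "op_module Q M" for Q :: "('a, 'r2) ring_scheme" and K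
  proof -
    interpret Q: op_module Q M by (rule Q)
    have "K \<subseteq> carrier M" using K Q.submoduleD(1)[of K] unfolding superfluous_def by blast
    then show ?thesis using Q.superfluous_subset_maximal[OF K] unfolding module_radical_def by blast
  qed
  have s': "superfluous R' M ?r'" by (rule R'.radical_superfluous[OF G(1,2)]) (use sub G(3) in blast)
  have s: "superfluous R M ?r" by (rule radical_superfluous[OF G])
  have "superfluous R M ?r'"
  proof (rule superfluous_restrict)
    show "submodule ?r' R M" "\<And>x. x \<in> ?r' \<Longrightarrow> E x \<in> ?r'" using s' sub unfolding superfluous_def by blast+
    fix N assume "submodule N R M" "\<And>x. x \<in> N \<Longrightarrow> E x \<in> N" "set_add M N ?r' = carrier M"
    then show "N = carrier M" using s' sub unfolding superfluous_def by blast
  qed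
  then have 1: "?r' \<subseteq> ?r"
    using superfluous_subset_maximal submoduleD(1)[of ?r'] unfolding module_radical_def superfluous_def by blast
  have "E x \<in> ?r" if x: "x \<in> ?r" for x
  proof -
    have xc: "x \<in> carrier M" using x unfolding module_radical_def by blast
    have "E x \<in> N" if "maximal_submodule R M N" for N
      using preimage_maximal[OF m that] x unfolding module_radical_def by blast
    then show ?thesis using E_closed[OF xc] unfolding module_radical_def by blast
  qed
  then have "submodule ?r R' M" using sub submodule_radical by blast
  then have "superfluous R' M ?r" using s sub unfolding superfluous_def by blast
  then have "?r \<subseteq> ?r'"
    using R'.superfluous_subset_maximal R'.submoduleD(1)[of ?r] unfolding module_radical_def superfluous_def by blast
  then show ?thesis using 1 by blast
qed

end

section \<open>Restriction from \<open>B\<^bsub>m,1,n\<^esub>\<close> to \<open>B\<^bsub>m,p,n\<^esub>\<close>\<close>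

lemma push_eq: "push K h a Y = (\<Sum>X\<in>K. a X * (if h X = Y then 1 else 0))"
  unfolding push_def by (rule sum.cong[OF refl]) simp

lemma push_push:
  assumes "finite K" "h ` K \<subseteq> K"
  shows "push K g (push K h a) = push K (\<lambda>X. g (h X)) a"
proof
  fix Y show "push K g (push K h a) Y = push K (\<lambda>X. g (h X)) a Y"
    unfolding push_eq[of K g] push_eq[of K "\<lambda>X. g (h X)"] by (rule sum_push[OF assms])
qed

lemma push_nonzero: "push K h a Y \<noteq> 0 \<Longrightarrow> \<exists>X\<in>K. h X = Y \<and> a X \<noteq> 0"
proof -
  assume "push K h a Y \<noteq> 0"
  then obtain X where "X \<in> K" "(if h X = Y then a X else 0) \<noteq> 0"
    unfolding push_def by (rule sum.not_neutral_contains_not_neutral)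
  then show ?thesis by (auto split: if_splits)
qed

lemma push_add: "push K h (\<lambda>X. a X + b X) = (\<lambda>Y. push K h a Y + push K h b Y)"
  by (rule ext) (simp add: push_def sum.distrib[symmetric] if_distrib cong: if_cong)

lemma push_identity:
  assumes "finite K" "\<And>X. X \<in> K \<Longrightarrow> h X = X" "\<And>X. a X \<noteq> 0 \<Longrightarrow> X \<in> K"
  shows "push K h a = a"
proof
  fix Y
  have "push K h a Y = (\<Sum>X\<in>K. if X = Y then a X else 0)" unfolding push_def by (rule sum.cong[OF refl]) (simp add: assms(2))
  then show "push K h a Y = a Y" using assms(1) assms(3)[of Y] by auto
qed

lemma push_single:
  assumes "finite K" "D \<in> K"
  shows "push K h (single D) = single (h D)"
proof
  fix Y
  have "push K h (single D) Y = (\<Sum>X\<in>K. if X = D then (if h D = Y then 1 else 0) else 0)"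
    unfolding push_def single_def by (rule sum.cong[OF refl]) auto
  also have "\<dots> = (if h D = Y then 1 else 0)" using assms by simp
  also have "\<dots> = single (h D) Y" by (auto simp: single_def)
  finally show "push K h (single D) Y = single (h D) Y" .
qed

locale brauer_algebras =
  fixes m p n :: nat and \<delta> :: "nat \<Rightarrow> 'k::field"
  assumes m: "m > 0" and n0: "n > 0" and p0: "p > 0" and pm: "p dvd m"
begin

abbreviation "Dg \<equiv> diagrams m n n"
abbreviation "Bo \<equiv> brauer_m1n m p n \<delta>"
abbreviation "Ap \<equiv> brauer_mpn m p n \<delta>"
abbreviation "tt j \<equiv> single (td m n j)"
abbreviation "psh u j \<equiv> push Dg (shift m u j)"
abbreviation "sc c \<equiv> (\<lambda>X. c * tt 0 X)"

text \<open>The component of degree \<open>i\<close> for the grading by label sums modulo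
  \<open>p\<close>.\<close>

definition gp :: "nat \<Rightarrow> (diagram \<Rightarrow> 'k) \<Rightarrow> diagram \<Rightarrow> 'k" where
  "gp i a X = (if label_sum X mod p = i mod p then a X else 0)"

definition homogeneous :: "nat \<Rightarrow> (diagram \<Rightarrow> 'k) \<Rightarrow> bool" where
  "homogeneous i a \<longleftrightarrow> (\<forall>X. a X \<noteq> 0 \<longrightarrow> X \<in> Dg \<and> label_sum X mod p = i mod p)"

lemma algebra_simps_brauer:
  "carrier Bo = {a. \<forall>X. a X \<noteq> 0 \<longrightarrow> X \<in> Dg}" "a \<in> carrier Ap \<longleftrightarrow> homogeneous 0 a"
  "mult Ap = mult Bo" "add Ap = add Bo" "add Bo = (\<lambda>f g X. f X + g X)" "one Ap = one Bo"
  by (auto simp: brauer_m1n_def brauer_mpn_def brauer_span_def homogeneous_def dvd_eq_mod_eq_0)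

lemma homogeneous_carrier: "homogeneous i a \<Longrightarrow> a \<in> carrier Bo"
  unfolding homogeneous_def algebra_simps_brauer(1) by blast

lemma carrier_subset: "a \<in> carrier Ap \<Longrightarrow> a \<in> carrier Bo"
  unfolding algebra_simps_brauer(2) by (rule homogeneous_carrier)

lemma gp_homogeneous: "a \<in> carrier Bo \<Longrightarrow> homogeneous i (gp i a)"
  unfolding homogeneous_def gp_def algebra_simps_brauer(1) by auto

lemma sum_gp: "(\<Sum>i<p. gp i a X) = a X"
proof -
  have "(\<Sum>i<p. gp i a X) = (\<Sum>i<p. if i = label_sum X mod p then a X else 0)"
    unfolding gp_def by (rule sum.cong[OF refl]) auto
  then show ?thesis using p0 by simp
qed

lemma shift_image: "shift m u j ` Dg \<subseteq> Dg"
  using shift_diagrams[OF m] by blast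

lemma psh_homogeneous:
  assumes u: "u \<in> nodes n n" and a: "homogeneous i a"
  shows "homogeneous (i + j) (psh u j a)"
  unfolding homogeneous_def
proof (intro allI impI)
  fix Y assume "psh u j a Y \<noteq> 0"
  from push_nonzero[OF this] obtain X where X: "X \<in> Dg" "shift m u j X = Y" "a X \<noteq> 0" by auto
  have "label_sum Y mod m mod p = (label_sum X + j) mod m mod p"
    unfolding X(2)[symmetric] label_sum_shift[OF X(1) u] ..
  then have "label_sum Y mod p = (label_sum X + j) mod p" using pm by (simp add: mod_mod_cancel)
  also have "\<dots> = (i + j) mod p"
  proof -
    have "label_sum X mod p = i mod p" using a X(3) unfolding homogeneous_def by auto
    then show ?thesis by (rule mod_add_cong) simp
  qed
  finally show "Y \<in> Dg \<and> label_sum Y mod p = (i + j) mod p" using X shift_diagrams[OF m] by blast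
qed

lemma psh_psh: "psh u i (psh u j a) = psh u (i + j) a"
  unfolding push_push[OF finite_diagrams shift_image] shift_shift ..

lemma psh_multiple: "a \<in> carrier Bo \<Longrightarrow> m dvd j \<Longrightarrow> psh u j a = a"
  by (rule push_identity[OF finite_diagrams]) (auto simp: shift_multiple algebra_simps_brauer(1))

lemma nodes_1: "North 1 \<in> nodes n n" "South 1 \<in> nodes n n" using n0 by simp_all

lemma homogeneous_mod: "homogeneous i a \<Longrightarrow> i mod p = j mod p \<Longrightarrow> homogeneous j a"
  unfolding homogeneous_def by simp

lemma tt_homogeneous: "homogeneous j (tt j)"
proof -
  have i: "id_diagram n \<in> Dg" by (rule group_diagrams_subset[OF id_diagram_group[OF m]])
  have "homogeneous 0 (single (id_diagram n))"
    unfolding homogeneous_def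
  proof (intro allI impI)
    fix X assume "single (id_diagram n) X \<noteq> (0::'k)"
    then have X: "X = id_diagram n" unfolding single_def by (metis (full_types))
    have "label_sum (id_diagram n) = 0" unfolding id_diagram_perm label_sum_perm_diagram by simp
    then show "X \<in> Dg \<and> label_sum X mod p = 0 mod p" using i X by simp
  qed
  from psh_homogeneous[OF nodes_1(1) this, of j] show ?thesis
    unfolding push_single[OF finite_diagrams i] td_def[symmetric] by simp
qed

lemma psh_tt: "psh (North 1) i (tt j) = tt (i + j)"
  unfolding push_single[OF finite_diagrams td_diagrams[OF m]] by (simp add: td_def shift_shift)

lemma tt_carrier: "tt j \<in> carrier Bo" by (rule homogeneous_carrier[OF tt_homogeneous])

lemma sc_carrier: "sc c \<in> carrier Ap"
  using tt_homogeneous[of 0] unfolding algebra_simps_brauer(2) homogeneous_def by auto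

lemma tt_multiple: "m dvd j \<Longrightarrow> tt j = tt 0"
  unfolding td_def by (simp add: shift_multiple[OF group_diagrams_subset[OF id_diagram_group[OF m]]])

end

lemma (in abelian_group) finsum_Times:
  assumes "finite I" "finite J" "\<And>i j. i \<in> I \<Longrightarrow> j \<in> J \<Longrightarrow> F (i, j) \<in> carrier G"
  shows "finsum G F (I \<times> J) = finsum G (\<lambda>i. finsum G (\<lambda>j. F (i, j)) J) I"
  using assms(1,3)
proof (induction I rule: finite_induct)
  case (insert k I)
  have F1: "F \<in> Pair k ` J \<rightarrow> carrier G" and F2: "F \<in> I \<times> J \<rightarrow> carrier G" using insert.prems by auto
  have "insert k I \<times> J = Pair k ` J \<union> I \<times> J" by auto
  then have "finsum G F (insert k I \<times> J) = finsum G F (Pair k ` J) \<oplus> finsum G F (I \<times> J)"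
    using finsum_Un_disjoint[OF _ _ _ F1 F2] insert.hyps assms(2) by auto
  also have "finsum G F (Pair k ` J) = finsum G (\<lambda>j. F (k, j)) J" by (rule finsum_reindex[OF F1]) (simp add: inj_on_def)
  also have "finsum G F (I \<times> J) = finsum G (\<lambda>i. finsum G (\<lambda>j. F (i, j)) J) I" using insert by simp
  finally show ?case using insert.hyps insert.prems by (subst finsum_insert) (auto intro!: finsum_closed)
qed simp

section \<open>Products with powers of t_1 and the grading by label sums\<close>

context brauer_algebras
begin

abbreviation "lf \<equiv> loop_factor m p \<delta>"

lemma mult_Bo: "(a \<otimes>\<^bsub>Bo\<^esub> b) D = (\<Sum>x\<in>Dg. \<Sum>y\<in>Dg. if concatenation m x y = D then a x * b y * lf x y else 0)"
  by (simp add: brauer_m1n_def brauer_span_def)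

lemma one_Bo: "\<one>\<^bsub>Bo\<^esub> = tt 0"
proof -
  have "td m n 0 = id_diagram n"
    unfolding td_def by (rule shift_multiple[OF group_diagrams_subset[OF id_diagram_group[OF m]]]) simp
  then show ?thesis by (simp add: brauer_m1n_def brauer_span_def single_def)
qed

lemma td_products:
  assumes x: "x \<in> Dg"
  shows "concatenation m (td m n j) x = shift m (North 1) j x" "lf (td m n j) x = 1"
    and "concatenation m x (td m n j) = shift m (South 1) j x" "lf x (td m n j) = 1"
proof -
  have i: "id_diagram n \<in> diagrams m n n" by (rule group_diagrams_subset[OF id_diagram_group[OF m]])
  show "concatenation m (td m n j) x = shift m (North 1) j x"
    unfolding td_def concatenation_shift_North(1)[OF i x] concatenation_id_left(1)[OF x] ..
  show "lf (td m n j) x = 1"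
    unfolding td_def concatenation_shift_North(2)[OF i x] by (simp add: loop_factor_def concatenation_id_left(2)[OF x])
  have s: "shift m (South 1) j x \<in> Dg" by (rule shift_diagrams[OF m x])
  show "concatenation m x (td m n j) = shift m (South 1) j x"
    unfolding td_def concatenation_shift_middle(1)[OF x i, symmetric] concatenation_id_right(1)[OF s] ..
  show "lf x (td m n j) = 1"
    unfolding td_def concatenation_shift_middle(2)[OF x i, symmetric]
    unfolding loop_factor_def concatenation_id_right(2)[OF s] by simp
qed

lemma sum_single:
  assumes "D \<in> Dg"
  shows "(\<Sum>x\<in>Dg. if P x then c * single D x * F x else 0) = (if P D then c * F D else 0)"
proof -
  have "(\<Sum>x\<in>Dg. if P x then c * single D x * F x else 0) = (\<Sum>x\<in>Dg. if x = D then (if P D then c * F D else 0) else 0)"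
    by (rule sum.cong[OF refl]) (simp add: single_def)
  then show ?thesis using assms finite_diagrams by simp
qed

text \<open>The scalar is included so that \<open>j = 0\<close> covers multiplication by
  \<open>c\<close> times the unit.\<close>

lemma mult_tt:
  "(\<lambda>X. c * tt j X) \<otimes>\<^bsub>Bo\<^esub> a = (\<lambda>X. c * psh (North 1) j a X)"
  "a \<otimes>\<^bsub>Bo\<^esub> (\<lambda>X. c * tt j X) = (\<lambda>X. c * psh (South 1) j a X)"
proof -
  have t: "td m n j \<in> Dg" by (rule td_diagrams[OF m])
  show "(\<lambda>X. c * tt j X) \<otimes>\<^bsub>Bo\<^esub> a = (\<lambda>X. c * psh (North 1) j a X)"
  proof
    fix D
    have "((\<lambda>X. c * tt j X) \<otimes>\<^bsub>Bo\<^esub> a) D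
        = (\<Sum>y\<in>Dg. \<Sum>x\<in>Dg. if concatenation m x y = D then c * tt j x * (a y * lf x y) else 0)"
      unfolding mult_Bo by (subst sum.swap) (unfold mult.assoc, rule refl)
    also have "\<dots> = (\<Sum>y\<in>Dg. if shift m (North 1) j y = D then c * a y else 0)"
      by (rule sum.cong[OF refl]) (subst sum_single[OF t], simp add: td_products)
    also have "\<dots> = c * psh (North 1) j a D" by (simp add: push_def sum_distrib_left if_distrib cong: if_cong)
    finally show "((\<lambda>X. c * tt j X) \<otimes>\<^bsub>Bo\<^esub> a) D = c * psh (North 1) j a D" .
  qed
  show "a \<otimes>\<^bsub>Bo\<^esub> (\<lambda>X. c * tt j X) = (\<lambda>X. c * psh (South 1) j a X)"
  proof
    fix D
    have "(a \<otimes>\<^bsub>Bo\<^esub> (\<lambda>X. c * tt j X)) D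
        = (\<Sum>x\<in>Dg. \<Sum>y\<in>Dg. if concatenation m x y = D then c * tt j y * (a x * lf x y) else 0)"
      unfolding mult_Bo by (intro sum.cong refl if_cong) (simp add: mult_ac)
    also have "\<dots> = (\<Sum>x\<in>Dg. if shift m (South 1) j x = D then c * a x else 0)"
      by (rule sum.cong[OF refl]) (subst sum_single[OF t], simp add: td_products)
    also have "\<dots> = c * psh (South 1) j a D" by (simp add: push_def sum_distrib_left if_distrib cong: if_cong)
    finally show "(a \<otimes>\<^bsub>Bo\<^esub> (\<lambda>X. c * tt j X)) D = c * psh (South 1) j a D" .
  qed
qed

text \<open>If the loop factor is nonzero, all loop labels are multiples of \<open>p\<close>, so the
  label sum is additive modulo \<open>p\<close>; congruences modulo \<open>m\<close> may be reduced
  because \<open>p\<close> divides \<open>m\<close>.\<close>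

lemma label_sum_mod_p:
  assumes x: "x \<in> diagrams m a b" and y: "y \<in> diagrams m b c" and nz: "lf x y \<noteq> 0"
  shows "label_sum (concatenation m x y) mod p = (label_sum x + label_sum y) mod p"
proof -
  have fl: "finite (loops x y)"
    unfolding loops_def using finite_components[OF finite_xy[OF x y]] by simp
  have "p dvd component_label m C" if "C \<in> loops x y" for C
    using nz that fl unfolding loop_factor_def loop_value_def by (auto split: if_splits)
  then have pl: "p dvd (\<Sum>C\<in>loops x y. component_label m C)" by (rule dvd_sum)
  let ?q = "\<Sum>C\<in>loops x y. component_label m C"
  have "(label_sum x + label_sum y) mod m mod p = (label_sum (concatenation m x y) + ?q) mod m mod p"
    unfolding label_sum_concatenation[OF x y] ..
  then have "(label_sum x + label_sum y) mod p = (label_sum (concatenation m x y) + ?q) mod p"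
    using pm by (simp add: mod_mod_cancel)
  also have "\<dots> = label_sum (concatenation m x y) mod p" using pl by (auto simp: dvd_def)
  finally show ?thesis by (rule sym)
qed

text \<open>Elements of \<open>A\<close> have degree zero, so taking a homogeneous component
  commutes with multiplication by them.\<close>

lemma gp_mult:
  assumes a: "a \<in> carrier Ap"
  shows "gp i (a \<otimes>\<^bsub>Bo\<^esub> b) = a \<otimes>\<^bsub>Bo\<^esub> gp i b"
proof
  fix D
  have "gp i (a \<otimes>\<^bsub>Bo\<^esub> b) D = (\<Sum>x\<in>Dg. \<Sum>y\<in>Dg. if concatenation m x y = D then
      (if label_sum D mod p = i mod p then a x * b y * lf x y else 0) else 0)"
    unfolding gp_def mult_Bo by (simp cong: if_cong)
  also have "\<dots> = (a \<otimes>\<^bsub>Bo\<^esub> gp i b) D"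
    unfolding mult_Bo
  proof (rule sum.cong[OF refl], rule sum.cong[OF refl])
    fix x y assume x: "x \<in> Dg" and y: "y \<in> Dg"
    have "(if label_sum D mod p = i mod p then a x * b y * lf x y else 0) = a x * gp i b y * lf x y"
      if D: "concatenation m x y = D"
    proof (cases "a x = 0 \<or> lf x y = 0")
      case False
      then have "label_sum x mod p = 0" using a unfolding algebra_simps_brauer(2) homogeneous_def by simp
      moreover have "label_sum D mod p = (label_sum x + label_sum y) mod p"
        using label_sum_mod_p[OF x y] False D by simp
      ultimately have "label_sum D mod p = label_sum y mod p" by (simp add: mod_add_eq[symmetric])
      then show ?thesis by (simp add: gp_def)
    qed auto
    then show "(if concatenation m x y = D then (if label_sum D mod p = i mod p then a x * b y * lf x y else 0) else 0)
        = (if concatenation m x y = D then a x * gp i b y * lf x y else 0)" by simp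
  qed
  finally show "gp i (a \<otimes>\<^bsub>Bo\<^esub> b) D = (a \<otimes>\<^bsub>Bo\<^esub> gp i b) D" .
qed

text \<open>The coefficient in \<open>A\<close> of t_1^i when \<open>b\<close> is expanded in powers
  of t_1, with the powers on the left for \<open>North 1\<close> and on the right for
  \<open>South 1\<close>; the shift by \<open>m - i\<close> undoes one by \<open>i\<close>.\<close>

definition aR :: "node \<Rightarrow> nat \<Rightarrow> (diagram \<Rightarrow> 'k) \<Rightarrow> diagram \<Rightarrow> 'k" where
  "aR u i b = psh u (m - i) (gp i b)"

lemma aR:
  assumes b: "b \<in> carrier Bo" and i: "i < p" and u: "u \<in> nodes n n"
  shows "aR u i b \<in> carrier Ap" "psh u i (aR u i b) = gp i b"
proof -
  have im: "i \<le> m" using i pm m by (meson dvd_imp_le le_trans less_imp_le)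
  have "homogeneous (i + (m - i)) (aR u i b)"
    unfolding aR_def by (rule psh_homogeneous[OF u gp_homogeneous[OF b]])
  then show "aR u i b \<in> carrier Ap"
    unfolding algebra_simps_brauer(2) by (rule homogeneous_mod) (use im pm in simp)
  show "psh u i (aR u i b) = gp i b"
    unfolding aR_def psh_psh by (rule psh_multiple[OF homogeneous_carrier[OF gp_homogeneous[OF b]]]) (use im in simp)
qed

end

text \<open>The laws that standard modules and genuine left modules over \<open>B\<close> have in
  common, about scalars and powers of t_1. For the former they come from label shifts, for the
  latter from the module axioms.\<close>

locale brauer_operators = brauer_algebras m p n \<delta> + op_module "brauer_m1n m p n \<delta>" M
  for m p n :: nat and \<delta> :: "nat \<Rightarrow> 'k::field_char_0" and M :: "(diagram \<Rightarrow> 'k, 'b) module" (structure) +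
  fixes \<xi> :: 'k and d :: nat
  assumes mpd: "m = p * d" and primitive: "primitive_root_of_unity m \<xi>"
    and op_add: "a \<in> carrier Bo \<Longrightarrow> b \<in> carrier Bo \<Longrightarrow> x \<in> carrier M \<Longrightarrow> (\<lambda>X. a X + b X) \<odot>\<^bsub>M\<^esub> x = a \<odot>\<^bsub>M\<^esub> x \<oplus>\<^bsub>M\<^esub> b \<odot>\<^bsub>M\<^esub> x"
    and op_one: "x \<in> carrier M \<Longrightarrow> tt 0 \<odot>\<^bsub>M\<^esub> x = x"
    and op_left: "a \<in> carrier Bo \<Longrightarrow> x \<in> carrier M \<Longrightarrow> tt j \<odot>\<^bsub>M\<^esub> (a \<odot>\<^bsub>M\<^esub> x) = psh (North 1) j a \<odot>\<^bsub>M\<^esub> x"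
    and op_right: "a \<in> carrier Bo \<Longrightarrow> x \<in> carrier M \<Longrightarrow> a \<odot>\<^bsub>M\<^esub> (tt j \<odot>\<^bsub>M\<^esub> x) = psh (South 1) j a \<odot>\<^bsub>M\<^esub> x"
    and op_sc_left: "a \<in> carrier Bo \<Longrightarrow> x \<in> carrier M \<Longrightarrow> sc c \<odot>\<^bsub>M\<^esub> (a \<odot>\<^bsub>M\<^esub> x) = (\<lambda>X. c * a X) \<odot>\<^bsub>M\<^esub> x"
    and op_sc_right: "a \<in> carrier Bo \<Longrightarrow> x \<in> carrier M \<Longrightarrow> a \<odot>\<^bsub>M\<^esub> (sc c \<odot>\<^bsub>M\<^esub> x) = (\<lambda>X. c * a X) \<odot>\<^bsub>M\<^esub> x"
begin

abbreviation "E \<equiv> (\<lambda>x. tt 1 \<odot>\<^bsub>M\<^esub> x)"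

lemma op_module_Ap: "op_module Ap M"
  by unfold_locales (simp_all add: smult_closed[OF carrier_subset] smult_r_distr[OF carrier_subset])

lemma tt_tt: "x \<in> carrier M \<Longrightarrow> tt i \<odot>\<^bsub>M\<^esub> (tt j \<odot>\<^bsub>M\<^esub> x) = tt (i + j) \<odot>\<^bsub>M\<^esub> x"
  by (simp only: op_left[OF tt_carrier] psh_tt)

lemma E_funpow: "x \<in> carrier M \<Longrightarrow> (E ^^ i) x = tt i \<odot>\<^bsub>M\<^esub> x"
proof (induction i)
  case 0
  then show ?case using op_one by simp
next
  case (Suc i)
  then show ?case using tt_tt[OF Suc.prems, of 1 i] by simp
qed

text \<open>\<xi>^d is the primitive \<open>p\<close>-th root of unity that drives the Fourier
  argument, and t_1^p lies in \<open>A\<close> because its label sum is divisible by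
  \<open>p\<close>.\<close>

lemma cyclic: "cyclic_extension Ap M sc E m p (\<xi> ^ d)"
proof -
  interpret A: op_module Ap M by (rule op_module_Ap)
  have scB: "sc c \<in> carrier Bo" for c by (rule carrier_subset[OF sc_carrier])
  show ?thesis
  proof (unfold_locales)
    show "sc c \<in> carrier Ap" for c by (rule sc_carrier)
    show "sc 1 \<odot>\<^bsub>M\<^esub> x = x" if "x \<in> carrier M" for x using op_one[OF that] by simp
    show "sc (c + c') \<odot>\<^bsub>M\<^esub> x = sc c \<odot>\<^bsub>M\<^esub> x \<oplus>\<^bsub>M\<^esub> sc c' \<odot>\<^bsub>M\<^esub> x" if "x \<in> carrier M" for x c c'
      using op_add[OF scB scB that, of c c'] by (simp only: distrib_right)
    show "sc (c * c') \<odot>\<^bsub>M\<^esub> x = sc c \<odot>\<^bsub>M\<^esub> (sc c' \<odot>\<^bsub>M\<^esub> x)" if "x \<in> carrier M" for x c c'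
      using op_sc_left[OF scB that, of c c'] by (simp only: mult.assoc)
    show "sc c \<odot>\<^bsub>M\<^esub> (a \<odot>\<^bsub>M\<^esub> x) = a \<odot>\<^bsub>M\<^esub> (sc c \<odot>\<^bsub>M\<^esub> x)" if "a \<in> carrier Ap" "x \<in> carrier M" for a x c
      unfolding op_sc_left[OF carrier_subset[OF that(1)] that(2)] op_sc_right[OF carrier_subset[OF that(1)] that(2)] ..
    show "E x \<in> carrier M" if "x \<in> carrier M" for x by (rule smult_closed[OF tt_carrier that])
    show "E (x \<oplus>\<^bsub>M\<^esub> y) = E x \<oplus>\<^bsub>M\<^esub> E y" if "x \<in> carrier M" "y \<in> carrier M" for x y by (rule smult_r_distr[OF tt_carrier that])
    show "(E ^^ m) x = x" if "x \<in> carrier M" for x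
      unfolding E_funpow[OF that] tt_multiple[OF dvd_refl] by (rule op_one[OF that])
    show "p \<le> m" using pm m by (rule dvd_imp_le)
    show "0 < p" by (rule p0)
    show "\<exists>a'\<in>carrier Ap. \<forall>x\<in>carrier M. a \<odot>\<^bsub>M\<^esub> E x = E (a' \<odot>\<^bsub>M\<^esub> x)" if a: "a \<in> carrier Ap" for a
    proof (intro bexI ballI)
      \<comment> \<open>\<open>?a\<close> is \<open>a\<close> conjugated by t_1: a southern shift by
        1 followed by a northern shift by \<open>m - 1\<close>, so its degree is again zero.\<close>
      let ?b = "psh (South 1) 1 a" let ?a = "psh (North 1) (m - 1) ?b"
      have b: "homogeneous (0 + 1) ?b" by (rule psh_homogeneous[OF nodes_1(2) a[unfolded algebra_simps_brauer(2)]])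
      have "homogeneous (0 + 1 + (m - 1)) ?a" by (rule psh_homogeneous[OF nodes_1(1) b])
      then show a': "?a \<in> carrier Ap" unfolding algebra_simps_brauer(2) by (rule homogeneous_mod) (use m pm in simp)
      fix x assume x: "x \<in> carrier M"
      have "psh (North 1) 1 ?a = ?b"
        unfolding psh_psh by (rule psh_multiple[OF homogeneous_carrier[OF b]]) (use m in simp)
      then show "a \<odot>\<^bsub>M\<^esub> E x = E (?a \<odot>\<^bsub>M\<^esub> x)"
        using op_right[OF carrier_subset[OF a] x] op_left[OF carrier_subset[OF a'] x] by simp
    qed
    show "\<exists>a\<in>carrier Ap. \<forall>x\<in>carrier M. (E ^^ p) x = a \<odot>\<^bsub>M\<^esub> x"
    proof (intro bexI ballI)
      show "tt p \<in> carrier Ap" unfolding algebra_simps_brauer(2) by (rule homogeneous_mod[OF tt_homogeneous]) simp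
      show "(E ^^ p) x = tt p \<odot>\<^bsub>M\<^esub> x" if "x \<in> carrier M" for x by (rule E_funpow[OF that])
    qed
    show "E (sc c \<odot>\<^bsub>M\<^esub> x) = sc c \<odot>\<^bsub>M\<^esub> E x" if "x \<in> carrier M" for x c
      unfolding op_sc_left[OF tt_carrier that] op_sc_right[OF tt_carrier that] ..
    show "(\<xi> ^ d) ^ p = 1" using primitive mpd unfolding primitive_root_of_unity_def by (simp add: power_mult[symmetric] mult.commute)
    show "(\<xi> ^ d) ^ j \<noteq> 1" if "0 < j" "j < p" for j
    proof -
      have "0 < d" using m mpd by simp
      then have "0 < d * j" "d * j < m" using that mpd by (simp_all add: mult.commute)
      then show ?thesis using primitive unfolding primitive_root_of_unity_def power_mult[symmetric] by blast
    qed
    show "(of_nat p :: 'k) \<noteq> 0" using p0 by simp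
  qed
qed

lemma op_sum:
  assumes x: "x \<in> carrier M" and "finite I" "\<And>i. i \<in> I \<Longrightarrow> a i \<in> carrier Bo"
  shows "(\<lambda>X. \<Sum>i\<in>I. a i X) \<in> carrier Bo \<and> (\<lambda>X. \<Sum>i\<in>I. a i X) \<odot>\<^bsub>M\<^esub> x = finsum M (\<lambda>i. a i \<odot>\<^bsub>M\<^esub> x) I"
  using assms(2,3)
proof (induction I rule: finite_induct)
  case empty
  have z: "(\<lambda>X. 0) \<in> carrier Bo" unfolding algebra_simps_brauer(1) by simp
  have "(\<lambda>X. 0) \<odot>\<^bsub>M\<^esub> x = (\<lambda>X. 0) \<odot>\<^bsub>M\<^esub> x \<oplus>\<^bsub>M\<^esub> (\<lambda>X. 0) \<odot>\<^bsub>M\<^esub> x" using op_add[OF z z x] by simp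
  then have "(\<lambda>X. 0) \<odot>\<^bsub>M\<^esub> x = \<zero>\<^bsub>M\<^esub>" using smult_closed[OF z x] by (metis M.add.l_cancel_one')
  then show ?case using z by simp
next
  case (insert k I)
  have ak: "a k \<in> carrier Bo" using insert by simp
  have aI: "(\<lambda>X. \<Sum>i\<in>I. a i X) \<in> carrier Bo" "(\<lambda>X. \<Sum>i\<in>I. a i X) \<odot>\<^bsub>M\<^esub> x = finsum M (\<lambda>i. a i \<odot>\<^bsub>M\<^esub> x) I" using insert by auto
  have e: "(\<lambda>X. \<Sum>i\<in>insert k I. a i X) = (\<lambda>X. a k X + (\<Sum>i\<in>I. a i X))" using insert.hyps by simp
  have "(\<lambda>X. a k X + (\<Sum>i\<in>I. a i X)) \<in> carrier Bo"
    using ak aI(1) unfolding algebra_simps_brauer(1) mem_Collect_eq by (metis add.right_neutral)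
  moreover have "finsum M (\<lambda>i. a i \<odot>\<^bsub>M\<^esub> x) (insert k I) = a k \<odot>\<^bsub>M\<^esub> x \<oplus>\<^bsub>M\<^esub> finsum M (\<lambda>i. a i \<odot>\<^bsub>M\<^esub> x) I"
    using insert.hyps insert.prems smult_closed[OF _ x] by (intro M.finsum_insert) auto
  ultimately show ?case unfolding e op_add[OF ak aI(1) x] aI(2) by simp
qed

text \<open>\<open>b\<close> is split into homogeneous components, and from each a power of t_1 is
  pulled out, on the left or on the right.\<close>

lemma smult_decompose:
  assumes b: "b \<in> carrier Bo" and x: "x \<in> carrier M"
  shows "b \<odot>\<^bsub>M\<^esub> x = finsum M (\<lambda>i. tt i \<odot>\<^bsub>M\<^esub> (aR (North 1) i b \<odot>\<^bsub>M\<^esub> x)) {..<p}"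
    and "b \<odot>\<^bsub>M\<^esub> x = finsum M (\<lambda>i. aR (South 1) i b \<odot>\<^bsub>M\<^esub> (tt i \<odot>\<^bsub>M\<^esub> x)) {..<p}"
proof -
  have g: "gp i b \<in> carrier Bo" for i by (rule homogeneous_carrier[OF gp_homogeneous[OF b]])
  have "(\<lambda>X. \<Sum>i<p. gp i b X) = b" by (rule ext) (rule sum_gp)
  then have s: "b \<odot>\<^bsub>M\<^esub> x = finsum M (\<lambda>i. gp i b \<odot>\<^bsub>M\<^esub> x) {..<p}"
    using op_sum[OF x, of "{..<p}" "\<lambda>i. gp i b"] g by simp
  have cl: "(\<lambda>i. gp i b \<odot>\<^bsub>M\<^esub> x) \<in> {..<p} \<rightarrow> carrier M" using smult_closed[OF g x] by blast
  have 1: "gp i b \<odot>\<^bsub>M\<^esub> x = tt i \<odot>\<^bsub>M\<^esub> (aR (North 1) i b \<odot>\<^bsub>M\<^esub> x)" "gp i b \<odot>\<^bsub>M\<^esub> x = aR (South 1) i b \<odot>\<^bsub>M\<^esub> (tt i \<odot>\<^bsub>M\<^esub> x)" if "i < p" for i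
    using op_left[OF carrier_subset[OF aR(1)[OF b that nodes_1(1)]] x, of i] aR(2)[OF b that nodes_1(1)]
      op_right[OF carrier_subset[OF aR(1)[OF b that nodes_1(2)]] x, of i] aR(2)[OF b that nodes_1(2)] by simp_all
  have cl1: "(\<lambda>i. tt i \<odot>\<^bsub>M\<^esub> (aR (North 1) i b \<odot>\<^bsub>M\<^esub> x)) \<in> {..<p} \<rightarrow> carrier M"
    and cl2: "(\<lambda>i. aR (South 1) i b \<odot>\<^bsub>M\<^esub> (tt i \<odot>\<^bsub>M\<^esub> x)) \<in> {..<p} \<rightarrow> carrier M"
    using cl 1 by (auto simp: Pi_iff)
  show "b \<odot>\<^bsub>M\<^esub> x = finsum M (\<lambda>i. tt i \<odot>\<^bsub>M\<^esub> (aR (North 1) i b \<odot>\<^bsub>M\<^esub> x)) {..<p}"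
    unfolding s by (rule M.finsum_cong'[OF refl cl1]) (use 1(1) in simp)
  show "b \<odot>\<^bsub>M\<^esub> x = finsum M (\<lambda>i. aR (South 1) i b \<odot>\<^bsub>M\<^esub> (tt i \<odot>\<^bsub>M\<^esub> x)) {..<p}"
    unfolding s by (rule M.finsum_cong'[OF refl cl2]) (use 1(2) in simp)
qed

text \<open>Stability under \<open>E\<close> gives stability under all powers of t_1, and
  \<open>smult_decompose\<close> expresses every operator of \<open>B\<close> through these and
  \<open>A\<close>.\<close>

lemma submodule_iff: "submodule N Bo M \<longleftrightarrow> submodule N Ap M \<and> (\<forall>x\<in>N. E x \<in> N)"
proof (intro iffI conjI ballI)
  assume N: "submodule N Bo M"
  note D = submoduleD[OF N]
  show "submodule N Ap M"
    by (rule op_module.submoduleI[OF op_module_Ap]) (use D carrier_subset in auto)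
  show "E x \<in> N" if "x \<in> N" for x by (rule D(5)[OF tt_carrier that])
next
  assume N: "submodule N Ap M \<and> (\<forall>x\<in>N. E x \<in> N)"
  note D = op_module.submoduleD[OF op_module_Ap conjunct1[OF N]]
  have Nc: "x \<in> N \<Longrightarrow> x \<in> carrier M" for x by (rule D(1))
  have Ei: "tt i \<odot>\<^bsub>M\<^esub> x \<in> N" if x: "x \<in> N" for i x
  proof -
    have "(E ^^ i) x \<in> N" using x N by (induction i) auto
    then show ?thesis using E_funpow[OF Nc[OF x]] by simp
  qed
  show "submodule N Bo M"
  proof (rule submoduleI)
    fix b x assume b: "b \<in> carrier Bo" and x: "x \<in> N"
    have "tt i \<odot>\<^bsub>M\<^esub> (aR (North 1) i b \<odot>\<^bsub>M\<^esub> x) \<in> N" if "i < p" for i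
      by (rule Ei[OF D(5)[OF aR(1)[OF b that nodes_1(1)] x]])
    then show "b \<odot>\<^bsub>M\<^esub> x \<in> N"
      unfolding smult_decompose(1)[OF b Nc[OF x]]
      by (intro op_module.submodule_finsum[OF op_module_Ap conjunct1[OF N]]) auto
  qed (use D in auto)
qed

lemma superfluous_Ap:
  assumes K: "superfluous Bo M K"
  shows "superfluous Ap M K"
proof -
  interpret C: cyclic_extension Ap M sc E m p "\<xi> ^ d" by (rule cyclic)
  show ?thesis
  proof (rule C.superfluous_restrict)
    show "submodule K Ap M" "\<And>x. x \<in> K \<Longrightarrow> E x \<in> K" using K submodule_iff unfolding superfluous_def by blast+
    fix N assume "submodule N Ap M" "\<And>x. x \<in> N \<Longrightarrow> E x \<in> N" "set_add M N K = carrier M"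
    then show "N = carrier M" using K submodule_iff unfolding superfluous_def by blast
  qed
qed

lemma radical_Ap:
  assumes "finite G" "G \<subseteq> carrier M" "\<And>N. submodule N Ap M \<Longrightarrow> G \<subseteq> N \<Longrightarrow> N = carrier M"
  shows "module_radical Bo M = module_radical Ap M"
  by (rule cyclic_extension.radical_extension[OF cyclic m op_module_axioms submodule_iff assms])

end

lemma left_module_brauer_operators:
  fixes \<delta> :: "nat \<Rightarrow> 'k::field_char_0"
  assumes "brauer_algebras m p n" and M: "left_module (brauer_m1n m p n \<delta>) M"
    and "m = p * d" "primitive_root_of_unity m \<xi>"
  shows "brauer_operators m p n \<delta> M \<xi> d"
proof -
  interpret brauer_algebras m p n \<delta> by fact
  interpret left_module Bo M by fact
  have p1: "tt j \<otimes>\<^bsub>Bo\<^esub> a = psh (North 1) j a" "a \<otimes>\<^bsub>Bo\<^esub> tt j = psh (South 1) j a" for j a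
    using mult_tt(1)[of 1 j a] mult_tt(2)[of a 1 j] by simp_all
  have p2: "sc c \<otimes>\<^bsub>Bo\<^esub> a = (\<lambda>X. c * a X)" "a \<otimes>\<^bsub>Bo\<^esub> sc c = (\<lambda>X. c * a X)" if "a \<in> carrier Bo" for c a
    unfolding mult_tt psh_multiple[OF that dvd_0_right] by (rule refl)+
  have scB: "sc c \<in> carrier Bo" for c by (rule carrier_subset[OF sc_carrier])
  show ?thesis
  proof unfold_locales
    show "a \<odot>\<^bsub>M\<^esub> x \<in> carrier M" if "a \<in> carrier Bo" "x \<in> carrier M" for a x by (rule smult_closed[OF that])
    show "a \<odot>\<^bsub>M\<^esub> (x \<oplus>\<^bsub>M\<^esub> y) = a \<odot>\<^bsub>M\<^esub> x \<oplus>\<^bsub>M\<^esub> a \<odot>\<^bsub>M\<^esub> y" if "a \<in> carrier Bo" "x \<in> carrier M" "y \<in> carrier M" for a x y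
      by (rule smult_r_distr[OF that])
    show "m = p * d" "primitive_root_of_unity m \<xi>" by fact+
    show "(\<lambda>X. a X + b X) \<odot>\<^bsub>M\<^esub> x = a \<odot>\<^bsub>M\<^esub> x \<oplus>\<^bsub>M\<^esub> b \<odot>\<^bsub>M\<^esub> x" if "a \<in> carrier Bo" "b \<in> carrier Bo" "x \<in> carrier M" for a b x
      using smult_l_distr[OF that] unfolding algebra_simps_brauer(5) .
    show "tt 0 \<odot>\<^bsub>M\<^esub> x = x" if "x \<in> carrier M" for x using smult_one[OF that] unfolding one_Bo .
    show "tt j \<odot>\<^bsub>M\<^esub> (a \<odot>\<^bsub>M\<^esub> x) = psh (North 1) j a \<odot>\<^bsub>M\<^esub> x" if "a \<in> carrier Bo" "x \<in> carrier M" for a x j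
      using smult_assoc[OF tt_carrier that] unfolding p1 by (rule sym)
    show "a \<odot>\<^bsub>M\<^esub> (tt j \<odot>\<^bsub>M\<^esub> x) = psh (South 1) j a \<odot>\<^bsub>M\<^esub> x" if "a \<in> carrier Bo" "x \<in> carrier M" for a x j
      using smult_assoc[OF that(1) tt_carrier that(2)] unfolding p1 by (rule sym)
    show "sc c \<odot>\<^bsub>M\<^esub> (a \<odot>\<^bsub>M\<^esub> x) = (\<lambda>X. c * a X) \<odot>\<^bsub>M\<^esub> x" if "a \<in> carrier Bo" "x \<in> carrier M" for a x c
      using smult_assoc[OF scB that] unfolding p2[OF that(1)] by (rule sym)
    show "a \<odot>\<^bsub>M\<^esub> (sc c \<odot>\<^bsub>M\<^esub> x) = (\<lambda>X. c * a X) \<odot>\<^bsub>M\<^esub> x" if "a \<in> carrier Bo" "x \<in> carrier M" for a x c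
      using smult_assoc[OF that(1) scB that(2)] unfolding p2[OF that(1)] by (rule sym)
  qed
qed

section \<open>Projectivity over the subalgebra\<close>

context brauer_operators
begin

text \<open>Every element of \<open>B\<close> expands in the powers of t_1 with coordinates
  \<open>aR (South 1) i\<close> in \<open>A\<close>; composing a dual basis over \<open>B\<close>
  with this expansion gives one over \<open>A\<close>. The powers stand on the right so that the
  coordinates are linear for \<open>A\<close> acting from the left.\<close>

lemma dual_basis_Ap:
  assumes LM: "left_module Bo M" and db: "dual_basis Bo M J \<phi> e"
  shows "dual_basis Ap M (J \<times> {..<p}) (\<lambda>(k, i) x. aR (South 1) i (\<phi> k x)) (\<lambda>(k, i). tt i \<odot>\<^bsub>M\<^esub> e k)"
proof -
  interpret LM: left_module Bo M by (rule LM)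
  have J: "finite J" and \<phi>: "k \<in> J \<Longrightarrow> \<phi> k \<in> mod_hom Bo M (regular_module Bo)" and e: "k \<in> J \<Longrightarrow> e k \<in> carrier M"
    and ex: "x \<in> carrier M \<Longrightarrow> x = finsum M (\<lambda>k. \<phi> k x \<odot>\<^bsub>M\<^esub> e k) J" for k x
    using db unfolding dual_basis_def by auto
  have \<phi>c: "\<phi> k x \<in> carrier Bo" if "k \<in> J" "x \<in> carrier M" for k x using mod_homD(1)[OF \<phi>[OF that(1)] that(2)] by simp
  have aR_mult: "aR (South 1) i (a \<otimes>\<^bsub>Bo\<^esub> b) = a \<otimes>\<^bsub>Bo\<^esub> aR (South 1) i b" if a: "a \<in> carrier Ap" and b: "b \<in> carrier Bo" for i a b
  proof -
    have r: "psh (South 1) j c = c \<otimes>\<^bsub>Bo\<^esub> tt j" for j c using mult_tt(2)[of c 1 j] by simp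
    \<comment> \<open>Associativity of \<open>B\<close> is available at this point, as a left module
      presupposes a ring.\<close>
    show ?thesis
      unfolding aR_def gp_mult[OF a] r
      by (rule LM.R.m_assoc[OF carrier_subset[OF a] homogeneous_carrier[OF gp_homogeneous[OF b]] tt_carrier])
  qed
  have aR_add: "aR u i (\<lambda>X. a X + b X) = (\<lambda>X. aR u i a X + aR u i b X)" for u i a b
  proof -
    have "gp i (\<lambda>X. a X + b X) = (\<lambda>X. gp i a X + gp i b X)" by (rule ext) (simp add: gp_def)
    then show ?thesis unfolding aR_def by (simp only: push_add)
  qed
  have hom: "(\<lambda>x. aR (South 1) i (\<phi> k x)) \<in> mod_hom Ap M (regular_module Ap)" if k: "k \<in> J" and i: "i < p" for k i
  proof (rule mod_homI)
    show "aR (South 1) i (\<phi> k x) \<in> carrier (regular_module Ap)" if "x \<in> carrier M" for x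
      using aR(1)[OF \<phi>c[OF k that] i nodes_1(2)] by simp
    show "aR (South 1) i (\<phi> k (x \<oplus>\<^bsub>M\<^esub> y)) = aR (South 1) i (\<phi> k x) \<oplus>\<^bsub>regular_module Ap\<^esub> aR (South 1) i (\<phi> k y)"
      if "x \<in> carrier M" "y \<in> carrier M" for x y
      using mod_homD(2)[OF \<phi>[OF k] that] by (simp add: algebra_simps_brauer(4,5) aR_add)
    show "aR (South 1) i (\<phi> k (a \<odot>\<^bsub>M\<^esub> x)) = a \<odot>\<^bsub>regular_module Ap\<^esub> aR (South 1) i (\<phi> k x)"
      if "a \<in> carrier Ap" "x \<in> carrier M" for a x
      using mod_homD(3)[OF \<phi>[OF k] carrier_subset[OF that(1)] that(2)] aR_mult[OF that(1) \<phi>c[OF k that(2)]]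
      by (simp add: algebra_simps_brauer(3))
  qed
  have expand: "x = finsum M (\<lambda>j. (case j of (k, i) \<Rightarrow> \<lambda>x. aR (South 1) i (\<phi> k x)) x \<odot>\<^bsub>M\<^esub> (case j of (k, i) \<Rightarrow> tt i \<odot>\<^bsub>M\<^esub> e k)) (J \<times> {..<p})"
    if x: "x \<in> carrier M" for x
  proof -
    have cl: "aR (South 1) i (\<phi> k x) \<odot>\<^bsub>M\<^esub> (tt i \<odot>\<^bsub>M\<^esub> e k) \<in> carrier M" if "k \<in> J" "i < p" for k i
      by (rule smult_closed[OF carrier_subset[OF aR(1)[OF \<phi>c[OF that(1) x] that(2) nodes_1(2)]] smult_closed[OF tt_carrier e[OF that(1)]]])
    have "finsum M (\<lambda>j. (case j of (k, i) \<Rightarrow> \<lambda>x. aR (South 1) i (\<phi> k x)) x \<odot>\<^bsub>M\<^esub> (case j of (k, i) \<Rightarrow> tt i \<odot>\<^bsub>M\<^esub> e k)) (J \<times> {..<p})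
        = finsum M (\<lambda>k. finsum M (\<lambda>i. aR (South 1) i (\<phi> k x) \<odot>\<^bsub>M\<^esub> (tt i \<odot>\<^bsub>M\<^esub> e k)) {..<p}) J"
      using M.finsum_Times[OF J finite_lessThan, of p "\<lambda>j. (case j of (k, i) \<Rightarrow> \<lambda>x. aR (South 1) i (\<phi> k x)) x \<odot>\<^bsub>M\<^esub> (case j of (k, i) \<Rightarrow> tt i \<odot>\<^bsub>M\<^esub> e k)"] cl
      by simp
    also have "\<dots> = finsum M (\<lambda>k. \<phi> k x \<odot>\<^bsub>M\<^esub> e k) J"
      by (rule M.finsum_cong'[OF refl])
        (use smult_closed[OF \<phi>c[OF _ x] e] smult_decompose(2)[OF \<phi>c[OF _ x] e] in \<open>auto simp: Pi_iff\<close>)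
    also have "\<dots> = x" by (rule ex[OF x, symmetric])
    finally show ?thesis by (rule sym)
  qed
  show ?thesis
    unfolding dual_basis_def
  proof (intro conjI ballI)
    show "finite (J \<times> {..<p})" using J by simp
    fix j assume "j \<in> J \<times> {..<p}"
    then obtain k i where j: "j = (k, i)" "k \<in> J" "i < p" by auto
    show "(case j of (k, i) \<Rightarrow> \<lambda>x. aR (South 1) i (\<phi> k x)) \<in> mod_hom Ap M (regular_module Ap)"
      unfolding j(1) prod.case by (rule hom[OF j(2,3)])
    show "(case j of (k, i) \<Rightarrow> tt i \<odot>\<^bsub>M\<^esub> e k) \<in> carrier M"
      unfolding j(1) prod.case by (rule smult_closed[OF tt_carrier e[OF j(2)]])
  next
    fix x assume "x \<in> carrier M"
    then show "x = finsum M (\<lambda>j. (case j of (k, i) \<Rightarrow> \<lambda>x. aR (South 1) i (\<phi> k x)) x \<odot>\<^bsub>M\<^esub> (case j of (k, i) \<Rightarrow> tt i \<odot>\<^bsub>M\<^esub> e k)) (J \<times> {..<p})"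
      by (rule expand)
  qed
qed

lemma left_module_Ap:
  assumes LM: "left_module Bo M" and R: "ring Ap"
  shows "left_module Ap M"
proof -
  interpret LM: left_module Bo M by (rule LM)
  interpret R: ring Ap by (rule R)
  note c = carrier_subset
  show ?thesis
  proof unfold_locales
    fix a b x y assume a: "a \<in> carrier Ap" and x: "x \<in> carrier M"
    show "a \<odot>\<^bsub>M\<^esub> x \<in> carrier M" by (rule smult_closed[OF c[OF a] x])
    show "a \<odot>\<^bsub>M\<^esub> (x \<oplus>\<^bsub>M\<^esub> y) = a \<odot>\<^bsub>M\<^esub> x \<oplus>\<^bsub>M\<^esub> a \<odot>\<^bsub>M\<^esub> y" if "y \<in> carrier M"
      by (rule smult_r_distr[OF c[OF a] x that])
    assume b: "b \<in> carrier Ap"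
    show "(a \<oplus>\<^bsub>Ap\<^esub> b) \<odot>\<^bsub>M\<^esub> x = a \<odot>\<^bsub>M\<^esub> x \<oplus>\<^bsub>M\<^esub> b \<odot>\<^bsub>M\<^esub> x"
      unfolding algebra_simps_brauer(4) by (rule LM.smult_l_distr[OF c[OF a] c[OF b] x])
    show "(a \<otimes>\<^bsub>Ap\<^esub> b) \<odot>\<^bsub>M\<^esub> x = a \<odot>\<^bsub>M\<^esub> (b \<odot>\<^bsub>M\<^esub> x)"
      unfolding algebra_simps_brauer(3) by (rule LM.smult_assoc[OF c[OF a] c[OF b] x])
  next
    show "\<one>\<^bsub>Ap\<^esub> \<odot>\<^bsub>M\<^esub> x = x" if "x \<in> carrier M" for x
      unfolding algebra_simps_brauer(6) by (rule LM.smult_one[OF that])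
  qed
qed

end

lemma mod_isomorphic_restrict: "mod_isomorphic R M N \<Longrightarrow> mod_isomorphic R (restrict_scalars R M) N"
  unfolding mod_isomorphic_def mod_hom_def restrict_scalars_def by simp

section \<open>The comparison applied to the standard modules\<close>

context standard_module_stabilizer
begin

lemma brauer_algebras: "brauer_algebras m p n"
  using m n0 p0 mpd by unfold_locales simp_all

lemma brauer_operators_Delta_bar: "brauer_operators m p n \<delta> \<Delta> \<xi> d"
proof -
  interpret Q: brauer_algebras m p n \<delta> by (rule brauer_algebras)
  interpret D: op_module "brauer_m1n m p n \<delta>" \<Delta> by (rule op_module_Delta_bar)
  have sc: "act (Q.sc c) f = (\<lambda>b. c * f b)" if "f \<in> carrier \<Delta>" for c f
    using act_td_zero[OF that] by (simp only: act_scale(1))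
  show ?thesis
  proof unfold_locales
    show "m = p * d" by (rule mpd)
    show "primitive_root_of_unity m \<xi>" by (rule primitive)
    show "act (\<lambda>X. a X + b X) x = act a x \<oplus>\<^bsub>\<Delta>\<^esub> act b x" for a b x by (rule act_add_left)
    show "act (Q.tt 0) x = x" if "x \<in> carrier \<Delta>" for x by (rule act_td_zero[OF that])
    show "act (Q.tt j) (act a x) = act (Q.psh (North 1) j a) x" for a x j by (rule act_td_left)
    show "act a (act (Q.tt j) x) = act (Q.psh (South 1) j a) x" for a x j by (rule act_td_right)
    show "act (Q.sc c) (act a x) = act (\<lambda>X. c * a X) x" for a x c
      unfolding sc[OF act_closed] by (rule act_scale(1)[symmetric])
    show "act a (act (Q.sc c) x) = act (\<lambda>X. c * a X) x" if "x \<in> carrier \<Delta>" for a x c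
      unfolding sc[OF that] act_scale(2) by (rule act_scale(1)[symmetric])
  qed
qed

text \<open>The operators of \<open>A\<close> include the scalars, so the basis vectors are a finite
  generating set over \<open>A\<close>, as the comparison of radicals requires.\<close>

lemma radical_Delta_bar: "module_radical (brauer_m1n m p n \<delta>) \<Delta> = module_radical Ap \<Delta>"
proof (rule brauer_operators.radical_Ap[OF brauer_operators_Delta_bar])
  interpret Q: brauer_algebras m p n \<delta> by (rule brauer_algebras)
  let ?e = "\<lambda>b b'. if b' = b then 1 else 0 :: 'k"
  show "finite (?e ` Bs)" using finite_std_basis by simp
  have e: "?e b \<in> carrier \<Delta>" if "b \<in> Bs" for b using that unfolding Delta_bar_simps(1) by simp
  show "?e ` Bs \<subseteq> carrier \<Delta>"
  proof (rule image_subsetI)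
    fix b assume "b \<in> Bs" then show "?e b \<in> carrier \<Delta>" by (rule e)
  qed
  fix H assume H: "submodule H Ap \<Delta>" and sub: "?e ` Bs \<subseteq> H"
  note D = op_module.submoduleD[OF op_module_Delta_bar H]
  have "f \<in> H" if f: "f \<in> carrier \<Delta>" for f
  proof -
    have s: "(\<lambda>b'. f b * ?e b b') \<in> H" if b: "b \<in> Bs" for b
    proof -
      have "?e b \<in> H" using sub b by (rule subsetD[OF _ imageI])
      from D(5)[OF Q.sc_carrier this, of "f b"] show ?thesis unfolding act_scale(1) act_td_zero[OF e[OF b]] .
    qed
    have "f = finsum \<Delta> (\<lambda>b b'. f b * ?e b b') Bs"
    proof
      fix b'
      have "(\<Sum>b\<in>Bs. f b * ?e b b') = (\<Sum>b\<in>Bs. if b = b' then f b' else 0)" by (rule sum.cong[OF refl]) auto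
      also have "\<dots> = f b'" using finite_std_basis f unfolding Delta_bar_simps(1) by auto
      finally have "(\<Sum>b\<in>Bs. f b * ?e b b') = f b'" .
      then show "f b' = finsum \<Delta> (\<lambda>b b'. f b * ?e b b') Bs b'"
        using finsum_Delta_bar[OF finite_std_basis, of "\<lambda>b b'. f b * ?e b b'"] s D(1) by (simp add: Pi_iff)
    qed
    also have "\<dots> \<in> H"
      by (rule op_module.submodule_finsum[OF op_module_Delta_bar H]) (use s finite_std_basis in auto)
    finally show ?thesis .
  qed
  then show "H = carrier \<Delta>" using D(1) by blast
qed

end

theorem mainTheorem5:
  fixes m p d n t :: nat
    and \<xi> :: "'k :: {alg_closed_field, field_char_0}"
    and \<delta> :: "nat \<Rightarrow> 'k"
    and lam :: multipartition
  assumes "m > 0" "p > 0" "d > 0" "n > 0" "m = p * d"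
    and "primitive_root_of_unity m \<xi>"
    and "even n \<Longrightarrow> \<exists>i<d. \<delta> i \<noteq> 0"
    and "lam \<in> Lambda_m1n m n"
    and "t dvd p"
    and "stabilizer_Zp p d lam = generate (integer_mod_group p) {int t mod int p}"
  shows "mod_isomorphic (brauer_mpn m p n \<delta>)
           (restrict_scalars (brauer_mpn m p n \<delta>) (L_bar m p \<xi> \<delta> n lam))
           (dsum {r. r < p div t} (\<lambda>r. L_simple m p d \<xi> \<delta> n lam t r))
       \<and> (\<forall>(Pbar :: (diagram \<Rightarrow> 'k, 'a) module) (P :: nat \<Rightarrow> (diagram \<Rightarrow> 'k, 'b) module).
           projective_cover (brauer_m1n m p n \<delta>) Pbar (L_bar m p \<xi> \<delta> n lam) \<longrightarrow>
           (\<forall>r<p div t. projective_cover (brauer_mpn m p n \<delta>) (P r) (L_simple m p d \<xi> \<delta> n lam t r)) \<longrightarrow>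
           mod_isomorphic (brauer_mpn m p n \<delta>)
             (restrict_scalars (brauer_mpn m p n \<delta>) Pbar)
             (dsum {r. r < p div t} P))"
proof -
  let ?B = "brauer_m1n m p n \<delta>" and ?A = "brauer_mpn m p n \<delta>" and ?D = "Delta_bar m p \<xi> \<delta> n lam"
  let ?L = "L_bar m p \<xi> \<delta> n lam" and ?I = "{r. r < p div t}" and ?Lr = "\<lambda>r. L_simple m p d \<xi> \<delta> n lam t r"
  obtain l where l: "2 * l \<le> n" "lam \<in> multipartitions m (n - 2 * l)" using assms(8) unfolding Lambda_m1n_def by blast
  define N where "N = n - 2 * l"
  have lam: "length lam = m" "\<And>\<mu>. \<mu> \<in> set lam \<Longrightarrow> is_partition \<mu>" "N = mp_size lam" "n = N + 2 * l"
    using l unfolding multipartitions_def N_def by auto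
  have \<xi>: "\<xi> ^ m = 1" using assms(6) unfolding primitive_root_of_unity_def by blast
  have tp: "0 < t" "t \<le> p" using assms(2,9) by (auto intro: dvd_imp_le dvd_pos_nat)
  have fixed: "rotate (d * t) lam = lam"
  \<comment> \<open>For \<open>t = p\<close> the reduced generator is 0 and carries no information,
    but rotation by \<open>d * p = m\<close> is a full turn of \<open>lam\<close>.\<close>
  proof (cases "t = p")
    case True
    then show ?thesis using assms(5) lam(1) by (simp add: mult.commute)
  next
    case False
    then have "int t mod int p = int t" using tp by simp
    then have "int t \<in> stabilizer_Zp p d lam"
      unfolding assms(10) using generate.incl[of "int t" "{int t mod int p}"] by simp
    then have "(rotate d ^^ nat (int t)) lam = lam" unfolding stabilizer_Zp_def by blast
    then show ?thesis by (simp add: rotate_funpow)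
  qed
  interpret X: standard_module_stabilizer m p n N l \<xi> \<delta> lam d t
    using assms(1-6,9) \<xi> lam fixed by unfold_locales auto
  \<comment> \<open>An equality rather than an isomorphism: the two heads are quotients of one
    module by the same set.\<close>
  have L: "?L = module_head ?A ?D" unfolding L_bar_def module_head_def X.radical_Delta_bar ..
  have q: "X.q = p div t" by (rule X.q_def)
  have iso: "mod_isomorphic ?A ?L (dsum ?I ?Lr)"
    using X.head_Delta_bar unfolding L q L_simple_def .
  have opD: "op_module ?A ?D" by (rule X.op_module_Delta_bar)
  have opL: "op_module ?A ?L"
    unfolding L module_head_def by (rule op_module.op_module_quotient[OF opD op_module.submodule_radical[OF opD]])
  have opLr: "op_module ?A (?Lr r)" for r
    unfolding L_simple_def module_head_def
    by (rule op_module.op_module_quotient[OF X.op_module_Delta op_module.submodule_radical[OF X.op_module_Delta]])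
  have "mod_isomorphic ?A (restrict_scalars ?A Pbar) (dsum ?I P)"
    if PB: "projective_cover ?B Pbar ?L" and PA: "\<forall>r<p div t. projective_cover ?A (P r) (?Lr r)"
    for Pbar :: "(diagram \<Rightarrow> 'k, 'a) module" and P :: "nat \<Rightarrow> (diagram \<Rightarrow> 'k, 'b) module"
  proof -
    obtain g where P: "projective_module ?B Pbar" and g: "g \<in> mod_hom ?B Pbar ?L" "g ` carrier Pbar = carrier ?L"
      and K: "superfluous ?B Pbar {x \<in> carrier Pbar. g x = \<zero>\<^bsub>?L\<^esub>}"
      using PB unfolding projective_cover_def by blast
    have LM: "left_module ?B Pbar" using P unfolding projective_module_def by blast
    interpret Y: brauer_operators m p n \<delta> Pbar \<xi> d
      by (rule left_module_brauer_operators[OF X.brauer_algebras LM assms(5,6)])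
    \<comment> \<open>There is at least one cover over \<open>A\<close>, and its being a left module
      carries the ring laws of \<open>A\<close>.\<close>
    have "0 < p div t" using tp by (simp add: div_greater_zero_iff)
    then have "left_module ?A (P 0)" using PA unfolding projective_cover_def projective_module_def by blast
    then have R: "ring ?A" by (rule left_module.axioms(1))
    obtain M \<phi> e where "dual_basis ?B Pbar {..<M::nat} \<phi> e" using projective_imp_dual_basis[OF P] by blast
    note db = Y.dual_basis_Ap[OF LM this]
    have gA: "g \<in> mod_hom ?A Pbar ?L"
      by (rule mod_homI) (use mod_homD(1,2)[OF g(1)] mod_homD(3)[OF g(1) Y.carrier_subset] in auto)
    \<comment> \<open>The covering map over \<open>B\<close> is followed by the first isomorphism,
      which leaves its kernel, and hence superfluity of the kernel, unchanged.\<close>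
    obtain f where f: "f \<in> mod_hom ?A ?L (dsum ?I ?Lr)" and bij: "bij_betw f (carrier ?L) (carrier (dsum ?I ?Lr))"
      using iso unfolding mod_isomorphic_def by blast
    interpret L: op_module ?A ?L by (rule opL)
    have opS: "op_module ?A (dsum ?I ?Lr)" by (rule op_module_dsum[OF opLr])
    have f0: "f \<zero>\<^bsub>?L\<^esub> = \<zero>\<^bsub>dsum ?I ?Lr\<^esub>"
      by (rule additive_zero[OF L.abelian_group_axioms op_module.axioms(1)[OF opS] mod_homD(4)[OF f] mod_homD(2)[OF f]])
    have ker: "f (g x) = \<zero>\<^bsub>dsum ?I ?Lr\<^esub> \<longleftrightarrow> g x = \<zero>\<^bsub>?L\<^esub>" if x: "x \<in> carrier Pbar" for x
      using inj_on_eq_iff[OF bij_betw_imp_inj_on[OF bij] mod_homD(1)[OF gA x] L.zero_closed] unfolding f0 .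
    have "mod_isomorphic ?A Pbar (dsum ?I P)"
    proof (rule projective_cover_unique_dsum[OF _ R Y.left_module_Ap[OF LM R] db opLr])
      show "finite ?I" by simp
      show "(\<lambda>x. f (g x)) \<in> mod_hom ?A Pbar (dsum ?I ?Lr)" by (rule mod_hom_comp[OF gA f])
      show "(\<lambda>x. f (g x)) ` carrier Pbar = carrier (dsum ?I ?Lr)"
        using bij_betw_imp_surj_on[OF bij] unfolding g(2)[symmetric] image_image .
      have "{x \<in> carrier Pbar. f (g x) = \<zero>\<^bsub>dsum ?I ?Lr\<^esub>} = {x \<in> carrier Pbar. g x = \<zero>\<^bsub>?L\<^esub>}"
        by (rule Collect_cong) (use ker in blast)
      then show "superfluous ?A Pbar {x \<in> carrier Pbar. f (g x) = \<zero>\<^bsub>dsum ?I ?Lr\<^esub>}"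
        using Y.superfluous_Ap[OF K] by simp
      show "projective_cover ?A (P r) (?Lr r)" if "r \<in> ?I" for r using PA that by simp
    qed
    then show ?thesis by (rule mod_isomorphic_restrict)
  qed
  then show ?thesis using mod_isomorphic_restrict[OF iso] by blast
qed

end
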